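(* Let $0<r<1$, let $T$ be an $\mathbb{A}_r$-contraction on a complex Hilbert space $\mathcal{H}$, and let $X\in\mathcal{B}(\mathcal{H})$ satisfy $TX=XT$. Let $T_X$ be the operator on $\mathcal{H}\oplus\mathcal{H}$ given by $$T_X=\begin{bmatrix} T & X\\ 0 & T\end{bmatrix}.$$ Then the following are equivalent. (1) $T_X$ is an $\mathbb{A}_r$-contraction. (2) For every $\epsilon\in(0,1)$ and every $\alpha\in\mathbb{T}$ there exists a contraction $K(\epsilon;\alpha)$ on $\mathcal{H}$ such that $$\frac{X\,\Gamma_\epsilon'(\alpha T)}{2}=\big(\mathrm{Re}\,\Gamma_\epsilon(\alpha T)\big)^{1/2}\,K(\epsilon;\alpha)\,\big(\mathrm{Re}\,\Gamma_\epsilon(\alpha T)\big)^{1/2}.$$ (3) For every $\epsilon\in(0,1)$ and every $\alpha\in\mathbb{T}$ there exists a unitary $U(\epsilon;\alpha)$ on $\mathcal{H}\oplus\mathcal{H}$ such that $$\frac{X\,\Gamma_\epsilon'(\alpha T)}{2}=\begin{bmatrix}\big(\mathrm{Re}\,\Gamma_\epsilon(\alpha T)\big)^{1/2} & 0\end{bmatrix}\,U(\epsilon;\alpha)\,\begin{bmatrix}\big(\mathrm{Re}\,\Gamma_\epsilon(\alpha T)\big)^{1/2}\\ 0\end{bmatrix}.$$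
   Context: All operators are bounded linear operators on complex Hilbert spaces; $\mathcal{B}(\mathcal{H})$ is the space of all operators on $\mathcal{H}$; a contraction is an operator of norm at most $1$; $\mathbb{T}$ is the unit circle in $\mathbb{C}$. Fix $0<r<1$ and put $\mathbb{A}_r=\{z\in\mathbb{C}: r<|z|<1\}$, with closure $\overline{\mathbb{A}}_r$. A compact set $K\subseteq\mathbb{C}$ is a spectral set for an operator $T$ if $\sigma(T)\subseteq K$ and $\|f(T)\|\le\sup_{x\in K}|f(x)|$ for every rational function $f$ with poles off $K$. An operator having $\overline{\mathbb{A}}_r$ as a spectral set is called an $\mathbb{A}_r$-contraction. For $\epsilon\in(0,1)$ let $$\Gamma_\epsilon(z)=2\sum_{k=-\infty}^{\infty}\frac{(1-\epsilon)^k}{1+(1-\epsilon)^{2k}r^k}\,z^k ,$$ which converges to a holomorphic function on a neighbourhood of $\overline{\mathbb{A}}_r$; $\Gamma_\epsilon'$ denotes its derivative. If $\sigma(T)\subseteq\overline{\mathbb{A}}_r$ and $\alpha\in\mathbb{T}$, then $\Gamma_\epsilon(\alpha T)$ and $\Gamma_\epsilon'(\alpha T)$ are the operators obtained by applying $\Gamma_\epsilon$ and $\Gamma_\epsilon'$ to $\alpha T$ by the holomorphic functional calculus. For an operator $S$, $\mathrm{Re}\,S=(S+S^* )/2$. For an $\mathbb{A}_r$-contraction $T$ one has $\mathrm{Re}\,\Gamma_\epsilon(\alpha T)\ge 0$ for all $\epsilon\in(0,1)$, $\alpha\in\mathbb{T}$ (a known result of Agler), and $(\mathrm{Re}\,\Gamma_\epsilon(\alpha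 T))^{1/2}$ denotes its positive square root. For $A\in\mathcal{B}(\mathcal{H})$, $\begin{bmatrix}A&0\end{bmatrix}:\mathcal{H}\oplus\mathcal{H}\to\mathcal{H}$ is the row operator and $\begin{bmatrix}A\\0\end{bmatrix}:\mathcal{H}\to\mathcal{H}\oplus\mathcal{H}$ is the column operator. *)

theory Defs
  imports "HOL-Complex_Analysis.Complex_Analysis" "HOL-Computational_Algebra.Polynomial"
begin

section \<open>Complex Hilbert spaces\<close>

text \<open>A complex Hilbert space is a complete real inner product space with a compatible complex
  scalar multiplication and a complex inner product (linear in the first argument) whose real part
  is the underlying real inner product; so the norm is the usual one, \<open>\<parallel>x\<parallel>\<^sup>2 = \<langle>x,x\<rangle>\<close>.\<close>

class complex_hilbert_space = real_inner + banach +
  fixes scaleC :: "complex \<Rightarrow> 'a \<Rightarrow> 'a"  (infixr \<open>*\<^sub>C\<close> 75)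
    and cinner :: "'a \<Rightarrow> 'a \<Rightarrow> complex"
  assumes scaleC_add_right: "c *\<^sub>C (x + y) = c *\<^sub>C x + c *\<^sub>C y"
    and scaleC_add_left: "(c + d) *\<^sub>C x = c *\<^sub>C x + d *\<^sub>C x"
    and scaleC_scaleC: "c *\<^sub>C (d *\<^sub>C x) = (c * d) *\<^sub>C x"
    and scaleR_eq_scaleC: "scaleR a x = complex_of_real a *\<^sub>C x"
    and cinner_commute: "cinner x y = cnj (cinner y x)"
    and cinner_add_left: "cinner (x + y) z = cinner x z + cinner y z"
    and cinner_scaleC_left: "cinner (c *\<^sub>C x) y = c * cinner x y"
    and inner_eq_Re_cinner: "inner x y = Re (cinner x y)"

lemma norm_scaleC: "norm (c *\<^sub>C x) = cmod c * norm (x :: 'a::complex_hilbert_space)"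
proof -
  have "cinner (c *\<^sub>C x) (c *\<^sub>C x) = c * cnj c * cinner x x"
    by (subst cinner_scaleC_left, subst cinner_commute, subst cinner_scaleC_left)
       (simp add: cinner_commute[symmetric])
  also have "c * cnj c = complex_of_real ((cmod c)\<^sup>2)"
    by (simp add: complex_mult_cnj cmod_power2)
  finally have "inner (c *\<^sub>C x) (c *\<^sub>C x) = (cmod c)\<^sup>2 * inner x x"
    by (simp add: inner_eq_Re_cinner)
  then show ?thesis
    by (simp add: norm_eq_sqrt_inner real_sqrt_mult)
qed

lemma bounded_linear_scaleC:
  "bounded_linear (\<lambda>x :: 'a::complex_hilbert_space. c *\<^sub>C x)"
  by (rule bounded_linear_intro[where K = "cmod c"])
     (simp_all add: scaleC_add_right scaleR_eq_scaleC scaleC_scaleC norm_scaleC mult.commute)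

instantiation prod :: (complex_hilbert_space, complex_hilbert_space) complex_hilbert_space
begin

definition scaleC_prod :: "complex \<Rightarrow> 'a \<times> 'b \<Rightarrow> 'a \<times> 'b" where
  "scaleC_prod c p = (c *\<^sub>C fst p, c *\<^sub>C snd p)"

definition cinner_prod :: "'a \<times> 'b \<Rightarrow> 'a \<times> 'b \<Rightarrow> complex" where
  "cinner_prod p q = cinner (fst p) (fst q) + cinner (snd p) (snd q)"

instance
proof
  fix x y :: "'a \<times> 'b"
  show "cinner x y = cnj (cinner y x)"
    unfolding cinner_prod_def
    by (simp add: cinner_commute[of "fst x" "fst y"] cinner_commute[of "snd x" "snd y"])
qed (simp_all add: scaleC_prod_def cinner_prod_def scaleC_add_right scaleC_add_left scaleC_scaleC
      scaleR_eq_scaleC cinner_add_left cinner_scaleC_left inner_eq_Re_cinner inner_prod_def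
      scaleR_prod_def algebra_simps)

end


section \<open>Bounded operators\<close>

text \<open>The type \<open>'a \<Rightarrow>\<^sub>L 'b\<close> consists of the bounded real-linear maps; the operators between complex
  Hilbert spaces are its complex-linear elements. The norm on this type is the operator norm.\<close>

definition complex_linear ::
    "('a::complex_hilbert_space \<Rightarrow>\<^sub>L 'b::complex_hilbert_space) \<Rightarrow> bool" where
  "complex_linear A \<longleftrightarrow> (\<forall>c x. blinfun_apply A (c *\<^sub>C x) = c *\<^sub>C blinfun_apply A x)"

lift_definition scalar_op :: "complex \<Rightarrow> 'a::complex_hilbert_space \<Rightarrow>\<^sub>L 'a"
  is "\<lambda>c x. c *\<^sub>C x"
  by (rule bounded_linear_scaleC)

definition cmul_op :: "complex \<Rightarrow> ('a \<Rightarrow>\<^sub>L 'a) \<Rightarrow> ('a::complex_hilbert_space \<Rightarrow>\<^sub>L 'a)" where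
  "cmul_op c A = scalar_op c o\<^sub>L A"

primrec op_power :: "('a \<Rightarrow>\<^sub>L 'a) \<Rightarrow> nat \<Rightarrow> ('a::complex_hilbert_space \<Rightarrow>\<^sub>L 'a)" where
  "op_power A 0 = id_blinfun"
| "op_power A (Suc n) = A o\<^sub>L op_power A n"

definition is_inverse_op :: "('a::complex_hilbert_space \<Rightarrow>\<^sub>L 'a) \<Rightarrow> ('a \<Rightarrow>\<^sub>L 'a) \<Rightarrow> bool" where
  "is_inverse_op A B \<longleftrightarrow> A o\<^sub>L B = id_blinfun \<and> B o\<^sub>L A = id_blinfun"

definition inverse_op :: "('a::complex_hilbert_space \<Rightarrow>\<^sub>L 'a) \<Rightarrow> ('a \<Rightarrow>\<^sub>L 'a)" where
  "inverse_op A = (THE B. is_inverse_op A B)"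

text \<open>A real-linear two-sided inverse of a complex-linear operator is automatically
  complex-linear, so complex linearity of the inverse need not be required.\<close>

definition op_spectrum :: "('a::complex_hilbert_space \<Rightarrow>\<^sub>L 'a) \<Rightarrow> complex set" where
  "op_spectrum T = {z. \<not> (\<exists>B. is_inverse_op (scalar_op z - T) B)}"

definition adjoint_op ::
    "('a::complex_hilbert_space \<Rightarrow>\<^sub>L 'b::complex_hilbert_space) \<Rightarrow> ('b \<Rightarrow>\<^sub>L 'a)" where
  "adjoint_op A =
     (THE B. \<forall>x y. cinner (blinfun_apply A x) y = cinner x (blinfun_apply B y))"

definition Re_op :: "('a::complex_hilbert_space \<Rightarrow>\<^sub>L 'a) \<Rightarrow> ('a \<Rightarrow>\<^sub>L 'a)" where
  "Re_op A = (1/2) *\<^sub>R (A + adjoint_op A)"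

definition positive_op :: "('a::complex_hilbert_space \<Rightarrow>\<^sub>L 'a) \<Rightarrow> bool" where
  "positive_op A \<longleftrightarrow> complex_linear A \<and>
     (\<forall>x. cinner (blinfun_apply A x) x \<in> \<real> \<and> 0 \<le> Re (cinner (blinfun_apply A x) x))"

definition sqrt_op :: "('a::complex_hilbert_space \<Rightarrow>\<^sub>L 'a) \<Rightarrow> ('a \<Rightarrow>\<^sub>L 'a)" where
  "sqrt_op A = (THE B. positive_op B \<and> B o\<^sub>L B = A)"

definition contraction_op ::
    "('a::complex_hilbert_space \<Rightarrow>\<^sub>L 'b::complex_hilbert_space) \<Rightarrow> bool" where
  "contraction_op A \<longleftrightarrow> complex_linear A \<and> norm A \<le> 1"

definition unitary_op :: "('a::complex_hilbert_space \<Rightarrow>\<^sub>L 'a) \<Rightarrow> bool" where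
  "unitary_op U \<longleftrightarrow> complex_linear U \<and>
     adjoint_op U o\<^sub>L U = id_blinfun \<and> U o\<^sub>L adjoint_op U = id_blinfun"


section \<open>Block operators on direct sums\<close>

definition row_op :: "('a \<Rightarrow>\<^sub>L 'c) \<Rightarrow> ('b \<Rightarrow>\<^sub>L 'c) \<Rightarrow>
    (('a::complex_hilbert_space \<times> 'b::complex_hilbert_space) \<Rightarrow>\<^sub>L 'c::complex_hilbert_space)" where
  "row_op A B = (A o\<^sub>L fst_blinfun) + (B o\<^sub>L snd_blinfun)"

definition column_op :: "('a \<Rightarrow>\<^sub>L 'b) \<Rightarrow> ('a \<Rightarrow>\<^sub>L 'c) \<Rightarrow>
    ('a::complex_hilbert_space \<Rightarrow>\<^sub>L ('b::complex_hilbert_space \<times> 'c::complex_hilbert_space))" where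
  "column_op A B = Blinfun (\<lambda>x. (blinfun_apply A x, blinfun_apply B x))"

lemma row_op_apply [simp]:
  "blinfun_apply (row_op A B) p = blinfun_apply A (fst p) + blinfun_apply B (snd p)"
  by (simp add: row_op_def blinfun.add_left)

lemma column_op_apply [simp]:
  "blinfun_apply (column_op A B) x = (blinfun_apply A x, blinfun_apply B x)"
  unfolding column_op_def
  by (subst bounded_linear_Blinfun_apply)
     (simp_all add: bounded_linear_Pair blinfun.bounded_linear_right)

text \<open>\<open>block_op A B C D\<close> is the operator matrix with rows \<open>[A B]\<close> and \<open>[C D]\<close>.\<close>

definition block_op :: "('a \<Rightarrow>\<^sub>L 'c) \<Rightarrow> ('b \<Rightarrow>\<^sub>L 'c) \<Rightarrow> ('a \<Rightarrow>\<^sub>L 'd) \<Rightarrow> ('b \<Rightarrow>\<^sub>L 'd) \<Rightarrow>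
    (('a::complex_hilbert_space \<times> 'b::complex_hilbert_space) \<Rightarrow>\<^sub>L
     ('c::complex_hilbert_space \<times> 'd::complex_hilbert_space))" where
  "block_op A B C D = column_op (row_op A B) (row_op C D)"


section \<open>Spectral sets\<close>

definition poly_op :: "complex poly \<Rightarrow> ('a::complex_hilbert_space \<Rightarrow>\<^sub>L 'a) \<Rightarrow> ('a \<Rightarrow>\<^sub>L 'a)" where
  "poly_op p T = (\<Sum>i\<le>degree p. cmul_op (coeff p i) (op_power T i))"

text \<open>A rational function with poles off \<open>K\<close> is a quotient \<open>p/q\<close> of polynomials with \<open>q\<close> having
  no zeros in \<open>K\<close>; it acts on \<open>T\<close> as \<open>p(T) q(T)\<^sup>-\<^sup>1\<close>.\<close>

definition spectral_set :: "complex set \<Rightarrow> ('a::complex_hilbert_space \<Rightarrow>\<^sub>L 'a) \<Rightarrow> bool" where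
  "spectral_set K T \<longleftrightarrow> compact K \<and> op_spectrum T \<subseteq> K \<and>
     (\<forall>p q. (\<forall>z\<in>K. poly q z \<noteq> 0) \<longrightarrow>
        norm (poly_op p T o\<^sub>L inverse_op (poly_op q T)) \<le> (SUP z\<in>K. cmod (poly p z / poly q z)))"

definition annulus :: "real \<Rightarrow> complex set" where
  "annulus r = {z. r < cmod z \<and> cmod z < 1}"

definition annulus_contraction :: "real \<Rightarrow> ('a::complex_hilbert_space \<Rightarrow>\<^sub>L 'a) \<Rightarrow> bool" where
  "annulus_contraction r T \<longleftrightarrow> complex_linear T \<and> spectral_set (closure (annulus r)) T"


section \<open>The holomorphic functional calculus\<close>

text \<open>A cycle, given as a list of closed paths in \<open>U - K\<close>, that winds once around every point of \<open>K\<close>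
  and not at all around any point outside \<open>U\<close>.\<close>

definition surrounding_cycle :: "complex set \<Rightarrow> complex set \<Rightarrow> (real \<Rightarrow> complex) list \<Rightarrow> bool" where
  "surrounding_cycle U K \<gamma>s \<longleftrightarrow>
     (\<forall>\<gamma>\<in>set \<gamma>s. valid_path \<gamma> \<and> pathfinish \<gamma> = pathstart \<gamma> \<and> path_image \<gamma> \<subseteq> U - K) \<and>
     (\<forall>w\<in>K. (\<Sum>\<gamma>\<leftarrow>\<gamma>s. winding_number \<gamma> w) = 1) \<and>
     (\<forall>w. w \<notin> U \<longrightarrow> (\<Sum>\<gamma>\<leftarrow>\<gamma>s. winding_number \<gamma> w) = 0)"

text \<open>The integral of \<open>f(z) (z - T)\<^sup>-\<^sup>1\<close> along \<open>\<gamma>\<close>; the library's contour integral covers only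
  complex-valued integrands, hence the explicit parametrisation.\<close>

definition resolvent_integral ::
    "(complex \<Rightarrow> complex) \<Rightarrow> ('a::complex_hilbert_space \<Rightarrow>\<^sub>L 'a) \<Rightarrow> (real \<Rightarrow> complex) \<Rightarrow> ('a \<Rightarrow>\<^sub>L 'a)" where
  "resolvent_integral f T \<gamma> =
     integral {0..1} (\<lambda>t. cmul_op (f (\<gamma> t) * vector_derivative \<gamma> (at t within {0..1}))
                            (inverse_op (scalar_op (\<gamma> t) - T)))"

text \<open>\<open>hol_calc U f T\<close> is the Riesz--Dunford operator \<open>f(T)\<close>, for \<open>U\<close> an open neighbourhood of the
  spectrum of \<open>T\<close> on which \<open>f\<close> is holomorphic. By Cauchy's theorem it does not depend on the cycle.\<close>

definition hol_calc ::
    "complex set \<Rightarrow> (complex \<Rightarrow> complex) \<Rightarrow> ('a::complex_hilbert_space \<Rightarrow>\<^sub>L 'a) \<Rightarrow> ('a \<Rightarrow>\<^sub>L 'a)" where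
  "hol_calc U f T =
     cmul_op (1 / (2 * of_real pi * \<i>))
       (\<Sum>\<gamma>\<leftarrow>(SOME \<gamma>s. surrounding_cycle U (op_spectrum T) \<gamma>s). resolvent_integral f T \<gamma>)"


section \<open>The kernel\<close>

definition Gamma_ker :: "real \<Rightarrow> real \<Rightarrow> complex \<Rightarrow> complex" where
  "Gamma_ker r \<epsilon> z =
     2 * (\<Sum>\<^sub>\<infinity>k\<in>(UNIV :: int set).
            of_real ((1 - \<epsilon>) powi k / (1 + (1 - \<epsilon>) powi (2 * k) * r powi k)) * z powi k)"

text \<open>The open annulus of convergence of the Laurent series above.\<close>

definition Gamma_dom :: "real \<Rightarrow> real \<Rightarrow> complex set" where
  "Gamma_dom r \<epsilon> = {z. (1 - \<epsilon>) * r < cmod z \<and> cmod z < 1 / (1 - \<epsilon>)}"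

definition Gamma_op :: "real \<Rightarrow> real \<Rightarrow> ('a::complex_hilbert_space \<Rightarrow>\<^sub>L 'a) \<Rightarrow> ('a \<Rightarrow>\<^sub>L 'a)" where
  "Gamma_op r \<epsilon> S = hol_calc (Gamma_dom r \<epsilon>) (Gamma_ker r \<epsilon>) S"

definition Gamma_deriv_op :: "real \<Rightarrow> real \<Rightarrow> ('a::complex_hilbert_space \<Rightarrow>\<^sub>L 'a) \<Rightarrow> ('a \<Rightarrow>\<^sub>L 'a)" where
  "Gamma_deriv_op r \<epsilon> S = hol_calc (Gamma_dom r \<epsilon>) (deriv (Gamma_ker r \<epsilon>)) S"

end

theory Submission
  imports Defs "HOL-Computational_Algebra.Fundamental_Theorem_Algebra"
begin

text \<open>
  Agler's criterion characterises the \<open>A\<^sub>r\<close>-contractions among the operators \<open>S\<close> with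
  spectrum in the closed annulus: \<open>S\<close> is one if and only if every
  \<open>\<Gamma>\<^sub>\<epsilon>(\<alpha> S)\<close> is accretive, that is, has positive real part
  (\<open>annulus_contraction_iff_accretive\<close>). The theorem is this criterion at \<open>T\<^sub>X\<close>. The
  functional calculus maps a triangular block operator to a triangular block operator, with off-diagonal entry
  \<open>X f'(T)\<close> (\<open>hol_calc_block\<close>). So with \<open>P = Re \<Gamma>\<^sub>\<epsilon>(\<alpha>
  T)\<close> and \<open>Y = X \<Gamma>\<^sub>\<epsilon>'(\<alpha> T) / 2\<close>, accretivity of
  \<open>\<Gamma>\<^sub>\<epsilon>(\<alpha> T\<^sub>X)\<close> is positivity of the block operator with diagonal
  entries \<open>P\<close> and off-diagonal entries \<open>\<alpha> Y\<close> and its adjoint; the factor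
  \<open>\<alpha>\<close> is removed by conjugation with a diagonal unitary. Positivity is equivalent to \<open>Y =
  P\<^sup>1\<^sup>/\<^sup>2 K P\<^sup>1\<^sup>/\<^sup>2\<close> for a contraction \<open>K\<close> by Douglas
  factorisation (\<open>positive_block_iff_contraction\<close>), and Halmos dilation replaces the contraction by a
  compressed unitary (\<open>contraction_iff_compressed_unitary\<close>).

  The substance is Agler's criterion. The function \<open>\<Gamma>\<^sub>\<epsilon>\<close> is, up to a dilation of
  the variable, the analytic completion of a harmonic Poisson kernel of an annulus \<open>q < |w| < 1\<close> with
  unit masses at \<open>1\<close> and at \<open>q\<close> (\<open>Gamma_ker_eq_kernel\<close>); in particular its real
  part is positive, and Cayley transforms turn the spectral set condition into accretivity
  (\<open>accretive_of_spectral_set\<close>). For the converse, rotations give accretivity for the kernels with poles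
  \<open>c\<close> and \<open>q c\<close> at equal angles. A kernel with poles \<open>a\<close> and \<open>q b\<close>
  at different angles has two zeros and two poles just as the symmetric one does, and the two are Moebius transforms
  of each other: after subtraction of imaginary constants their product is a positive constant
  (\<open>kernel_product_constant\<close>). Hence all kernels are accretive at the operator
  (\<open>accretive_general_kernel\<close>). Every Laurent polynomial with positive real part on both circles is, up
  to scaling and an imaginary constant, a limit of positive combinations of kernels
  (\<open>positive_laurent_average\<close>), so it is accretive too; Cayley transforms lead from there to the von
  Neumann inequality for Laurent polynomials (\<open>contractive_laurent_poly\<close>), and approximation to the one
  for rational functions (\<open>spectral_set_of_accretive_kernels\<close>).

  The functional calculus is defined by Cauchy integrals over an arbitrary cycle around the spectrum. Its value does
  not depend on the cycle because \<open>\<langle>R(z) x, y\<rangle>\<close> is holomorphic off the spectrum and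
  \<open>R(z)\<close> vanishes at infinity (\<open>cycle_integral_resolvent\<close>); on Laurent polynomials the
  calculus is algebraic, and the bound \<open>hol_calc_bound\<close> carries identities from there to uniform limits.
\<close>

section \<open>Complex inner products and complex-linear operators\<close>

lemma cinner_add_right: "cinner x (y + z) = cinner x y + cinner x z"
  for x :: "'a::complex_hilbert_space"
  by (metis cinner_add_left cinner_commute complex_cnj_add)

lemma cinner_scaleC_right: "cinner x (c *\<^sub>C y) = cnj c * cinner x y"
  for x :: "'a::complex_hilbert_space"
  by (metis cinner_commute cinner_scaleC_left complex_cnj_mult)

lemma Im_cinner: "Im (cinner x y) = inner x (\<i> *\<^sub>C y)"
  for x :: "'a::complex_hilbert_space"
  by (simp add: inner_eq_Re_cinner cinner_scaleC_right)

lemma inner_scaleC_scaleC: "inner (c *\<^sub>C x) (c *\<^sub>C y) = (cmod c)\<^sup>2 * inner x y"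
  for x :: "'a::complex_hilbert_space"
proof -
  have "cinner (c *\<^sub>C x) (c *\<^sub>C y) = (c * cnj c) * cinner x y"
    by (simp add: cinner_scaleC_left cinner_scaleC_right)
  also have "c * cnj c = complex_of_real ((cmod c)\<^sup>2)"
    by (simp add: complex_mult_cnj cmod_power2)
  finally show ?thesis by (simp add: inner_eq_Re_cinner)
qed

lemma scaleC_one [simp]: "1 *\<^sub>C x = (x :: 'a::complex_hilbert_space)"
  using scaleR_eq_scaleC[of 1 x] by simp

lemma scaleC_zero_left [simp]: "0 *\<^sub>C x = (0 :: 'a::complex_hilbert_space)"
  using scaleR_eq_scaleC[of 0 x] by simp

lemma scaleC_zero_right [simp]: "c *\<^sub>C 0 = (0 :: 'a::complex_hilbert_space)"
  using norm_scaleC[of c 0] by simp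

lemma scaleC_minus_left: "(- c) *\<^sub>C x = - (c *\<^sub>C (x :: 'a::complex_hilbert_space))"
  by (metis ab_left_minus add_eq_0_iff2 scaleC_add_left scaleC_zero_left)

lemma scaleC_eq_Re_Im: "c *\<^sub>C x = Re c *\<^sub>R x + Im c *\<^sub>R (\<i> *\<^sub>C (x :: 'a::complex_hilbert_space))"
proof -
  have "c = complex_of_real (Re c) + complex_of_real (Im c) * \<i>"
    by (simp add: complex_eq_iff)
  then have "c *\<^sub>C x = (complex_of_real (Re c) + complex_of_real (Im c) * \<i>) *\<^sub>C x"
    by (rule arg_cong)
  then show ?thesis
    by (simp add: scaleC_add_left scaleR_eq_scaleC scaleC_scaleC)
qed

lemma cinner_scaleR_left: "cinner (a *\<^sub>R x) y = a *\<^sub>R cinner x (y :: 'a::complex_hilbert_space)"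
  by (simp add: scaleR_eq_scaleC cinner_scaleC_left scaleR_conv_of_real)

lemma cinner_scaleR_right: "cinner x (a *\<^sub>R y) = a *\<^sub>R cinner x (y :: 'a::complex_hilbert_space)"
  by (simp add: scaleR_eq_scaleC cinner_scaleC_right scaleR_conv_of_real)

lemma norm_cinner_le: "cmod (cinner x y) \<le> norm x * norm (y :: 'a::complex_hilbert_space)"
proof (cases "cinner x y = 0")
  case False
  define c where "c = cnj (cinner x y) / of_real (cmod (cinner x y))"
  have c: "cmod c = 1" using False by (simp add: c_def norm_divide)
  have "c * cinner x y = of_real (cmod (cinner x y))"
    using False unfolding c_def
    by (simp add: complex_norm_square[symmetric] power2_eq_square field_simps)
  then have "cmod (cinner x y) = inner (c *\<^sub>C x) y"
    by (simp add: inner_eq_Re_cinner cinner_scaleC_left)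
  also have "\<dots> \<le> norm (c *\<^sub>C x) * norm y" by (rule norm_cauchy_schwarz)
  finally show ?thesis using c by (simp add: norm_scaleC)
qed simp

lemma bounded_bilinear_cinner:
  "bounded_bilinear (cinner :: 'a::complex_hilbert_space \<Rightarrow> 'a \<Rightarrow> complex)"
proof (rule bounded_bilinear.intro)
  show "\<exists>K. \<forall>x y :: 'a. cmod (cinner x y) \<le> norm x * norm y * K"
    by (rule exI[of _ 1]) (simp add: norm_cinner_le)
qed (simp_all add: cinner_add_left cinner_add_right cinner_scaleR_left cinner_scaleR_right)

interpretation cinner: bounded_bilinear
  "cinner :: 'a::complex_hilbert_space \<Rightarrow> 'a \<Rightarrow> complex"
  by (rule bounded_bilinear_cinner)

lemma cinner_self: "cinner x x = of_real (inner x (x :: 'a::complex_hilbert_space))"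
proof -
  have "Im (cinner x x) = 0"
    using arg_cong[OF cinner_commute[of x x], of Im] by simp
  then show ?thesis
    by (simp add: complex_eq_iff inner_eq_Re_cinner)
qed

lemma blinfun_eq_of_cinner:
  fixes A B :: "'a::complex_hilbert_space \<Rightarrow>\<^sub>L 'b::complex_hilbert_space"
  assumes "\<And>x y. cinner (A x) y = cinner (B x) y"
  shows "A = B"
proof (rule blinfun_eqI)
  fix x
  have "cinner (A x - B x) (A x - B x) = 0"
    using assms by (simp add: cinner.diff_left)
  then show "A x = B x" by (simp add: cinner_self)
qed

lemma norm_blinfun_le_of_cinner:
  fixes A :: "'a::complex_hilbert_space \<Rightarrow>\<^sub>L 'b::complex_hilbert_space"
  assumes "\<And>x y. cmod (cinner (A x) y) \<le> C * norm x * norm y"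
  shows "norm A \<le> \<bar>C\<bar>"
proof (rule norm_blinfun_bound)
  fix x
  have "norm (A x) * norm (A x) \<le> C * norm x * norm (A x)"
    using assms[of x "A x"] by (simp add: cinner_self norm_mult power2_norm_eq_inner[symmetric] power2_eq_square)
  also have "\<dots> \<le> \<bar>C\<bar> * norm x * norm (A x)"
    by (intro mult_right_mono) auto
  finally show "norm (A x) \<le> \<bar>C\<bar> * norm x"
    by (cases "norm (A x) = 0") auto
qed auto

text \<open>Since scalars act through their real and imaginary parts, commuting with \<open>\<i>\<close> is all that
  complex linearity adds to real linearity.\<close>

lemma complex_linear_iff_imaginary_unit:
  "complex_linear A \<longleftrightarrow> (\<forall>x. A (\<i> *\<^sub>C x) = \<i> *\<^sub>C A x)"
proof
  assume *: "\<forall>x. A (\<i> *\<^sub>C x) = \<i> *\<^sub>C A x"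
  show "complex_linear A"
    unfolding complex_linear_def
  proof (intro allI)
    fix c x
    show "A (c *\<^sub>C x) = c *\<^sub>C A x"
      by (subst (1 2) scaleC_eq_Re_Im) (simp add: blinfun.add_right blinfun.scaleR_right *)
  qed
qed (auto simp: complex_linear_def)

lemma complex_linearD: "complex_linear A \<Longrightarrow> A (c *\<^sub>C x) = c *\<^sub>C A x"
  by (auto simp: complex_linear_def)

lemma scalar_op_apply [simp]: "scalar_op c x = c *\<^sub>C x"
  by transfer simp

lemma cmul_op_apply [simp]: "cmul_op c A x = c *\<^sub>C A x"
  by (simp add: cmul_op_def)

lemma complex_linear_simps [simp]:
  "complex_linear 0" "complex_linear id_blinfun" "complex_linear (scalar_op c)"
  by (auto simp: complex_linear_def scaleC_scaleC mult.commute)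

lemma complex_linear_add: "complex_linear A \<Longrightarrow> complex_linear B \<Longrightarrow> complex_linear (A + B)"
  and complex_linear_diff: "complex_linear A \<Longrightarrow> complex_linear B \<Longrightarrow> complex_linear (A - B)"
  and complex_linear_scaleR: "complex_linear A \<Longrightarrow> complex_linear (a *\<^sub>R A)"
  by (auto simp: complex_linear_iff_imaginary_unit blinfun.add_left blinfun.diff_left
      blinfun.scaleR_left bounded_linear.linear[OF bounded_linear_scaleC] linear_diff linear_add linear_cmul)

lemma complex_linear_compose:
  "complex_linear A \<Longrightarrow> complex_linear B \<Longrightarrow> complex_linear (A o\<^sub>L B)"
  by (auto simp: complex_linear_def)

lemma complex_linear_cmul: "complex_linear A \<Longrightarrow> complex_linear (cmul_op c A)"
  unfolding cmul_op_def by (rule complex_linear_compose) auto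

lemma complex_linear_sum: "(\<And>i. i \<in> I \<Longrightarrow> complex_linear (A i)) \<Longrightarrow> complex_linear (sum A I)"
  by (induction I rule: infinite_finite_induct) (auto intro: complex_linear_add)

lemma complex_linear_op_power: "complex_linear A \<Longrightarrow> complex_linear (op_power A n)"
  by (induction n) (auto intro: complex_linear_compose)

lemma complex_linear_lim:
  assumes "(f \<longlongrightarrow> A) F" "F \<noteq> bot" "\<And>n. complex_linear (f n)"
  shows "complex_linear A"
  unfolding complex_linear_def
proof (intro allI)
  fix c x
  have "((\<lambda>n. f n (c *\<^sub>C x)) \<longlongrightarrow> A (c *\<^sub>C x)) F"
    by (intro tendsto_intros assms)
  moreover have "((\<lambda>n. c *\<^sub>C f n x) \<longlongrightarrow> c *\<^sub>C A x) F"
    by (intro bounded_linear.tendsto[OF bounded_linear_scaleC] tendsto_intros assms)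
  moreover have "(\<lambda>n. f n (c *\<^sub>C x)) = (\<lambda>n. c *\<^sub>C f n x)"
    using assms(3) by (auto simp: complex_linear_def)
  ultimately show "A (c *\<^sub>C x) = c *\<^sub>C A x"
    using assms(2) tendsto_unique by fastforce
qed

section \<open>The Riesz representation theorem relative to an operator\<close>

lemma closure_range_blinfun_subspace:
  fixes Q :: "'a::real_normed_vector \<Rightarrow>\<^sub>L 'b::real_normed_vector"
  shows "subspace (closure (range Q))"
proof (rule subspaceI)
  show "0 \<in> closure (range Q)"
    using closure_subset[of "range Q"] blinfun.zero_right[of Q] by (metis rangeI subsetD)
next
  fix u v assume "u \<in> closure (range Q)" "v \<in> closure (range Q)"
  then obtain a b where ab: "\<And>n. a n \<in> range Q" "a \<longlonglongrightarrow> u" "\<And>n. b n \<in> range Q" "b \<longlonglongrightarrow> v"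
    unfolding closure_sequential by blast
  have "a n + b n \<in> range Q" for n
    using ab(1)[of n] ab(3)[of n] by (auto simp: blinfun.add_right[symmetric])
  moreover have "(\<lambda>n. a n + b n) \<longlonglongrightarrow> u + v" by (intro tendsto_intros ab)
  ultimately show "u + v \<in> closure (range Q)"
    unfolding closure_sequential by (intro exI[of _ "\<lambda>n. a n + b n"]) auto
next
  fix c u assume "u \<in> closure (range Q)"
  then obtain a where ab: "\<And>n. a n \<in> range Q" "a \<longlonglongrightarrow> u"
    unfolding closure_sequential by blast
  have "c *\<^sub>R a n \<in> range Q" for n
    using ab(1)[of n] by (auto simp: blinfun.scaleR_right[symmetric])
  moreover have "(\<lambda>n. c *\<^sub>R a n) \<longlonglongrightarrow> c *\<^sub>R u" by (intro tendsto_intros ab)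
  ultimately show "c *\<^sub>R u \<in> closure (range Q)"
    unfolding closure_sequential by (intro exI[of _ "\<lambda>n. c *\<^sub>R a n"]) auto
qed

lemma zero_of_orthogonal_range:
  fixes Q :: "'a::real_normed_vector \<Rightarrow>\<^sub>L 'b::real_inner"
  assumes "v \<in> closure (range Q)" "\<And>x. inner (Q x) v = 0"
  shows "v = 0"
proof -
  have "closed {u. inner u v = 0}" by (intro closed_Collect_eq continuous_intros)
  moreover have "range Q \<subseteq> {u. inner u v = 0}" using assms by auto
  ultimately have "closure (range Q) \<subseteq> {u. inner u v = 0}" by (rule closure_minimal[rotated])
  then show ?thesis using assms(1) by auto
qed

text \<open>For \<open>Q\<close> the identity this is the Riesz representation theorem, and its classical proof works
  for every \<open>Q\<close>: if \<open>x\<^sub>n\<close> minimises \<open>\<parallel>Q x\<parallel>\<^sup>2 - 2 l x\<close>, then the parallelogram law makes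
  \<open>Q x\<^sub>n\<close> a Cauchy sequence, and its limit represents \<open>l\<close>.\<close>

lemma riesz_relative:
  fixes Q :: "'a::real_normed_vector \<Rightarrow>\<^sub>L 'b::{real_inner,banach}" and l :: "'a \<Rightarrow> real"
  assumes lin: "linear l" and le: "\<And>x. \<bar>l x\<bar> \<le> norm (Q x) * M"
  obtains v where "v \<in> closure (range Q)" "\<And>x. l x = inner (Q x) v" "norm v \<le> \<bar>M\<bar>"
proof -
  define J where "J x = (norm (Q x))\<^sup>2 - 2 * l x" for x
  have J_ge: "J x \<ge> - M\<^sup>2" for x
  proof -
    have "0 \<le> (norm (Q x) - M)\<^sup>2" by simp
    then show ?thesis using le[of x] by (simp add: J_def power2_eq_square algebra_simps)
  qed
  define m where "m = (INF x. J x)"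
  have bdd: "bdd_below (range J)" using J_ge by (auto simp: bdd_below_def)
  have m_le: "m \<le> J x" for x unfolding m_def by (rule cINF_lower[OF bdd]) simp
  have "\<exists>x. J x < m + inverse (real (Suc n))" for n
  proof (rule ccontr)
    assume "\<not> ?thesis"
    then have "m + inverse (real (Suc n)) \<le> m"
      unfolding m_def by (intro cINF_greatest) (auto simp: not_less)
    then show False by simp
  qed
  then obtain x where x: "J (x n) < m + inverse (real (Suc n))" for n by metis
  have dist: "(norm (Q (x a) - Q (x b)))\<^sup>2 \<le> 2 * inverse (real (Suc a)) + 2 * inverse (real (Suc b))" for a b
  proof -
    have "(norm (Q (x a) - Q (x b)))\<^sup>2 = 2 * J (x a) + 2 * J (x b) - 4 * J ((1/2) *\<^sub>R (x a + x b))"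
      by (simp add: J_def blinfun.add_right blinfun.scaleR_right power2_norm_eq_inner linear_cmul[OF lin]
          linear_add[OF lin] inner_diff inner_add inner_commute[of "Q (x b)" "Q (x a)"] field_simps)
    then show ?thesis using x[of a] x[of b] m_le[of "(1/2) *\<^sub>R (x a + x b)"] by simp
  qed
  have "Cauchy (\<lambda>n. Q (x n))"
  proof (rule metric_CauchyI)
    fix e :: real assume e: "e > 0"
    obtain N where N: "inverse (real (Suc N)) < e\<^sup>2 / 4"
      using reals_Archimedean[of "e\<^sup>2/4"] e by auto
    show "\<exists>M. \<forall>m\<ge>M. \<forall>n\<ge>M. dist (Q (x m)) (Q (x n)) < e"
    proof (intro exI[of _ N] allI impI)
      fix m n assume mn: "m \<ge> N" "n \<ge> N"
      have "inverse (real (Suc m)) \<le> inverse (real (Suc N))" "inverse (real (Suc n)) \<le> inverse (real (Suc N))"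
        using mn by (auto intro!: le_imp_inverse_le)
      with dist[of m n] N have "(norm (Q (x m) - Q (x n)))\<^sup>2 < e\<^sup>2" by linarith
      then show "dist (Q (x m)) (Q (x n)) < e"
        unfolding dist_norm using e by (rule power2_less_imp_less[OF _ less_imp_le])
    qed
  qed
  then obtain v where v: "(\<lambda>n. Q (x n)) \<longlonglongrightarrow> v"
    using Cauchy_convergent_iff convergent_def by blast
  have v_in: "v \<in> closure (range Q)"
    using v unfolding closure_sequential by (intro exI[of _ "\<lambda>n. Q (x n)"]) auto
  have rep: "l y = inner (Q y) v" for y
  proof -
    have quad: "0 \<le> 2 * t * (inner v (Q y) - l y) + t\<^sup>2 * (norm (Q y))\<^sup>2" for t
    proof -
      have "- inverse (real (Suc n)) \<le> 2 * t * (inner (Q (x n)) (Q y) - l y) + t\<^sup>2 * (norm (Q y))\<^sup>2" for n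
      proof -
        have "J (x n + t *\<^sub>R y) = J (x n) + 2 * t * (inner (Q (x n)) (Q y) - l y) + t\<^sup>2 * (norm (Q y))\<^sup>2"
          by (simp add: J_def blinfun.add_right blinfun.scaleR_right power2_norm_eq_inner linear_cmul[OF lin]
              linear_add[OF lin] inner_diff inner_add inner_commute[of "Q y" "Q (x n)"] algebra_simps)
            (simp add: power2_eq_square)
        then show ?thesis using x[of n] m_le[of "x n + t *\<^sub>R y"] by simp
      qed
      moreover have "(\<lambda>n. - inverse (real (Suc n))) \<longlonglongrightarrow> - 0"
        by (intro tendsto_minus LIMSEQ_inverse_real_of_nat)
      moreover have "(\<lambda>n. 2 * t * (inner (Q (x n)) (Q y) - l y) + t\<^sup>2 * (norm (Q y))\<^sup>2) \<longlonglongrightarrow>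
          2 * t * (inner v (Q y) - l y) + t\<^sup>2 * (norm (Q y))\<^sup>2"
        by (intro tendsto_intros v)
      ultimately show ?thesis
        using LIMSEQ_le[of "\<lambda>n. - inverse (real (Suc n))"] by fastforce
    qed
    define d where "d = inner v (Q y) - l y"
    define b where "b = (norm (Q y))\<^sup>2"
    have b: "b \<ge> 0" by (simp add: b_def)
    define t where "t = - d / (b + 1)"
    have t: "t * (b + 1) = - d" using b by (simp add: t_def)
    have "0 \<le> (2 * t * d + t\<^sup>2 * b) * (b + 1)\<^sup>2"
      using quad[of t] by (simp add: d_def b_def)
    also have "\<dots> = 2 * (t * (b + 1)) * d * (b + 1) + (t * (b + 1))\<^sup>2 * b"
      by (simp add: power2_eq_square algebra_simps)
    also have "\<dots> = - (d\<^sup>2 * (b + 2))"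
      unfolding t by (simp add: power2_eq_square algebra_simps)
    finally have "d\<^sup>2 * (b + 2) \<le> 0" by simp
    then have "d = 0" using b
      by (simp add: mult_le_0_iff)
    then show ?thesis by (simp add: d_def inner_commute)
  qed
  have "(\<lambda>n. inner (Q (x n)) v) \<longlonglongrightarrow> inner v v" "(\<lambda>n. norm (Q (x n)) * \<bar>M\<bar>) \<longlonglongrightarrow> norm v * \<bar>M\<bar>"
    by (intro tendsto_intros v)+
  moreover have "inner (Q (x n)) v \<le> norm (Q (x n)) * \<bar>M\<bar>" for n
    using le[of "x n"] rep[of "x n"] mult_left_mono[of M "\<bar>M\<bar>" "norm (Q (x n))"] by fastforce
  ultimately have "inner v v \<le> norm v * \<bar>M\<bar>" by (intro LIMSEQ_le) auto
  then have "norm v * norm v \<le> norm v * \<bar>M\<bar>" by (simp add: power2_norm_eq_inner[symmetric] power2_eq_square)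
  then have "norm v \<le> \<bar>M\<bar>" by (cases "norm v = 0") auto
  then show thesis using that v_in rep by blast
qed

text \<open>The representing vectors depend linearly on a parameter. With \<open>Q\<close> and \<open>R\<close> identities up to
  scaling this gives adjoints; in general it is the factorisation lemma of Douglas.\<close>

lemma bilinear_form_factorization:
  fixes Q :: "'a::real_normed_vector \<Rightarrow>\<^sub>L 'b::{real_inner,banach}"
    and R :: "'c::real_normed_vector \<Rightarrow>\<^sub>L 'd::real_normed_vector"
    and b :: "'a \<Rightarrow> 'c \<Rightarrow> real"
  assumes lin1: "\<And>y. linear (\<lambda>x. b x y)" and lin2: "\<And>x. linear (b x)"
    and le: "\<And>x y. \<bar>b x y\<bar> \<le> norm (Q x) * norm (R y)"
  obtains V :: "'c \<Rightarrow>\<^sub>L 'b" where "\<And>y. V y \<in> closure (range Q)"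
    "\<And>x y. b x y = inner (Q x) (V y)" "\<And>y. norm (V y) \<le> norm (R y)"
proof -
  have "\<exists>v. v \<in> closure (range Q) \<and> (\<forall>x. b x y = inner (Q x) v) \<and> norm v \<le> norm (R y)" for y
    using riesz_relative[OF lin1 le, of y] by (metis abs_norm_cancel)
  then obtain v where v: "\<And>y. v y \<in> closure (range Q)" "\<And>x y. b x y = inner (Q x) (v y)"
    "\<And>y. norm (v y) \<le> norm (R y)" by metis
  note sub = closure_range_blinfun_subspace[of Q]
  have "bounded_linear v"
  proof (rule bounded_linear_intro)
    fix y z
    have "v (y + z) - (v y + v z) = 0"
      by (rule zero_of_orthogonal_range[of _ Q])
         (auto intro!: subspace_diff[OF sub] subspace_add[OF sub] v
           simp: inner_diff_right inner_add_right v(2)[symmetric] linear_add[OF lin2])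
    then show "v (y + z) = v y + v z" by simp
  next
    fix c y
    have "v (c *\<^sub>R y) - c *\<^sub>R v y = 0"
      by (rule zero_of_orthogonal_range[of _ Q])
         (auto intro!: subspace_diff[OF sub] subspace_mul[OF sub] v
           simp: inner_diff_right v(2)[symmetric] linear_cmul[OF lin2])
    then show "v (c *\<^sub>R y) = c *\<^sub>R v y" by simp
  next
    fix y show "norm (v y) \<le> norm y * norm R"
      using v(3)[of y] norm_blinfun[of R y] by (simp add: mult.commute)
  qed
  then show thesis
    using that[of "Blinfun v"] v by (simp add: bounded_linear_Blinfun_apply)
qed

lemma bounded_linear_inner_blinfun:
  fixes A :: "'a::real_normed_vector \<Rightarrow>\<^sub>L 'b::real_inner"
  shows "linear (\<lambda>x. inner (A x) y)" "linear (\<lambda>x. inner y (A x))"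
  by (auto intro!: linearI simp: blinfun.add_right blinfun.scaleR_right inner_add)

lemma inner_adjoint_exists:
  fixes A :: "'a::complex_hilbert_space \<Rightarrow>\<^sub>L 'b::complex_hilbert_space"
  obtains B :: "'b \<Rightarrow>\<^sub>L 'a" where "\<And>x y. inner (A x) y = inner x (B y)" "norm B \<le> norm A"
proof -
  have le: "\<bar>inner (A x) y\<bar> \<le> norm (id_blinfun x) * norm ((norm A *\<^sub>R id_blinfun) y)" for x y
    using Cauchy_Schwarz_ineq2[of "A x" y] norm_blinfun[of A x]
    by (simp add: blinfun.scaleR_left) (smt (verit) mult.commute mult.assoc mult_right_mono norm_ge_zero)
  obtain B :: "'b \<Rightarrow>\<^sub>L 'a" where B: "\<And>x y. inner (A x) y = inner (id_blinfun x) (B y)"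
      "\<And>y. norm (B y) \<le> norm ((norm A *\<^sub>R id_blinfun) y)"
    using bilinear_form_factorization[of "\<lambda>x y. inner (A x) y" id_blinfun "norm A *\<^sub>R id_blinfun :: 'b \<Rightarrow>\<^sub>L 'b", OF _ _ le]
    by (metis bounded_linear_inner_blinfun(1) bounded_linear.linear bounded_linear_inner_right)
  show thesis
    by (rule that[of B], use B in simp, rule norm_blinfun_bound) (use B(2) in \<open>auto simp: blinfun.scaleR_left\<close>)
qed

lemma inner_scaleC_i: "inner (\<i> *\<^sub>C x) y = - inner x (\<i> *\<^sub>C (y :: 'a::complex_hilbert_space))"
  by (simp add: inner_eq_Re_cinner cinner_scaleC_left cinner_scaleC_right)

lemma cinner_adjoint:
  fixes A :: "'a::complex_hilbert_space \<Rightarrow>\<^sub>L 'b::complex_hilbert_space"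
  assumes A: "complex_linear A"
  shows "cinner (A x) y = cinner x (adjoint_op A y)" and "norm (adjoint_op A) \<le> norm A"
    and "complex_linear (adjoint_op A)"
proof -
  obtain B :: "'b \<Rightarrow>\<^sub>L 'a" where B: "\<And>x y. inner (A x) y = inner x (B y)" "norm B \<le> norm A"
    using inner_adjoint_exists[of A] by blast
  have BC: "complex_linear B"
    unfolding complex_linear_iff_imaginary_unit
  proof
    fix y
    have "inner x (B (\<i> *\<^sub>C y) - \<i> *\<^sub>C B y) = 0" for x
      using A B(1)[of x "\<i> *\<^sub>C y"] B(1)[of "\<i> *\<^sub>C x" y]
      by (simp add: inner_diff_right complex_linear_def inner_scaleC_i)
    from this[of "B (\<i> *\<^sub>C y) - \<i> *\<^sub>C B y"] show "B (\<i> *\<^sub>C y) = \<i> *\<^sub>C B y" by simp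
  qed
  have *: "cinner (A x) y = cinner x (B y)" for x y
    using B(1)[of x y] B(1)[of x "\<i> *\<^sub>C y"] BC
    by (simp add: complex_eq_iff Im_cinner inner_eq_Re_cinner complex_linear_def)
  have "adjoint_op A = B"
    unfolding adjoint_op_def
  proof (rule the_equality)
    fix C :: "'b \<Rightarrow>\<^sub>L 'a" assume C: "\<forall>x y. cinner (A x) y = cinner x (C y)"
    show "C = B"
    proof (rule blinfun_eq_of_cinner)
      fix x y show "cinner (C x) y = cinner (B x) y"
        using C * by (metis cinner_commute)
    qed
  qed (use * in blast)
  then show "cinner (A x) y = cinner x (adjoint_op A y)" "norm (adjoint_op A) \<le> norm A"
    "complex_linear (adjoint_op A)"
    using * B BC by auto
qed

lemma inner_adjoint:
  fixes A :: "'a::complex_hilbert_space \<Rightarrow>\<^sub>L 'b::complex_hilbert_space"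
  assumes A: "complex_linear A"
  shows "inner (A x) y = inner x (adjoint_op A y)"
  using cinner_adjoint(1)[OF assms] by (simp add: inner_eq_Re_cinner)

lemma adjoint_unique:
  fixes A :: "'a::complex_hilbert_space \<Rightarrow>\<^sub>L 'b::complex_hilbert_space"
    and B :: "'b \<Rightarrow>\<^sub>L 'a"
  assumes "\<And>x y. cinner (A x) y = cinner x (B y)"
  shows "adjoint_op A = B"
  unfolding adjoint_op_def
proof (rule the_equality)
  fix C :: "'b \<Rightarrow>\<^sub>L 'a" assume C: "\<forall>x y. cinner (A x) y = cinner x (C y)"
  show "C = B"
  proof (rule blinfun_eq_of_cinner)
    fix x y show "cinner (C x) y = cinner (B x) y"
      using C assms by (metis cinner_commute)
  qed
qed (use assms in blast)

lemma Re_op_simps: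
  fixes A :: "'a::complex_hilbert_space \<Rightarrow>\<^sub>L 'a"
  assumes A: "complex_linear A"
  shows "inner (Re_op A x) x = inner (A x) x" and "complex_linear (Re_op A)"
    and "inner (Re_op A x) y = inner x (Re_op A y)"
proof -
  have *: "inner (adjoint_op A x) y = inner x (A y)" for x y
    using inner_adjoint[OF A, of y x] by (simp add: inner_commute)
  show "inner (Re_op A x) x = inner (A x) x"
    using *[of x x] by (simp add: Re_op_def blinfun.scaleR_left blinfun.add_left inner_add inner_commute)
  show "complex_linear (Re_op A)"
    unfolding Re_op_def by (intro complex_linear_scaleR complex_linear_add A cinner_adjoint)
  show "inner (Re_op A x) y = inner x (Re_op A y)"
    using *[of x y] inner_adjoint[OF A, of x y]
    by (simp add: Re_op_def blinfun.scaleR_left blinfun.add_left inner_add)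
qed

section \<open>Square roots of positive operators\<close>

lemma compose_assoc: "(A o\<^sub>L B) o\<^sub>L C = A o\<^sub>L (B o\<^sub>L C)"
  by (rule blinfun_eqI) simp

lemma compose_id [simp]: "A o\<^sub>L id_blinfun = A" "id_blinfun o\<^sub>L A = A"
  by (rule blinfun_eqI, simp)+

interpretation compose: bounded_bilinear
  "blinfun_compose :: ('b::real_normed_vector \<Rightarrow>\<^sub>L 'c::real_normed_vector) \<Rightarrow> ('a::real_normed_vector \<Rightarrow>\<^sub>L 'b) \<Rightarrow> ('a \<Rightarrow>\<^sub>L 'c)"
  by (rule bounded_bilinear_blinfun_compose)

lemma op_power_add: "op_power A (m + n) = op_power A m o\<^sub>L op_power A n"
  by (induction m) (auto simp: compose_assoc)

lemma op_power_commute: "D o\<^sub>L A = A o\<^sub>L D \<Longrightarrow> D o\<^sub>L op_power A n = op_power A n o\<^sub>L D"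
  by (induction n) (auto simp: compose_assoc[symmetric], simp add: compose_assoc)

lemma norm_op_power_le: "norm (op_power A n) \<le> norm A ^ n"
proof (induction n)
  case 0
  have "norm (id_blinfun :: 'a \<Rightarrow>\<^sub>L 'a) \<le> 1" by (rule norm_blinfun_bound) auto
  then show ?case by simp
next
  case (Suc n)
  then show ?case
    using norm_blinfun_compose[of A "op_power A n"] mult_left_mono[OF Suc, of "norm A"] by simp
qed

lemma positive_op_iff:
  "positive_op A \<longleftrightarrow> complex_linear A \<and> (\<forall>x y. inner (A x) y = inner x (A y)) \<and> (\<forall>x. 0 \<le> inner (A x) x)"
proof
  assume A: "positive_op A"
  then have lin: "complex_linear A" and re: "\<And>x. Im (cinner (A x) x) = 0"
    and ge: "\<And>x. 0 \<le> inner (A x) x"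
    by (auto simp: positive_op_def inner_eq_Re_cinner complex_is_Real_iff)
  have "inner (A x) y = inner x (A y)" for x y
  proof -
    \<comment> \<open>Polarisation: the form of \<open>A\<close> is real at \<open>x + \<i> y\<close>.\<close>
    have "Im (cinner (A (x + \<i> *\<^sub>C y)) (x + \<i> *\<^sub>C y)) = 0" by (rule re)
    then have "Re (cinner (A y) x) = Re (cinner (A x) y)"
      using re[of x] re[of y]
      by (simp add: blinfun.add_right complex_linearD[OF lin] cinner_add_left cinner_add_right
          cinner_scaleC_left cinner_scaleC_right)
    then show ?thesis by (simp add: inner_eq_Re_cinner[symmetric] inner_commute)
  qed
  then show "complex_linear A \<and> (\<forall>x y. inner (A x) y = inner x (A y)) \<and> (\<forall>x. 0 \<le> inner (A x) x)"
    using lin ge by blast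
next
  assume *: "complex_linear A \<and> (\<forall>x y. inner (A x) y = inner x (A y)) \<and> (\<forall>x. 0 \<le> inner (A x) x)"
  then have lin: "complex_linear A" by blast
  have "Im (cinner (A x) x) = 0" for x
  proof -
    have "inner (A x) (\<i> *\<^sub>C x) = inner x (A (\<i> *\<^sub>C x))" using * by blast
    also have "\<dots> = - inner (A x) (\<i> *\<^sub>C x)"
      by (metis complex_linearD[OF lin] inner_commute inner_scaleC_i)
    finally show ?thesis by (simp add: Im_cinner)
  qed
  with * show "positive_op A"
    by (auto simp: positive_op_def inner_eq_Re_cinner complex_is_Real_iff)
qed

lemma cinner_selfadjoint:
  assumes "positive_op A"
  shows "cinner (A x) y = cinner x (A y)"
proof -
  have lin: "complex_linear A" and sa: "\<And>x y. inner (A x) y = inner x (A y)"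
    using assms by (auto simp: positive_op_iff)
  show ?thesis
    using sa[of x y] sa[of x "\<i> *\<^sub>C y"]
    by (simp add: complex_eq_iff Im_cinner complex_linearD[OF lin] inner_eq_Re_cinner)
qed

lemma positive_op_norm_apply:
  assumes "positive_op A"
  shows "(norm (A x))\<^sup>2 \<le> norm A * inner (A x) x"
proof (cases "A x = 0")
  case False
  define y where "y = A x"
  have sa: "inner (A u) v = inner u (A v)" and ge: "0 \<le> inner (A u) u" for u v
    using assms by (auto simp: positive_op_iff)
  define n where "n = (norm y)\<^sup>2"
  have n: "n > 0" using False by (simp add: n_def y_def)
  have "inner (A y) y \<le> norm (A y) * norm y" by (rule norm_cauchy_schwarz)
  also have "\<dots> \<le> norm A * n"
    using norm_blinfun[of A y] by (simp add: n_def power2_eq_square mult.assoc[symmetric] mult_right_mono)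
  finally have yy: "inner (A y) y \<le> norm A * n" .
  \<comment> \<open>Positivity at \<open>x - t y\<close>, with the value of \<open>t\<close> that minimises the resulting bound.\<close>
  have quad: "0 \<le> inner (A x) x - 2 * t * n + t\<^sup>2 * (norm A * n)" for t
  proof -
    have "0 \<le> inner (A (x - t *\<^sub>R y)) (x - t *\<^sub>R y)" by (rule ge)
    also have "\<dots> = inner (A x) x - 2 * t * n + t\<^sup>2 * inner (A y) y"
      using sa[of y x]
      by (simp add: blinfun.diff_right blinfun.scaleR_right inner_diff n_def y_def[symmetric]
          power2_norm_eq_inner algebra_simps) (simp add: power2_eq_square)
    also have "\<dots> \<le> inner (A x) x - 2 * t * n + t\<^sup>2 * (norm A * n)"
      using mult_left_mono[OF yy, of "t\<^sup>2"] by simp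
    finally show ?thesis .
  qed
  have "norm A > 0" using False norm_blinfun[of A x] by (metis mult_zero_left norm_le_zero_iff norm_ge_zero less_eq_real_def)
  then have "inner (A x) x - 2 * (1 / norm A) * n + (1 / norm A)\<^sup>2 * (norm A * n) = inner (A x) x - n / norm A"
    by (simp add: power2_eq_square field_simps)
  then have "n / norm A \<le> inner (A x) x" using quad[of "1 / norm A"] by linarith
  then show ?thesis
    using \<open>norm A > 0\<close> by (simp add: n_def y_def field_simps)
qed auto

text \<open>The coefficients of the power series of \<open>sqrt (1 - t)\<close>.\<close>

definition sqrt_coeff :: "nat \<Rightarrow> real" where
  "sqrt_coeff n = (-1) ^ n * ((1/2) gchoose n)"

lemma sqrt_coeff_0 [simp]: "sqrt_coeff 0 = 1"
  by (simp add: sqrt_coeff_def)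

lemma sqrt_coeff_Suc: "sqrt_coeff (Suc n) = sqrt_coeff n * (real n - 1/2) / real (Suc n)"
proof -
  have "real (Suc n) * ((1/2::real) gchoose Suc n) = (1/2 - real n) * ((1/2) gchoose n)"
    using gbinomial_mult_1[of "1/2::real" n] by (simp add: algebra_simps)
  then have *: "((1/2::real) gchoose Suc n) = (1/2 - real n) * ((1/2) gchoose n) / real (Suc n)"
    by (simp add: field_simps)
  have "(-1) ^ Suc n * ((1/2::real) gchoose Suc n) = (-1) ^ n * ((real n - 1/2) * ((1/2) gchoose n) / real (Suc n))"
    unfolding * by (simp add: field_simps)
  then show ?thesis unfolding sqrt_coeff_def by (simp add: mult_ac del: of_nat_Suc)
qed

lemma sqrt_coeff_nonpos: "sqrt_coeff (Suc n) \<le> 0"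
proof (induction n)
  case (Suc n)
  show ?case
    by (subst sqrt_coeff_Suc) (use Suc in \<open>auto simp: divide_nonpos_nonneg mult_nonpos_nonneg\<close>)
qed (simp add: sqrt_coeff_Suc)

lemma sum_sqrt_coeff: "(\<Sum>k\<le>n. sqrt_coeff k) = - (2 * real n + 2) * sqrt_coeff (Suc n)"
proof (induction n)
  case (Suc n)
  have "(\<Sum>k\<le>Suc n. sqrt_coeff k) = - (2 * real n + 1) * sqrt_coeff (Suc n)"
    by (simp add: Suc algebra_simps)
  also have "\<dots> = - (2 * real (Suc n) + 2) * sqrt_coeff (Suc (Suc n))"
    by (subst (2) sqrt_coeff_Suc) (simp add: field_simps)
  finally show ?case .
qed (simp add: sqrt_coeff_Suc)

lemma sum_abs_sqrt_coeff: "(\<Sum>k<n. \<bar>sqrt_coeff (Suc k)\<bar>) \<le> 1"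
proof -
  have "(\<Sum>k\<le>n. sqrt_coeff k) = 1 + (\<Sum>k<n. sqrt_coeff (Suc k))"
    by (simp add: sum.atMost_shift)
  moreover have "(\<Sum>k\<le>n. sqrt_coeff k) \<ge> 0"
    using sqrt_coeff_nonpos[of n] by (simp add: sum_sqrt_coeff mult_nonpos_nonpos)
  moreover have "(\<Sum>k<n. \<bar>sqrt_coeff (Suc k)\<bar>) = - (\<Sum>k<n. sqrt_coeff (Suc k))"
    using sqrt_coeff_nonpos by (simp add: sum_negf[symmetric] abs_of_nonpos)
  ultimately show ?thesis by linarith
qed

lemma summable_sqrt_coeff: "summable (\<lambda>n. \<bar>sqrt_coeff n\<bar>)"
proof -
  have "summable (\<lambda>n. \<bar>sqrt_coeff (Suc n)\<bar>)"
    by (rule bounded_imp_summable[of _ 1]) (use sum_abs_sqrt_coeff[of "Suc _"] in \<open>auto simp: lessThan_Suc_atMost\<close>)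
  then show ?thesis by (subst (asm) summable_Suc_iff)
qed

lemma sqrt_coeff_convolution:
  "(\<Sum>i\<le>n. sqrt_coeff i * sqrt_coeff (n - i)) = (if n = 0 then 1 else if n = 1 then -1 else 0)"
proof -
  have "(\<Sum>i\<le>n. sqrt_coeff i * sqrt_coeff (n - i)) = (\<Sum>i\<le>n. (-1)^n * (((1/2) gchoose i) * ((1/2) gchoose (n - i))))"
    by (rule sum.cong) (auto simp: sqrt_coeff_def power_add[symmetric] algebra_simps)
  also have "\<dots> = (-1)^n * (((1/2) + (1/2) :: real) gchoose n)"
    by (simp add: sum_distrib_left[symmetric] atLeast0AtMost[symmetric] gbinomial_Vandermonde)
  also have "((1/2) + (1/2) :: real) gchoose n = of_nat (1 choose n)"
    using binomial_gbinomial[of 1 n, where 'a = real] by simp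
  finally show ?thesis by (cases "n = 0"; cases "n = 1") (auto simp: binomial_eq_0)
qed

text \<open>If \<open>\<parallel>B\<parallel> \<le> 1\<close> then the series of \<open>sqrt (1 - B)\<close> converges in norm, because its coefficients
  are absolutely summable. Being a norm limit of polynomials in \<open>B\<close>, its sum inherits every
  commutation property of \<open>B\<close>.\<close>

lemma sqrt_of_one_minus:
  fixes B :: "'a::complex_hilbert_space \<Rightarrow>\<^sub>L 'a"
  assumes B: "complex_linear B" "norm B \<le> 1" and sa: "\<And>x y. inner (B x) y = inner x (B y)"
  obtains C where "positive_op C" "C o\<^sub>L C = id_blinfun - B"
    "\<And>D. D o\<^sub>L B = B o\<^sub>L D \<Longrightarrow> D o\<^sub>L C = C o\<^sub>L D"
proof -
  have pw: "norm (op_power B n) \<le> 1" for n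
    using norm_op_power_le[of B n] power_le_one[of "norm B" n] B by simp
  have "summable (\<lambda>n. norm (sqrt_coeff n *\<^sub>R op_power B n))"
    by (rule summable_comparison_test'[OF summable_sqrt_coeff, of 0])
       (use pw in \<open>auto intro: mult_left_le\<close>)
  then have "summable (\<lambda>n. sqrt_coeff n *\<^sub>R op_power B n)" by (rule summable_norm_cancel)
  define S where "S N = (\<Sum>n<N. sqrt_coeff n *\<^sub>R op_power B n)" for N
  define C where "C = (\<Sum>n. sqrt_coeff n *\<^sub>R op_power B n)"
  have S: "S \<longlonglongrightarrow> C"
    unfolding S_def C_def by (rule summable_LIMSEQ) fact
  have S_lin: "complex_linear (S N)" for N
    unfolding S_def by (intro complex_linear_sum complex_linear_scaleR complex_linear_op_power B)
  have C_lin: "complex_linear C" by (rule complex_linear_lim[OF S _ S_lin]) simp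
  have sa_pow: "inner (op_power B n x) y = inner x (op_power B n y)" for n x y
  proof (induction n arbitrary: x y)
    case (Suc n)
    have "inner (B (op_power B n x)) y = inner x (op_power B n (B y))"
      by (simp add: sa Suc)
    also have "op_power B n (B y) = B (op_power B n y)"
      using op_power_commute[of B B n] by (metis blinfun_apply_blinfun_compose)
    finally show ?case by simp
  qed simp
  have sa_S: "inner (S N x) y = inner x (S N y)" for N x y
    by (simp add: S_def blinfun.sum_left inner_sum_left inner_sum_right blinfun.scaleR_left sa_pow)
  have "inner (C x) y = inner x (C y)" for x y
  proof (rule LIMSEQ_unique)
    show "(\<lambda>N. inner (S N x) y) \<longlonglongrightarrow> inner (C x) y" by (intro tendsto_intros S)
    show "(\<lambda>N. inner (S N x) y) \<longlonglongrightarrow> inner x (C y)"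
      unfolding sa_S by (intro tendsto_intros S)
  qed
  moreover have "0 \<le> inner (C x) x" for x
  proof (rule LIMSEQ_le_const)
    show "(\<lambda>N. inner (S N x) x) \<longlonglongrightarrow> inner (C x) x" by (intro tendsto_intros S)
    show "\<exists>N. \<forall>n\<ge>N. 0 \<le> inner (S n x) x"
    proof (intro exI[of _ 1] allI impI)
      fix n :: nat assume "n \<ge> 1"
      then obtain m where m: "n = Suc m" by (cases n) auto
      have *: "\<bar>sqrt_coeff (Suc k) * inner (op_power B (Suc k) x) x\<bar> \<le> \<bar>sqrt_coeff (Suc k)\<bar> * inner x x" for k
      proof -
        have "\<bar>inner (op_power B (Suc k) x) x\<bar> \<le> norm (op_power B (Suc k) x) * norm x"
          by (rule Cauchy_Schwarz_ineq2)
        also have "\<dots> \<le> (norm (op_power B (Suc k)) * norm x) * norm x"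
          by (intro mult_right_mono norm_blinfun) auto
        also have "\<dots> \<le> inner x x"
          using mult_right_mono[OF pw[of "Suc k"], of "norm x * norm x"]
          by (simp add: power2_norm_eq_inner[symmetric] power2_eq_square mult.assoc)
        finally show ?thesis by (simp add: abs_mult mult_left_mono del: op_power.simps)
      qed
      have "\<bar>\<Sum>k<m. sqrt_coeff (Suc k) * inner (op_power B (Suc k) x) x\<bar> \<le> (\<Sum>k<m. \<bar>sqrt_coeff (Suc k)\<bar> * inner x x)"
        using * by (intro order_trans[OF sum_abs] sum_mono) blast
      also have "\<dots> \<le> inner x x"
        unfolding sum_distrib_right[symmetric]
        using mult_right_mono[OF sum_abs_sqrt_coeff[of m], of "inner x x"] by simp
      finally have "\<bar>\<Sum>k<m. sqrt_coeff (Suc k) * inner (op_power B (Suc k) x) x\<bar> \<le> inner x x" .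
      moreover have "inner (S n x) x = inner x x + (\<Sum>k<m. sqrt_coeff (Suc k) * inner (op_power B (Suc k) x) x)"
        unfolding S_def m sum.lessThan_Suc_shift
        by (simp add: blinfun.add_left blinfun.sum_left inner_add inner_sum_left blinfun.scaleR_left del: op_power.simps(2))
      ultimately show "0 \<le> inner (S n x) x" by linarith
    qed
  qed
  ultimately have pos: "positive_op C" using C_lin by (auto simp: positive_op_iff)
  have "C o\<^sub>L C = id_blinfun - B"
  proof -
    let ?a = "\<lambda>n. \<bar>sqrt_coeff n\<bar>"
    define g where "g = (\<lambda>(i, j). (sqrt_coeff i * sqrt_coeff j) *\<^sub>R op_power B (i + j))"
    have SS: "S N o\<^sub>L S N = sum g ({..<N} \<times> {..<N})" for N
      by (simp add: S_def g_def sum.cartesian_product[symmetric] compose.sum_left compose.sum_right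
          compose.scaleR_left compose.scaleR_right op_power_add scaleR_sum_right)
         (subst sum.swap, simp add: mult.commute)
    have T: "sum g {(i, j). i + j < N} = id_blinfun - B" if "N \<ge> 2" for N
    proof -
      have "sum g {(i, j). i + j < N} = (\<Sum>k<N. \<Sum>i\<le>k. (sqrt_coeff i * sqrt_coeff (k - i)) *\<^sub>R op_power B k)"
        unfolding g_def by (subst sum.triangle_reindex) (auto intro!: sum.cong)
      also have "\<dots> = (\<Sum>k<N. (if k = 0 then 1 else if k = 1 then -1 else 0) *\<^sub>R op_power B k)"
        by (simp only: scaleR_left.sum[symmetric] sqrt_coeff_convolution)
      also have "\<dots> = (\<Sum>k\<in>{0, 1}. (if k = 0 then 1 else if k = 1 then -1 else 0) *\<^sub>R op_power B k)"
        using that by (intro sum.mono_neutral_right) auto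
      finally show ?thesis by simp
    qed
    define e where "e N = (\<Sum>i<N. ?a i) * (\<Sum>i<N. ?a i) - (\<Sum>k<N. \<Sum>i\<le>k. ?a i * ?a (k - i))" for N
    have "norm ((S N o\<^sub>L S N) - sum g {(i, j). i + j < N}) \<le> e N" for N
    proof -
      have sub: "{(i, j). i + j < N} \<subseteq> {..<N} \<times> {..<N}" and fin: "finite ({..<N} \<times> {..<N})"
        by auto
      have "(S N o\<^sub>L S N) - sum g {(i, j). i + j < N} = sum g ({..<N} \<times> {..<N} - {(i, j). i + j < N})"
        by (simp only: SS sum_diff[OF fin sub])
      also have "norm \<dots> \<le> (\<Sum>p\<in>{..<N} \<times> {..<N} - {(i, j). i + j < N}. case p of (i, j) \<Rightarrow> ?a i * ?a j)"
        by (rule sum_norm_le) (use pw in \<open>auto simp: g_def abs_mult intro!: mult_left_le\<close>)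
      also have "\<dots> = (\<Sum>p\<in>{..<N} \<times> {..<N}. case p of (i, j) \<Rightarrow> ?a i * ?a j) -
          (\<Sum>p\<in>{(i, j). i + j < N}. case p of (i, j) \<Rightarrow> ?a i * ?a j)"
        by (rule sum_diff[OF fin sub])
      also have "\<dots> = e N"
        by (simp add: e_def sum_product sum.cartesian_product sum.triangle_reindex)
      finally show ?thesis .
    qed
    then have ev: "\<forall>\<^sub>F N in sequentially. norm ((S N o\<^sub>L S N) - sum g {(i, j). i + j < N}) \<le> e N"
      by (simp add: always_eventually)
    have e: "e \<longlonglongrightarrow> (\<Sum>i. ?a i) * (\<Sum>i. ?a i) - (\<Sum>i. ?a i) * (\<Sum>i. ?a i)"
    proof -
      have "(\<lambda>k. \<Sum>i\<le>k. ?a i * ?a (k - i)) sums ((\<Sum>i. ?a i) * (\<Sum>i. ?a i))"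
        using summable_sqrt_coeff by (intro Cauchy_product_sums) auto
      then show ?thesis
        unfolding e_def by (intro tendsto_intros summable_LIMSEQ summable_sqrt_coeff) (simp add: sums_def)
    qed
    have "(\<lambda>N. (S N o\<^sub>L S N) - sum g {(i, j). i + j < N}) \<longlonglongrightarrow> 0"
      by (rule Lim_null_comparison[OF ev]) (use e in simp)
    moreover have "\<forall>\<^sub>F N in sequentially. (S N o\<^sub>L S N) - sum g {(i, j). i + j < N} = (S N o\<^sub>L S N) - (id_blinfun - B)"
      using eventually_ge_at_top[of 2] by eventually_elim (simp add: T)
    ultimately have "(\<lambda>N. (S N o\<^sub>L S N) - (id_blinfun - B)) \<longlonglongrightarrow> 0"
      using tendsto_cong by fastforce
    moreover have "(\<lambda>N. (S N o\<^sub>L S N) - (id_blinfun - B)) \<longlonglongrightarrow> (C o\<^sub>L C) - (id_blinfun - B)"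
      by (intro tendsto_intros S bounded_bilinear.tendsto[OF bounded_bilinear_blinfun_compose])
    ultimately show ?thesis using LIMSEQ_unique by fastforce
  qed
  moreover have "D o\<^sub>L C = C o\<^sub>L D" if D: "D o\<^sub>L B = B o\<^sub>L D" for D
  proof (rule LIMSEQ_unique)
    show "(\<lambda>N. D o\<^sub>L S N) \<longlonglongrightarrow> (D o\<^sub>L C)"
      by (intro tendsto_intros S bounded_bilinear.tendsto[OF bounded_bilinear_blinfun_compose])
    have "D o\<^sub>L S N = S N o\<^sub>L D" for N
      by (simp add: S_def compose.sum_left compose.sum_right
          compose.scaleR_left compose.scaleR_right op_power_commute[OF D])
    then show "(\<lambda>N. D o\<^sub>L S N) \<longlonglongrightarrow> (C o\<^sub>L D)"
      by (simp only:) (intro tendsto_intros S bounded_bilinear.tendsto[OF bounded_bilinear_blinfun_compose])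
  qed
  ultimately show thesis using that pos by blast
qed

text \<open>After scaling, a positive operator differs from the identity by a contraction. Inheriting the commutants makes the root unique.\<close>

lemma sqrt_exists:
  fixes A :: "'a::complex_hilbert_space \<Rightarrow>\<^sub>L 'a"
  assumes A: "positive_op A"
  obtains C where "positive_op C" "C o\<^sub>L C = A" "\<And>D. D o\<^sub>L A = A o\<^sub>L D \<Longrightarrow> D o\<^sub>L C = C o\<^sub>L D"
proof (cases "A = 0")
  case True
  then show ?thesis using that[of 0] A by simp
next
  case False
  define t where "t = norm A"
  have t: "t > 0" using False by (simp add: t_def)
  define B where "B = id_blinfun - (1/t) *\<^sub>R A"
  have A': "complex_linear A" "\<And>x y. inner (A x) y = inner x (A y)" "\<And>x. 0 \<le> inner (A x) x"
    using A by (auto simp: positive_op_iff)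
  have "norm B \<le> 1"
  proof (rule norm_blinfun_bound)
    fix x
    have "(norm (A x))\<^sup>2 \<le> t * inner (A x) x"
      unfolding t_def by (rule positive_op_norm_apply[OF A])
    then have "(norm (A x))\<^sup>2 / t\<^sup>2 \<le> inner (A x) x / t"
      using t by (simp add: field_simps power2_eq_square)
    moreover have "(norm (B x))\<^sup>2 = (norm x)\<^sup>2 - 2 * (inner (A x) x / t) + (norm (A x))\<^sup>2 / t\<^sup>2"
      by (simp add: B_def blinfun.diff_left blinfun.scaleR_left power2_norm_eq_inner inner_diff
          inner_commute[of x "A x"]) (simp add: power2_eq_square diff_divide_distrib)
    moreover have "0 \<le> inner (A x) x / t" using A' t by simp
    ultimately have "(norm (B x))\<^sup>2 \<le> (norm x)\<^sup>2" by linarith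
    then show "norm (B x) \<le> 1 * norm x" by simp
  qed simp
  moreover have "complex_linear B"
    unfolding B_def by (intro complex_linear_diff complex_linear_scaleR A') simp
  moreover have "inner (B x) y = inner x (B y)" for x y
    by (simp add: B_def blinfun.diff_left blinfun.scaleR_left inner_diff A')
  ultimately obtain C where C: "positive_op C" "C o\<^sub>L C = id_blinfun - B"
    "\<And>D. D o\<^sub>L B = B o\<^sub>L D \<Longrightarrow> D o\<^sub>L C = C o\<^sub>L D"
    using sqrt_of_one_minus by blast
  show ?thesis
  proof (rule that[of "sqrt t *\<^sub>R C"])
    show "positive_op (sqrt t *\<^sub>R C)"
      using C(1) t by (auto simp: positive_op_iff complex_linear_scaleR blinfun.scaleR_left)
    show "(sqrt t *\<^sub>R C) o\<^sub>L (sqrt t *\<^sub>R C) = A"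
      using C(2) t by (simp add: compose.scaleR_left compose.scaleR_right B_def)
    fix D assume "D o\<^sub>L A = A o\<^sub>L D"
    then have "D o\<^sub>L B = B o\<^sub>L D"
      by (simp add: B_def compose.diff_left compose.diff_right
          compose.scaleR_left compose.scaleR_right)
    then show "D o\<^sub>L (sqrt t *\<^sub>R C) = (sqrt t *\<^sub>R C) o\<^sub>L D"
      using C(3) by (simp add: compose.scaleR_left compose.scaleR_right)
  qed
qed

lemma inner_zero_positive_op:
  assumes "positive_op A" "inner (A x) x = 0"
  shows "A x = 0"
  using positive_op_norm_apply[OF assms(1), of x] assms(2) by simp

lemma sqrt_op:
  fixes A :: "'a::complex_hilbert_space \<Rightarrow>\<^sub>L 'a"
  assumes A: "positive_op A"
  shows positive_sqrt_op: "positive_op (sqrt_op A)" and sqrt_op_square: "sqrt_op A o\<^sub>L sqrt_op A = A"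
    and sqrt_op_commute: "D o\<^sub>L A = A o\<^sub>L D \<Longrightarrow> D o\<^sub>L sqrt_op A = sqrt_op A o\<^sub>L D"
    and sqrt_op_unique: "positive_op B \<Longrightarrow> B o\<^sub>L B = A \<Longrightarrow> sqrt_op A = B"
proof -
  obtain C where C: "positive_op C" "C o\<^sub>L C = A" "\<And>D. D o\<^sub>L A = A o\<^sub>L D \<Longrightarrow> D o\<^sub>L C = C o\<^sub>L D"
    using sqrt_exists[OF A] by blast
  have uniq: "B = C" if B: "positive_op B" "B o\<^sub>L B = A" for B
  proof (rule blinfun_eqI)
    fix x
    have "B o\<^sub>L A = A o\<^sub>L B" using B(2) by (metis compose_assoc)
    then have com: "B (C z) = C (B z)" for z using C(3) by (metis blinfun_apply_blinfun_compose)
    have sq: "B (B z) = C (C z)" for z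
      using B(2) C(2) by (metis blinfun_apply_blinfun_compose)
    define y where "y = C x - B x"
    have "inner (C y) y + inner (B y) y = 0"
      by (simp add: inner_add_left[symmetric]) (simp add: y_def blinfun.diff_right com sq)
    then have "inner (C y) y = 0" "inner (B y) y = 0"
      using B(1) C(1) by (auto simp: positive_op_iff add_nonneg_eq_0_iff)
    then have "C y = 0" "B y = 0" using inner_zero_positive_op B(1) C(1) by auto
    then have "inner y y = 0"
      using B(1) C(1) by (simp add: y_def inner_diff_left inner_diff_right blinfun.diff_right positive_op_iff)
    then show "B x = C x" by (simp add: y_def)
  qed
  have eq: "sqrt_op A = C"
    unfolding sqrt_op_def by (rule the_equality) (use C(1,2) uniq in blast)+
  show "positive_op (sqrt_op A)" "sqrt_op A o\<^sub>L sqrt_op A = A"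
    "D o\<^sub>L A = A o\<^sub>L D \<Longrightarrow> D o\<^sub>L sqrt_op A = sqrt_op A o\<^sub>L D"
    "positive_op B \<Longrightarrow> B o\<^sub>L B = A \<Longrightarrow> sqrt_op A = B"
    unfolding eq using C uniq by blast+
qed

section \<open>Positive block operators, contractions and unitary dilations\<close>

lemma scaleC_Pair [simp]: "c *\<^sub>C (x, y) = (c *\<^sub>C x, c *\<^sub>C y)"
  by (simp add: scaleC_prod_def)

lemma cinner_Pair [simp]: "cinner (x, y) (u, v) = cinner x u + cinner y v"
  by (simp add: cinner_prod_def)

lemma block_op_apply [simp]: "block_op A B C D (x, y) = (A x + B y, C x + D y)"
  by (simp add: block_op_def)

lemma block_op_compose:
  "block_op A B C D o\<^sub>L block_op A' B' C' D' =
    block_op ((A o\<^sub>L A') + (B o\<^sub>L C')) ((A o\<^sub>L B') + (B o\<^sub>L D'))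
      ((C o\<^sub>L A') + (D o\<^sub>L C')) ((C o\<^sub>L B') + (D o\<^sub>L D'))"
  by (rule blinfun_eqI) (auto simp: blinfun.add_right blinfun.add_left)

lemma block_op_id: "block_op id_blinfun 0 0 id_blinfun = id_blinfun"
  by (rule blinfun_eqI) auto

lemma complex_linear_block:
  "complex_linear A \<Longrightarrow> complex_linear B \<Longrightarrow> complex_linear C \<Longrightarrow> complex_linear D \<Longrightarrow>
    complex_linear (block_op A B C D)"
  by (auto simp: complex_linear_def scaleC_add_right)

lemma block_op_eq_iff:
  "block_op A B C D = block_op A' B' C' D' \<longleftrightarrow> A = A' \<and> B = B' \<and> C = C' \<and> D = D'"
proof
  assume eq: "block_op A B C D = block_op A' B' C' D'"
  have "A x + B y = A' x + B' y" "C x + D y = C' x + D' y" for x y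
    using arg_cong[OF eq, of "\<lambda>F. F (x, y)"] by simp_all
  from this[of _ 0] this[of 0] show "A = A' \<and> B = B' \<and> C = C' \<and> D = D'"
    by (auto intro!: blinfun_eqI)
qed auto

lemma adjoint_block:
  assumes "complex_linear A" "complex_linear B" "complex_linear C" "complex_linear D"
  shows "adjoint_op (block_op A B C D) = block_op (adjoint_op A) (adjoint_op C) (adjoint_op B) (adjoint_op D)"
  by (rule adjoint_unique) (use assms in \<open>auto simp: cinner_add_left cinner_add_right cinner_adjoint(1)\<close>)

lemma adjoint_adjoint: "complex_linear A \<Longrightarrow> adjoint_op (adjoint_op A) = A"
  by (rule adjoint_unique) (metis cinner_adjoint(1) cinner_commute)

lemma adjoint_compose:
  "complex_linear A \<Longrightarrow> complex_linear B \<Longrightarrow> adjoint_op (A o\<^sub>L B) = adjoint_op B o\<^sub>L adjoint_op A"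
  by (rule adjoint_unique) (simp add: cinner_adjoint(1))

lemma adjoint_minus: "complex_linear A \<Longrightarrow> adjoint_op (- A) = - adjoint_op A"
  by (rule adjoint_unique) (simp add: cinner_adjoint(1) blinfun.minus_left cinner.minus_left cinner.minus_right)

lemma adjoint_positive: "positive_op A \<Longrightarrow> adjoint_op A = A"
  by (rule adjoint_unique) (rule cinner_selfadjoint)

lemma complex_linear_uminus: "complex_linear A \<Longrightarrow> complex_linear (- A)"
  using complex_linear_diff[of 0 A] by simp

lemma positive_defect:
  fixes K :: "'a::complex_hilbert_space \<Rightarrow>\<^sub>L 'b::complex_hilbert_space"
  assumes "contraction_op K"
  shows "positive_op (id_blinfun - (adjoint_op K o\<^sub>L K))"
proof -
  have lin: "complex_linear K" and le: "norm K \<le> 1" using assms by (auto simp: contraction_op_def)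
  have ad: "inner (adjoint_op K u) v = inner u (K v)" for u v
    using inner_adjoint[OF lin, of v u] by (simp add: inner_commute)
  have "norm (K x) \<le> norm x" for x
    using norm_blinfun[of K x] mult_right_mono[OF le, of "norm x"] by simp
  then have "inner (K x) (K x) \<le> inner x x" for x
    by (simp add: power2_norm_eq_inner[symmetric])
  then show ?thesis
    by (auto simp: positive_op_iff blinfun.diff_left inner_diff ad inner_adjoint[OF lin, symmetric]
        intro!: complex_linear_diff complex_linear_compose lin cinner_adjoint(3)[OF lin])
qed

lemma contraction_adjoint: "contraction_op K \<Longrightarrow> contraction_op (adjoint_op K)"
  using cinner_adjoint(2,3)[of K] by (auto simp: contraction_op_def)

lemma positive_op_diag: "positive_op A \<Longrightarrow> positive_op D \<Longrightarrow> positive_op (block_op A 0 0 D)"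
  by (auto simp: positive_op_iff complex_linear_block)

text \<open>An intertwining relation between two operators is a commutation relation between block operators.\<close>

lemma sqrt_op_intertwine:
  assumes A: "positive_op A" and A': "positive_op A'" and K: "K o\<^sub>L A = A' o\<^sub>L K"
  shows "K o\<^sub>L sqrt_op A = sqrt_op A' o\<^sub>L K"
proof -
  let ?E = "block_op 0 K 0 0" and ?D = "block_op A' 0 0 A"
  have "sqrt_op ?D = block_op (sqrt_op A') 0 0 (sqrt_op A)"
    by (rule sqrt_op_unique)
       (use A A' in \<open>auto simp: positive_op_diag positive_sqrt_op block_op_compose sqrt_op_square\<close>)
  moreover have "?E o\<^sub>L ?D = ?D o\<^sub>L ?E"
    using K by (simp add: block_op_compose)
  then have "?E o\<^sub>L sqrt_op ?D = sqrt_op ?D o\<^sub>L ?E"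
    by (intro sqrt_op_commute positive_op_diag A A')
  ultimately show ?thesis by (simp add: block_op_compose block_op_eq_iff)
qed

text \<open>Halmos: the defect operators complete a contraction to a unitary operator matrix.\<close>

lemma halmos_dilation:
  fixes K :: "'a::complex_hilbert_space \<Rightarrow>\<^sub>L 'a"
  assumes K: "contraction_op K"
  obtains B C D :: "'a \<Rightarrow>\<^sub>L 'a" where "unitary_op (block_op K B C D)"
proof -
  define K' where "K' = adjoint_op K"
  have lin: "complex_linear K" "complex_linear K'" and K': "contraction_op K'" and KK: "adjoint_op K' = K"
    using K contraction_adjoint[OF K] by (auto simp: contraction_op_def K'_def adjoint_adjoint)
  define A where "A = id_blinfun - (K' o\<^sub>L K)"
  define A' where "A' = id_blinfun - (K o\<^sub>L K')"
  have A: "positive_op A" unfolding A_def K'_def by (rule positive_defect[OF K])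
  have A': "positive_op A'" using positive_defect[OF K'] by (simp add: A'_def KK)
  define D where "D = sqrt_op A"
  define D' where "D' = sqrt_op A'"
  have D: "positive_op D" "D o\<^sub>L D = A" and D': "positive_op D'" "D' o\<^sub>L D' = A'"
    using A A' by (auto simp: D_def D'_def positive_sqrt_op sqrt_op_square)
  have Dlin: "complex_linear D" "complex_linear D'" using D D' by (auto simp: positive_op_def)
  have KD: "K o\<^sub>L D = D' o\<^sub>L K"
    unfolding D_def D'_def
    by (rule sqrt_op_intertwine[OF A A'])
       (simp add: A_def A'_def compose.diff_left compose.diff_right compose_assoc)
  then have "adjoint_op (K o\<^sub>L D) = adjoint_op (D' o\<^sub>L K)" by simp
  then have DK: "D o\<^sub>L K' = K' o\<^sub>L D'"
    by (simp add: adjoint_compose lin Dlin adjoint_positive D D' K'_def)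
  let ?U = "block_op K D' D (- K')"
  have adj: "adjoint_op ?U = block_op K' D D' (- K)"
    by (simp add: adjoint_block lin Dlin complex_linear_uminus adjoint_minus KK adjoint_positive D D')
       (simp add: K'_def)
  have "unitary_op ?U"
    unfolding unitary_op_def adj block_op_compose
    by (auto simp: block_op_id[symmetric] block_op_eq_iff D D' A_def A'_def compose.minus_left
        compose.minus_right KD DK intro!: complex_linear_block lin Dlin complex_linear_uminus)
  then show thesis by (rule that)
qed

lemma unitary_op_norm:
  assumes "unitary_op U"
  shows "norm (U x) = norm x"
proof -
  have "adjoint_op U (U x) = x"
    using assms by (metis unitary_op_def blinfun_apply_blinfun_compose blinfun_apply_id_blinfun)
  then have "inner (U x) (U x) = inner x x"
    using assms inner_adjoint[of U x "U x"] by (simp add: unitary_op_def)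
  then show ?thesis by (simp add: norm_eq_sqrt_inner)
qed

text \<open>The row and the column compress a unitary to its upper left corner, and the contractions are
  exactly the corners of unitaries.\<close>

lemma contraction_iff_compressed_unitary:
  fixes Q Y :: "'a::complex_hilbert_space \<Rightarrow>\<^sub>L 'a"
  shows "(\<exists>K :: 'a \<Rightarrow>\<^sub>L 'a. contraction_op K \<and> Y = Q o\<^sub>L K o\<^sub>L Q) \<longleftrightarrow>
    (\<exists>U :: ('a \<times> 'a) \<Rightarrow>\<^sub>L ('a \<times> 'a). unitary_op U \<and> Y = row_op Q 0 o\<^sub>L U o\<^sub>L column_op Q 0)"
proof safe
  fix K :: "'a \<Rightarrow>\<^sub>L 'a" assume K: "contraction_op K"
  then obtain B C D :: "'a \<Rightarrow>\<^sub>L 'a" where U: "unitary_op (block_op K B C D)" by (rule halmos_dilation)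
  have "Q o\<^sub>L K o\<^sub>L Q = row_op Q 0 o\<^sub>L block_op K B C D o\<^sub>L column_op Q 0"
    by (rule blinfun_eqI) simp
  with U show "\<exists>U :: ('a \<times> 'a) \<Rightarrow>\<^sub>L ('a \<times> 'a). unitary_op U \<and> Q o\<^sub>L K o\<^sub>L Q = row_op Q 0 o\<^sub>L U o\<^sub>L column_op Q 0" by blast
next
  fix U :: "('a \<times> 'a) \<Rightarrow>\<^sub>L ('a \<times> 'a)" assume U: "unitary_op U"
  define K where "K = row_op id_blinfun 0 o\<^sub>L U o\<^sub>L column_op id_blinfun 0"
  have K: "K x = fst (U (x, 0))" for x by (simp add: K_def)
  have lin: "complex_linear U" using U by (simp add: unitary_op_def)
  have "complex_linear K"
    using complex_linearD[OF lin] by (auto simp: complex_linear_def K scaleC_prod_def)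
      (metis fst_conv scaleC_Pair scaleC_zero_right scaleC_prod_def)
  moreover have "norm K \<le> 1"
  proof (rule norm_blinfun_bound)
    fix x
    have "norm (K x) \<le> norm (U (x, 0))" unfolding K by (metis norm_fst_le surjective_pairing)
    then show "norm (K x) \<le> 1 * norm x" by (simp add: unitary_op_norm[OF U] norm_Pair)
  qed simp
  moreover have "row_op Q 0 o\<^sub>L U o\<^sub>L column_op Q 0 = Q o\<^sub>L K o\<^sub>L Q"
    by (rule blinfun_eqI) (simp add: K)
  ultimately show "\<exists>K. contraction_op K \<and> row_op Q 0 o\<^sub>L U o\<^sub>L column_op Q 0 = Q o\<^sub>L K o\<^sub>L Q"
    by (auto simp: contraction_op_def)
qed

text \<open>Nonnegativity of the quadratic form in \<open>(s, t)\<close> is nonnegativity of its discriminant; it turns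
  positivity of a block operator into a Cauchy--Schwarz inequality.\<close>

lemma quadratic_form_bound:
  fixes a b c :: real
  assumes "a \<ge> 0" "b \<ge> 0" and *: "\<And>s t. 0 \<le> s\<^sup>2 * a\<^sup>2 + t\<^sup>2 * b\<^sup>2 + 2 * (s * t * c)"
  shows "\<bar>c\<bar> \<le> a * b"
proof -
  have "c = 0" if "a = 0"
    using *[of "- (b\<^sup>2 + 1) / (2 * c)" 1] that by (cases "c = 0") (auto simp: field_simps)
  moreover have "c = 0" if "b = 0"
    using *[of 1 "- (a\<^sup>2 + 1) / (2 * c)"] that by (cases "c = 0") (auto simp: field_simps)
  moreover have "\<bar>c\<bar> \<le> a * b" if "a \<noteq> 0" "b \<noteq> 0"
  proof -
    have "0 \<le> (a * b) * (a * b + c)" "0 \<le> (a * b) * (a * b - c)"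
      using *[of b a] *[of b "- a"] by (simp_all add: power2_eq_square algebra_simps)
    moreover have "a * b > 0" using that assms by simp
    ultimately have "0 \<le> a * b + c" "0 \<le> a * b - c" by (simp_all only: zero_le_mult_iff) linarith+
    then show ?thesis by linarith
  qed
  ultimately show ?thesis using assms by fastforce
qed

text \<open>The factor with values in the closure of the range of \<open>Q\<close> is determined by the form that
  it represents, so it inherits complex linearity from that form.\<close>

lemma complex_linear_factor:
  fixes Q :: "'a::complex_hilbert_space \<Rightarrow>\<^sub>L 'b::complex_hilbert_space"
    and V :: "'c::complex_hilbert_space \<Rightarrow>\<^sub>L 'b"
  assumes Q: "complex_linear Q" and V: "\<And>y. V y \<in> closure (range Q)"
    and form: "\<And>x y. inner (Q x) (V (\<i> *\<^sub>C y)) = - inner (Q (\<i> *\<^sub>C x)) (V y)"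
  shows "complex_linear V"
  unfolding complex_linear_iff_imaginary_unit
proof
  fix y
  have "V (\<i> *\<^sub>C y) - \<i> *\<^sub>C V y = 0"
  proof (rule zero_of_orthogonal_range[of _ Q])
    have "(\<lambda>v. \<i> *\<^sub>C v) ` closure (range Q) \<subseteq> closure (range Q)"
    proof (rule image_closure_subset)
      show "continuous_on (closure (range Q)) (\<lambda>v. \<i> *\<^sub>C v)"
        by (intro linear_continuous_on bounded_linear_scaleC)
      have "\<i> *\<^sub>C Q x \<in> range Q" for x
        by (metis complex_linearD[OF Q] rangeI)
      then show "(\<lambda>v. \<i> *\<^sub>C v) ` range Q \<subseteq> closure (range Q)"
        using closure_subset[of "range Q"] by auto
    qed simp
    then show "V (\<i> *\<^sub>C y) - \<i> *\<^sub>C V y \<in> closure (range Q)"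
      using V by (intro subspace_diff[OF closure_range_blinfun_subspace]) auto
    fix x
    show "inner (Q x) (V (\<i> *\<^sub>C y) - \<i> *\<^sub>C V y) = 0"
      using form[of x y] by (simp add: inner_diff_right complex_linearD[OF Q] inner_scaleC_i)
  qed
  then show "V (\<i> *\<^sub>C y) = \<i> *\<^sub>C V y" by simp
qed

text \<open>A block matrix with equal diagonal entries \<open>P\<close> is positive if and only if the off-diagonal entry
  factors through the square root of \<open>P\<close> by a contraction: positivity is a Cauchy--Schwarz
  inequality for the form of \<open>Y\<close>, and two applications of the factorisation lemma turn that
  inequality into the contraction.\<close>

lemma positive_block_iff_contraction:
  fixes P Y :: "'a::complex_hilbert_space \<Rightarrow>\<^sub>L 'a"
  assumes P: "positive_op P" and Y: "complex_linear Y"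
  shows "(\<forall>x y. 0 \<le> inner (P x) x + inner (P y) y + 2 * inner (Y y) x) \<longleftrightarrow>
    (\<exists>K. contraction_op K \<and> Y = sqrt_op P o\<^sub>L K o\<^sub>L sqrt_op P)"
proof -
  define Q where "Q = sqrt_op P"
  have Q: "positive_op Q" "Q o\<^sub>L Q = P" using P by (auto simp: Q_def positive_sqrt_op sqrt_op_square)
  have Qlin: "complex_linear Q" and Qsa: "\<And>x y. inner (Q x) y = inner x (Q y)"
    using Q(1) by (auto simp: positive_op_iff)
  have P_norm: "inner (P x) x = (norm (Q x))\<^sup>2" for x
    using Q(2) Qsa[of "Q x" x] by (auto simp: power2_norm_eq_inner)
  show ?thesis
  proof
    assume pos: "\<forall>x y. 0 \<le> inner (P x) x + inner (P y) y + 2 * inner (Y y) x"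
    have bound: "\<bar>inner (Y y) x\<bar> \<le> norm (Q x) * norm (Q y)" for x y
    proof (rule quadratic_form_bound)
      fix s t :: real
      show "0 \<le> s\<^sup>2 * (norm (Q x))\<^sup>2 + t\<^sup>2 * (norm (Q y))\<^sup>2 + 2 * (s * t * inner (Y y) x)"
        using pos[rule_format, of "s *\<^sub>R x" "t *\<^sub>R y"]
        unfolding P_norm[symmetric] by (simp add: blinfun.scaleR_right power2_eq_square algebra_simps)
    qed auto
    obtain V :: "'a \<Rightarrow>\<^sub>L 'a" where V: "\<And>y. V y \<in> closure (range Q)" "\<And>x y. inner (Y y) x = inner (Q x) (V y)"
        "\<And>y. norm (V y) \<le> norm (Q y)"
      using bilinear_form_factorization[of "\<lambda>x y. inner (Y y) x" Q Q, OF _ _ bound]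
        bounded_linear_inner_blinfun(1)[of Y] by (metis bounded_linear.linear bounded_linear_inner_right)
    have YV: "Y y = Q (V y)" for y
    proof -
      have "inner (Y y - Q (V y)) x = 0" for x
        using V(2)[where x = x and y = y] Qsa[of x "V y"] by (simp add: inner_diff_left inner_diff_right inner_commute)
      from this[of "Y y - Q (V y)"] show ?thesis by simp
    qed
    have Vlin: "complex_linear V"
    proof (rule complex_linear_factor[OF Qlin V(1)])
      show "inner (Q x) (V (\<i> *\<^sub>C y)) = - inner (Q (\<i> *\<^sub>C x)) (V y)" for x y
        using V(2)[where x = x and y = "\<i> *\<^sub>C y"] V(2)[where x = "\<i> *\<^sub>C x" and y = y]
        by (simp add: complex_linearD[OF Y] inner_scaleC_i)
    qed
    have "\<bar>inner (V y) u\<bar> \<le> norm (Q y) * norm (id_blinfun u)" for y u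
      using Cauchy_Schwarz_ineq2[of "V y" u] mult_right_mono[OF V(3)[of y], of "norm u"] by simp
    then obtain L :: "'a \<Rightarrow>\<^sub>L 'a" where L: "\<And>y. L y \<in> closure (range Q)" "\<And>y u. inner (V y) u = inner (Q y) (L u)"
        "\<And>u. norm (L u) \<le> norm (id_blinfun u :: 'a)"
      using bilinear_form_factorization[of "\<lambda>y u. inner (V y) u" Q "id_blinfun :: 'a \<Rightarrow>\<^sub>L 'a"]
        bounded_linear_inner_blinfun(1)[of V] by (metis bounded_linear.linear bounded_linear_inner_right)
    obtain K :: "'a \<Rightarrow>\<^sub>L 'a" where K: "\<And>x y. inner (L x) y = inner x (K y)" "norm K \<le> norm L"
      using inner_adjoint_exists[of L] by blast
    have KQ: "K (Q y) = V y" for y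
    proof -
      have "inner (V y - K (Q y)) u = 0" for u
        using L(2)[of y u] K(1)[of u "Q y"] by (simp add: inner_diff_left inner_diff_right inner_commute)
      from this[of "V y - K (Q y)"] show ?thesis by simp
    qed
    have Llin: "complex_linear L"
    proof (rule complex_linear_factor[OF Qlin L(1)])
      show "inner (Q y) (L (\<i> *\<^sub>C u)) = - inner (Q (\<i> *\<^sub>C y)) (L u)" for y u
        using L(2)[where y = y and u = "\<i> *\<^sub>C u"] L(2)[where y = "\<i> *\<^sub>C y" and u = u]
        by (simp add: complex_linearD[OF Vlin] inner_scaleC_i)
    qed
    have "complex_linear K"
      unfolding complex_linear_iff_imaginary_unit
    proof
      fix y
      have "inner x (K (\<i> *\<^sub>C y) - \<i> *\<^sub>C K y) = 0" for x
        using K(1)[of x "\<i> *\<^sub>C y"] K(1)[of "\<i> *\<^sub>C x" y]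
        by (simp add: inner_diff_right complex_linearD[OF Llin] inner_scaleC_i)
      from this[of "K (\<i> *\<^sub>C y) - \<i> *\<^sub>C K y"] show "K (\<i> *\<^sub>C y) = \<i> *\<^sub>C K y" by simp
    qed
    moreover have "norm L \<le> 1" by (rule norm_blinfun_bound) (use L(3) in auto)
    then have "norm K \<le> 1" using K(2) by simp
    moreover have "Y = Q o\<^sub>L K o\<^sub>L Q" by (rule blinfun_eqI) (simp add: KQ YV)
    ultimately show "\<exists>K. contraction_op K \<and> Y = sqrt_op P o\<^sub>L K o\<^sub>L sqrt_op P"
      unfolding Q_def contraction_op_def by blast
  next
    assume "\<exists>K. contraction_op K \<and> Y = sqrt_op P o\<^sub>L K o\<^sub>L sqrt_op P"
    then obtain K where K: "norm K \<le> 1" and Y: "Y = Q o\<^sub>L K o\<^sub>L Q"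
      by (auto simp: contraction_op_def Q_def)
    show "\<forall>x y. 0 \<le> inner (P x) x + inner (P y) y + 2 * inner (Y y) x"
    proof (intro allI)
      fix x y
      have "norm (K (Q y)) \<le> norm (Q y)"
        using norm_blinfun[of K "Q y"] mult_right_mono[OF K, of "norm (Q y)"] by simp
      then have "\<bar>inner (K (Q y)) (Q x)\<bar> \<le> norm (Q y) * norm (Q x)"
        by (meson Cauchy_Schwarz_ineq2 mult_right_mono norm_ge_zero order_trans)
      moreover have "inner (Y y) x = inner (K (Q y)) (Q x)" by (simp add: Y Qsa)
      moreover have "0 \<le> (norm (Q x) - norm (Q y))\<^sup>2" by simp
      ultimately show "0 \<le> inner (P x) x + inner (P y) y + 2 * inner (Y y) x"
        unfolding P_norm power2_diff abs_le_iff mult.commute[of "norm (Q y)" "norm (Q x)"] by linarith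
    qed
  qed
qed

section \<open>Inverses, polynomials in an operator, and the resolvent\<close>

lemma is_inverse_op_unique:
  assumes "is_inverse_op A B" "is_inverse_op A C"
  shows "B = C"
proof -
  have "B = B o\<^sub>L (A o\<^sub>L C)" using assms by (simp add: is_inverse_op_def)
  also have "\<dots> = (B o\<^sub>L A) o\<^sub>L C" by (simp add: compose_assoc)
  finally show ?thesis using assms by (simp add: is_inverse_op_def)
qed

lemma inverse_op_eq: "is_inverse_op A B \<Longrightarrow> inverse_op A = B"
  unfolding inverse_op_def by (rule the_equality) (auto intro: is_inverse_op_unique)

lemma is_inverse_op_compose:
  assumes "is_inverse_op A B" "is_inverse_op C D"
  shows "is_inverse_op (A o\<^sub>L C) (D o\<^sub>L B)"
proof -
  have "(A o\<^sub>L C) o\<^sub>L (D o\<^sub>L B) = A o\<^sub>L ((C o\<^sub>L D) o\<^sub>L B)" "(D o\<^sub>L B) o\<^sub>L (A o\<^sub>L C) = D o\<^sub>L ((B o\<^sub>L A) o\<^sub>L C)"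
    by (simp_all add: compose_assoc)
  then show ?thesis using assms by (simp add: is_inverse_op_def)
qed

lemma complex_linear_inverse:
  assumes "complex_linear A" "is_inverse_op A B"
  shows "complex_linear B"
  unfolding complex_linear_def
proof (intro allI)
  fix c x
  have AB: "A (B u) = u" and BA: "B (A u) = u" for u
    using assms(2) by (metis is_inverse_op_def blinfun_apply_blinfun_compose blinfun_apply_id_blinfun)+
  show "B (c *\<^sub>C x) = c *\<^sub>C B x"
    using BA[of "c *\<^sub>C B x"] by (simp add: complex_linearD[OF assms(1)] AB)
qed

lemma is_inverse_op_commute:
  assumes "is_inverse_op A B" "D o\<^sub>L A = A o\<^sub>L D"
  shows "D o\<^sub>L B = B o\<^sub>L D"
proof -
  have "D o\<^sub>L B = (B o\<^sub>L A) o\<^sub>L (D o\<^sub>L B)" using assms by (simp add: is_inverse_op_def)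
  also have "\<dots> = B o\<^sub>L ((A o\<^sub>L D) o\<^sub>L B)" by (simp add: compose_assoc)
  also have "\<dots> = B o\<^sub>L (D o\<^sub>L (A o\<^sub>L B))" by (simp add: assms(2)[symmetric] compose_assoc)
  finally show ?thesis using assms by (simp add: is_inverse_op_def)
qed

lemma scaleC_minus_right: "c *\<^sub>C (- x) = - (c *\<^sub>C (x :: 'a::complex_hilbert_space))"
  by (metis add.right_inverse add_eq_0_iff scaleC_add_right scaleC_zero_right)

lemma scaleC_diff_right: "c *\<^sub>C (x - y) = c *\<^sub>C x - c *\<^sub>C (y :: 'a::complex_hilbert_space)"
  using scaleC_add_right[of c x "- y"] by (simp add: scaleC_minus_right)

lemma scaleC_diff_left: "(c - d) *\<^sub>C x = c *\<^sub>C x - d *\<^sub>C (x :: 'a::complex_hilbert_space)"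
  using scaleC_add_left[of c "- d" x] by (simp add: scaleC_minus_left)

lemma bounded_bilinear_cmul_op:
  "bounded_bilinear (cmul_op :: complex \<Rightarrow> ('a::complex_hilbert_space \<Rightarrow>\<^sub>L 'a) \<Rightarrow> ('a \<Rightarrow>\<^sub>L 'a))"
proof (rule bounded_bilinear.intro)
  have "norm (cmul_op c A) \<le> norm c * norm A * 1" for c and A :: "'a \<Rightarrow>\<^sub>L 'a"
    by (rule norm_blinfun_bound)
       (auto simp: norm_scaleC mult.assoc intro: mult_left_mono norm_blinfun)
  then show "\<exists>K. \<forall>c (A :: 'a \<Rightarrow>\<^sub>L 'a). norm (cmul_op c A) \<le> norm c * norm A * K" by blast
qed (auto intro!: blinfun_eqI simp: blinfun.add_left blinfun.scaleR_left scaleC_add_left scaleC_add_right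
      scaleR_eq_scaleC scaleC_scaleC mult.commute scaleR_conv_of_real)

interpretation cmul: bounded_bilinear
  "cmul_op :: complex \<Rightarrow> ('a::complex_hilbert_space \<Rightarrow>\<^sub>L 'a) \<Rightarrow> ('a \<Rightarrow>\<^sub>L 'a)"
  by (rule bounded_bilinear_cmul_op)

lemma norm_cmul_op: "norm (cmul_op c A) = cmod c * norm A"
proof (rule antisym)
  show "norm (cmul_op c A) \<le> cmod c * norm A"
    by (rule norm_blinfun_bound)
       (auto simp: norm_scaleC mult.assoc intro: mult_left_mono norm_blinfun)
  show "cmod c * norm A \<le> norm (cmul_op c A)"
  proof (cases "c = 0")
    case False
    have "norm A \<le> norm (cmul_op c A) / cmod c"
    proof (rule norm_blinfun_bound)
      fix x show "norm (A x) \<le> norm (cmul_op c A) / cmod c * norm x"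
        using norm_blinfun[of "cmul_op c A" x] False by (simp add: norm_scaleC field_simps)
    qed simp
    then show ?thesis using False by (simp add: field_simps)
  qed auto
qed

lemma cmul_op_cmul_op: "cmul_op c (cmul_op d A) = cmul_op (c * d) A"
  by (rule blinfun_eqI) (simp add: scaleC_scaleC)

lemma cmul_op_one [simp]: "cmul_op 1 A = A"
  by (rule blinfun_eqI) simp

lemma scalar_op_simps: "scalar_op 1 = id_blinfun" "scalar_op 0 = 0" "cmul_op c id_blinfun = scalar_op c"
  "scalar_op (c + d) = scalar_op c + scalar_op d" "scalar_op (c - d) = scalar_op c - scalar_op d"
  by (rule blinfun_eqI, simp add: blinfun.add_left scaleC_add_left blinfun.diff_left scaleC_diff_left)+

lemma cmul_op_compose: "cmul_op c A o\<^sub>L B = cmul_op c (A o\<^sub>L B)"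
  by (rule blinfun_eqI) simp

lemma compose_cmul_op: "complex_linear A \<Longrightarrow> A o\<^sub>L cmul_op c B = cmul_op c (A o\<^sub>L B)"
  by (rule blinfun_eqI) (simp add: complex_linear_def)

lemma scalar_op_commute: "complex_linear A \<Longrightarrow> A o\<^sub>L scalar_op c = scalar_op c o\<^sub>L A"
  by (rule blinfun_eqI) (simp add: complex_linear_def)

subsection \<open>Polynomials\<close>

lemma poly_op_eq_sum: "degree p \<le> N \<Longrightarrow> poly_op p T = (\<Sum>i\<le>N. cmul_op (coeff p i) (op_power T i))"
  unfolding poly_op_def
  by (rule sum.mono_neutral_left) (auto simp: coeff_eq_0 cmul.zero_left)

lemma poly_op_0 [simp]: "poly_op 0 T = 0"
  by (simp add: poly_op_def cmul.zero_left)

lemma poly_op_pCons: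
  assumes "complex_linear T"
  shows "poly_op (pCons a p) T = scalar_op a + (T o\<^sub>L poly_op p T)"
proof -
  have "poly_op (pCons a p) T = (\<Sum>i\<le>Suc (degree p). cmul_op (coeff (pCons a p) i) (op_power T i))"
    by (rule poly_op_eq_sum) (rule degree_pCons_le)
  also have "\<dots> = scalar_op a + (\<Sum>i\<le>degree p. T o\<^sub>L cmul_op (coeff p i) (op_power T i))"
    by (simp add: sum.atMost_Suc_shift scalar_op_simps compose_cmul_op[OF assms] del: sum.atMost_Suc)
  finally show ?thesis by (simp add: poly_op_def compose.sum_right)
qed

lemma complex_linear_poly_op: "complex_linear T \<Longrightarrow> complex_linear (poly_op p T)"
  unfolding poly_op_def by (intro complex_linear_sum complex_linear_cmul complex_linear_op_power)

lemma poly_op_add: "poly_op (p + q) T = poly_op p T + poly_op q T"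
proof -
  let ?N = "max (degree p) (degree q)"
  show ?thesis
    by (simp add: poly_op_eq_sum[of _ ?N] degree_add_le cmul.add_left sum.distrib)
qed

lemma poly_op_smult: "poly_op (smult c p) T = cmul_op c (poly_op p T)"
  by (simp add: poly_op_eq_sum[of "smult c p" "degree p"] degree_smult_le)
     (simp add: poly_op_def cmul.sum_right cmul_op_cmul_op)

lemma poly_op_mult:
  assumes "complex_linear T"
  shows "poly_op (p * q) T = poly_op p T o\<^sub>L poly_op q T"
proof (induction p)
  case (pCons a p)
  have "scalar_op a o\<^sub>L A = cmul_op a A" for A :: "'a \<Rightarrow>\<^sub>L 'a" by (rule blinfun_eqI) simp
  then show ?case
    by (simp add: poly_op_add poly_op_smult poly_op_pCons[OF assms] pCons.IH scalar_op_simps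
        compose.add_left compose_assoc)
qed simp

lemma poly_op_const [simp]: "poly_op [:c:] T = scalar_op c"
  by (simp add: poly_op_def scalar_op_simps)

lemma poly_op_monom: "poly_op (monom c n) T = cmul_op c (op_power T n)"
  by (simp add: poly_op_eq_sum[of "monom c n" n] degree_monom_le)
     (subst sum.mono_neutral_right[of _ "{n}"], auto simp: cmul.zero_left)

lemma poly_op_commute:
  "complex_linear T \<Longrightarrow> complex_linear D \<Longrightarrow> D o\<^sub>L T = T o\<^sub>L D \<Longrightarrow> D o\<^sub>L poly_op p T = poly_op p T o\<^sub>L D"
  by (simp add: poly_op_def compose.sum_left compose.sum_right compose_cmul_op cmul_op_compose op_power_commute)

lemma poly_op_cmul:
  assumes "complex_linear T"
  shows "poly_op (pcompose p [:0, \<alpha>:]) T = poly_op p (cmul_op \<alpha> T)"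
  by (induction p)
     (simp_all add: pcompose_pCons poly_op_add poly_op_mult[OF assms] poly_op_pCons[OF assms] poly_op_smult
        poly_op_pCons[OF complex_linear_cmul[OF assms]] cmul_op_compose compose_cmul_op[OF assms])

lemma not_in_op_spectrum: "z \<notin> op_spectrum T \<longleftrightarrow> (\<exists>B. is_inverse_op (scalar_op z - T) B)"
  by (auto simp: op_spectrum_def)

text \<open>A polynomial without zeros in the spectrum splits into linear factors that are invertible at \<open>T\<close>.\<close>

lemma poly_op_invertible:
  assumes T: "complex_linear T" and "\<And>z. z \<in> op_spectrum T \<Longrightarrow> poly p z \<noteq> 0" and "p \<noteq> 0"
  shows "\<exists>B. is_inverse_op (poly_op p T) B"
  using assms(2,3)
proof (induction "degree p" arbitrary: p)
  case 0
  then obtain c where c: "p = [:c:]" "c \<noteq> 0" by (metis degree_eq_zeroE pCons_0_0)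
  have "is_inverse_op (scalar_op c) (scalar_op (1 / c) :: 'a \<Rightarrow>\<^sub>L 'a)"
    unfolding is_inverse_op_def using c(2) by (auto intro!: blinfun_eqI simp: scaleC_scaleC)
  then show ?case using c by auto
next
  case (Suc n)
  then have "\<not> constant (poly p)" by (simp add: constant_degree)
  then obtain z where z: "poly p z = 0" using fundamental_theorem_of_algebra by blast
  then obtain q where q: "p = [:- z, 1:] * q" by (metis dvdE poly_eq_0_iff_dvd)
  have q0: "q \<noteq> 0" using q Suc.prems(2) by auto
  have "degree p = degree [:- z, 1:] + degree q"
    unfolding q by (rule degree_mult_eq) (use q0 in auto)
  then have "degree q = n" using Suc(2) by simp
  moreover have "poly q w \<noteq> 0" if "w \<in> op_spectrum T" for w
    using Suc.prems(1)[OF that] q by auto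
  ultimately obtain B where B: "is_inverse_op (poly_op q T) B" using Suc(1) q0 by blast
  have "z \<notin> op_spectrum T" using z Suc.prems(1) by blast
  then obtain C where C: "is_inverse_op (scalar_op z - T) C" by (auto simp: not_in_op_spectrum)
  have "poly_op [:- z, 1:] T = - (scalar_op z - T)"
    by (rule blinfun_eqI) (simp add: poly_op_pCons[OF T] blinfun.add_left blinfun.minus_left blinfun.diff_left scaleC_minus_left)
  moreover have "is_inverse_op (- (scalar_op z - T)) (- C)"
    using C by (simp add: is_inverse_op_def compose.minus_left compose.minus_right del: minus_diff_eq)
  ultimately have "is_inverse_op (poly_op [:- z, 1:] T) (- C)" by simp
  from is_inverse_op_compose[OF this B] show ?case
    unfolding q poly_op_mult[OF T] by blast
qed

subsection \<open>The resolvent\<close>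

lemma neumann_inverse:
  fixes E :: "'a::complex_hilbert_space \<Rightarrow>\<^sub>L 'a"
  assumes "norm E < 1"
  shows "\<exists>B. is_inverse_op (id_blinfun - E) B"
proof -
  have "summable (\<lambda>n. norm (op_power E n))"
    by (rule summable_comparison_test'[OF summable_geometric[of "norm E"], of 0])
       (use assms norm_op_power_le[of E] in auto)
  then have "summable (\<lambda>n. op_power E n)" by (rule summable_norm_cancel)
  then obtain B where B: "(\<lambda>N. \<Sum>n<N. op_power E n) \<longlonglongrightarrow> B" using summable_LIMSEQ by blast
  have "(\<lambda>n. norm E ^ n) \<longlonglongrightarrow> 0" using assms by (intro LIMSEQ_power_zero) simp
  then have E0: "(\<lambda>n. op_power E n) \<longlonglongrightarrow> 0"
    by (rule Lim_null_comparison[rotated]) (simp add: norm_op_power_le)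
  have comm: "op_power E n o\<^sub>L E = E o\<^sub>L op_power E n" for n by (metis op_power_commute)
  have tele: "(\<Sum>n<N. op_power E n) - (\<Sum>n<N. E o\<^sub>L op_power E n) = id_blinfun - op_power E N" for N
  proof (induction N)
    case (Suc N)
    have "(\<Sum>n<Suc N. op_power E n) - (\<Sum>n<Suc N. E o\<^sub>L op_power E n) =
        ((\<Sum>n<N. op_power E n) - (\<Sum>n<N. E o\<^sub>L op_power E n)) + (op_power E N - op_power E (Suc N))"
      by (simp only: sum.lessThan_Suc op_power.simps add_diff_add)
    also have "\<dots> = id_blinfun - op_power E (Suc N)" by (simp only: Suc) simp
    finally show ?case .
  qed simp
  have 1: "(id_blinfun - E) o\<^sub>L (\<Sum>n<N. op_power E n) = id_blinfun - op_power E N"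
    and 2: "(\<Sum>n<N. op_power E n) o\<^sub>L (id_blinfun - E) = id_blinfun - op_power E N" for N
    using tele[of N] by (simp_all add: compose.diff_left compose.diff_right compose.sum_left compose.sum_right comm sum_subtractf)
  have lim: "(\<lambda>N. id_blinfun - op_power E N) \<longlonglongrightarrow> id_blinfun"
    using tendsto_diff[OF tendsto_const E0] by simp
  have "(id_blinfun - E) o\<^sub>L B = id_blinfun"
    by (rule LIMSEQ_unique[OF compose.tendsto[OF tendsto_const B]]) (use lim 1 in simp)
  moreover have "B o\<^sub>L (id_blinfun - E) = id_blinfun"
    by (rule LIMSEQ_unique[OF compose.tendsto[OF B tendsto_const]]) (use lim 2 in simp)
  ultimately show ?thesis by (auto simp: is_inverse_op_def)
qed

definition resolvent :: "('a::complex_hilbert_space \<Rightarrow>\<^sub>L 'a) \<Rightarrow> complex \<Rightarrow> ('a \<Rightarrow>\<^sub>L 'a)" where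
  "resolvent T z = inverse_op (scalar_op z - T)"

lemma resolvent_inverse:
  assumes "z \<notin> op_spectrum T"
  shows "is_inverse_op (scalar_op z - T) (resolvent T z)"
  using assms inverse_op_eq unfolding resolvent_def not_in_op_spectrum by blast

lemma resolvent_apply:
  assumes "z \<notin> op_spectrum T"
  shows "z *\<^sub>C resolvent T z x - T (resolvent T z x) = x"
    and "resolvent T z (z *\<^sub>C x - T x) = x"
proof -
  have "(scalar_op z - T) (resolvent T z x) = x" "resolvent T z ((scalar_op z - T) x) = x"
    using resolvent_inverse[OF assms]
    by (metis is_inverse_op_def blinfun_apply_blinfun_compose blinfun_apply_id_blinfun)+
  then show "z *\<^sub>C resolvent T z x - T (resolvent T z x) = x" "resolvent T z (z *\<^sub>C x - T x) = x"
    by (simp_all add: blinfun.diff_left)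
qed

lemma complex_linear_resolvent:
  assumes "complex_linear T" "z \<notin> op_spectrum T"
  shows "complex_linear (resolvent T z)"
  by (rule complex_linear_inverse[OF _ resolvent_inverse[OF assms(2)]]) (simp add: complex_linear_diff assms)

lemma resolvent_commute:
  assumes "complex_linear T" "z \<notin> op_spectrum T" "complex_linear D" "D o\<^sub>L T = T o\<^sub>L D"
  shows "D o\<^sub>L resolvent T z = resolvent T z o\<^sub>L D"
  by (rule is_inverse_op_commute[OF resolvent_inverse[OF assms(2)]])
     (simp add: compose.diff_left compose.diff_right assms scalar_op_commute)

lemma resolvent_identity:
  assumes T: "complex_linear T" and z: "z \<notin> op_spectrum T" and w: "w \<notin> op_spectrum T"
  shows "resolvent T z x - resolvent T w x = (w - z) *\<^sub>C resolvent T z (resolvent T w x)"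
proof -
  let ?v = "resolvent T w x"
  have "x = (w - z) *\<^sub>C ?v + (z *\<^sub>C ?v - T ?v)"
    using resolvent_apply(1)[OF w, of x] by (simp add: scaleC_diff_left)
  then have "resolvent T z x = resolvent T z ((w - z) *\<^sub>C ?v) + resolvent T z (z *\<^sub>C ?v - T ?v)"
    by (metis blinfun.add_right)
  then show ?thesis
    using complex_linearD[OF complex_linear_resolvent[OF T z]] resolvent_apply(2)[OF z] by simp
qed

lemma open_resolvent_set:
  assumes T: "complex_linear T"
  shows "open (- op_spectrum T)"
proof (rule openI)
  fix z assume "z \<in> - op_spectrum T"
  then have z: "z \<notin> op_spectrum T" by simp
  let ?R = "resolvent T z"
  have "ball z (1 / (norm ?R + 1)) \<subseteq> - op_spectrum T"
  proof
    fix w assume "w \<in> ball z (1 / (norm ?R + 1))"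
    then have "cmod (z - w) * (norm ?R + 1) < 1"
      by (simp add: dist_norm pos_less_divide_eq add_nonneg_pos)
    then have "norm (cmul_op (z - w) ?R) < 1"
      by (simp add: norm_cmul_op distrib_left) (smt (verit) norm_ge_zero)
    then obtain B where B: "is_inverse_op (id_blinfun - cmul_op (z - w) ?R) B"
      using neumann_inverse by blast
    have "(scalar_op z - T) o\<^sub>L (id_blinfun - cmul_op (z - w) ?R) = scalar_op w - T"
    proof (rule blinfun_eqI)
      fix x
      have "(scalar_op z - T) ((z - w) *\<^sub>C ?R x) = (z - w) *\<^sub>C (z *\<^sub>C ?R x - T (?R x))"
        by (simp add: blinfun.diff_left complex_linearD[OF T] scaleC_diff_right scaleC_scaleC mult.commute)
      then show "((scalar_op z - T) o\<^sub>L (id_blinfun - cmul_op (z - w) ?R)) x = (scalar_op w - T) x"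
        by (simp add: blinfun.diff_left blinfun.diff_right resolvent_apply(1)[OF z] scaleC_diff_left)
    qed
    then have "is_inverse_op (scalar_op w - T) (B o\<^sub>L ?R)"
      using is_inverse_op_compose[OF resolvent_inverse[OF z] B] by simp
    then show "w \<in> - op_spectrum T" using not_in_op_spectrum by blast
  qed
  then show "\<exists>e>0. ball z e \<subseteq> - op_spectrum T"
    by (intro exI[of _ "1 / (norm ?R + 1)"]) (auto simp: add_nonneg_pos)
qed

text \<open>The resolvent identity gives continuity once the resolvent is bounded near \<open>z\<close>, which the Neumann
  series supplies.\<close>

lemma isCont_resolvent:
  assumes T: "complex_linear T" and z: "z \<notin> op_spectrum T"
  shows "isCont (resolvent T) z"
proof -
  let ?R = "resolvent T"
  define C where "C = norm (?R z)"
  have C: "C \<ge> 0" by (simp add: C_def)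
  have diff: "?R w - ?R z = cmul_op (z - w) (?R w o\<^sub>L ?R z)" if "w \<notin> op_spectrum T" for w
    by (rule blinfun_eqI) (simp add: blinfun.diff_left resolvent_identity[OF T that z])
  have le: "norm (?R w - ?R z) \<le> cmod (z - w) * (2 * C * C)" if w: "w \<notin> op_spectrum T" and d: "cmod (z - w) * (2 * (C + 1)) < 1" for w
  proof -
    have 1: "norm (?R w - ?R z) \<le> cmod (z - w) * (norm (?R w) * C)"
      unfolding diff[OF w] norm_cmul_op C_def by (intro mult_left_mono norm_blinfun_compose) auto
    have "norm (?R w) \<le> C + norm (?R w - ?R z)"
      unfolding C_def by (metis norm_triangle_sub add.commute)
    moreover have "cmod (z - w) * C \<le> 1 / 2"
      using d by (simp add: algebra_simps) (smt (verit) norm_ge_zero)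
    then have "cmod (z - w) * (norm (?R w) * C) \<le> 1 / 2 * norm (?R w)"
      by (metis mult.assoc mult.commute mult_right_mono norm_ge_zero)
    ultimately have "norm (?R w) \<le> 2 * C" using 1 by linarith
    then have "cmod (z - w) * (norm (?R w) * C) \<le> cmod (z - w) * (2 * C * C)"
      using C by (intro mult_left_mono mult_right_mono) auto
    with 1 show ?thesis by linarith
  qed
  have "eventually (\<lambda>w. w \<in> - op_spectrum T) (nhds z)"
    using open_resolvent_set[OF T] z by (intro eventually_nhds_in_open) auto
  moreover have "eventually (\<lambda>w. cmod (z - w) < 1 / (2 * (C + 1))) (nhds z)"
    using eventually_nhds_in_open[of "ball z (1 / (2 * (C + 1)))" z] C by (simp add: dist_norm)
  ultimately have "eventually (\<lambda>w. norm (?R w - ?R z) \<le> cmod (z - w) * (2 * C * C)) (nhds z)"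
    by eventually_elim (rule le, use C in \<open>auto simp: pos_less_divide_eq\<close>)
  then have ev: "eventually (\<lambda>w. norm (?R w - ?R z) \<le> cmod (z - w) * (2 * C * C)) (at z)"
    by (auto simp: eventually_at_filter elim: eventually_mono)
  have "((\<lambda>w. cmod (z - w) * (2 * C * C)) \<longlongrightarrow> cmod (z - z) * (2 * C * C)) (at z)"
    by (intro tendsto_intros)
  then have "((\<lambda>w. ?R w - ?R z) \<longlongrightarrow> 0) (at z)"
    by (intro Lim_null_comparison[OF ev]) simp
  then show ?thesis by (simp add: isCont_def LIM_zero_iff)
qed

lemma continuous_on_resolvent:
  "complex_linear T \<Longrightarrow> continuous_on (- op_spectrum T) (resolvent T)"
  by (simp add: continuous_at_imp_continuous_on isCont_resolvent)

lemma resolvent_weak_derivative: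
  assumes T: "complex_linear T" and z: "z \<notin> op_spectrum T"
  shows "((\<lambda>z. cinner (resolvent T z x) y) has_field_derivative - cinner (resolvent T z (resolvent T z x)) y) (at z)"
proof -
  let ?R = "resolvent T"
  have "((\<lambda>w. - cinner (?R w (?R z x)) y) \<longlongrightarrow> - cinner (?R z (?R z x)) y) (at z)"
    using isCont_resolvent[OF T z] by (intro tendsto_intros cinner.tendsto) (simp add: isCont_def)
  moreover have "\<forall>\<^sub>F w in at z. - cinner (?R w (?R z x)) y = (cinner (?R w x) y - cinner (?R z x) y) / (w - z)"
  proof -
    have "\<forall>\<^sub>F w in at z. w \<in> - op_spectrum T"
      by (rule eventually_at_in_open'[OF open_resolvent_set[OF T]]) (use z in simp)
    moreover have "\<forall>\<^sub>F w in at z. w \<noteq> z" by (rule eventually_neq_at_within)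
    ultimately have "\<forall>\<^sub>F w in at z. w \<in> - op_spectrum T \<and> w \<noteq> z" by (rule eventually_conj)
    then show ?thesis
    proof eventually_elim
      case (elim w)
      have "cinner (?R w x) y - cinner (?R z x) y = (z - w) * cinner (?R w (?R z x)) y"
        using resolvent_identity[OF T _ z, of w x] elim
        by (simp add: cinner.diff_left[symmetric] cinner_scaleC_left)
      then show ?case using elim by (simp add: field_simps)
    qed
  qed
  ultimately show ?thesis
    unfolding has_field_derivative_iff by (rule Lim_transform_eventually)
qed

lemma holomorphic_resolvent:
  "complex_linear T \<Longrightarrow> (\<lambda>z. cinner (resolvent T z x) y) holomorphic_on - op_spectrum T"
  unfolding holomorphic_on_def field_differentiable_def
  using has_field_derivative_at_within[OF resolvent_weak_derivative] by (metis ComplD)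

lemma resolvent_tendsto_zero:
  assumes T: "complex_linear T" and bdd: "bounded (op_spectrum T)"
  shows "((\<lambda>z. cinner (resolvent T z x) y) \<longlongrightarrow> 0) at_infinity"
proof (rule Lim_null_comparison)
  obtain M where M: "\<And>z. z \<in> op_spectrum T \<Longrightarrow> cmod z \<le> M" using bdd by (auto simp: bounded_iff)
  show "\<forall>\<^sub>F z in at_infinity. norm (cinner (resolvent T z x) y) \<le> norm x * norm y * inverse (cmod z - norm T)"
    unfolding eventually_at_infinity
  proof (intro exI[of _ "max (M + 1) (norm T + 1)"] allI impI)
    fix z :: complex assume z: "max (M + 1) (norm T + 1) \<le> norm z"
    then have "z \<notin> op_spectrum T" using M by fastforce
    let ?v = "resolvent T z x"
    have "z *\<^sub>C ?v = x + T ?v"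
      using resolvent_apply(1)[OF \<open>z \<notin> op_spectrum T\<close>, of x] by (simp add: algebra_simps)
    then have "cmod z * norm ?v \<le> norm x + norm T * norm ?v"
      by (metis norm_scaleC norm_triangle_le norm_blinfun add_left_mono)
    then have "norm ?v \<le> norm x * inverse (cmod z - norm T)"
      using z by (simp add: field_simps)
    then have "norm ?v * norm y \<le> norm x * inverse (cmod z - norm T) * norm y"
      by (rule mult_right_mono) simp
    then show "norm (cinner ?v y) \<le> norm x * norm y * inverse (cmod z - norm T)"
      using norm_cinner_le[of ?v y] by (simp add: mult_ac)
  qed
  have "filterlim (\<lambda>z::complex. cmod z - norm T) at_top at_infinity"
    using filterlim_tendsto_add_at_top[OF tendsto_const[of "- norm T"] filterlim_norm_at_top] by simp
  then have "((\<lambda>z::complex. inverse (cmod z - norm T)) \<longlongrightarrow> 0) at_infinity"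
    by (rule tendsto_inverse_0_at_top)
  then show "((\<lambda>z. norm x * norm y * inverse (cmod z - norm T)) \<longlongrightarrow> 0) at_infinity"
    by (rule tendsto_mult_right_zero)
qed

section \<open>Contour integrals of operator-valued functions\<close>

lemma bounded_linear_cinner_blinfun:
  "bounded_linear (\<lambda>A :: 'a::complex_hilbert_space \<Rightarrow>\<^sub>L 'b::complex_hilbert_space. cinner (A x) y)"
  using bounded_linear_compose[OF cinner.bounded_linear_left blinfun.bounded_linear_left] .

lemma continuous_on_cmul_op [continuous_intros]:
  assumes "continuous_on S f" "continuous_on S F"
  shows "continuous_on S (\<lambda>x. cmul_op (f x) (F x))"
  using cmul.continuous_on[OF assms] .

text \<open>Goursat's construction of a primitive by integration along segments. The Cauchy theorem
  enters only through the scalar functions \<open>\<langle>F z x, y\<rangle>\<close>, so the operator-valued function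
  need only be weakly holomorphic and norm continuous.\<close>

lemma local_primitive:
  fixes F :: "complex \<Rightarrow> ('a::complex_hilbert_space \<Rightarrow>\<^sub>L 'a)"
  assumes cont: "continuous_on (ball c e) F"
    and hol: "\<And>x y. (\<lambda>z. cinner (F z x) y) holomorphic_on ball c e"
  obtains P where "\<And>z. z \<in> ball c e \<Longrightarrow> (P has_derivative (\<lambda>h. cmul_op h (F z))) (at z)"
proof -
  define seg where "seg a b = integral {0..1} (\<lambda>t. cmul_op (b - a) (F (linepath a b t)))" for a b
  have line_in: "linepath a b t \<in> ball c e" if "a \<in> ball c e" "b \<in> ball c e" "t \<in> {0..1}" for a b t
    using that convex_ball[of c e] by (metis closed_segment_subset linepath_image_01 image_eqI subsetD)
  have int: "(\<lambda>t. cmul_op (b - a) (F (linepath a b t))) integrable_on {0..1}"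
    if "a \<in> ball c e" "b \<in> ball c e" for a b
    by (intro integrable_continuous_real continuous_intros continuous_on_compose2[OF cont])
       (use line_in that in auto)
  have weak: "cinner (seg a b x) y = p b - p a"
    if ab: "a \<in> ball c e" "b \<in> ball c e"
      and p: "\<And>z. z \<in> ball c e \<Longrightarrow> (p has_field_derivative cinner (F z x) y) (at z within ball c e)" for a b x y p
  proof -
    have "((\<lambda>z. cinner (F z x) y) has_contour_integral (p (pathfinish (linepath a b)) - p (pathstart (linepath a b)))) (linepath a b)"
      by (rule contour_integral_primitive[OF p]) (use line_in ab in \<open>auto simp: path_image_def linepath_image_01[symmetric] simp del: linepath_image_01\<close>)
    then have "integral {0..1} (\<lambda>t. cinner (F (linepath a b t) x) y * (b - a)) = p b - p a"
      by (auto simp: has_contour_integral_linepath dest: integral_unique)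
    moreover have "cinner (seg a b x) y = integral {0..1} ((\<lambda>A :: 'a \<Rightarrow>\<^sub>L 'a. cinner (A x) y) \<circ> (\<lambda>t. cmul_op (b - a) (F (linepath a b t))))"
      unfolding seg_def by (rule integral_linear[OF int[OF ab] bounded_linear_cinner_blinfun, symmetric])
    ultimately show ?thesis by (simp add: o_def cinner_scaleC_left mult.commute)
  qed
  have chasles: "seg c w - seg c z = seg z w" if zw: "z \<in> ball c e" "w \<in> ball c e" for z w
  proof (rule blinfun_eq_of_cinner)
    fix x y
    obtain p where p: "\<And>z. z \<in> ball c e \<Longrightarrow> (p has_field_derivative cinner (F z x) y) (at z within ball c e)"
      using holomorphic_convex_primitive'[OF convex_ball open_ball hol[of x y]] by blast
    have "c \<in> ball c e" using zw(1) by (metis centre_in_ball dist_not_less_zero dual_order.strict_trans1 mem_ball not_less)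
    then show "cinner ((seg c w - seg c z) x) y = cinner (seg z w x) y"
      using weak[OF _ _ p] zw by (simp add: blinfun.diff_left cinner.diff_left)
  qed
  have "(seg c has_derivative (\<lambda>h. cmul_op h (F z))) (at z)" if z: "z \<in> ball c e" for z
    unfolding has_derivative_at_alt
    proof (intro conjI allI impI)
      show "bounded_linear (\<lambda>h. cmul_op h (F z))" by (rule cmul.bounded_linear_left)
      fix d :: real assume d: "d > 0"
      have "isCont F z" using cont z by (simp add: continuous_on_eq_continuous_at)
      then obtain \<delta> where \<delta>: "\<delta> > 0" "\<And>w. dist w z < \<delta> \<Longrightarrow> dist (F w) (F z) < d"
        using d unfolding continuous_at_eps_delta by metis
      obtain \<eta> where \<eta>: "\<eta> > 0" "ball z \<eta> \<subseteq> ball c e" using z open_ball openE by blast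
      show "\<exists>d'>0. \<forall>w. norm (w - z) < d' \<longrightarrow> norm (seg c w - seg c z - cmul_op (w - z) (F z)) \<le> d * norm (w - z)"
      proof (intro exI[of _ "min \<delta> \<eta>"] conjI allI impI)
        fix w assume "norm (w - z) < min \<delta> \<eta>"
        then have w: "dist w z < \<delta>" "w \<in> ball c e" using \<eta> by (auto simp: dist_norm norm_minus_commute subset_iff)
        have near: "dist (linepath z w t) z < \<delta>" if "t \<in> {0..1}" for t
        proof -
          have "linepath z w t - z = t *\<^sub>R (w - z)" by (simp add: linepath_def algebra_simps)
          then have "dist (linepath z w t) z \<le> dist w z"
            using that by (simp add: dist_norm mult_left_le_one_le)
          then show ?thesis using w by simp
        qed
        have "seg c w - seg c z - cmul_op (w - z) (F z) = integral {0..1} (\<lambda>t. cmul_op (w - z) (F (linepath z w t)) - cmul_op (w - z) (F z))"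
          unfolding chasles[OF z w(2)]
          by (subst Henstock_Kurzweil_Integration.integral_diff[OF int[OF z w(2)]]) (auto simp: seg_def)
        also have "norm \<dots> \<le> integral {0..1} (\<lambda>t::real. d * norm (w - z))"
        proof (rule integral_norm_bound_integral)
          show "(\<lambda>t. cmul_op (w - z) (F (linepath z w t)) - cmul_op (w - z) (F z)) integrable_on {0..1}"
            by (intro integrable_diff int z w) auto
          fix t :: real assume t: "t \<in> {0..1}"
          have "norm (F (linepath z w t) - F z) \<le> d" using \<delta>(2)[OF near[OF t]] by (simp add: dist_norm)
          then show "norm (cmul_op (w - z) (F (linepath z w t)) - cmul_op (w - z) (F z)) \<le> d * norm (w - z)"
            by (simp add: cmul.diff_right[symmetric] norm_cmul_op) (metis mult.commute mult_left_mono norm_ge_zero)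
        qed auto
        finally show "norm (seg c w - seg c z - cmul_op (w - z) (F z)) \<le> d * norm (w - z)" by simp
      qed (use \<delta> \<eta> in auto)
    qed
  then show thesis by (rule that)
qed

text \<open>A valid path need not be rectifiable, so continuity of the integrand alone would not give
  integrability; local primitives do.\<close>

lemma operator_contour_integrable:
  fixes F :: "complex \<Rightarrow> ('a::complex_hilbert_space \<Rightarrow>\<^sub>L 'a)"
  assumes V: "open V" and cont: "continuous_on V F"
    and hol: "\<And>x y. (\<lambda>z. cinner (F z x) y) holomorphic_on V"
    and \<gamma>: "valid_path \<gamma>" "path_image \<gamma> \<subseteq> V"
  shows "(\<lambda>t. cmul_op (vector_derivative \<gamma> (at t within {0..1})) (F (\<gamma> t))) integrable_on {0..1}"
    (is "?f integrable_on _")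
proof -
  obtain K where K: "finite K" "\<And>t. t \<in> {0..1} - K \<Longrightarrow> \<gamma> differentiable (at t within {0..1})"
    and c\<gamma>: "continuous_on {0..1} \<gamma>"
    using piecewise_C1_imp_differentiable[of \<gamma> "{0..1}"] \<gamma>(1)
    by (auto simp: valid_path_def piecewise_differentiable_on_def)
  have "?f integrable_on cbox 0 1"
  proof (rule integrable_on_little_subintervals, intro ballI)
    fix t :: real assume "t \<in> cbox 0 1"
    then have t: "t \<in> {0..1}" by simp
    then have "\<gamma> t \<in> V" using \<gamma>(2) by (auto simp: path_image_def)
    then obtain e where e: "e > 0" "ball (\<gamma> t) e \<subseteq> V" using V openE by blast
    obtain P where P: "\<And>z. z \<in> ball (\<gamma> t) e \<Longrightarrow> (P has_derivative (\<lambda>h. cmul_op h (F z))) (at z)"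
      using local_primitive[of "\<gamma> t" e F] continuous_on_subset[OF cont e(2)] holomorphic_on_subset[OF hol e(2)]
      by blast
    obtain d where d: "d > 0" "\<And>s. s \<in> {0..1} \<Longrightarrow> dist s t < d \<Longrightarrow> dist (\<gamma> s) (\<gamma> t) < e"
      using c\<gamma> t e(1) unfolding continuous_on_iff by metis
    show "\<exists>d>0. \<forall>u v. t \<in> cbox u v \<and> cbox u v \<subseteq> ball t d \<and> cbox u v \<subseteq> cbox 0 1 \<longrightarrow> ?f integrable_on cbox u v"
    proof (intro exI[of _ d] conjI allI impI d(1))
      fix u v :: real assume "t \<in> cbox u v \<and> cbox u v \<subseteq> ball t d \<and> cbox u v \<subseteq> cbox 0 1"
      then have uv: "u \<le> v" "{u..v} \<subseteq> ball t d" "{u..v} \<subseteq> {0..1}" by auto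
      then have in_ball: "\<gamma> s \<in> ball (\<gamma> t) e" if "s \<in> {u..v}" for s
        using d(2)[of s] that by (auto simp: dist_commute subset_iff)
      have "(?f has_integral (P (\<gamma> v) - P (\<gamma> u))) {u..v}"
      proof (rule fundamental_theorem_of_calculus_interior_strong[OF K(1) uv(1)])
        fix s assume s: "s \<in> {u<..<v} - K"
        then have s01: "s \<in> {0..1}" "0 < s" "s < 1" and suv: "s \<in> {u..v}"
          using uv by (auto simp: subset_iff intro: le_less_trans less_le_trans)
        have at: "at s within {0..1} = at s" using s01 by (simp add: at_within_Icc_at)
        define D where "D = vector_derivative \<gamma> (at s within {0..1})"
        have "(\<gamma> has_vector_derivative D) (at s)"
          using K(2)[of s] s s01 unfolding D_def at by (simp add: vector_derivative_works)
        then have "(\<gamma> has_derivative (\<lambda>h. h *\<^sub>R D)) (at s)" by (simp add: has_vector_derivative_def)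
        from diff_chain_at[OF this P[OF in_ball[OF suv]]]
        have "((\<lambda>s. P (\<gamma> s)) has_vector_derivative cmul_op D (F (\<gamma> s))) (at s)"
          by (simp add: o_def has_vector_derivative_def cmul.scaleR_left)
        then show "((\<lambda>s. P (\<gamma> s)) has_vector_derivative ?f s) (at s)" by (simp add: D_def)
      next
        show "continuous_on {u..v} (\<lambda>s. P (\<gamma> s))"
        proof (rule continuous_on_compose2[of "ball (\<gamma> t) e" P])
          show "continuous_on (ball (\<gamma> t) e) P"
            using P has_derivative_continuous by (blast intro: continuous_at_imp_continuous_on)
          show "continuous_on {u..v} \<gamma>" by (rule continuous_on_subset[OF c\<gamma> uv(3)])
        qed (use in_ball in auto)
      qed
      then show "?f integrable_on cbox u v" by (auto simp: integrable_on_def)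
    qed
  qed
  then show ?thesis by simp
qed

lemma resolvent_integral_weak:
  fixes T :: "'a::complex_hilbert_space \<Rightarrow>\<^sub>L 'a"
  assumes T: "complex_linear T" and U: "open U" and f: "f holomorphic_on U"
    and \<gamma>: "valid_path \<gamma>" "path_image \<gamma> \<subseteq> U - op_spectrum T"
  shows "cinner (resolvent_integral f T \<gamma> x) y = contour_integral \<gamma> (\<lambda>z. f z * cinner (resolvent T z x) y)"
proof -
  let ?V = "U - op_spectrum T"
  define F where "F z = cmul_op (f z) (resolvent T z)" for z
  have V: "open ?V" using U open_resolvent_set[OF T] by (metis Diff_eq open_Int)
  have "(\<lambda>t. cmul_op (vector_derivative \<gamma> (at t within {0..1})) (F (\<gamma> t))) integrable_on {0..1}"
  proof (rule operator_contour_integrable[OF V _ _ \<gamma>])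
    show "continuous_on ?V F"
      unfolding F_def
      by (intro continuous_intros continuous_on_subset[OF continuous_on_resolvent[OF T]]
          continuous_on_subset[OF holomorphic_on_imp_continuous_on[OF f]]) auto
    show "(\<lambda>z. cinner (F z x) y) holomorphic_on ?V" for x y
      unfolding F_def cmul_op_apply cinner_scaleC_left
      by (intro holomorphic_intros holomorphic_on_subset[OF f] holomorphic_on_subset[OF holomorphic_resolvent[OF T]]) auto
  qed
  from integral_linear[OF this bounded_linear_cinner_blinfun, of x y]
  have "integral {0..1} (\<lambda>t. cinner (F (\<gamma> t) x) y * vector_derivative \<gamma> (at t within {0..1})) =
      cinner (integral {0..1} (\<lambda>t. cmul_op (vector_derivative \<gamma> (at t within {0..1})) (F (\<gamma> t))) x) y"
    by (simp add: o_def cinner_scaleC_left mult.commute)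
  moreover have "resolvent_integral f T \<gamma> = integral {0..1} (\<lambda>t. cmul_op (vector_derivative \<gamma> (at t within {0..1})) (F (\<gamma> t)))"
    unfolding resolvent_integral_def F_def cmul_op_cmul_op resolvent_def[symmetric] by (simp add: mult.commute)
  moreover have "contour_integral \<gamma> (\<lambda>z. f z * cinner (resolvent T z x) y) =
      integral {0..1} (\<lambda>t. cinner (F (\<gamma> t) x) y * vector_derivative \<gamma> (at t within {0..1}))"
    unfolding contour_integral_def has_contour_integral_def contour_integrable_on_def integral_def integrable_on_def
    by (simp add: F_def cinner_scaleC_left)
  ultimately show ?thesis by simp
qed

section \<open>The functional calculus on an annulus\<close>

definition loops_in :: "complex set \<Rightarrow> (real \<Rightarrow> complex) list \<Rightarrow> bool" where
  "loops_in V \<gamma>s \<longleftrightarrow> (\<forall>\<gamma>\<in>set \<gamma>s. valid_path \<gamma> \<and> pathfinish \<gamma> = pathstart \<gamma> \<and> path_image \<gamma> \<subseteq> V)"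

definition cycle_integral :: "(real \<Rightarrow> complex) list \<Rightarrow> (complex \<Rightarrow> complex) \<Rightarrow> complex" where
  "cycle_integral \<gamma>s g = (\<Sum>\<gamma>\<leftarrow>\<gamma>s. contour_integral \<gamma> g)"

lemma cycle_integral_cong:
  assumes "loops_in V \<gamma>s" "\<And>z. z \<in> V \<Longrightarrow> f z = g z"
  shows "cycle_integral \<gamma>s f = cycle_integral \<gamma>s g"
  unfolding cycle_integral_def
  by (intro arg_cong[where f = sum_list] map_cong refl contour_integral_cong)
     (use assms in \<open>auto simp: loops_in_def\<close>)

lemma loops_in_subset: "loops_in V \<gamma>s \<Longrightarrow> V \<subseteq> W \<Longrightarrow> loops_in W \<gamma>s"
  by (auto simp: loops_in_def)

context
  fixes V \<gamma>s
  assumes V: "open V" and loops: "loops_in V \<gamma>s"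
begin

lemma loops_integrable: "f holomorphic_on V \<Longrightarrow> \<gamma> \<in> set \<gamma>s \<Longrightarrow> f contour_integrable_on \<gamma>"
  using loops contour_integrable_holomorphic_simple[OF _ V] by (auto simp: loops_in_def)

lemma cycle_integral_add:
  assumes "f holomorphic_on V" "g holomorphic_on V"
  shows "cycle_integral \<gamma>s (\<lambda>z. f z + g z) = cycle_integral \<gamma>s f + cycle_integral \<gamma>s g"
proof -
  have "map (\<lambda>\<gamma>. contour_integral \<gamma> (\<lambda>z. f z + g z)) \<gamma>s = map (\<lambda>\<gamma>. contour_integral \<gamma> f + contour_integral \<gamma> g) \<gamma>s"
    by (intro map_cong refl contour_integral_add loops_integrable assms)
  then show ?thesis unfolding cycle_integral_def by (simp only: sum_list_addf)
qed

lemma cycle_integral_lmul: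
  assumes "f holomorphic_on V"
  shows "cycle_integral \<gamma>s (\<lambda>z. c * f z) = c * cycle_integral \<gamma>s f"
proof -
  have "map (\<lambda>\<gamma>. contour_integral \<gamma> (\<lambda>z. c * f z)) \<gamma>s = map (\<lambda>\<gamma>. c * contour_integral \<gamma> f) \<gamma>s"
    by (intro map_cong refl contour_integral_lmul loops_integrable assms)
  then show ?thesis unfolding cycle_integral_def by (simp only: sum_list_const_mult)
qed

lemma cycle_integral_diff:
  assumes "f holomorphic_on V" "g holomorphic_on V"
  shows "cycle_integral \<gamma>s (\<lambda>z. f z - g z) = cycle_integral \<gamma>s f - cycle_integral \<gamma>s g"
  using cycle_integral_add[OF assms(1), of "\<lambda>z. (-1) * g z"] cycle_integral_lmul[OF assms(2), of "-1"] assms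
  by (simp add: holomorphic_on_minus)

lemma cycle_integral_sum:
  assumes "finite I" "\<And>i. i \<in> I \<Longrightarrow> f i holomorphic_on V"
  shows "cycle_integral \<gamma>s (\<lambda>z. \<Sum>i\<in>I. f i z) = (\<Sum>i\<in>I. cycle_integral \<gamma>s (f i))"
  using assms
proof (induction I rule: finite_induct)
  case empty
  then show ?case by (simp add: cycle_integral_def)
next
  case (insert i I)
  then show ?case
    by (simp add: cycle_integral_add holomorphic_on_sum)
qed

lemma cycle_integral_primitive:
  assumes "\<And>z. z \<in> V \<Longrightarrow> (p has_field_derivative f z) (at z)"
  shows "cycle_integral \<gamma>s f = 0"
proof -
  have "contour_integral \<gamma> f = 0" if "\<gamma> \<in> set \<gamma>s" for \<gamma>
    by (rule contour_integral_unique, rule Cauchy_theorem_primitive[of V p])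
       (use assms that loops in \<open>auto simp: loops_in_def intro: has_field_derivative_at_within\<close>)
  then have "map (\<lambda>\<gamma>. contour_integral \<gamma> f) \<gamma>s = map (\<lambda>\<gamma>. 0) \<gamma>s" by (intro map_cong refl)
  then show ?thesis unfolding cycle_integral_def by (simp only:) simp
qed

end

lemma cycle_integral_inverse:
  assumes "loops_in (- {w}) \<gamma>s"
  shows "cycle_integral \<gamma>s (\<lambda>z. 1 / (z - w)) = 2 * of_real pi * \<i> * (\<Sum>\<gamma>\<leftarrow>\<gamma>s. winding_number \<gamma> w)"
proof -
  have "contour_integral \<gamma> (\<lambda>z. 1 / (z - w)) = 2 * of_real pi * \<i> * winding_number \<gamma> w" if "\<gamma> \<in> set \<gamma>s" for \<gamma>
    using that assms winding_number_valid_path[of \<gamma> w] by (auto simp: loops_in_def)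
  then have "map (\<lambda>\<gamma>. contour_integral \<gamma> (\<lambda>z. 1 / (z - w))) \<gamma>s = map (\<lambda>\<gamma>. 2 * of_real pi * \<i> * winding_number \<gamma> w) \<gamma>s"
    by (intro map_cong refl)
  then show ?thesis unfolding cycle_integral_def by (simp only: sum_list_const_mult)
qed

lemma field_differentiable_transform_within_open:
  assumes "f field_differentiable at w" "open S" "w \<in> S" "\<And>u. u \<in> S \<Longrightarrow> f u = g u"
  shows "g field_differentiable at w"
  using assms has_field_derivative_transform_within_open unfolding field_differentiable_def by metis

lemma cauchy_transform_differentiable:
  assumes V: "open V" and \<phi>: "\<phi> holomorphic_on V" and \<gamma>: "valid_path \<gamma>" "path_image \<gamma> \<subseteq> V"
    and w: "w \<notin> path_image \<gamma>"
  shows "(\<lambda>w. contour_integral \<gamma> (\<lambda>z. \<phi> z / (z - w))) field_differentiable at w"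
proof -
  have "open (- path_image \<gamma>)" using closed_valid_path_image[OF \<gamma>(1)] by (simp add: open_Compl)
  then obtain e where e: "e > 0" "cball w e \<subseteq> - path_image \<gamma>" using w open_contains_cball by blast
  define V' where "V' = V - cball w e"
  have V': "open V'" "path_image \<gamma> \<subseteq> V'" using V e \<gamma> by (auto simp: V'_def open_Diff)
  \<comment> \<open>Replace the path by a polynomial one, which has a bounded derivative.\<close>
  obtain d where d: "d > 0" "\<And>g h. valid_path g \<Longrightarrow> valid_path h \<Longrightarrow>
      (\<And>t. t \<in> {0..1} \<Longrightarrow> norm (g t - \<gamma> t) < d \<and> norm (h t - \<gamma> t) < d) \<Longrightarrow>
      pathstart h = pathstart g \<Longrightarrow> pathfinish h = pathfinish g \<Longrightarrow>
      path_image g \<subseteq> V' \<and> path_image h \<subseteq> V' \<and>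
      (\<forall>f. f holomorphic_on V' \<longrightarrow> contour_integral h f = contour_integral g f)"
    using contour_integral_nearby_ends[OF V'(1) valid_path_imp_path[OF \<gamma>(1)] V'(2)] by metis
  obtain p where p: "polynomial_function p" "pathstart p = pathstart \<gamma>" "pathfinish p = pathfinish \<gamma>"
      "\<And>t. t \<in> {0..1} \<Longrightarrow> norm (p t - \<gamma> t) < d"
    using path_approx_polynomial_function[OF valid_path_imp_path[OF \<gamma>(1)] d(1)] by metis
  have vp: "valid_path p" using p(1) by (rule valid_path_polynomial_function)
  have pV: "path_image p \<subseteq> V'" and eq: "\<And>f. f holomorphic_on V' \<Longrightarrow> contour_integral \<gamma> f = contour_integral p f"
    using d(2)[OF vp \<gamma>(1)] p d(1) by auto
  obtain p' where p': "polynomial_function p'" "\<And>x. (p has_vector_derivative (p' x)) (at x)"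
    using has_vector_derivative_polynomial_function[OF p(1)] by blast
  have "bounded (p' ` {0..1})"
    by (intro compact_imp_bounded compact_continuous_image continuous_on_polymonial_function p') auto
  then obtain B where B: "\<And>t. t \<in> {0..1} \<Longrightarrow> norm (p' t) \<le> B" unfolding bounded_iff by blast
  have hol: "(\<lambda>z. \<phi> z / (z - u)) holomorphic_on V'" if "u \<in> ball w e" for u
    using that by (intro holomorphic_intros holomorphic_on_subset[OF \<phi>]) (auto simp: V'_def)
  have "((\<lambda>u. contour_integral p (\<lambda>z. \<phi> z / (z - u))) has_field_derivative
      (of_nat 1 * contour_integral p (\<lambda>z. \<phi> z / (z - w) ^ Suc 1))) (at w)"
  proof (rule Cauchy_next_derivative(2)[where S = "ball w e" and B = B])
    show "continuous_on (path_image p) \<phi>"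
      by (rule holomorphic_on_imp_continuous_on[OF holomorphic_on_subset[OF \<phi>]]) (use pV in \<open>auto simp: V'_def\<close>)
    show "norm (vector_derivative p (at t)) \<le> B" if "t \<in> {0..1}" for t
      using B[OF that] vector_derivative_at[OF p'(2)] by simp
    show "((\<lambda>z. \<phi> z / (z - u) ^ 1) has_contour_integral contour_integral p (\<lambda>z. \<phi> z / (z - u))) p"
      if "u \<in> ball w e - path_image p" for u
      using has_contour_integral_integral[OF contour_integrable_holomorphic_simple[OF hol V'(1) vp pV]] that by simp
    show "w \<in> ball w e - path_image p" using pV e by (auto simp: V'_def)
  qed (auto simp: vp)
  then have "(\<lambda>u. contour_integral p (\<lambda>z. \<phi> z / (z - u))) field_differentiable at w"
    by (auto simp: field_differentiable_def)
  moreover have "contour_integral \<gamma> (\<lambda>z. \<phi> z / (z - u)) = contour_integral p (\<lambda>z. \<phi> z / (z - u))" if "u \<in> ball w e" for u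
    by (rule eq[OF hol[OF that]])
  ultimately show ?thesis
    using field_differentiable_transform_within_open[of "\<lambda>u. contour_integral p (\<lambda>z. \<phi> z / (z - u))" w "ball w e"
        "\<lambda>u. contour_integral \<gamma> (\<lambda>z. \<phi> z / (z - u))"] e(1) by simp
qed

text \<open>A cycle around the spectrum reproduces the identity. With \<open>A\<close> the normalised integral of the
  resolvent \<open>R\<close>, the function \<open>\<langle>R w (x - A x), y\<rangle>\<close> is holomorphic off the spectrum. By the
  resolvent identity it equals a Cauchy integral wherever the cycle has winding number one, hence
  it extends over the spectrum to an entire function. It vanishes at infinity, so it is zero.\<close>

lemma cycle_integral_resolvent:
  fixes T :: "'a::complex_hilbert_space \<Rightarrow>\<^sub>L 'a"
  assumes T: "complex_linear T" and bdd: "bounded (op_spectrum T)"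
    and loops: "loops_in (- op_spectrum T) \<gamma>s"
    and wind: "\<And>w. w \<in> op_spectrum T \<Longrightarrow> (\<Sum>\<gamma>\<leftarrow>\<gamma>s. winding_number \<gamma> w) = 1"
  shows "cycle_integral \<gamma>s (\<lambda>z. cinner (resolvent T z x) y) = 2 * of_real pi * \<i> * cinner x y"
proof -
  let ?S = "op_spectrum T" and ?R = "resolvent T"
  define c where "c = 2 * of_real pi * \<i>"
  have c: "c \<noteq> 0" by (simp add: c_def)
  note op = open_resolvent_set[OF T]
  define A where "A = cmul_op (1 / c) (\<Sum>\<gamma>\<leftarrow>\<gamma>s. resolvent_integral (\<lambda>_. 1) T \<gamma>)"
  have A: "cinner (A x) y = cycle_integral \<gamma>s (\<lambda>z. cinner (?R z x) y) / c" for x y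
  proof -
    have "cinner ((\<Sum>\<gamma>\<leftarrow>\<gamma>s. resolvent_integral (\<lambda>_. 1) T \<gamma>) x) y = cycle_integral \<gamma>s (\<lambda>z. cinner (?R z x) y)"
      using loops
    proof (induction \<gamma>s)
      case (Cons \<gamma> \<gamma>s)
      have "cinner (resolvent_integral (\<lambda>_. 1) T \<gamma> x) y = contour_integral \<gamma> (\<lambda>z. 1 * cinner (?R z x) y)"
        by (rule resolvent_integral_weak[OF T open_UNIV]) (use Cons.prems in \<open>auto simp: loops_in_def\<close>)
      then show ?case
        using Cons by (simp add: blinfun.add_left cinner_add_left cycle_integral_def loops_in_def)
    qed (simp add: cycle_integral_def cinner.zero_left)
    then show ?thesis by (simp add: A_def cinner_scaleC_left)
  qed
  have RA: "cinner (?R w (A x)) y = cycle_integral \<gamma>s (\<lambda>z. cinner (?R w (?R z x)) y) / c" if "w \<notin> ?S" for w x y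
    using A[of x "adjoint_op (?R w) y"]
    by (simp add: cinner_adjoint(1)[OF complex_linear_resolvent[OF T that]])
  obtain M where M: "\<And>z. z \<in> ?S \<Longrightarrow> cmod z \<le> M" using bdd by (auto simp: bounded_iff)
  define w0 where "w0 = complex_of_real (\<bar>M\<bar> + 1)"
  have w0: "w0 \<notin> ?S" using M[of w0] by (auto simp: w0_def)
  have zero: "cinner (?R w0 (x - A x)) y = 0" for y
  proof -
    define G where "G w = cinner (?R w (x - A x)) y" for w
    define \<phi> where "\<phi> z = cinner (?R z x) y" for z
    have \<phi>_hol: "\<phi> holomorphic_on - ?S" unfolding \<phi>_def by (rule holomorphic_resolvent[OF T])
    define C where "C w = cycle_integral \<gamma>s (\<lambda>z. \<phi> z / (z - w)) / c" for w
    define n where "n w = (\<Sum>\<gamma>\<leftarrow>\<gamma>s. winding_number \<gamma> w)" for w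
    have G_C: "G w = C w" if w: "w \<notin> ?S" "loops_in (- {w}) \<gamma>s" "n w = 1" for w
    proof -
      let ?V = "- ?S - {w}"
      have V: "open ?V" using op by (simp add: open_Diff)
      have lV: "loops_in ?V \<gamma>s" using w(2) loops by (auto simp: loops_in_def)
      have h1: "(\<lambda>z. \<phi> z / (z - w)) holomorphic_on ?V" "(\<lambda>z. 1 / (z - w)) holomorphic_on ?V"
        by (auto intro!: holomorphic_intros holomorphic_on_subset[OF \<phi>_hol])
      have "cycle_integral \<gamma>s (\<lambda>z. cinner (?R w (?R z x)) y) = cycle_integral \<gamma>s (\<lambda>z. \<phi> w * (1 / (z - w)) - \<phi> z / (z - w))"
      proof (rule cycle_integral_cong[OF lV])
        fix z assume z: "z \<in> ?V"
        then have "(z - w) * cinner (?R w (?R z x)) y = \<phi> w - \<phi> z"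
          using resolvent_identity[OF T w(1), of z x]
          by (simp add: \<phi>_def cinner_scaleC_left[symmetric] cinner.diff_left[symmetric])
        then show "cinner (?R w (?R z x)) y = \<phi> w * (1 / (z - w)) - \<phi> z / (z - w)"
          using z by (simp add: diff_divide_distrib[symmetric] eq_divide_eq mult.commute)
      qed
      also have "\<dots> = \<phi> w * cycle_integral \<gamma>s (\<lambda>z. 1 / (z - w)) - cycle_integral \<gamma>s (\<lambda>z. \<phi> z / (z - w))"
        by (subst cycle_integral_diff[OF V lV holomorphic_on_mult[OF holomorphic_on_const h1(2)] h1(1)])
           (simp only: cycle_integral_lmul[OF V lV h1(2)])
      also have "cycle_integral \<gamma>s (\<lambda>z. 1 / (z - w)) = c"
        using cycle_integral_inverse[OF w(2)] w(3) by (simp add: n_def c_def)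
      finally have "cinner (?R w (A x)) y = \<phi> w - C w"
        using RA[OF w(1), of x y] c by (simp add: C_def diff_divide_distrib)
      then show ?thesis by (simp add: G_def \<phi>_def blinfun.diff_right cinner.diff_left)
    qed
    have G_hol: "G holomorphic_on - ?S" unfolding G_def by (rule holomorphic_resolvent[OF T])
    define E where "E w = (if w \<in> ?S then C w else G w)" for w
    have "E field_differentiable at w" for w
    proof (cases "w \<in> ?S")
      case False
      have "G field_differentiable at w" using G_hol op False by (auto intro: holomorphic_on_imp_differentiable_at)
      then show ?thesis
        by (rule field_differentiable_transform_within_open[OF _ op]) (use False in \<open>auto simp: E_def\<close>)
    next
      case True
      define W where "W = (\<Inter>\<gamma>\<in>set \<gamma>s. {z. z \<notin> path_image \<gamma> \<and> winding_number \<gamma> z = winding_number \<gamma> w})"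
      have W: "open W"
        unfolding W_def
        by (intro open_INT ballI open_winding_number_levelsets) (use loops in \<open>auto simp: loops_in_def valid_path_imp_path\<close>)
      have wW: "w \<in> W" using True loops by (auto simp: W_def loops_in_def)
      have nW: "n u = 1" if "u \<in> W" for u
      proof -
        have "n u = n w" unfolding n_def
          by (intro arg_cong[where f = sum_list] map_cong refl) (use that in \<open>auto simp: W_def\<close>)
        then show ?thesis using wind[OF True] by (simp add: n_def)
      qed
      have EC: "E u = C u" if "u \<in> W" for u
      proof (cases "u \<in> ?S")
        case False
        have "loops_in (- {u}) \<gamma>s" using that loops by (auto simp: W_def loops_in_def)
        then show ?thesis using G_C[OF False] nW[OF that] False by (simp add: E_def)
      qed (simp add: E_def)
      have "(\<lambda>w. cycle_integral \<gamma>s (\<lambda>z. \<phi> z / (z - w))) field_differentiable at w"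
        using loops
      proof (induction \<gamma>s)
        case (Cons \<gamma> \<gamma>s)
        have "(\<lambda>w. contour_integral \<gamma> (\<lambda>z. \<phi> z / (z - w))) field_differentiable at w"
          by (rule cauchy_transform_differentiable[OF op \<phi>_hol]) (use Cons.prems True in \<open>auto simp: loops_in_def\<close>)
        moreover have "(\<lambda>w. cycle_integral \<gamma>s (\<lambda>z. \<phi> z / (z - w))) field_differentiable at w"
          using Cons by (auto simp: loops_in_def)
        ultimately show ?case by (simp add: cycle_integral_def field_differentiable_add)
      qed (simp add: cycle_integral_def)
      then have "C field_differentiable at w"
        unfolding C_def by (intro field_differentiable_divide field_differentiable_const) (auto simp: c)
      then show ?thesis
        by (rule field_differentiable_transform_within_open[OF _ W wW]) (simp add: EC)
    qed
    then have E_hol: "E holomorphic_on UNIV" by (auto simp: holomorphic_on_def)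
    have "\<forall>\<^sub>F w in at_infinity. E w = G w"
      unfolding eventually_at_infinity by (intro exI[of _ "M + 1"]) (use M in \<open>force simp: E_def\<close>)
    moreover have "(G \<longlongrightarrow> 0) at_infinity" unfolding G_def by (rule resolvent_tendsto_zero[OF T bdd])
    ultimately have "(E \<longlongrightarrow> 0) at_infinity" by (simp add: tendsto_cong)
    then have E0: "E w = 0" for w by (rule Liouville_weak_0[OF E_hol])
    from this[of w0] show ?thesis using w0 by (simp add: E_def G_def)
  qed
  have "?R w0 (x - A x) = 0" using zero[of "?R w0 (x - A x)"] by (simp add: cinner_self)
  then have "A x = x" using resolvent_apply(1)[OF w0, of "x - A x"] by (simp add: blinfun.zero_right)
  then show ?thesis using A[of x y] c by (simp add: c_def field_simps)
qed

definition open_annulus :: "real \<Rightarrow> real \<Rightarrow> complex set" where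
  "open_annulus R1 R2 = {z. R1 < cmod z \<and> cmod z < R2}"

definition closed_annulus :: "real \<Rightarrow> real \<Rightarrow> complex set" where
  "closed_annulus a b = {z. a \<le> cmod z \<and> cmod z \<le> b}"

lemma open_open_annulus [simp]: "open (open_annulus R1 R2)"
  unfolding open_annulus_def by (intro open_Collect_conj open_Collect_less continuous_intros)

lemma compact_closed_annulus [simp]: "compact (closed_annulus a b)"
proof -
  have "closed (closed_annulus a b)"
    unfolding closed_annulus_def by (intro closed_Collect_conj closed_Collect_le continuous_intros)
  moreover have "bounded (closed_annulus a b)"
    by (auto simp: bounded_iff closed_annulus_def)
  ultimately show ?thesis by (simp add: compact_eq_bounded_closed)
qed

text \<open>A circle outside \<open>K\<close> and a reversed circle inside it: their winding numbers add up to one between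
  the circles and cancel elsewhere.\<close>

lemma surrounding_cycle_annulus:
  assumes "0 < R1" "R1 < a" "a \<le> b" "b < R2" and K: "K \<subseteq> closed_annulus a b"
  shows "\<exists>\<gamma>s. surrounding_cycle (open_annulus R1 R2) K \<gamma>s"
proof -
  define \<rho>1 where "\<rho>1 = (R1 + a) / 2"
  define \<rho>2 where "\<rho>2 = (b + R2) / 2"
  have \<rho>: "R1 < \<rho>1" "\<rho>1 < a" "b < \<rho>2" "\<rho>2 < R2" "0 < \<rho>1" "\<rho>1 < \<rho>2"
    using assms by (auto simp: \<rho>1_def \<rho>2_def)
  let ?C1 = "circlepath 0 \<rho>1" and ?C2 = "circlepath 0 \<rho>2"
  have img: "path_image ?C1 = sphere 0 \<rho>1" "path_image ?C2 = sphere 0 \<rho>2"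
    using \<rho> by auto
  have out: "winding_number (circlepath 0 \<rho>) w = 0" if "\<rho> < cmod w" "\<rho> > 0" for \<rho> w
    by (rule winding_number_zero_outside[of _ "cball 0 \<rho>"]) (use that in auto)
  have rev: "winding_number (reversepath ?C1) w = - winding_number ?C1 w" if "cmod w \<noteq> \<rho>1" for w
    by (rule winding_number_reversepath) (use that \<rho> in \<open>auto simp: img\<close>)
  have "surrounding_cycle (open_annulus R1 R2) K [?C2, reversepath ?C1]"
    unfolding surrounding_cycle_def
  proof (intro conjI ballI allI impI)
    fix \<gamma> assume "\<gamma> \<in> set [?C2, reversepath ?C1]"
    then consider "\<gamma> = ?C2" | "\<gamma> = reversepath ?C1" by auto
    then show "valid_path \<gamma>" "pathfinish \<gamma> = pathstart \<gamma>" "path_image \<gamma> \<subseteq> open_annulus R1 R2 - K"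
      using \<rho> K by (cases; force simp: img open_annulus_def closed_annulus_def)+
  next
    fix w assume "w \<in> K"
    then have "\<rho>1 < cmod w" "cmod w < \<rho>2" using K \<rho> by (auto simp: closed_annulus_def)
    then show "(\<Sum>\<gamma>\<leftarrow>[?C2, reversepath ?C1]. winding_number \<gamma> w) = 1"
      using \<rho> rev[of w] out[of \<rho>1 w] winding_number_circlepath[of w 0 \<rho>2] by simp
  next
    fix w assume "w \<notin> open_annulus R1 R2"
    then consider "cmod w \<le> R1" | "R2 \<le> cmod w" by (auto simp: open_annulus_def)
    then show "(\<Sum>\<gamma>\<leftarrow>[?C2, reversepath ?C1]. winding_number \<gamma> w) = 0"
    proof cases
      case 1
      then show ?thesis using \<rho> rev[of w] winding_number_circlepath[of w 0 \<rho>2] winding_number_circlepath[of w 0 \<rho>1] by simp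
    next
      case 2
      then show ?thesis using \<rho> rev[of w] out[of \<rho>1 w] out[of \<rho>2 w] by simp
    qed
  qed
  then show ?thesis by blast
qed

locale annular_operator =
  fixes T :: "'a::complex_hilbert_space \<Rightarrow>\<^sub>L 'a" and R1 a b R2 :: real
  assumes lin: "complex_linear T" and radii: "0 < R1" "R1 < a" "a \<le> b" "b < R2"
    and spectrum: "op_spectrum T \<subseteq> closed_annulus a b"
begin

abbreviation "U \<equiv> open_annulus R1 R2"

definition T_inv :: "'a \<Rightarrow>\<^sub>L 'a" where "T_inv = - resolvent T 0"

lemma zero_not_in_spectrum: "0 \<notin> op_spectrum T"
  using spectrum radii by (auto simp: closed_annulus_def)

lemma T_inv: "T o\<^sub>L T_inv = id_blinfun" "T_inv o\<^sub>L T = id_blinfun"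
  using resolvent_inverse[OF zero_not_in_spectrum]
  by (simp_all add: is_inverse_op_def T_inv_def scalar_op_simps compose.minus_left compose.minus_right)

lemma T_inv_apply [simp]: "T (T_inv x) = x" "T_inv (T x) = x"
  using T_inv by (metis blinfun_apply_blinfun_compose blinfun_apply_id_blinfun)+

lemma complex_linear_T_inv: "complex_linear T_inv"
  unfolding T_inv_def by (intro complex_linear_uminus complex_linear_resolvent lin zero_not_in_spectrum)

lemma bounded_spectrum: "bounded (op_spectrum T)"
  using bounded_subset[OF compact_imp_bounded[OF compact_closed_annulus] spectrum] .

definition cyc :: "(real \<Rightarrow> complex) list" where
  "cyc = (SOME \<gamma>s. surrounding_cycle U (op_spectrum T) \<gamma>s)"

lemma cyc: "surrounding_cycle U (op_spectrum T) cyc"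
  unfolding cyc_def by (rule someI_ex, rule surrounding_cycle_annulus[OF radii spectrum])

abbreviation "V \<equiv> U - op_spectrum T"

lemma open_V: "open V"
  using open_Int[OF open_open_annulus open_resolvent_set[OF lin]] by (simp add: Diff_eq)

lemma loops_V: "loops_in V cyc"
  using cyc by (auto simp: surrounding_cycle_def loops_in_def)

lemmas cycle_simps = cycle_integral_add[OF open_V loops_V] cycle_integral_diff[OF open_V loops_V]
  cycle_integral_lmul[OF open_V loops_V]

lemma holomorphic_resolvent_V: "(\<lambda>z. cinner (resolvent T z x) y) holomorphic_on V"
  by (rule holomorphic_on_subset[OF holomorphic_resolvent[OF lin]]) auto

lemma hol_calc_weak:
  assumes f: "f holomorphic_on U"
  shows "cinner (hol_calc U f T x) y = cycle_integral cyc (\<lambda>z. f z * cinner (resolvent T z x) y) / (2 * of_real pi * \<i>)"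
proof -
  have "cinner ((\<Sum>\<gamma>\<leftarrow>\<gamma>s. resolvent_integral f T \<gamma>) x) y = cycle_integral \<gamma>s (\<lambda>z. f z * cinner (resolvent T z x) y)"
    if "loops_in V \<gamma>s" for \<gamma>s
    using that
  proof (induction \<gamma>s)
    case (Cons \<gamma> \<gamma>s)
    have "cinner (resolvent_integral f T \<gamma> x) y = contour_integral \<gamma> (\<lambda>z. f z * cinner (resolvent T z x) y)"
      by (rule resolvent_integral_weak[OF lin open_open_annulus f]) (use Cons.prems in \<open>auto simp: loops_in_def\<close>)
    then show ?case
      using Cons by (simp add: blinfun.add_left cinner_add_left cycle_integral_def loops_in_def)
  qed (simp add: cycle_integral_def cinner.zero_left)
  from this[OF loops_V] show ?thesis
    unfolding hol_calc_def cyc_def[symmetric] by (simp add: cinner_scaleC_left)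
qed

lemma zero_not_in_V: "z \<in> U \<Longrightarrow> z \<noteq> 0"
  using radii by (auto simp: open_annulus_def)

lemma power_int_holomorphic_V: "(\<lambda>z. z powi k) holomorphic_on V"
  using zero_not_in_V by (intro holomorphic_intros) auto

text \<open>Every power but \<open>1 / z\<close> has a primitive, and the cycle does not wind around \<open>0\<close>.\<close>

lemma cycle_integral_power_int: "cycle_integral cyc (\<lambda>z. z powi k) = 0"
proof (cases "k = -1")
  case True
  have "loops_in (- {0}) cyc" using loops_V zero_not_in_V by (rule_tac loops_in_subset) auto
  moreover have "(\<Sum>\<gamma>\<leftarrow>cyc. winding_number \<gamma> 0) = 0"
    using cyc zero_not_in_V unfolding surrounding_cycle_def by blast
  ultimately show ?thesis
    using True cycle_integral_inverse[of 0 cyc] by (simp add: power_int_minus divide_inverse)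
next
  case False
  then have k: "of_int (k + 1) \<noteq> (0::complex)" by (metis add.inverse_inverse eq_neg_iff_add_eq_0 of_int_eq_0_iff)
  have "((\<lambda>z. z powi (k + 1) / of_int (k + 1)) has_field_derivative z powi k) (at z)" if "z \<in> V" for z
  proof -
    have "z \<noteq> 0" using that zero_not_in_V by auto
    then have "((\<lambda>z. z powi (k + 1)) has_field_derivative of_int (k + 1) * z powi (k + 1 - 1) * 1) (at z)"
      by (intro DERIV_power_int DERIV_ident) auto
    from DERIV_cdivide[OF this, of "of_int (k + 1)"] k show ?thesis by simp
  qed
  then show ?thesis by (rule cycle_integral_primitive[OF open_V loops_V])
qed

lemma laurent_holomorphic: "(\<lambda>z. poly p z / z ^ n) holomorphic_on U"
  using zero_not_in_V by (intro holomorphic_intros) auto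

lemma laurent_holomorphic_V: "(\<lambda>z. poly p z / z ^ n) holomorphic_on V"
  by (rule holomorphic_on_subset[OF laurent_holomorphic]) auto

lemma cycle_integral_laurent: "cycle_integral cyc (\<lambda>z. poly p z / z ^ n) = 0"
proof -
  have "cycle_integral cyc (\<lambda>z. poly p z / z ^ n) = cycle_integral cyc (\<lambda>z. \<Sum>i\<le>degree p. coeff p i * z powi (int i - int n))"
  proof (rule cycle_integral_cong[OF loops_V])
    fix z assume "z \<in> V"
    then have "z \<noteq> 0" using zero_not_in_V by auto
    then show "poly p z / z ^ n = (\<Sum>i\<le>degree p. coeff p i * z powi (int i - int n))"
      by (simp add: poly_altdef sum_divide_distrib power_int_diff)
  qed
  also have "\<dots> = (\<Sum>i\<le>degree p. cycle_integral cyc (\<lambda>z. coeff p i * z powi (int i - int n)))"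
    by (intro cycle_integral_sum[OF open_V loops_V] holomorphic_on_mult holomorphic_on_const power_int_holomorphic_V) simp
  also have "\<dots> = 0"
    by (simp add: cycle_simps(3)[OF power_int_holomorphic_V] cycle_integral_power_int)
  finally show ?thesis .
qed

text \<open>Since \<open>z R(z) = 1 + R(z) T\<close>, multiplying the integrand by \<open>z\<close> multiplies the integral by \<open>T\<close>.\<close>

lemma cycle_integral_poly_resolvent:
  "cycle_integral cyc (\<lambda>z. poly p z * cinner (resolvent T z x) y) = 2 * of_real pi * \<i> * cinner (poly_op p T x) y"
proof (induction p arbitrary: x)
  case 0
  then show ?case using cycle_integral_laurent[of 0 0] by (simp add: cinner.zero_left)
next
  case (pCons c p)
  have "cycle_integral cyc (\<lambda>z. poly (pCons c p) z * cinner (resolvent T z x) y) =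
      cycle_integral cyc (\<lambda>z. (c * cinner (resolvent T z x) y + cinner x y * (poly p z / z ^ 0)) + poly p z * cinner (resolvent T z (T x)) y)"
  proof (rule cycle_integral_cong[OF loops_V])
    fix z assume z: "z \<in> V"
    then have "z *\<^sub>C resolvent T z x = x + T (resolvent T z x)"
      using resolvent_apply(1)[of z T x] by (simp add: algebra_simps)
    also have "T (resolvent T z x) = resolvent T z (T x)"
      using resolvent_commute[OF lin _ lin refl, of z] z by (metis DiffD2 blinfun_apply_blinfun_compose)
    finally have *: "z * cinner (resolvent T z x) y = cinner x y + cinner (resolvent T z (T x)) y"
      by (metis cinner_add_left cinner_scaleC_left)
    have "poly (pCons c p) z * cinner (resolvent T z x) y =
        c * cinner (resolvent T z x) y + poly p z * (z * cinner (resolvent T z x) y)"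
      by (simp add: algebra_simps)
    then show "poly (pCons c p) z * cinner (resolvent T z x) y =
      (c * cinner (resolvent T z x) y + cinner x y * (poly p z / z ^ 0)) + poly p z * cinner (resolvent T z (T x)) y"
      unfolding * by (simp add: algebra_simps)
  qed
  also have "\<dots> = c * cycle_integral cyc (\<lambda>z. cinner (resolvent T z x) y) + cinner x y * cycle_integral cyc (\<lambda>z. poly p z / z ^ 0)
      + cycle_integral cyc (\<lambda>z. poly p z * cinner (resolvent T z (T x)) y)"
    by (subst cycle_simps(1), intro holomorphic_intros holomorphic_resolvent_V laurent_holomorphic_V, intro holomorphic_intros holomorphic_resolvent_V,
        subst cycle_simps(1), intro holomorphic_intros holomorphic_resolvent_V, intro holomorphic_intros laurent_holomorphic_V)
       (simp only: cycle_simps(3)[OF holomorphic_resolvent_V] cycle_simps(3)[OF laurent_holomorphic_V])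
  also have "cycle_integral cyc (\<lambda>z. cinner (resolvent T z x) y) = 2 * of_real pi * \<i> * cinner x y"
  proof (rule cycle_integral_resolvent[OF lin bounded_spectrum])
    show "loops_in (- op_spectrum T) cyc" by (rule loops_in_subset[OF loops_V]) auto
  qed (use cyc in \<open>auto simp: surrounding_cycle_def\<close>)
  finally have "cycle_integral cyc (\<lambda>z. poly (pCons c p) z * cinner (resolvent T z x) y) =
      c * (2 * of_real pi * \<i> * cinner x y) + 2 * of_real pi * \<i> * cinner (poly_op p T (T x)) y"
    by (simp only: cycle_integral_laurent pCons.IH mult_zero_right add_0_right)
  moreover have "poly_op p T (T x) = T (poly_op p T x)"
    using arg_cong[OF poly_op_commute[OF lin lin refl, of p], of "\<lambda>A. A x"] by simp
  ultimately show ?case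
    by (simp add: poly_op_pCons[OF lin] blinfun.add_left cinner_add_left cinner_scaleC_left algebra_simps)
qed

text \<open>The same recursion, run downwards: \<open>R(z) / z\<close> differs from \<open>R(z) T\<^sup>-\<^sup>1\<close> by \<open>T\<^sup>-\<^sup>1 / z\<close>.\<close>

lemma cycle_integral_laurent_resolvent:
  "cycle_integral cyc (\<lambda>z. (poly p z / z ^ n) * cinner (resolvent T z x) y) =
    2 * of_real pi * \<i> * cinner (poly_op p T (op_power T_inv n x)) y"
proof (induction n arbitrary: x)
  case 0
  then show ?case by (simp add: cycle_integral_poly_resolvent)
next
  case (Suc n)
  have "cycle_integral cyc (\<lambda>z. (poly p z / z ^ Suc n) * cinner (resolvent T z x) y) =
      cycle_integral cyc (\<lambda>z. (poly p z / z ^ n) * cinner (resolvent T z (T_inv x)) y - cinner (T_inv x) y * (poly p z / z ^ Suc n))"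
  proof (rule cycle_integral_cong[OF loops_V])
    fix z assume z: "z \<in> V"
    then have z0: "z \<noteq> 0" using zero_not_in_V by auto
    have "z *\<^sub>C resolvent T z (T_inv x) = T_inv x + resolvent T z x"
    proof -
      have "T (resolvent T z (T_inv x)) = resolvent T z (T (T_inv x))"
        using resolvent_commute[OF lin _ lin refl, of z] z by (metis DiffD2 blinfun_apply_blinfun_compose)
      then show ?thesis using resolvent_apply(1)[of z T "T_inv x"] z by (simp add: algebra_simps)
    qed
    then have "z * cinner (resolvent T z (T_inv x)) y = cinner (T_inv x) y + cinner (resolvent T z x) y"
      by (metis cinner_add_left cinner_scaleC_left)
    then have *: "cinner (resolvent T z (T_inv x)) y = (cinner (T_inv x) y + cinner (resolvent T z x) y) / z"
      using z0 by (simp add: eq_divide_eq mult.commute)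
    show "(poly p z / z ^ Suc n) * cinner (resolvent T z x) y =
      (poly p z / z ^ n) * cinner (resolvent T z (T_inv x)) y - cinner (T_inv x) y * (poly p z / z ^ Suc n)"
      unfolding * using z0 by (simp add: field_simps)
  qed
  also have "\<dots> = cycle_integral cyc (\<lambda>z. (poly p z / z ^ n) * cinner (resolvent T z (T_inv x)) y)
      - cinner (T_inv x) y * cycle_integral cyc (\<lambda>z. poly p z / z ^ Suc n)"
    by (subst cycle_simps(2), rule holomorphic_on_mult[OF laurent_holomorphic_V holomorphic_resolvent_V],
        rule holomorphic_on_mult[OF holomorphic_on_const laurent_holomorphic_V])
       (simp only: cycle_simps(3)[OF laurent_holomorphic_V])
  also have "\<dots> = 2 * of_real pi * \<i> * cinner (poly_op p T (op_power T_inv n (T_inv x))) y"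
    by (simp only: Suc cycle_integral_laurent mult_zero_right diff_zero)
  also have "op_power T_inv n (T_inv x) = op_power T_inv (Suc n) x"
    using op_power_commute[of T_inv T_inv n] by (metis blinfun_apply_blinfun_compose op_power.simps(2))
  finally show ?case .
qed

definition laurent_op :: "complex poly \<Rightarrow> nat \<Rightarrow> ('a \<Rightarrow>\<^sub>L 'a)" where
  "laurent_op p n = poly_op p T o\<^sub>L op_power T_inv n"

lemma hol_calc_laurent: "hol_calc U (\<lambda>z. poly p z / z ^ n) T = laurent_op p n"
proof (rule blinfun_eq_of_cinner)
  show "cinner (hol_calc U (\<lambda>z. poly p z / z ^ n) T x) y = cinner (laurent_op p n x) y" for x y
    unfolding hol_calc_weak[OF laurent_holomorphic] cycle_integral_laurent_resolvent
    by (simp add: laurent_op_def)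
qed

lemma hol_calc_diff:
  assumes "f holomorphic_on U" "g holomorphic_on U"
  shows "hol_calc U (\<lambda>z. f z - g z) T = hol_calc U f T - hol_calc U g T"
proof (rule blinfun_eq_of_cinner)
  fix x y
  have "f holomorphic_on V" "g holomorphic_on V" using assms by (auto elim: holomorphic_on_subset)
  then have "cycle_integral cyc (\<lambda>z. f z * cinner (resolvent T z x) y - g z * cinner (resolvent T z x) y) =
      cycle_integral cyc (\<lambda>z. f z * cinner (resolvent T z x) y) - cycle_integral cyc (\<lambda>z. g z * cinner (resolvent T z x) y)"
    by (intro cycle_simps(2) holomorphic_on_mult holomorphic_resolvent_V)
  then show "cinner (hol_calc U (\<lambda>z. f z - g z) T x) y = cinner ((hol_calc U f T - hol_calc U g T) x) y"
    by (simp add: hol_calc_weak assms holomorphic_on_diff blinfun.diff_left cinner.diff_left left_diff_distrib diff_divide_distrib)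
qed

lemma compact_subset_open_annulus:
  assumes "compact D" "D \<subseteq> U"
  obtains a' b' where "R1 < a'" "a' < a" "b < b'" "b' < R2" "D \<subseteq> closed_annulus a' b'"
proof -
  define a0 where "a0 = (R1 + a) / 2"
  define b0 where "b0 = (b + R2) / 2"
  let ?D = "cmod ` (D \<union> {of_real a0, of_real b0})"
  have ab: "R1 < a0" "a0 < a" "b < b0" "b0 < R2" "0 < a0" "0 < b0" using radii by (auto simp: a0_def b0_def)
  have D: "compact ?D" "?D \<noteq> {}"
    using assms(1) by (auto intro!: compact_insert compact_continuous_image continuous_on_norm_id)
  obtain m where m: "m \<in> ?D" "\<And>t. t \<in> ?D \<Longrightarrow> m \<le> t" using compact_attains_inf[OF D] by blast
  obtain M where M: "M \<in> ?D" "\<And>t. t \<in> ?D \<Longrightarrow> t \<le> M" using compact_attains_sup[OF D] by blast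
  have in_range: "R1 < t \<and> t < R2" if "t \<in> ?D" for t
    using that assms(2) ab radii by (auto simp: open_annulus_def)
  have "m \<le> a0" "b0 \<le> M" using m(2)[of a0] M(2)[of b0] ab by auto
  moreover have "D \<subseteq> closed_annulus m M"
    using m(2) M(2) by (auto simp: closed_annulus_def)
  ultimately show thesis
    using that[of m M] in_range[OF m(1)] in_range[OF M(1)] ab by simp
qed

text \<open>The constant depends only on the cycle: nearby rectifiable paths carry the integrals of
  all holomorphic functions at once, and the resolvent is bounded near the cycle.\<close>

lemma hol_calc_bound:
  obtains a' b' C where "R1 < a'" "a' < a" "b < b'" "b' < R2" "0 < C"
    "\<And>f B. f holomorphic_on U \<Longrightarrow> (\<And>z. z \<in> closed_annulus a' b' \<Longrightarrow> cmod (f z) \<le> B) \<Longrightarrow> norm (hol_calc U f T) \<le> C * B"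
proof -
  define I where "I = (\<Union>\<gamma>\<in>set cyc. path_image \<gamma>)"
  have I: "compact I" "I \<subseteq> V"
    using loops_V unfolding I_def loops_in_def
    by (auto intro!: compact_UN compact_valid_path_image)
  obtain e where e: "e > 0" "(\<Union>x\<in>I. cball x e) \<subseteq> V"
    using compact_subset_open_imp_cball_epsilon_subset[OF I(1) open_V I(2)] .
  define D where "D = (\<Union>x\<in>I. \<Union>y\<in>cball 0 e. {x + y})"
  have D: "compact D"
    unfolding D_def by (rule compact_sums'[OF I(1) compact_cball])
  have D_eq: "D = (\<Union>x\<in>I. cball x e)"
  proof
    show "(\<Union>x\<in>I. cball x e) \<subseteq> D"
    proof
      fix z assume "z \<in> (\<Union>x\<in>I. cball x e)"
      then obtain x where "x \<in> I" "z \<in> cball x e" by blast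
      then show "z \<in> D" unfolding D_def
        by (intro UN_I[of x] UN_I[of "z - x"]) (auto simp: dist_norm norm_minus_commute)
    qed
  qed (auto simp: D_def dist_norm)
  then have DV: "D \<subseteq> V" using e by simp
  define S where "S = (\<Union>x\<in>I. ball x e)"
  have S: "open S" "S \<subseteq> D" "I \<subseteq> S" using e by (force simp: S_def D_eq)+
  have "D \<subseteq> U" using DV by auto
  then obtain a' b' where ab: "R1 < a'" "a' < a" "b < b'" "b' < R2" "D \<subseteq> closed_annulus a' b'"
    using compact_subset_open_annulus[OF D] by blast
  have "continuous_on D (resolvent T)"
    by (rule continuous_on_subset[OF continuous_on_resolvent[OF lin]]) (use DV in auto)
  then have "bounded (resolvent T ` D)" by (intro compact_imp_bounded compact_continuous_image D)
  then obtain M where M: "M > 0" "\<And>z. z \<in> D \<Longrightarrow> norm (resolvent T z) \<le> M"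
    unfolding bounded_pos by blast
  have "\<exists>L\<ge>0. \<forall>f B. f holomorphic_on S \<and> (\<forall>z\<in>S. norm (f z) \<le> B) \<longrightarrow> norm (cycle_integral \<gamma>s f) \<le> L * B"
    if "set \<gamma>s \<subseteq> set cyc" for \<gamma>s
    using that
  proof (induction \<gamma>s)
    case Nil
    then show ?case by (intro exI[of _ 0]) (auto simp: cycle_integral_def)
  next
    case (Cons \<gamma> \<gamma>s)
    then obtain L where L: "L \<ge> 0" "\<And>f B. f holomorphic_on S \<Longrightarrow> (\<forall>z\<in>S. norm (f z) \<le> B) \<Longrightarrow> norm (cycle_integral \<gamma>s f) \<le> L * B"
      by auto
    have "valid_path \<gamma>" "path_image \<gamma> \<subseteq> S" using Cons.prems S(3) loops_V by (auto simp: loops_in_def I_def)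
    then obtain L' where L': "L' > 0" "\<And>f B. f holomorphic_on S \<Longrightarrow> (\<forall>z\<in>S. norm (f z) \<le> B) \<Longrightarrow> norm (contour_integral \<gamma> f) \<le> L' * B"
      using contour_integral_bound_exists[OF S(1)] by metis
    show ?case
    proof (intro exI[of _ "L' + L"] conjI allI impI)
      fix f B assume "f holomorphic_on S \<and> (\<forall>z\<in>S. norm (f z) \<le> B)"
      then show "norm (cycle_integral (\<gamma> # \<gamma>s) f) \<le> (L' + L) * B"
        using L(2)[of f B] L'(2)[of f B]
        by (simp add: cycle_integral_def distrib_right) (meson add_mono norm_triangle_le)
    qed (use L L' in auto)
  qed
  then obtain L where L: "L \<ge> 0" "\<And>f B. f holomorphic_on S \<Longrightarrow> (\<forall>z\<in>S. norm (f z) \<le> B) \<Longrightarrow> norm (cycle_integral cyc f) \<le> L * B"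
    by blast
  define C where "C = L * M / (2 * pi) + 1"
  show thesis
  proof (rule that[OF ab(1-4), of C])
    show "0 < C" using L M by (simp add: C_def add_nonneg_pos)
    fix f B assume f: "f holomorphic_on U" and B: "\<And>z. z \<in> closed_annulus a' b' \<Longrightarrow> cmod (f z) \<le> B"
    have "of_real a \<in> closed_annulus a' b'" using ab radii by (auto simp: closed_annulus_def)
    from B[OF this] have B0: "B \<ge> 0" using norm_ge_zero order_trans by blast
    have "norm (hol_calc U f T) \<le> \<bar>L * M * B / (2 * pi)\<bar>"
    proof (rule norm_blinfun_le_of_cinner)
      fix x y
      have "norm (cycle_integral cyc (\<lambda>z. f z * cinner (resolvent T z x) y)) \<le> L * (B * (M * norm x * norm y))"
      proof (rule L(2))
        show "(\<lambda>z. f z * cinner (resolvent T z x) y) holomorphic_on S"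
          by (rule holomorphic_on_subset[of _ V], rule holomorphic_on_mult[OF holomorphic_on_subset[OF f] holomorphic_resolvent_V])
             (use S DV in auto)
        show "\<forall>z\<in>S. norm (f z * cinner (resolvent T z x) y) \<le> B * (M * norm x * norm y)"
        proof
          fix z assume "z \<in> S"
          then have z: "z \<in> D" "cmod (f z) \<le> B" using S ab(5) B by auto
          have "norm (cinner (resolvent T z x) y) \<le> norm (resolvent T z x) * norm y" by (rule norm_cinner_le)
          also have "norm (resolvent T z x) \<le> M * norm x"
            using norm_blinfun[of "resolvent T z" x] mult_right_mono[OF M(2)[OF z(1)], of "norm x"] by simp
          finally have "norm (cinner (resolvent T z x) y) \<le> M * norm x * norm y" by (simp add: mult_right_mono)
          then show "norm (f z * cinner (resolvent T z x) y) \<le> B * (M * norm x * norm y)"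
            using z B0 by (simp add: norm_mult mult_mono)
        qed
      qed
      then show "cmod (cinner (hol_calc U f T x) y) \<le> L * M * B / (2 * pi) * norm x * norm y"
        by (simp add: hol_calc_weak[OF f] norm_divide norm_mult field_simps)
    qed
    also have "\<dots> \<le> C * B" using L M B0 by (simp add: C_def algebra_simps)
    finally show "norm (hol_calc U f T) \<le> C * B" .
  qed
qed

end

section \<open>Positive kernels on an annulus\<close>

lemma connected_open_annulus: "connected (open_annulus R1 R2)"
proof (cases "R1 < 0")
  case True
  then have "open_annulus R1 R2 = ball 0 R2" by (auto simp: open_annulus_def intro: less_le_trans)
  then show ?thesis by simp
next
  case False
  have "open_annulus R1 R2 = (\<lambda>(t, u). of_real t * u) ` ({R1<..<R2} \<times> sphere (0::complex) 1)"
  proof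
    show "open_annulus R1 R2 \<subseteq> (\<lambda>(t, u). of_real t * u) ` ({R1<..<R2} \<times> sphere (0::complex) 1)"
    proof
      fix z assume z: "z \<in> open_annulus R1 R2"
      then have "z \<noteq> 0" using False by (auto simp: open_annulus_def)
      then show "z \<in> (\<lambda>(t, u). of_real t * u) ` ({R1<..<R2} \<times> sphere (0::complex) 1)"
        using z by (intro image_eqI[of _ _ "(cmod z, sgn z)"]) (auto simp: open_annulus_def sgn_eq norm_divide)
    qed
  qed (use False in \<open>auto simp: open_annulus_def norm_mult\<close>)
  moreover have "connected \<dots>"
    unfolding case_prod_beta
    by (intro connected_continuous_image connected_Times continuous_intros connected_sphere) auto
  ultimately show ?thesis by simp
qed

lemma frontier_closed_annulus: "frontier (closed_annulus a b) \<subseteq> {z. cmod z = a \<or> cmod z = b}"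
proof -
  have "open_annulus a b \<subseteq> interior (closed_annulus a b)"
    by (rule interior_maximal[OF _ open_open_annulus]) (auto simp: open_annulus_def closed_annulus_def)
  moreover have "closure (closed_annulus a b) = closed_annulus a b"
    by (simp add: closure_closed compact_imp_closed)
  ultimately have "frontier (closed_annulus a b) \<subseteq> closed_annulus a b - open_annulus a b"
    unfolding frontier_def by auto
  also have "\<dots> \<subseteq> {z. cmod z = a \<or> cmod z = b}"
    by (auto simp: open_annulus_def closed_annulus_def)
  finally show ?thesis .
qed

lemma minimum_real_closed_annulus:
  assumes hol: "f holomorphic_on S" and S: "closed_annulus a b \<subseteq> S"
    and le: "\<And>z. cmod z = a \<or> cmod z = b \<Longrightarrow> a \<le> cmod z \<Longrightarrow> cmod z \<le> b \<Longrightarrow> m \<le> Re (f z)"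
    and z: "z \<in> closed_annulus a b"
  shows "m \<le> Re (f z)"
proof -
  have cl: "closure (closed_annulus a b) = closed_annulus a b"
    by (simp add: closure_closed compact_imp_closed)
  have "Re (- f z) \<le> - m"
  proof (rule maximum_real_frontier[where S = "closed_annulus a b" and f = "\<lambda>z. - f z"])
    show "(\<lambda>z. - f z) holomorphic_on interior (closed_annulus a b)"
      using interior_subset S by (intro holomorphic_on_minus holomorphic_on_subset[OF hol]) blast
    show "continuous_on (closure (closed_annulus a b)) (\<lambda>z. - f z)"
      unfolding cl by (intro continuous_intros holomorphic_on_imp_continuous_on holomorphic_on_subset[OF hol S])
    show "Re (- f z) \<le> - m" if "z \<in> frontier (closed_annulus a b)" for z
    proof -
      have "z \<in> closed_annulus a b"
        using that cl frontier_def by blast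
      then show ?thesis
        using le[of z] subsetD[OF frontier_closed_annulus that] by (auto simp: closed_annulus_def)
    qed
  qed (use z in \<open>simp_all add: compact_imp_bounded\<close>)
  then show ?thesis by simp
qed

lemma holomorphic_two_zeros:
  assumes "open S" "f holomorphic_on S" "p1 \<in> S" "p2 \<in> S" "p1 \<noteq> p2" "f p1 = 0" "f p2 = 0"
  obtains g where "g holomorphic_on S" "\<And>z. z \<in> S \<Longrightarrow> f z = (z - p1) * (z - p2) * g z"
proof -
  define f1 where "f1 = (\<lambda>z. if z = p1 then deriv f p1 else (f z - f p1) / (z - p1))"
  define f2 where "f2 = (\<lambda>z. if z = p2 then deriv f1 p2 else (f1 z - f1 p2) / (z - p2))"
  have f1: "f1 holomorphic_on S" unfolding f1_def by (rule pole_lemma_open) fact+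
  have f2: "f2 holomorphic_on S" unfolding f2_def by (rule pole_lemma_open) fact+
  have 1: "f z = (z - p1) * f1 z" for z using assms by (auto simp: f1_def)
  have "f1 p2 = 0" using 1[of p2] assms by simp
  then have 2: "f1 z = (z - p2) * f2 z" for z by (auto simp: f2_def)
  show thesis
    by (rule that[OF f2]) (simp add: 1 2 mult.assoc)
qed

lemma real_valued_holomorphic_constant:
  assumes "f holomorphic_on S" "open S" "connected S" "\<And>z. z \<in> S \<Longrightarrow> Im (f z) = 0"
  shows "f constant_on S"
proof (rule ccontr)
  assume "\<not> f constant_on S"
  then have "open (f ` S)" using open_mapping_thm[OF assms(1-3) assms(2) order_refl] by simp
  moreover have "S \<noteq> {}" using \<open>\<not> f constant_on S\<close> by (auto simp: constant_on_def)
  then obtain z where z: "z \<in> S" by blast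
  ultimately obtain e where e: "e > 0" "ball (f z) e \<subseteq> f ` S" by (metis image_eqI openE)
  have "f z + \<i> * of_real (e / 2) \<in> ball (f z) e" using e by (simp add: dist_norm norm_mult)
  then have "f z + \<i> * of_real (e / 2) \<in> f ` S" using e(2) by (rule rev_subsetD)
  then have "Im (f z + \<i> * of_real (e / 2)) = 0" using assms(4) by (elim imageE) metis
  then show False using assms(4)[OF z] e by simp
qed

text \<open>A Lambert series: expanding the denominators gives \<open>\<Sum>j. Q\<^sup>j x / (1 - Q\<^sup>j x)\<close>, whose poles form a
  geometric progression. Sums of such series give the kernels of an annulus.\<close>

definition lambert :: "real \<Rightarrow> complex \<Rightarrow> complex" where
  "lambert Q x = (\<Sum>n. x ^ Suc n / (1 - of_real Q ^ Suc n))"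

lemma lambert_denominator:
  assumes "0 < Q" "Q < 1"
  shows "1 - Q \<le> cmod (1 - of_real Q ^ Suc n)" and "1 - complex_of_real Q ^ Suc n \<noteq> 0"
proof -
  have "Q ^ Suc n \<le> Q" using assms by (simp add: power_le_one mult_left_le)
  moreover have "cmod (1 - of_real Q ^ Suc n) = \<bar>1 - Q ^ Suc n\<bar>"
    by (metis norm_of_real of_real_1 of_real_diff of_real_power)
  ultimately show 1: "1 - Q \<le> cmod (1 - of_real Q ^ Suc n)" by linarith
  then show "1 - complex_of_real Q ^ Suc n \<noteq> 0" using assms by auto
qed

lemma norm_lambert_term:
  assumes "0 < Q" "Q < 1"
  shows "cmod (x ^ Suc n / (1 - of_real Q ^ Suc n)) \<le> cmod x ^ Suc n / (1 - Q)"
  unfolding norm_divide norm_power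
  using lambert_denominator(1)[OF assms, of n] assms by (intro divide_left_mono) (auto intro!: mult_pos_pos)

lemma summable_lambert:
  assumes "0 < Q" "Q < 1" "cmod x < 1"
  shows "summable (\<lambda>n. x ^ Suc n / (1 - of_real Q ^ Suc n))"
proof (rule summable_comparison_test'[where N = 0])
  show "summable (\<lambda>n. cmod x ^ Suc n / (1 - Q))"
    using assms by (intro summable_divide) (simp add: summable_mult)
qed (rule norm_lambert_term[OF assms(1,2)])

lemma lambert_sums:
  "0 < Q \<Longrightarrow> Q < 1 \<Longrightarrow> cmod x < 1 \<Longrightarrow> (\<lambda>n. x ^ Suc n / (1 - of_real Q ^ Suc n)) sums lambert Q x"
  unfolding lambert_def by (rule summable_sums[OF summable_lambert])

lemma lambert_holomorphic:
  assumes Q: "0 < Q" "Q < 1"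
  shows "lambert Q holomorphic_on ball 0 1"
proof (rule power_series_holomorphic)
  fix w :: complex assume "w \<in> ball 0 1"
  then have "(\<lambda>n. w ^ Suc n / (1 - of_real Q ^ Suc n)) sums lambert Q w" using lambert_sums[OF Q] by simp
  then have "(\<lambda>n. (\<lambda>n. (if n = 0 then 0 else 1 / (1 - of_real Q ^ n)) * (w - 0) ^ n) (Suc n)) sums lambert Q w"
    by simp
  then show "(\<lambda>n. (if n = 0 then 0 else 1 / (1 - of_real Q ^ n)) * (w - 0) ^ n) sums lambert Q w"
    by (subst (asm) sums_Suc_iff) simp
qed

lemma lambert_cnj:
  assumes "0 < Q" "Q < 1" "cmod x < 1"
  shows "lambert Q (cnj x) = cnj (lambert Q x)"
proof -
  have "(\<lambda>n. cnj (x ^ Suc n / (1 - of_real Q ^ Suc n))) sums cnj (lambert Q x)"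
    unfolding sums_cnj by (rule lambert_sums[OF assms])
  then have "(\<lambda>n. cnj x ^ Suc n / (1 - of_real Q ^ Suc n)) sums cnj (lambert Q x)" by simp
  then show ?thesis using lambert_sums[of Q "cnj x"] assms sums_unique2 by fastforce
qed

text \<open>Splitting off the term with the pole at \<open>1\<close> leaves a series that converges in a larger disc.\<close>

lemma lambert_shift:
  assumes Q: "0 < Q" "Q < 1" and x: "cmod x < 1"
  shows "lambert Q x = x / (1 - x) + lambert Q (of_real Q * x)"
proof -
  have "cmod (of_real Q * x) \<le> cmod x" using Q by (simp add: norm_mult mult_left_le_one_le)
  then have Qx: "cmod (of_real Q * x) < 1" using x by simp
  have "(\<lambda>n. x * x ^ n) sums (x * (1 / (1 - x)))" using x by (intro sums_mult geometric_sums)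
  from sums_add[OF this lambert_sums[OF Q Qx]]
  have "(\<lambda>n. x ^ Suc n + (of_real Q * x) ^ Suc n / (1 - of_real Q ^ Suc n)) sums (x / (1 - x) + lambert Q (of_real Q * x))"
    by simp
  moreover have "x ^ Suc n + (of_real Q * x) ^ Suc n / (1 - of_real Q ^ Suc n) = x ^ Suc n / (1 - of_real Q ^ Suc n)" for n
    using lambert_denominator(2)[OF Q, of n] by (simp add: power_mult_distrib field_simps del: power_Suc)
  ultimately show ?thesis using lambert_sums[OF Q x] sums_unique2 by simp
qed

locale annulus_kernel =
  fixes q :: real
  assumes q: "0 < q" "q < 1"
begin

abbreviation "Q \<equiv> q\<^sup>2"

lemma Q: "0 < Q" "Q < 1" "Q < q"
  using q power_strict_decreasing[of 1 2 q] by (simp_all add: power_less_one_iff)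

abbreviation "qc \<equiv> complex_of_real q"

abbreviation "Dom \<equiv> open_annulus Q (1 / q)"

lemma Dom_I: "q \<le> cmod w \<Longrightarrow> cmod w \<le> 1 \<Longrightarrow> w \<in> Dom"
proof -
  have "1 < 1 / q" using q by simp
  then show "q \<le> cmod w \<Longrightarrow> cmod w \<le> 1 \<Longrightarrow> w \<in> Dom"
    using Q(3) unfolding open_annulus_def mem_Collect_eq by linarith
qed

text \<open>The part of the kernel without poles near the closed annulus \<open>q \<le> |w| \<le> 1\<close>.\<close>

definition kernel_reg :: "complex \<Rightarrow> complex \<Rightarrow> complex \<Rightarrow> complex" where
  "kernel_reg a b w = lambert Q (qc\<^sup>2 * w / a) - lambert Q (qc\<^sup>2 * a / w) + lambert Q (qc\<^sup>2 * qc * b / w) - lambert Q (qc * w / b)"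

text \<open>The analytic completion of a harmonic Poisson kernel: its real part is the harmonic function on
  \<open>q < |w| < 1\<close> whose boundary values are a point mass at \<open>a\<close> on the outer circle and one of equal weight at
  \<open>q b\<close> on the inner circle. Equality of the weights is what allows a single-valued conjugate function.\<close>

definition kernel :: "complex \<Rightarrow> complex \<Rightarrow> complex \<Rightarrow> complex" where
  "kernel a b w = 1 + 2 * w / (a - w) + 2 * qc * b / (w - qc * b) + 2 * kernel_reg a b w"

lemma O_nonzero: "w \<in> Dom \<Longrightarrow> w \<noteq> 0"
  using Q by (auto simp: open_annulus_def)

lemma O_args:
  assumes "w \<in> Dom" "cmod a = 1" "cmod b = 1"
  shows "cmod (qc\<^sup>2 * w / a) < 1" "cmod (qc\<^sup>2 * a / w) < 1" "cmod (qc\<^sup>2 * qc * b / w) < 1" "cmod (qc * w / b) < 1"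
proof -
  have w: "Q < cmod w" "cmod w * q < 1" "cmod w > 0"
    using assms(1) q Q by (auto simp: open_annulus_def field_simps intro: less_trans)
  have "Q * cmod w \<le> q * cmod w" using Q w by (intro mult_right_mono) auto
  also have "\<dots> < 1" using w by (simp add: mult.commute)
  finally have "Q * cmod w < 1" .
  then show "cmod (qc\<^sup>2 * w / a) < 1" "cmod (qc * w / b) < 1"
    using w assms q by (simp_all add: norm_mult norm_divide mult.commute norm_power)
  have "Q * q < cmod w" using mult_left_le[of q Q] Q(1) q w by linarith
  then show "cmod (qc\<^sup>2 * a / w) < 1" "cmod (qc\<^sup>2 * qc * b / w) < 1"
    using w assms q by (simp_all add: norm_mult norm_divide norm_power)
qed

lemma lambert_Q_holomorphic [holomorphic_intros]:
  assumes "f holomorphic_on S" "\<And>z. z \<in> S \<Longrightarrow> cmod (f z) < 1"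
  shows "(\<lambda>z. lambert Q (f z)) holomorphic_on S"
  using holomorphic_on_compose_gen[OF assms(1) lambert_holomorphic[OF Q(1,2)]] assms(2)
  by (simp add: o_def image_subset_iff)

lemma kernel_reg_holomorphic:
  assumes "cmod a = 1" "cmod b = 1"
  shows "kernel_reg a b holomorphic_on Dom"
  unfolding kernel_reg_def using O_args[OF _ assms] assms O_nonzero
  by (intro holomorphic_intros) auto

lemma kernel_holomorphic:
  assumes "cmod a = 1" "cmod b = 1"
  shows "kernel a b holomorphic_on Dom - {a, qc * b}"
  unfolding kernel_def
  by (intro holomorphic_intros holomorphic_on_subset[OF kernel_reg_holomorphic[OF assms]]) auto

text \<open>Inversion exchanges the two circles together with the two poles, so estimates at the outer circle
  carry over to the inner one.\<close>

lemma kernel_symmetric: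
  assumes "cmod a = 1" "cmod b = 1" "w \<noteq> 0" "w \<noteq> a" "w \<noteq> qc * b"
  shows "kernel a b (qc * a * b / w) = kernel a b w"
proof -
  have nz: "a \<noteq> 0" "b \<noteq> 0" "complex_of_real q \<noteq> 0" using assms q by auto
  have "qc\<^sup>2 * (qc * a * b / w) / a = qc\<^sup>2 * qc * b / w" "qc\<^sup>2 * a / (qc * a * b / w) = qc * w / b"
    "qc\<^sup>2 * qc * b / (qc * a * b / w) = qc\<^sup>2 * w / a" "qc * (qc * a * b / w) / b = qc\<^sup>2 * a / w"
    using nz assms by (simp_all add: field_simps power2_eq_square)
  then have "kernel_reg a b (qc * a * b / w) = kernel_reg a b w"
    by (simp add: kernel_reg_def)
  moreover have "2 * (qc * a * b / w) / (a - qc * a * b / w) = 2 * qc * b / (w - qc * b)"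
    using nz assms by (simp add: divide_simps) (simp add: algebra_simps)
  moreover have "2 * qc * b / (qc * a * b / w - qc * b) = 2 * w / (a - w)"
    using nz assms by (simp add: divide_simps) (simp add: algebra_simps)
  ultimately show ?thesis by (simp add: kernel_def)
qed

lemma kernel_laurent:
  assumes "cmod a = 1" "cmod b = 1" "q < cmod w" "cmod w < 1"
  shows "kernel a b w = 1 + 2 * lambert Q (w / a) - 2 * lambert Q (qc\<^sup>2 * a / w) + 2 * lambert Q (qc * b / w) - 2 * lambert Q (qc * w / b)"
proof -
  have nz: "a \<noteq> 0" "b \<noteq> 0" "w \<noteq> 0" "w \<noteq> a" "w \<noteq> qc * b" using assms q by (auto simp: norm_mult)
  have 1: "lambert Q (w / a) = w / (a - w) + lambert Q (qc\<^sup>2 * w / a)"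
    using lambert_shift[OF Q(1,2), of "w / a"] assms nz by (simp add: norm_divide divide_simps)
  have "cmod (qc * b / w) < 1" using assms q by (simp add: norm_divide norm_mult divide_less_eq)
  then have 2: "lambert Q (qc * b / w) = qc * b / (w - qc * b) + lambert Q (qc\<^sup>2 * qc * b / w)"
    using lambert_shift[OF Q(1,2), of "qc * b / w"] nz by (simp add: divide_simps mult.assoc)
  show ?thesis
    unfolding kernel_def kernel_reg_def 1 2 by (simp add: algebra_simps)
qed

text \<open>The part of the kernel that is regular on the outer circle is purely imaginary there, because
  the Lambert series takes conjugate points to conjugate values.\<close>

lemma kernel_outer_remainder_imaginary:
  assumes "cmod a = 1" "cmod b = 1" "cmod w = 1"
  shows "Re (2 * qc * b / (w - qc * b) + 2 * kernel_reg a b w) = 0"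
proof -
  have nz: "a \<noteq> 0" "b \<noteq> 0" "w \<noteq> 0" "w \<noteq> qc * b" using assms q by (auto simp: norm_mult)
  have wO: "w \<in> Dom" using assms q by (intro Dom_I) auto
  have inv: "cnj u = 1 / u" if "cmod u = 1" for u
    using that by (metis complex_div_cnj divide_self_if mult_1 norm_one one_power2 of_real_1 div_by_1 complex_cnj_cnj complex_norm_square nonzero_eq_divide_eq norm_eq_zero of_real_power zero_neq_one mult.commute)
  have c1: "cnj (qc\<^sup>2 * w / a) = qc\<^sup>2 * a / w" using assms by (simp add: inv)
  have c2: "cnj (qc * b / w) = qc * w / b" using assms by (simp add: inv)
  note args = O_args[OF wO assms(1,2)]
  have E1: "lambert Q (qc\<^sup>2 * a / w) = cnj (lambert Q (qc\<^sup>2 * w / a))"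
    unfolding c1[symmetric] by (rule lambert_cnj[OF Q(1,2) args(1)])
  have u: "cmod (qc * b / w) < 1" using assms q by (simp add: norm_divide norm_mult)
  have E2: "lambert Q (qc * w / b) = cnj (lambert Q (qc * b / w))"
    unfolding c2[symmetric] by (rule lambert_cnj[OF Q(1,2) u])
  have E3: "lambert Q (qc * b / w) = qc * b / (w - qc * b) + lambert Q (qc\<^sup>2 * qc * b / w)"
    using lambert_shift[OF Q(1,2) u] nz by (simp add: divide_simps mult.assoc)
  have "2 * qc * b / (w - qc * b) + 2 * kernel_reg a b w =
      2 * (lambert Q (qc\<^sup>2 * w / a) - cnj (lambert Q (qc\<^sup>2 * w / a))) + 2 * (lambert Q (qc * b / w) - cnj (lambert Q (qc * b / w)))"
    unfolding kernel_reg_def E1 E2 unfolding E3 by (simp add: algebra_simps)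
  then show ?thesis by simp
qed

lemma Re_moebius:
  assumes "w \<noteq> a"
  shows "Re (1 + 2 * w / (a - w)) = ((cmod a)\<^sup>2 - (cmod w)\<^sup>2) / (cmod (a - w))\<^sup>2"
proof -
  have "1 + 2 * w / (a - w) = (a + w) / (a - w)" using assms by (simp add: divide_simps)
  also have "\<dots> = (a + w) * cnj (a - w) / of_real ((cmod (a - w))\<^sup>2)"
    by (metis complex_div_cnj complex_norm_square)
  finally have "Re (1 + 2 * w / (a - w)) = Re ((a + w) * cnj (a - w)) / (cmod (a - w))\<^sup>2"
    by (metis Re_divide_of_real)
  also have "Re ((a + w) * cnj (a - w)) = (cmod a)\<^sup>2 - (cmod w)\<^sup>2"
    by (simp add: cmod_power2) (simp add: power2_eq_square algebra_simps)
  finally show ?thesis .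
qed

lemma kernel_imaginary_outer:
  assumes "cmod a = 1" "cmod b = 1" "cmod w = 1" "w \<noteq> a"
  shows "Re (kernel a b w) = 0"
  using kernel_outer_remainder_imaginary[OF assms(1-3)] Re_moebius[OF assms(4)] assms
  by (simp add: kernel_def)

lemma kernel_imaginary_inner:
  assumes "cmod a = 1" "cmod b = 1" "cmod w = q" "w \<noteq> qc * b"
  shows "Re (kernel a b w) = 0"
proof -
  have w: "w \<noteq> 0" "w \<noteq> a" using assms q by auto
  have "qc * a * b / w \<noteq> a" using assms w q by (auto simp: field_simps)
  moreover have "cmod (qc * a * b / w) = 1" using assms q by (simp add: norm_mult norm_divide)
  ultimately show ?thesis
    using kernel_imaginary_outer[OF assms(1,2)] kernel_symmetric[OF assms(1,2) w assms(4)] by metis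
qed

text \<open>Near the outer circle the kernel differs from a Poisson kernel by a function whose real part
  tends uniformly to zero. By symmetry the same holds near the inner circle, and the minimum
  principle does the rest.\<close>

lemma kernel_lower_bound_near_outer:
  assumes ab: "cmod a = 1" "cmod b = 1" and \<eta>: "0 < \<eta>"
  obtains \<rho>0 where "q < \<rho>0" "\<rho>0 < 1"
    "\<And>\<rho> w. \<rho>0 < \<rho> \<Longrightarrow> \<rho> < 1 \<Longrightarrow> cmod w = \<rho> \<Longrightarrow> - \<eta> \<le> Re (kernel a b w)"
proof -
  define m where "m = (1 + q) / 2"
  have m: "q < m" "m < 1" using q by (auto simp: m_def)
  define g where "g w = 2 * qc * b / (w - qc * b) + 2 * kernel_reg a b w" for w
  have sub: "closed_annulus m 1 \<subseteq> Dom - {qc * b}"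
    using m q ab by (auto simp: closed_annulus_def norm_mult intro!: Dom_I)
  have "continuous_on (closed_annulus m 1) g"
    unfolding g_def using sub
    by (intro holomorphic_on_imp_continuous_on holomorphic_intros holomorphic_on_subset[OF kernel_reg_holomorphic[OF ab]]) auto
  then have "uniformly_continuous_on (closed_annulus m 1) g"
    by (intro compact_uniformly_continuous) auto
  then obtain d where d: "d > 0" "\<And>u v. u \<in> closed_annulus m 1 \<Longrightarrow> v \<in> closed_annulus m 1 \<Longrightarrow> dist u v < d \<Longrightarrow> dist (g u) (g v) < \<eta>"
    unfolding uniformly_continuous_on_def using \<eta> by metis
  show thesis
  proof (rule that[of "max m (1 - d)"])
    fix \<rho> w assume \<rho>: "max m (1 - d) < \<rho>" "\<rho> < 1" and w: "cmod w = \<rho>"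
    then have \<rho>0: "0 < \<rho>" using m q by auto
    define v where "v = w / \<rho>"
    have v: "cmod v = 1" using \<rho>0 w by (simp add: v_def norm_divide)
    have "w = \<rho> * v" using \<rho>0 by (simp add: v_def)
    then have "w - v = (\<rho> - 1) * v" by (simp add: left_diff_distrib)
    then have "dist w v = 1 - \<rho>" using v \<rho> by (simp add: dist_norm norm_mult) (metis abs_minus_commute abs_of_pos diff_gt_0_iff_gt norm_of_real of_real_1 of_real_diff)
    then have "dist (g w) (g v) < \<eta>"
      using \<rho> w v m by (intro d(2)) (auto simp: closed_annulus_def)
    then have "\<bar>Re (g w) - Re (g v)\<bar> < \<eta>"
      using abs_Re_le_cmod[of "g w - g v"] by (simp add: dist_norm)
    moreover have "Re (g v) = 0" unfolding g_def by (rule kernel_outer_remainder_imaginary[OF ab v])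
    moreover have "Re (1 + 2 * w / (a - w)) \<ge> 0"
    proof -
      have "w \<noteq> a" using w \<rho> ab by auto
      then show ?thesis using w \<rho> \<rho>0 ab by (subst Re_moebius) (auto simp: power_le_one)
    qed
    moreover have "Re (kernel a b w) = Re (1 + 2 * w / (a - w)) + Re (g w)" by (simp add: kernel_def g_def)
    ultimately show "- \<eta> \<le> Re (kernel a b w)" by linarith
  qed (use m d q in auto)
qed

lemma kernel_nonneg:
  assumes ab: "cmod a = 1" "cmod b = 1" and w: "w \<in> open_annulus q 1"
  shows "0 \<le> Re (kernel a b w)"
proof (rule field_le_epsilon[of 0 "Re (kernel a b w)", simplified])
  fix \<eta> :: real assume \<eta>: "0 < \<eta>"
  obtain \<rho>0 where \<rho>0: "q < \<rho>0" "\<rho>0 < 1"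
    "\<And>\<rho> w. \<rho>0 < \<rho> \<Longrightarrow> \<rho> < 1 \<Longrightarrow> cmod w = \<rho> \<Longrightarrow> - \<eta> \<le> Re (kernel a b w)"
    using kernel_lower_bound_near_outer[OF ab \<eta>] by blast
  define \<rho> where "\<rho> = (max \<rho>0 (max (cmod w) (q / cmod w)) + 1) / 2"
  have w': "q < cmod w" "cmod w < 1" using w by (auto simp: open_annulus_def)
  then have "q / cmod w < 1" using q by (simp add: divide_less_eq)
  moreover define M where "M = max \<rho>0 (max (cmod w) (q / cmod w))"
  ultimately have "M < 1" "\<rho>0 \<le> M" "cmod w \<le> M" "q / cmod w \<le> M" using \<rho>0(2) w' by auto
  moreover have "\<rho> = (M + 1) / 2" by (simp add: \<rho>_def M_def)
  ultimately have \<rho>: "\<rho>0 < \<rho>" "\<rho> < 1" "cmod w < \<rho>" "q / cmod w < \<rho>" by simp_all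
  have \<rho>q: "q < \<rho>" using \<rho>0 \<rho> by simp
  have "q < \<rho> * cmod w" using \<rho>(4) q w' by (subst (asm) pos_divide_less_eq) auto
  then have qr: "q < q / \<rho>" "q / \<rho> < cmod w" using \<rho> \<rho>q q w' by (auto simp: field_simps)
  have "- \<eta> \<le> Re (kernel a b w)"
  proof (rule minimum_real_closed_annulus[OF kernel_holomorphic[OF ab]])
    show "closed_annulus (q / \<rho>) \<rho> \<subseteq> Dom - {a, qc * b}"
      using qr \<rho> q ab by (auto simp: closed_annulus_def norm_mult intro!: Dom_I)
    show "w \<in> closed_annulus (q / \<rho>) \<rho>" using qr \<rho> by (simp add: closed_annulus_def)
    fix z assume z: "cmod z = q / \<rho> \<or> cmod z = \<rho>"
    then show "- \<eta> \<le> Re (kernel a b z)"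
    proof
      assume z: "cmod z = q / \<rho>"
      have nz: "z \<noteq> 0" "z \<noteq> a" "z \<noteq> qc * b" using z qr \<rho> q ab w' by (auto simp: norm_mult)
      have "cmod (qc * a * b / z) = \<rho>" using z ab q \<rho>q by (simp add: norm_mult norm_divide)
      from \<rho>0(3)[OF \<rho>(1,2) this] show ?thesis by (simp add: kernel_symmetric[OF ab nz])
    qed (use \<rho>0(3)[OF \<rho>(1,2)] in auto)
  qed
  then show "0 \<le> Re (kernel a b w) + \<eta>" by simp
qed

lemma annulus_subset_Dom: "open_annulus q 1 \<subseteq> Dom"
  by (auto simp: open_annulus_def[of q 1] intro!: Dom_I)

lemma kernel_holomorphic_annulus:
  assumes ab: "cmod a = 1" "cmod b = 1"
  shows "kernel a b holomorphic_on open_annulus q 1"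
  by (rule holomorphic_on_subset[OF kernel_holomorphic[OF ab]])
     (use annulus_subset_Dom ab q in \<open>auto simp: open_annulus_def norm_mult\<close>)

lemma kernel_not_constant:
  assumes ab: "cmod a = 1" "cmod b = 1"
  shows "\<not> kernel a b constant_on open_annulus q 1"
proof
  assume "kernel a b constant_on open_annulus q 1"
  then obtain c where c: "\<And>w. w \<in> open_annulus q 1 \<Longrightarrow> kernel a b w = c" by (auto simp: constant_on_def)
  define m where "m = (1 + q) / 2"
  have m: "q < m" "m < 1" "0 < m" using q by (auto simp: m_def)
  have a0: "a \<noteq> 0" using ab by auto
  have sub: "closed_annulus m 1 \<subseteq> Dom - {qc * b}"
    using m q ab by (auto simp: closed_annulus_def norm_mult intro!: Dom_I)
  have "continuous_on (closed_annulus m 1) (\<lambda>w. 2 * qc * b / (w - qc * b) + 2 * kernel_reg a b w)"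
    using sub
    by (intro holomorphic_on_imp_continuous_on holomorphic_intros holomorphic_on_subset[OF kernel_reg_holomorphic[OF ab]]) auto
  then have "bounded ((\<lambda>w. 2 * qc * b / (w - qc * b) + 2 * kernel_reg a b w) ` closed_annulus m 1)"
    by (intro compact_imp_bounded compact_continuous_image) auto
  then obtain M where M: "\<And>w. w \<in> closed_annulus m 1 \<Longrightarrow> cmod (2 * qc * b / (w - qc * b) + 2 * kernel_reg a b w) \<le> M"
    unfolding bounded_iff by blast
  \<comment> \<open>The pole at \<open>a\<close> makes the kernel unbounded along the radius through \<open>a\<close>.\<close>
  have bound: "(1 + t) / (1 - t) \<le> cmod c + M" if t: "m \<le> t" "t < 1" for t
  proof -
    have t0: "0 < t" "q < t" using t m by auto
    have "of_real t * a \<in> open_annulus q 1" "of_real t * a \<in> closed_annulus m 1"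
      using t t0 ab by (auto simp: open_annulus_def closed_annulus_def norm_mult)
    note c[OF this(1)] M[OF this(2)]
    moreover have "1 + 2 * (t * a) / (a - t * a) = of_real ((1 + t) / (1 - t))"
    proof -
      have "a - t * a = a * (1 - of_real t)" by (simp add: algebra_simps)
      moreover have "1 - complex_of_real t \<noteq> 0" using t by (metis eq_iff_diff_eq_0 less_irrefl of_real_1 of_real_eq_iff)
      ultimately show ?thesis using a0 by (simp add: divide_simps)
    qed
    then have "of_real ((1 + t) / (1 - t)) = kernel a b (t * a) - (2 * qc * b / (t * a - qc * b) + 2 * kernel_reg a b (t * a))"
      by (simp add: kernel_def)
    ultimately have "cmod (of_real ((1 + t) / (1 - t))) \<le> cmod c + M"
      by (simp only:) (meson add_left_mono norm_triangle_ineq4 order_trans)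
    then show ?thesis using t t0 by (simp add: norm_divide del: of_real_add of_real_diff of_real_divide)
  qed
  define B where "B = max (cmod c + M) 1"
  define t where "t = max m (1 - 1 / (B + 1))"
  have B: "B \<ge> 1" "cmod c + M \<le> B" by (auto simp: B_def)
  have t: "m \<le> t" "t < 1" "0 < t" using m B by (auto simp: t_def)
  have "1 - t \<le> 1 / (B + 1)" by (simp add: t_def)
  then have "(1 - t) * (B + 1) \<le> 1" using B by (simp add: field_simps)
  then have "B + 1 \<le> (1 + t) / (1 - t)" using t by (simp add: field_simps)
  with bound[OF t(1,2)] B show False by linarith
qed

text \<open>A nonconstant holomorphic function is open, so its real part cannot attain the bound zero.\<close>

lemma kernel_positive:
  assumes ab: "cmod a = 1" "cmod b = 1" and w: "w \<in> open_annulus q 1"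
  shows "0 < Re (kernel a b w)"
proof (rule ccontr)
  assume "\<not> ?thesis"
  then have w0: "Re (kernel a b w) = 0" using kernel_nonneg[OF ab w] by simp
  have "open (kernel a b ` open_annulus q 1)"
    by (rule open_mapping_thm[OF kernel_holomorphic_annulus[OF ab] _ connected_open_annulus _ order_refl kernel_not_constant[OF ab]]) auto
  then obtain e where e: "e > 0" "ball (kernel a b w) e \<subseteq> kernel a b ` open_annulus q 1"
    using w by (metis image_eqI openE)
  have "kernel a b w - of_real (e / 2) \<in> ball (kernel a b w) e" using e by (simp add: dist_norm)
  then have "kernel a b w - of_real (e / 2) \<in> kernel a b ` open_annulus q 1" using e(2) by (rule rev_subsetD)
  then have "0 \<le> Re (kernel a b w - of_real (e / 2))" using kernel_nonneg[OF ab] by (elim imageE) metis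
  then show False using w0 e by simp
qed

lemma sphere_minus_finite_dense:
  assumes "finite F" "0 < \<rho>" "cmod p = \<rho>" "e > 0"
  obtains z where "cmod z = \<rho>" "z \<notin> F" "dist z p < e"
proof -
  have "p islimpt sphere 0 \<rho>"
  proof (rule connected_imp_perfect)
    show "connected (sphere (0::complex) \<rho>)" by (rule connected_sphere) simp
    show "sphere (0::complex) \<rho> \<noteq> {x}" for x
    proof
      assume sph: "sphere (0::complex) \<rho> = {x}"
      have "of_real \<rho> \<in> sphere (0::complex) \<rho>" "- of_real \<rho> \<in> sphere (0::complex) \<rho>" using assms by simp_all
      then have "complex_of_real \<rho> = - of_real \<rho>" unfolding sph by simp
      from arg_cong[OF this, of Re] show False using assms by simp
    qed
  qed (use assms in auto)
  then have "infinite (sphere 0 \<rho> \<inter> ball p e)" using assms by (simp add: islimpt_eq_infinite_ball)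
  then obtain z where "z \<in> sphere 0 \<rho> \<inter> ball p e" "z \<notin> F"
    using assms(1) by (meson finite_subset subsetI)
  then show thesis using that[of z] by (auto simp: dist_commute)
qed

lemma clear_denominators:
  fixes w a p k t :: complex
  assumes "w \<noteq> a" "w \<noteq> p"
  shows "(1 + 2 * w / (a - w) + 2 * p / (w - p) + k - t) * ((w - a) * (w - p)) =
    (1 + k - t) * ((w - a) * (w - p)) - 2 * w * (w - p) + 2 * p * (w - a)"
proof -
  have "2 * w / (a - w) = - (2 * w / (w - a))"
    by (metis minus_diff_eq minus_divide_right)
  then have 1: "2 * w / (a - w) * (w - a) = - 2 * w" using assms by simp
  have 2: "2 * p / (w - p) * (w - p) = 2 * p" using assms by simp
  have "(1 + X + Y + k - t) * (A * P) = (1 + k - t) * (A * P) + (X * A) * P + (Y * P) * A" for X Y A P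
    by (simp add: algebra_simps)
  from this[of "2 * w / (a - w)" "2 * p / (w - p)" "w - a" "w - p"] show ?thesis
    unfolding 1 2 by simp
qed

text \<open>The kernel with poles at \<open>a\<close> and \<open>q b\<close> is a Moebius transform, preserving the right half plane,
  of a symmetric kernel with poles at \<open>c\<close> and \<open>q c\<close>, provided \<open>c\<^sup>2 = a b\<close>. Indeed the symmetry
  of the kernels lets each factor below vanish at both poles of the other, so the product is
  holomorphic across both circles; it is real on them, hence constant.\<close>

lemma kernel_product_constant:
  assumes a: "cmod a = 1" and b: "cmod b = 1" and c: "cmod c = 1" and sq: "c\<^sup>2 = a * b" and ca: "c \<noteq> a"
  obtains \<kappa> t1 t2 :: real where "\<kappa> > 0"
    "\<And>w. w \<in> open_annulus q 1 \<Longrightarrow> (kernel a b w - \<i> * t1) * (kernel c c w - \<i> * t2) = \<kappa>"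
proof -
  have nz: "a \<noteq> 0" "b \<noteq> 0" "c \<noteq> 0" "qc \<noteq> 0" using a b c q by auto
  have cb: "c \<noteq> b"
  proof
    assume "c = b"
    then have "c * c = a * c" using sq by (simp add: power2_eq_square)
    then show False using ca nz by simp
  qed
  have ne: "a \<noteq> qc * x" "b \<noteq> qc * x" "c \<noteq> qc * x" if "cmod x = 1" for x
    using that a b c q by (auto simp: norm_mult dest!: arg_cong[where f = cmod])
  have inD: "a \<in> Dom" "c \<in> Dom" "qc * b \<in> Dom" "qc * c \<in> Dom"
    using a b c q by (auto simp: norm_mult intro!: Dom_I)
  define N where "N w = kernel a b w - kernel a b c" for w
  define M where "M w = kernel c c w - kernel c c a" for w
  define n where "n w = (1 + 2 * kernel_reg a b w - kernel a b c) * ((w - a) * (w - qc * b)) - 2 * w * (w - qc * b) + 2 * qc * b * (w - a)" for w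
  define m where "m w = (1 + 2 * kernel_reg c c w - kernel c c a) * ((w - c) * (w - qc * c)) - 2 * w * (w - qc * c) + 2 * qc * c * (w - c)" for w
  have n: "n w = N w * ((w - a) * (w - qc * b))" if "w \<noteq> a" "w \<noteq> qc * b" for w
    using clear_denominators[OF that, of "2 * kernel_reg a b w" "kernel a b c"]
    by (simp add: n_def N_def kernel_def mult.assoc)
  have m: "m w = M w * ((w - c) * (w - qc * c))" if "w \<noteq> c" "w \<noteq> qc * c" for w
    using clear_denominators[OF that, of "2 * kernel_reg c c w" "kernel c c a"]
    by (simp add: m_def M_def kernel_def mult.assoc)
  have "n holomorphic_on Dom" "m holomorphic_on Dom"
    unfolding n_def m_def by (intro holomorphic_intros kernel_reg_holomorphic a b c)+
  have symN: "kernel a b (qc * c) = kernel a b c"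
  proof -
    have "qc * a * b / c = qc * c" using sq nz by (simp add: field_simps power2_eq_square)
    then show ?thesis using kernel_symmetric[OF a b nz(3) ca ne(3)[OF b]] by simp
  qed
  have symM: "kernel c c (qc * b) = kernel c c a"
  proof -
    have "qc * c * c / a = qc * b" using sq nz by (simp add: field_simps power2_eq_square)
    then show ?thesis using kernel_symmetric[OF c c nz(1) ca[symmetric] ne(1)[OF c]] by simp
  qed
  have qcc: "qc * c \<noteq> qc * b" "qc * b \<noteq> qc * c" "qc * c \<noteq> a" "qc * b \<noteq> c" "qc * b \<noteq> a" "qc * c \<noteq> c"
    using cb nz ne(1)[OF c] ne(3)[OF b] ne(1)[OF b] ne(3)[OF c] by auto
  have n0: "n c = 0" "n (qc * c) = 0"
    using n[of c] n[of "qc * c"] ca qcc by (auto simp: N_def symN)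
  have m0: "m a = 0" "m (qc * b) = 0"
    using m[of a] m[of "qc * b"] ca qcc by (auto simp: M_def symM)
  obtain n1 where n1: "n1 holomorphic_on Dom" "\<And>z. z \<in> Dom \<Longrightarrow> n z = (z - c) * (z - qc * c) * n1 z"
    using holomorphic_two_zeros[OF open_open_annulus \<open>n holomorphic_on Dom\<close> inD(2) inD(4) qcc(6)[symmetric] n0] by blast
  obtain m1 where m1: "m1 holomorphic_on Dom" "\<And>z. z \<in> Dom \<Longrightarrow> m z = (z - a) * (z - qc * b) * m1 z"
    using holomorphic_two_zeros[OF open_open_annulus \<open>m holomorphic_on Dom\<close> inD(1) inD(3) qcc(5)[symmetric] m0] by blast
  define D where "D w = n1 w * m1 w" for w
  have D_hol: "D holomorphic_on Dom" unfolding D_def by (intro holomorphic_intros n1 m1)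
  define F where "F = {a, qc * b, c, qc * c}"
  have D: "D w = N w * M w" if "w \<in> Dom" "w \<notin> F" for w
  proof -
    have ne: "(w - a) * (w - qc * b) \<noteq> 0" "(w - c) * (w - qc * c) \<noteq> 0" using that by (auto simp: F_def)
    define A where "A = (w - a) * (w - qc * b)"
    define C where "C = (w - c) * (w - qc * c)"
    have "N w * A = C * n1 w" "M w * C = A * m1 w"
      using n[of w] m[of w] n1(2)[of w] m1(2)[of w] that by (auto simp: F_def A_def C_def)
    then have "(N w * A) * (M w * C) = (C * n1 w) * (A * m1 w)" by simp
    then have "(N w * M w) * (A * C) = D w * (A * C)" unfolding D_def by (simp only: mult_ac)
    then have "(N w * M w) * (((w - a) * (w - qc * b)) * ((w - c) * (w - qc * c))) =
        D w * (((w - a) * (w - qc * b)) * ((w - c) * (w - qc * c)))"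
      by (simp only: A_def C_def)
    then show ?thesis using ne by simp
  qed
  define t1 where "t1 = Im (kernel a b c)"
  define t2 where "t2 = Im (kernel c c a)"
  have t1: "kernel a b c = \<i> * t1" using kernel_imaginary_outer[OF a b c ca] by (simp add: t1_def complex_eq_iff)
  have t2: "kernel c c a = \<i> * t2" using kernel_imaginary_outer[OF c c a ca[symmetric]] by (simp add: t2_def complex_eq_iff)
  have circ: "z \<in> Dom" if "cmod z = 1 \<or> cmod z = q" for z
    using that q by (auto intro!: Dom_I)
  have Im_off: "Im (D z) = 0" if z: "cmod z = 1 \<or> cmod z = q" "z \<notin> F" for z
  proof -
    have "Re (kernel a b z) = 0" "Re (kernel c c z) = 0"
      using z kernel_imaginary_outer kernel_imaginary_inner a b c by (auto simp: F_def)
    then show ?thesis using D[OF circ[OF z(1)] z(2)] by (simp add: N_def M_def t1 t2)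
  qed
  have Im_circ: "Im (D z) = 0" if z: "cmod z = 1 \<or> cmod z = q" for z
  proof (rule ccontr)
    assume nz: "Im (D z) \<noteq> 0"
    have "isCont D z" using D_hol circ[OF z] by (meson holomorphic_on_imp_continuous_on continuous_on_eq_continuous_at open_open_annulus)
    then obtain e where e: "e > 0" "\<And>u. dist u z < e \<Longrightarrow> dist (D u) (D z) < \<bar>Im (D z)\<bar>"
      using nz unfolding continuous_at_eps_delta by (metis zero_less_abs_iff)
    have "finite F" "0 < cmod z" using z q by (auto simp: F_def)
    then obtain u where u: "cmod u = cmod z" "u \<notin> F" "dist u z < e"
      using sphere_minus_finite_dense[of F "cmod z" z e] e(1) by blast
    have "Im (D u) = 0" using Im_off[of u] u z by simp
    then have "\<bar>Im (D z)\<bar> \<le> dist (D u) (D z)"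
      using abs_Im_le_cmod[of "D u - D z"] by (simp add: dist_norm)
    with e(2)[OF u(3)] show False by simp
  qed
  have sub: "closed_annulus q 1 \<subseteq> Dom"
    by (auto simp: closed_annulus_def intro!: Dom_I)
  have "Im (D z) = 0" if z: "z \<in> closed_annulus q 1" for z
  proof -
    have "0 \<le> Re (- \<i> * D z)"
      by (rule minimum_real_closed_annulus[OF _ sub _ z]) (auto intro!: holomorphic_intros D_hol simp: Im_circ)
    moreover have "0 \<le> Re (\<i> * D z)"
      by (rule minimum_real_closed_annulus[OF _ sub _ z]) (auto intro!: holomorphic_intros D_hol simp: Im_circ)
    ultimately show ?thesis by simp
  qed
  then have real: "Im (D z) = 0" if "z \<in> open_annulus q 1" for z
    using that by (auto simp: open_annulus_def closed_annulus_def)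
  have "D constant_on open_annulus q 1"
    by (rule real_valued_holomorphic_constant[OF holomorphic_on_subset[OF D_hol annulus_subset_Dom] _ connected_open_annulus])
       (auto simp: real)
  then obtain k where k: "\<And>w. w \<in> open_annulus q 1 \<Longrightarrow> D w = k" by (auto simp: constant_on_def)
  have notF: "w \<notin> F" if "w \<in> open_annulus q 1" for w
    using that a b c q by (auto simp: F_def open_annulus_def norm_mult)
  have NM: "N w * M w = k" if "w \<in> open_annulus q 1" for w
    using D[OF subsetD[OF annulus_subset_Dom that] notF[OF that]] k[OF that] by simp
  define w where "w = complex_of_real ((1 + q) / 2)"
  have w: "w \<in> open_annulus q 1" unfolding w_def open_annulus_def using q by (simp del: of_real_add of_real_divide)
  have pos: "0 < Re (N w)" "0 < Re (M w)"
    using kernel_positive[OF a b w] kernel_positive[OF c c w] by (auto simp: N_def M_def t1 t2)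
  have kR: "k = of_real (Re k)" using real[OF w] k[OF w] by (simp add: complex_eq_iff)
  have "Re k > 0"
  proof -
    have "N w * (M w * cnj (M w)) = of_real (Re k) * cnj (M w)" using NM[OF w] kR by (metis mult.assoc)
    moreover have "M w * cnj (M w) = of_real ((cmod (M w))\<^sup>2)" by (simp only: complex_norm_square)
    ultimately have "Re (N w * of_real ((cmod (M w))\<^sup>2)) = Re (of_real (Re k) * cnj (M w))" by simp
    then have "Re (N w) * (cmod (M w))\<^sup>2 = Re k * Re (M w)" by simp
    moreover have "M w \<noteq> 0" using pos by auto
    ultimately show ?thesis using pos by (metis mult_pos_pos norm_eq_zero zero_less_mult_pos2 zero_less_norm_iff zero_less_power)
  qed
  then show thesis
    using that[of "Re k" t1 t2] NM kR by (simp add: N_def M_def t1 t2)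
qed

end

section \<open>Laurent polynomials and averages of kernels\<close>

definition laurent_poly :: "(complex \<Rightarrow> complex) \<Rightarrow> bool" where
  "laurent_poly f \<longleftrightarrow> (\<exists>p n. \<forall>z. z \<noteq> 0 \<longrightarrow> f z = poly p z / z ^ n)"

lemma laurent_polyI: "(\<And>z. z \<noteq> 0 \<Longrightarrow> f z = poly p z / z ^ n) \<Longrightarrow> laurent_poly f"
  unfolding laurent_poly_def by blast

lemma laurent_poly_poly [simp]: "laurent_poly (poly p)"
  by (rule laurent_polyI[of _ p 0]) simp

lemma laurent_poly_const [simp]: "laurent_poly (\<lambda>z. c)"
  by (rule laurent_polyI[of _ "[:c:]" 0]) simp

lemma laurent_poly_linear [simp]: "laurent_poly (\<lambda>z. c * z)"
  by (rule laurent_polyI[of _ "[:0, c:]" 0]) simp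

lemma laurent_poly_inverse [simp]: "laurent_poly (\<lambda>z. c / z)"
  by (rule laurent_polyI[of _ "[:c:]" 1]) simp

lemma laurent_poly_add:
  assumes "laurent_poly f" "laurent_poly g"
  shows "laurent_poly (\<lambda>z. f z + g z)"
proof -
  obtain p n where f: "\<And>z. z \<noteq> 0 \<Longrightarrow> f z = poly p z / z ^ n" using assms(1) by (auto simp: laurent_poly_def)
  obtain p' n' where g: "\<And>z. z \<noteq> 0 \<Longrightarrow> g z = poly p' z / z ^ n'" using assms(2) by (auto simp: laurent_poly_def)
  show ?thesis
    by (rule laurent_polyI[of _ "p * monom 1 n' + p' * monom 1 n" "n + n'"])
       (simp add: f g poly_monom power_add field_simps)
qed

lemma laurent_poly_mult:
  assumes "laurent_poly f" "laurent_poly g"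
  shows "laurent_poly (\<lambda>z. f z * g z)"
proof -
  obtain p n where f: "\<And>z. z \<noteq> 0 \<Longrightarrow> f z = poly p z / z ^ n" using assms(1) by (auto simp: laurent_poly_def)
  obtain p' n' where g: "\<And>z. z \<noteq> 0 \<Longrightarrow> g z = poly p' z / z ^ n'" using assms(2) by (auto simp: laurent_poly_def)
  show ?thesis
    by (rule laurent_polyI[of _ "p * p'" "n + n'"]) (simp add: f g power_add)
qed

lemma laurent_poly_diff:
  assumes "laurent_poly f" "laurent_poly g"
  shows "laurent_poly (\<lambda>z. f z - g z)"
  using laurent_poly_add[OF assms(1) laurent_poly_mult[OF laurent_poly_const[of "-1"] assms(2)]] by simp

lemma laurent_poly_power: "laurent_poly f \<Longrightarrow> laurent_poly (\<lambda>z. f z ^ n)"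
  by (induction n) (auto intro: laurent_poly_mult)

lemma laurent_poly_sum: "(\<And>i. i \<in> I \<Longrightarrow> laurent_poly (f i)) \<Longrightarrow> laurent_poly (\<lambda>z. \<Sum>i\<in>I. f i z)"
  by (induction I rule: infinite_finite_induct) (auto intro: laurent_poly_add)

lemma laurent_poly_divide_const: "laurent_poly f \<Longrightarrow> laurent_poly (\<lambda>z. f z / c)"
  using laurent_poly_mult[OF laurent_poly_const[of "1 / c"]] by simp

lemma laurent_poly_scale:
  assumes "laurent_poly f" "c \<noteq> 0"
  shows "laurent_poly (\<lambda>z. f (c * z))"
proof -
  obtain p n where f: "\<And>z. z \<noteq> 0 \<Longrightarrow> f z = poly p z / z ^ n" using assms(1) by (auto simp: laurent_poly_def)
  show ?thesis
    by (rule laurent_polyI[of _ "smult (1 / c ^ n) (pcompose p [:0, c:])" n])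
       (simp add: f assms poly_pcompose power_mult_distrib mult.commute)
qed

definition lambert_part :: "real \<Rightarrow> nat \<Rightarrow> complex \<Rightarrow> complex" where
  "lambert_part Q L x = (\<Sum>n<L. x ^ Suc n / (1 - of_real Q ^ Suc n))"

lemma laurent_poly_lambert_part: "laurent_poly f \<Longrightarrow> laurent_poly (\<lambda>z. lambert_part Q L (f z))"
  unfolding lambert_part_def by (intro laurent_poly_sum laurent_poly_divide_const laurent_poly_power)

lemma lambert_part_tail:
  assumes Q: "0 < Q" "Q < 1" and x: "cmod x \<le> \<rho>" "\<rho> < 1"
  shows "cmod (lambert Q x - lambert_part Q L x) \<le> \<rho> ^ L * (\<rho> / ((1 - Q) * (1 - \<rho>)))"
proof -
  let ?f = "\<lambda>n. x ^ Suc n / (1 - of_real Q ^ Suc n)"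
  have \<rho>: "0 \<le> \<rho>" using x norm_ge_zero order_trans by blast
  have "lambert Q x - lambert_part Q L x = (\<Sum>n. ?f (n + L))"
    unfolding lambert_def lambert_part_def
    using suminf_minus_initial_segment[OF summable_lambert[OF Q, of x], of L] x by simp
  also have "cmod \<dots> \<le> (\<Sum>n. \<rho> ^ n * (\<rho> ^ Suc L / (1 - Q)))"
  proof (rule norm_suminf_le)
    fix n
    have "cmod (?f (n + L)) \<le> cmod x ^ Suc (n + L) / (1 - Q)" by (rule norm_lambert_term[OF Q])
    also have "\<dots> \<le> \<rho> ^ Suc (n + L) / (1 - Q)" using x Q by (intro divide_right_mono power_mono) auto
    also have "\<dots> = \<rho> ^ n * (\<rho> ^ Suc L / (1 - Q))" by (simp add: power_add)
    finally show "cmod (?f (n + L)) \<le> \<rho> ^ n * (\<rho> ^ Suc L / (1 - Q))" .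
  qed (use \<rho> x in \<open>auto intro!: summable_mult2 summable_geometric\<close>)
  also have "\<dots> = (1 / (1 - \<rho>)) * (\<rho> ^ Suc L / (1 - Q))"
    using \<rho> x by (subst suminf_mult2[symmetric]) (auto simp: suminf_geometric intro!: summable_geometric)
  finally show ?thesis by (simp add: field_simps)
qed

lemma lambert_part_uniform:
  assumes Q: "0 < Q" "Q < 1" and \<rho>: "0 \<le> \<rho>" "\<rho> < 1" and e: "0 < e"
  obtains L0 where "\<And>L x. L0 \<le> L \<Longrightarrow> cmod x \<le> \<rho> \<Longrightarrow> cmod (lambert Q x - lambert_part Q L x) < e"
proof -
  have "(\<lambda>L. \<rho> ^ L * (\<rho> / ((1 - Q) * (1 - \<rho>)))) \<longlonglongrightarrow> 0"
    using \<rho> by (intro tendsto_mult_left_zero LIMSEQ_power_zero) simp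
  then have "\<forall>\<^sub>F L in sequentially. \<rho> ^ L * (\<rho> / ((1 - Q) * (1 - \<rho>))) < e"
    using e by (rule order_tendstoD)
  then obtain L0 where "\<And>L. L0 \<le> L \<Longrightarrow> \<rho> ^ L * (\<rho> / ((1 - Q) * (1 - \<rho>))) < e"
    by (auto simp: eventually_sequentially)
  then show thesis
    by (intro that[of L0]) (rule le_less_trans[OF lambert_part_tail[OF Q _ \<rho>(2)]])
qed

text \<open>Orthogonality of the characters of a finite cyclic group.\<close>

definition character :: "nat \<Rightarrow> int \<Rightarrow> nat \<Rightarrow> complex" where
  "character N k j = cis (2 * pi * of_int k * real j / real N)"

lemma character_simps:
  "character N (k + l) j = character N k j * character N l j"
  "cnj (character N k j) = character N (- k) j"
  "cmod (character N k j) = 1" "character N 0 j = 1"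
  by (auto simp: character_def cis_mult cis_cnj add_divide_distrib distrib_left distrib_right)

lemma character_power: "character N 1 j ^ n = character N (int n) j"
  unfolding character_def Complex.DeMoivre by (simp add: mult_ac)

lemma character_inverse_power: "1 / character N 1 j ^ n = character N (- int n) j"
proof -
  have "character N (int n) j * character N (- int n) j = 1"
    by (simp add: character_simps(1)[symmetric] character_simps)
  then show ?thesis unfolding character_power by (metis divide_eq_eq mult.commute mult_zero_left zero_neq_one)
qed

lemma sum_character:
  assumes "\<bar>k\<bar> < int N"
  shows "(\<Sum>j<N. character N k j) = (if k = 0 then of_nat N else 0)"
proof (cases "k = 0")
  case False
  have N: "N > 0" using assms by (cases N) auto
  define w where "w = cis (2 * pi * of_int k / real N)"
  have "w \<noteq> 1"
  proof
    assume "w = 1"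
    then have "cos (2 * pi * of_int k / real N) = 1" by (metis Re_complex_of_real cis.sel(1) of_real_1 w_def)
    then obtain n :: int where "2 * pi * of_int k / real N = of_int n * 2 * pi" by (auto simp: cos_one_2pi_int)
    then have "real_of_int k = of_int n * real N" using N by (simp add: field_simps)
    then have "k = n * int N" by (metis of_int_eq_iff of_int_mult of_int_of_nat_eq)
    then show False using assms False by (cases "n = 0") (auto simp: abs_mult)
  qed
  have "character N k j = w ^ j" for j unfolding character_def w_def Complex.DeMoivre by (simp add: mult_ac)
  then have "(\<Sum>j<N. character N k j) = (w ^ N - 1) / (w - 1)" using \<open>w \<noteq> 1\<close> by (simp add: geometric_sum)
  also have "w ^ N = cis (2 * pi * of_int k)" unfolding w_def Complex.DeMoivre using N by simp
  also have "\<dots> = 1" by (metis cis_multiple_2pi Ints_of_int mult.commute mult.left_commute)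
  finally show ?thesis using False by simp
qed (simp add: character_simps)

text \<open>Sampling at \<open>2 L + 1\<close> roots of unity determines the Fourier coefficients of degree at most \<open>L\<close>
  exactly; taking real parts mixes each coefficient with the conjugate of the opposite one.\<close>

lemma trig_poly_fourier_coefficient:
  fixes A B :: "nat \<Rightarrow> complex" and L :: nat and g :: complex
  defines "N \<equiv> 2 * L + 1"
  defines "h \<equiv> \<lambda>j. complex_of_real (Re (g + (\<Sum>i<L. A i * character N (int (Suc i)) j + B i * character N (- int (Suc i)) j)))"
  shows "(\<Sum>j<N. h j) = of_nat N * of_real (Re g)"
    and "k < L \<Longrightarrow> (\<Sum>j<N. h j * character N (- int (Suc k)) j) = of_nat N * ((A k + cnj (B k)) / 2)"
    and "k < L \<Longrightarrow> (\<Sum>j<N. h j * character N (int (Suc k)) j) = of_nat N * ((B k + cnj (A k)) / 2)"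
proof -
  define \<alpha> where "\<alpha> i = (A i + cnj (B i)) / 2" for i
  define \<beta> where "\<beta> i = (B i + cnj (A i)) / 2" for i
  have Re_eq: "complex_of_real (Re z) = (z + cnj z) / 2" for z by (simp add: complex_eq_iff)
  have h: "h j = of_real (Re g) + (\<Sum>i<L. \<alpha> i * character N (int (Suc i)) j + \<beta> i * character N (- int (Suc i)) j)" for j
  proof -
    have "of_real (Re (A i * character N (int (Suc i)) j + B i * character N (- int (Suc i)) j)) =
        \<alpha> i * character N (int (Suc i)) j + \<beta> i * character N (- int (Suc i)) j" for i
      unfolding Re_eq \<alpha>_def \<beta>_def by (simp add: character_simps(2) field_simps)
    then show ?thesis unfolding h_def by (simp only: plus_complex.simps Re_sum of_real_add of_real_sum)
  qed
  have coeff: "(\<Sum>j<N. h j * character N m j) =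
      of_real (Re g) * (if m = 0 then of_nat N else 0) +
      (\<Sum>i<L. \<alpha> i * (if int (Suc i) + m = 0 then of_nat N else 0) + \<beta> i * (if - int (Suc i) + m = 0 then of_nat N else 0))"
    if m: "\<bar>m\<bar> \<le> int L" for m
  proof -
    have S: "(\<Sum>j<N. character N k j) = (if k = 0 then of_nat N else 0)" if "\<bar>k\<bar> \<le> 2 * int L" for k
      by (rule sum_character) (use that in \<open>auto simp: N_def\<close>)
    have "(\<Sum>j<N. h j * character N m j) = of_real (Re g) * (\<Sum>j<N. character N m j) +
      (\<Sum>i<L. \<alpha> i * (\<Sum>j<N. character N (int (Suc i) + m) j) + \<beta> i * (\<Sum>j<N. character N (- int (Suc i) + m) j))"
      unfolding h distrib_right sum.distrib sum_distrib_right sum_distrib_left character_simps(1)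
      by (subst (1 2) sum.swap) (simp add: mult.assoc sum.distrib)
    also have "\<dots> = of_real (Re g) * (if m = 0 then of_nat N else 0) +
      (\<Sum>i<L. \<alpha> i * (if int (Suc i) + m = 0 then of_nat N else 0) + \<beta> i * (if - int (Suc i) + m = 0 then of_nat N else 0))"
      using m by (intro arg_cong2[where f = "(+)"] arg_cong2[where f = "(*)"] sum.cong refl S) auto
    finally show ?thesis .
  qed
  show "(\<Sum>j<N. h j) = of_nat N * of_real (Re g)"
    using coeff[of 0] by (simp add: character_simps)
  show "(\<Sum>j<N. h j * character N (- int (Suc k)) j) = of_nat N * ((A k + cnj (B k)) / 2)" if "k < L"
  proof -
    have "(\<Sum>i<L. \<alpha> i * (if int (Suc i) + (- int (Suc k)) = 0 then of_nat N else 0) +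
        \<beta> i * (if - int (Suc i) + (- int (Suc k)) = 0 then of_nat N else 0)) = (\<Sum>i<L. if i = k then \<alpha> i * of_nat N else 0)"
      by (rule sum.cong) auto
    also have "\<dots> = \<alpha> k * of_nat N" using that by (subst sum.delta) auto
    finally have eq: "(\<Sum>i<L. \<alpha> i * (if int (Suc i) + (- int (Suc k)) = 0 then of_nat N else 0) +
        \<beta> i * (if - int (Suc i) + (- int (Suc k)) = 0 then of_nat N else 0)) = \<alpha> k * of_nat N" .
    have "\<bar>- int (Suc k)\<bar> \<le> int L" using that by simp
    from coeff[OF this] show ?thesis unfolding eq by (simp add: \<alpha>_def)
  qed
  show "(\<Sum>j<N. h j * character N (int (Suc k)) j) = of_nat N * ((B k + cnj (A k)) / 2)" if "k < L"
  proof -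
    have "(\<Sum>i<L. \<alpha> i * (if int (Suc i) + (int (Suc k)) = 0 then of_nat N else 0) +
        \<beta> i * (if - int (Suc i) + (int (Suc k)) = 0 then of_nat N else 0)) = (\<Sum>i<L. if i = k then \<beta> i * of_nat N else 0)"
      by (rule sum.cong) auto
    also have "\<dots> = \<beta> k * of_nat N" using that by (subst sum.delta) auto
    finally have eq: "(\<Sum>i<L. \<alpha> i * (if int (Suc i) + (int (Suc k)) = 0 then of_nat N else 0) +
        \<beta> i * (if - int (Suc i) + (int (Suc k)) = 0 then of_nat N else 0)) = \<beta> k * of_nat N" .
    have "\<bar>int (Suc k)\<bar> \<le> int L" using that by simp
    from coeff[OF this] show ?thesis unfolding eq by (simp add: \<beta>_def)
  qed
qed

context annulus_kernel
begin

definition kernel_part :: "nat \<Rightarrow> complex \<Rightarrow> complex \<Rightarrow> complex \<Rightarrow> complex" where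
  "kernel_part L a b w = 1 + 2 * lambert_part Q L (w / a) - 2 * lambert_part Q L (qc\<^sup>2 * a / w)
    + 2 * lambert_part Q L (qc * b / w) - 2 * lambert_part Q L (qc * w / b)"

lemma laurent_poly_kernel_part: "laurent_poly (kernel_part L a b)"
proof -
  have "laurent_poly (\<lambda>w. w / a)" "laurent_poly (\<lambda>w. qc * w / b)"
    using laurent_poly_linear[of "1 / a"] laurent_poly_linear[of "qc / b"] by simp_all
  then show ?thesis
    unfolding kernel_part_def[abs_def]
    by (intro laurent_poly_add laurent_poly_diff laurent_poly_mult laurent_poly_const laurent_poly_lambert_part laurent_poly_inverse)
qed

lemma kernel_part_uniform:
  assumes \<rho>: "q < \<rho>1" "\<rho>1 \<le> \<rho>2" "\<rho>2 < 1" and e: "0 < e"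
  obtains L0 where "\<And>L a b w. L0 \<le> L \<Longrightarrow> cmod a = 1 \<Longrightarrow> cmod b = 1 \<Longrightarrow> w \<in> closed_annulus \<rho>1 \<rho>2 \<Longrightarrow>
      cmod (kernel a b w - kernel_part L a b w) < e"
proof -
  define \<rho> where "\<rho> = max \<rho>2 (q / \<rho>1)"
  have \<rho>': "0 \<le> \<rho>" "\<rho> < 1" using \<rho> q by (auto simp: \<rho>_def)
  obtain L0 where L0: "\<And>L x. L0 \<le> L \<Longrightarrow> cmod x \<le> \<rho> \<Longrightarrow> cmod (lambert Q x - lambert_part Q L x) < e / 8"
    using lambert_part_uniform[OF Q(1,2) \<rho>', of "e / 8"] e by auto
  show thesis
  proof (rule that)
    fix L a b w assume L: "L0 \<le> L" and ab: "cmod a = 1" "cmod b = 1" and w: "w \<in> closed_annulus \<rho>1 \<rho>2"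
    have w': "\<rho>1 \<le> cmod w" "cmod w \<le> \<rho>2" "0 < cmod w" using w \<rho> q by (auto simp: closed_annulus_def)
    have "q / cmod w \<le> q / \<rho>1" using w' \<rho> q by (intro divide_left_mono) auto
    moreover have "Q / cmod w \<le> q / cmod w" using w' Q by (intro divide_right_mono) auto
    moreover have "q * cmod w \<le> \<rho>2" using mult_left_le_one_le[of "cmod w" q] q w' by linarith
    ultimately have x: "cmod (w / a) \<le> \<rho>" "cmod (qc\<^sup>2 * a / w) \<le> \<rho>" "cmod (qc * b / w) \<le> \<rho>" "cmod (qc * w / b) \<le> \<rho>"
      using w' ab q by (auto simp: \<rho>_def norm_divide norm_mult norm_power)
    define d where "d x = lambert Q x - lambert_part Q L x" for x
    have "kernel a b w - kernel_part L a b w = 2 * (d (w / a) - d (qc\<^sup>2 * a / w) + d (qc * b / w) - d (qc * w / b))"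
      using w' \<rho> ab by (subst kernel_laurent) (auto simp: kernel_part_def d_def algebra_simps)
    also have "cmod \<dots> \<le> 2 * (cmod (d (w / a)) + cmod (d (qc\<^sup>2 * a / w)) + cmod (d (qc * b / w)) + cmod (d (qc * w / b)))"
      unfolding norm_mult by (intro mult_mono order_trans[OF norm_triangle_ineq4] add_mono order_refl order_trans[OF norm_triangle_ineq]) auto
    also have "\<dots> < 2 * (e / 8 + e / 8 + e / 8 + e / 8)"
      unfolding d_def by (intro mult_strict_left_mono add_strict_mono L0 L x) auto
    finally show "cmod (kernel a b w - kernel_part L a b w) < e" by simp
  qed
qed

text \<open>A function whose real part is positive on both circles is, up to an imaginary constant, an
  average of kernels against its boundary values; for Laurent polynomials and truncated kernels a
  discrete average over roots of unity is already exact.\<close>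

lemma kernel_part_average:
  fixes c d :: "nat \<Rightarrow> complex" and L :: nat and g0 :: complex
  defines "N \<equiv> 2 * L + 1" and "\<zeta> \<equiv> character (2 * L + 1) 1"
  defines "G \<equiv> \<lambda>w. g0 + (\<Sum>i<L. c i * w ^ Suc i + d i / w ^ Suc i)"
  defines "u \<equiv> \<lambda>j. Re (G (\<zeta> j))" and "v \<equiv> \<lambda>l. Re (G (qc * \<zeta> l))"
  assumes w: "w \<noteq> 0"
  shows "(\<Sum>j<N. \<Sum>l<N. of_real (u j * v l) * kernel_part L (\<zeta> j) (\<zeta> l) w) / (of_nat N)\<^sup>2 =
      of_real (Re g0) * (G w - \<i> * of_real (Im g0))"
    and "(\<Sum>j<N. u j) = N * Re g0" and "(\<Sum>l<N. v l) = N * Re g0"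
proof -
  have N: "of_nat N \<noteq> (0::complex)" unfolding of_nat_eq_0_iff by (simp add: N_def)
  have qc0: "qc \<noteq> 0" using q by simp
  note fc = trig_poly_fourier_coefficient[where L = L and g = g0, folded N_def]
  define m where "m = complex_of_real (Re g0)"
  define \<alpha> where "\<alpha> k = (c k + cnj (d k)) / 2" for k
  define \<alpha>' where "\<alpha>' k = (c k * qc ^ Suc k + cnj (d k / qc ^ Suc k)) / 2" for k
  have zp: "\<zeta> j ^ n = character N (int n) j" "1 / \<zeta> j ^ n = character N (- int n) j" for j n
    unfolding \<zeta>_def N_def by (rule character_power, rule character_inverse_power)
  have zi: "x / \<zeta> j ^ n = x * character N (- int n) j" for x j n
    using zp(2)[of j n] by (metis mult.right_neutral times_divide_eq_right)
  have u: "complex_of_real (u j) = of_real (Re (g0 + (\<Sum>i<L. c i * character N (int (Suc i)) j + d i * character N (- int (Suc i)) j)))" for j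
    unfolding u_def G_def zi unfolding zp(1) ..
  have v: "complex_of_real (v l) = of_real (Re (g0 + (\<Sum>i<L. (c i * qc ^ Suc i) * character N (int (Suc i)) l + (d i / qc ^ Suc i) * character N (- int (Suc i)) l)))" for l
  proof -
    have "d i / (qc * \<zeta> l) ^ Suc i = (d i / qc ^ Suc i) * character N (- int (Suc i)) l" for i
      unfolding power_mult_distrib by (metis divide_divide_eq_left zi)
    moreover have "c i * (qc * \<zeta> l) ^ Suc i = (c i * qc ^ Suc i) * character N (int (Suc i)) l" for i
      unfolding power_mult_distrib zp(1) by (simp only: mult_ac)
    ultimately show ?thesis by (simp only: v_def G_def)
  qed
  have U0: "(\<Sum>j<N. complex_of_real (u j)) = of_nat N * m" unfolding u m_def by (rule fc(1))
  have V0: "(\<Sum>l<N. complex_of_real (v l)) = of_nat N * m" unfolding v m_def by (rule fc(1))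
  from arg_cong[OF U0, of Re] show "(\<Sum>j<N. u j) = N * Re g0" by (simp add: m_def)
  from arg_cong[OF V0, of Re] show "(\<Sum>l<N. v l) = N * Re g0" by (simp add: m_def)
  have cnj_\<alpha>: "cnj (\<alpha> k) = (d k + cnj (c k)) / 2" for k by (simp add: \<alpha>_def add.commute)
  have cnj_\<alpha>': "cnj (\<alpha>' k) = (d k / qc ^ Suc k + cnj (c k * qc ^ Suc k)) / 2" for k
    unfolding \<alpha>'_def complex_cnj_divide complex_cnj_add complex_cnj_cnj complex_cnj_numeral by (simp only: add.commute)
  have U: "(\<Sum>j<N. of_real (u j) * character N (- int (Suc k)) j) = of_nat N * \<alpha> k"
    "(\<Sum>j<N. of_real (u j) * character N (int (Suc k)) j) = of_nat N * cnj (\<alpha> k)" if "k < L" for k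
    unfolding u cnj_\<alpha> unfolding \<alpha>_def by (rule fc(2)[OF that], rule fc(3)[OF that])
  have V: "(\<Sum>l<N. of_real (v l) * character N (- int (Suc k)) l) = of_nat N * \<alpha>' k"
    "(\<Sum>l<N. of_real (v l) * character N (int (Suc k)) l) = of_nat N * cnj (\<alpha>' k)" if "k < L" for k
    unfolding v cnj_\<alpha>' unfolding \<alpha>'_def by (rule fc(2)[OF that], rule fc(3)[OF that])
  define y where "y k = 1 / (1 - complex_of_real Q ^ Suc k)" for k
  define E1 where "E1 j = 2 * lambert_part Q L (w / \<zeta> j) - 2 * lambert_part Q L (qc\<^sup>2 * \<zeta> j / w)" for j
  define E2 where "E2 l = 2 * lambert_part Q L (qc * \<zeta> l / w) - 2 * lambert_part Q L (qc * w / \<zeta> l)" for l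
  have part1: "lambert_part Q L (x * \<zeta> j) = (\<Sum>k<L. y k * x ^ Suc k * character N (int (Suc k)) j)" for x j
    unfolding lambert_part_def y_def power_mult_distrib zp(1) by (simp only: mult_ac times_divide_eq_left times_divide_eq_right mult_1_left)
  have part2: "lambert_part Q L (x / \<zeta> j) = (\<Sum>k<L. y k * x ^ Suc k * character N (- int (Suc k)) j)" for x j
    unfolding lambert_part_def y_def power_divide zi by (simp only: mult_ac times_divide_eq_left times_divide_eq_right mult_1_left)
  have swap: "(\<Sum>j<N. f j * (\<Sum>k<L. t k * g k j)) = (\<Sum>k<L. t k * (\<Sum>j<N. f j * g k j))" for g :: "nat \<Rightarrow> nat \<Rightarrow> complex" and f t :: "nat \<Rightarrow> complex"
    unfolding sum_distrib_left by (subst sum.swap) (simp only: mult_ac)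
  have S1: "(\<Sum>j<N. of_real (u j) * E1 j) = of_nat N * (\<Sum>k<L. 2 * y k * (w ^ Suc k * \<alpha> k - (qc\<^sup>2 / w) ^ Suc k * cnj (\<alpha> k)))"
  proof -
    have "(\<Sum>j<N. of_real (u j) * E1 j) = 2 * (\<Sum>j<N. of_real (u j) * lambert_part Q L (w / \<zeta> j)) - 2 * (\<Sum>j<N. of_real (u j) * lambert_part Q L (qc\<^sup>2 / w * \<zeta> j))"
      by (simp add: E1_def right_diff_distrib sum_subtractf sum_distrib_left mult_ac)
    also have "\<dots> = 2 * (\<Sum>k<L. y k * w ^ Suc k * (of_nat N * \<alpha> k)) - 2 * (\<Sum>k<L. y k * (qc\<^sup>2 / w) ^ Suc k * (of_nat N * cnj (\<alpha> k)))"
      unfolding part1 part2 swap using U by simp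
    finally show ?thesis by (simp add: sum_distrib_left sum_subtractf algebra_simps)
  qed
  have S2: "(\<Sum>l<N. of_real (v l) * E2 l) = of_nat N * (\<Sum>k<L. 2 * y k * ((qc / w) ^ Suc k * cnj (\<alpha>' k) - (qc * w) ^ Suc k * \<alpha>' k))"
  proof -
    have "(\<Sum>l<N. of_real (v l) * E2 l) = 2 * (\<Sum>l<N. of_real (v l) * lambert_part Q L (qc / w * \<zeta> l)) - 2 * (\<Sum>l<N. of_real (v l) * lambert_part Q L (qc * w / \<zeta> l))"
      by (simp add: E2_def right_diff_distrib sum_subtractf sum_distrib_left mult_ac)
    also have "\<dots> = 2 * (\<Sum>k<L. y k * (qc / w) ^ Suc k * (of_nat N * cnj (\<alpha>' k))) - 2 * (\<Sum>k<L. y k * (qc * w) ^ Suc k * (of_nat N * \<alpha>' k))"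
      unfolding part1 part2 swap using V by simp
    finally show ?thesis by (simp add: sum_distrib_left sum_subtractf algebra_simps)
  qed
  have summand: "2 * y k * (w ^ Suc k * \<alpha> k - (qc\<^sup>2 / w) ^ Suc k * cnj (\<alpha> k)) + 2 * y k * ((qc / w) ^ Suc k * cnj (\<alpha>' k) - (qc * w) ^ Suc k * \<alpha>' k)
      = c k * w ^ Suc k + d k / w ^ Suc k" for k
  proof -
    define X where "X = qc ^ Suc k"
    define W where "W = w ^ Suc k"
    have nz: "X \<noteq> 0" "W \<noteq> 0" using qc0 w by (auto simp: X_def W_def)
    have X: "complex_of_real Q ^ Suc k = X\<^sup>2" "(qc\<^sup>2) ^ Suc k = X\<^sup>2"
      unfolding X_def by (simp_all only: of_real_power power_mult[symmetric] mult.commute)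
    have cX: "cnj X = X" by (simp add: X_def)
    have y: "y k * (1 - X\<^sup>2) = 1"
      using lambert_denominator(2)[OF Q(1,2), of k] unfolding y_def X(1) by simp
    have "2 * y k * (W * \<alpha> k - X\<^sup>2 / W * cnj (\<alpha> k)) + 2 * y k * (X / W * cnj (\<alpha>' k) - X * W * \<alpha>' k)
      = y k * (W * (2 * \<alpha> k - X * (2 * \<alpha>' k)) + (X * (2 * cnj (\<alpha>' k)) - X\<^sup>2 * (2 * cnj (\<alpha> k))) / W)"
      by (simp add: algebra_simps diff_divide_distrib)
    also have "2 * \<alpha> k - X * (2 * \<alpha>' k) = c k * (1 - X\<^sup>2)"
      using nz by (simp add: \<alpha>_def \<alpha>'_def X_def[symmetric] cX del: power_Suc) (simp add: field_simps power2_eq_square)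
    also have "X * (2 * cnj (\<alpha>' k)) - X\<^sup>2 * (2 * cnj (\<alpha> k)) = d k * (1 - X\<^sup>2)"
      using nz by (simp add: \<alpha>_def \<alpha>'_def X_def[symmetric] cX del: power_Suc) (simp add: field_simps power2_eq_square)
    also have "y k * (W * (c k * (1 - X\<^sup>2)) + d k * (1 - X\<^sup>2) / W) = (y k * (1 - X\<^sup>2)) * (c k * W + d k / W)"
      by (simp only: distrib_left mult_ac times_divide_eq_right times_divide_eq_left)
    finally show ?thesis
      unfolding y by (simp only: X_def W_def power_divide power_mult_distrib X(2)[unfolded X_def] mult_1_left)
  qed
  have kp: "kernel_part L (\<zeta> j) (\<zeta> l) w = 1 + E1 j + E2 l" for j l
    by (simp add: kernel_part_def E1_def E2_def)
  have "(\<Sum>j<N. \<Sum>l<N. of_real (u j * v l) * kernel_part L (\<zeta> j) (\<zeta> l) w) =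
      (\<Sum>j<N. complex_of_real (u j)) * (\<Sum>l<N. complex_of_real (v l)) + (\<Sum>j<N. of_real (u j) * E1 j) * (\<Sum>l<N. complex_of_real (v l))
      + (\<Sum>j<N. complex_of_real (u j)) * (\<Sum>l<N. of_real (v l) * E2 l)"
    unfolding kp sum_product by (simp add: sum.distrib[symmetric] algebra_simps)
  also have "\<dots> = (of_nat N)\<^sup>2 * (m * (m + (\<Sum>k<L. c k * w ^ Suc k + d k / w ^ Suc k)))"
    unfolding U0 V0 S1 S2 summand[symmetric] sum.distrib by (simp add: power2_eq_square algebra_simps)
  also have "m + (\<Sum>k<L. c k * w ^ Suc k + d k / w ^ Suc k) = G w - \<i> * of_real (Im g0)"
  proof -
    have "m = g0 - \<i> * of_real (Im g0)" by (simp add: m_def complex_eq_iff)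
    then show ?thesis by (simp add: G_def)
  qed
  finally show "(\<Sum>j<N. \<Sum>l<N. of_real (u j * v l) * kernel_part L (\<zeta> j) (\<zeta> l) w) / (of_nat N)\<^sup>2 =
      of_real (Re g0) * (G w - \<i> * of_real (Im g0))"
    using N by (simp add: m_def)
qed

lemma laurent_poly_coefficients:
  assumes "laurent_poly G"
  obtains g0 c d L where "\<And>w. w \<noteq> 0 \<Longrightarrow> G w = g0 + (\<Sum>i<L. c i * w ^ Suc i + d i / w ^ Suc i)"
    "\<And>i. L \<le> i \<Longrightarrow> c i = 0" "\<And>i. L \<le> i \<Longrightarrow> d i = 0"
proof -
  obtain p n where p: "\<And>z. z \<noteq> 0 \<Longrightarrow> G z = poly p z / z ^ n" using assms by (auto simp: laurent_poly_def)
  define L where "L = max n (degree p)"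
  define c where "c i = coeff p (n + Suc i)" for i
  define d where "d i = (if i < n then coeff p (n - Suc i) else 0)" for i
  show thesis
  proof (rule that[of "coeff p n" c d L])
    fix w :: complex assume w: "w \<noteq> 0"
    have "poly p w = (\<Sum>i\<le>n + L. coeff p i * w ^ i)"
      unfolding poly_altdef by (rule sum.mono_neutral_left) (auto simp: L_def coeff_eq_0)
    also have "\<dots> = (\<Sum>i<n + Suc L. coeff p i * w ^ i)" by (simp add: lessThan_Suc_atMost)
    also have "\<dots> = (\<Sum>i<n. coeff p i * w ^ i) + (\<Sum>i<Suc L. coeff p (n + i) * w ^ (n + i))"
    proof -
      have "(\<Sum>i<n + M. f i) = (\<Sum>i<n. f i) + (\<Sum>i<M. f (n + i))" for f :: "nat \<Rightarrow> complex" and M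
        by (induction M) (auto simp: add.assoc)
      then show ?thesis .
    qed
    also have "(\<Sum>i<Suc L. coeff p (n + i) * w ^ (n + i)) = coeff p n * w ^ n + (\<Sum>i<L. c i * w ^ (n + Suc i))"
      unfolding sum.lessThan_Suc_shift by (simp add: c_def)
    also have "(\<Sum>i<n. coeff p i * w ^ i) = (\<Sum>i<n. coeff p (n - Suc i) * w ^ (n - Suc i))"
      by (rule sum.nat_diff_reindex[symmetric])
    finally have "G w = (\<Sum>i<n. coeff p (n - Suc i) * w ^ (n - Suc i)) / w ^ n + (coeff p n + (\<Sum>i<L. c i * w ^ (n + Suc i)) / w ^ n)"
      using w by (simp add: p add_divide_distrib)
    also have "(\<Sum>i<n. coeff p (n - Suc i) * w ^ (n - Suc i)) / w ^ n = (\<Sum>i<n. d i / w ^ Suc i)"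
      unfolding sum_divide_distrib
    proof (rule sum.cong[OF refl])
      fix i assume "i \<in> {..<n}"
      then have "w ^ n = w ^ (n - Suc i) * w ^ Suc i" by (simp add: power_add[symmetric] del: power_Suc)
      then show "coeff p (n - Suc i) * w ^ (n - Suc i) / w ^ n = d i / w ^ Suc i"
        using \<open>i \<in> {..<n}\<close> w by (simp add: d_def del: power_Suc)
    qed
    also have "\<dots> = (\<Sum>i<L. d i / w ^ Suc i)"
      by (rule sum.mono_neutral_left) (auto simp: L_def d_def)
    also have "(\<Sum>i<L. c i * w ^ (n + Suc i)) / w ^ n = (\<Sum>i<L. c i * w ^ Suc i)"
      using w by (simp add: sum_divide_distrib power_add)
    finally show "G w = coeff p n + (\<Sum>i<L. c i * w ^ Suc i + d i / w ^ Suc i)"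
      by (simp add: sum.distrib algebra_simps)
  qed (auto simp: L_def c_def d_def coeff_eq_0)
qed

text \<open>The kernels carry equal masses on both circles. This costs nothing: the mean of \<open>Re G\<close> over a circle
  is the constant term \<open>m\<close> on either of them, so the product of the two boundary densities is a
  measure on pairs \<open>(a, b)\<close> whose marginals are \<open>m\<close> times those densities.\<close>

lemma positive_laurent_average:
  assumes G: "laurent_poly G" and pos: "\<And>w. cmod w = 1 \<or> cmod w = q \<Longrightarrow> 0 < Re (G w)"
    and \<rho>: "q < \<rho>1" "\<rho>1 \<le> \<rho>2" "\<rho>2 < 1"
  obtains m t :: real where "m > 0"
    "\<And>e. e > 0 \<Longrightarrow> \<exists>I x a b. finite I \<and> (\<forall>i\<in>I. 0 \<le> x i \<and> cmod (a i) = 1 \<and> cmod (b i) = 1) \<and>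
        (\<forall>w\<in>closed_annulus \<rho>1 \<rho>2. cmod (of_real m * (G w - \<i> * of_real t) - (\<Sum>i\<in>(I::(nat \<times> nat) set). of_real (x i) * kernel (a i) (b i) w)) < e)"
proof -
  obtain g0 c d L where coeffs: "\<And>w. w \<noteq> 0 \<Longrightarrow> G w = g0 + (\<Sum>i<L. c i * w ^ Suc i + d i / w ^ Suc i)"
    "\<And>i. L \<le> i \<Longrightarrow> c i = 0" "\<And>i. L \<le> i \<Longrightarrow> d i = 0"
    using laurent_poly_coefficients[OF G] by blast
  define m where "m = Re g0"
  have G_eq: "G w = g0 + (\<Sum>i<L'. c i * w ^ Suc i + d i / w ^ Suc i)" if "w \<noteq> 0" "L \<le> L'" for w L'
    unfolding coeffs(1)[OF that(1)] using that(2)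
    by (intro arg_cong2[where f = "(+)"] refl sum.mono_neutral_left) (auto simp: coeffs)
  have \<zeta>: "cmod (character N 1 j) = 1" for N j by (rule character_simps)
  have u_pos: "0 < Re (g0 + (\<Sum>i<L'. c i * character N 1 j ^ Suc i + d i / character N 1 j ^ Suc i))"
    and v_pos: "0 < Re (g0 + (\<Sum>i<L'. c i * (qc * character N 1 j) ^ Suc i + d i / (qc * character N 1 j) ^ Suc i))"
    if "L \<le> L'" for L' N j
  proof -
    have nz: "character N 1 j \<noteq> 0" "qc * character N 1 j \<noteq> 0" using \<zeta>[of N j] q by auto
    show "0 < Re (g0 + (\<Sum>i<L'. c i * character N 1 j ^ Suc i + d i / character N 1 j ^ Suc i))"
      using pos[of "character N 1 j"] \<zeta>[of N j] unfolding G_eq[OF nz(1) that] by simp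
    show "0 < Re (g0 + (\<Sum>i<L'. c i * (qc * character N 1 j) ^ Suc i + d i / (qc * character N 1 j) ^ Suc i))"
      using pos[of "qc * character N 1 j"] \<zeta>[of N j] q unfolding G_eq[OF nz(2) that] by (simp add: norm_mult)
  qed
  have m: "m > 0"
  proof -
    have "0 < (\<Sum>j<2 * L + 1. Re (g0 + (\<Sum>i<L. c i * character (2 * L + 1) 1 j ^ Suc i + d i / character (2 * L + 1) 1 j ^ Suc i)))"
      by (rule sum_pos) (use u_pos[OF order_refl] in auto)
    also have "\<dots> = real (2 * L + 1) * m"
      unfolding m_def by (rule kernel_part_average(2)[of 1]) simp
    finally show ?thesis by (simp add: zero_less_mult_iff)
  qed
  show thesis
  proof (rule that[OF m, of "Im g0"])
    fix e :: real assume e: "e > 0"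
    define e' where "e' = e / m\<^sup>2"
    have "e' > 0" using e m by (simp add: e'_def)
    then obtain L0 where L0: "\<And>L a b w. L0 \<le> L \<Longrightarrow> cmod a = 1 \<Longrightarrow> cmod b = 1 \<Longrightarrow> w \<in> closed_annulus \<rho>1 \<rho>2 \<Longrightarrow>
      cmod (kernel a b w - kernel_part L a b w) < e'"
      using kernel_part_uniform[OF \<rho>] by blast
    define L' where "L' = max L L0"
    have L': "L \<le> L'" "L0 \<le> L'" by (auto simp: L'_def)
    define N where "N = 2 * L' + 1"
    have N: "real N > 0" by (simp add: N_def)
    define z where "z = character N 1"
    define u where "u j = Re (g0 + (\<Sum>i<L'. c i * z j ^ Suc i + d i / z j ^ Suc i))" for j
    define v where "v j = Re (g0 + (\<Sum>i<L'. c i * (qc * z j) ^ Suc i + d i / (qc * z j) ^ Suc i))" for j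
    have uv: "0 < u j" "0 < v j" for j
      unfolding u_def v_def z_def by (rule u_pos[OF L'(1)], rule v_pos[OF L'(1)])
    note avg = kernel_part_average[where L = L' and c = c and d = d and ?g0.0 = g0, folded N_def, folded z_def, folded u_def v_def]
    define x where "x = (\<lambda>(j, l). u j * v l / (real N)\<^sup>2)"
    define I where "I = {..<N} \<times> {..<N}"
    have sum_x: "(\<Sum>i\<in>I. x i) = m\<^sup>2"
    proof -
      have "(\<Sum>i\<in>I. x i) = (\<Sum>j<N. u j) * (\<Sum>l<N. v l) / (real N)\<^sup>2"
        by (simp add: x_def I_def sum.cartesian_product[symmetric] sum_product sum_divide_distrib)
      also have "\<dots> = (real N * m) * (real N * m) / (real N)\<^sup>2"
        using avg(2,3)[of 1] by (simp add: m_def)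
      finally show ?thesis using N by (simp add: power2_eq_square)
    qed
    have "cmod (of_real m * (G w - \<i> * of_real (Im g0)) - (\<Sum>i\<in>I. of_real (x i) * kernel (z (fst i)) (z (snd i)) w)) < e"
      if w: "w \<in> closed_annulus \<rho>1 \<rho>2" for w
    proof -
      have w0: "w \<noteq> 0" using w \<rho> q by (auto simp: closed_annulus_def)
      have "of_real m * (G w - \<i> * of_real (Im g0)) = (\<Sum>j<N. \<Sum>l<N. of_real (u j * v l) * kernel_part L' (z j) (z l) w) / (of_nat N)\<^sup>2"
        unfolding G_eq[OF w0 L'(1)] m_def using avg(1)[OF w0] by simp
      also have "\<dots> = (\<Sum>i\<in>I. of_real (x i) * kernel_part L' (z (fst i)) (z (snd i)) w)"
        by (simp add: x_def I_def sum.cartesian_product case_prod_beta sum_divide_distrib)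
      finally have "of_real m * (G w - \<i> * of_real (Im g0)) - (\<Sum>i\<in>I. of_real (x i) * kernel (z (fst i)) (z (snd i)) w) =
          (\<Sum>i\<in>I. of_real (x i) * (kernel_part L' (z (fst i)) (z (snd i)) w - kernel (z (fst i)) (z (snd i)) w))"
        by (simp add: sum_subtractf right_diff_distrib)
      also have "cmod \<dots> \<le> (\<Sum>i\<in>I. cmod (of_real (x i) * (kernel_part L' (z (fst i)) (z (snd i)) w - kernel (z (fst i)) (z (snd i)) w)))"
        by (rule norm_sum)
      also have "\<dots> < (\<Sum>i\<in>I. x i * e')"
      proof (rule sum_strict_mono)
        show "finite I" "I \<noteq> {}" by (auto simp: I_def N_def)
        fix i assume "i \<in> I"
        have xi: "x i > 0" using uv N by (simp add: x_def case_prod_beta)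
        have "cmod (kernel (z (fst i)) (z (snd i)) w - kernel_part L' (z (fst i)) (z (snd i)) w) < e'"
          by (rule L0[OF L'(2) _ _ w]) (auto simp: z_def \<zeta>)
        then show "cmod (of_real (x i) * (kernel_part L' (z (fst i)) (z (snd i)) w - kernel (z (fst i)) (z (snd i)) w)) < x i * e'"
          using xi by (simp add: norm_mult norm_minus_commute)
      qed
      also have "\<dots> = e" unfolding sum_distrib_right[symmetric] sum_x using m by (simp add: e'_def)
      finally show ?thesis .
    qed
    moreover have "0 \<le> x i" for i using uv[THEN less_imp_le] by (auto simp: x_def case_prod_beta)
    ultimately show "\<exists>I x a b. finite I \<and> (\<forall>i\<in>I. 0 \<le> x i \<and> cmod (a i) = 1 \<and> cmod (b i) = 1) \<and>
        (\<forall>w\<in>closed_annulus \<rho>1 \<rho>2. cmod (of_real m * (G w - \<i> * of_real (Im g0)) - (\<Sum>i\<in>(I::(nat \<times> nat) set). of_real (x i) * kernel (a i) (b i) w)) < e)"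
      by (intro exI[of _ I] exI[of _ x] exI[of _ "\<lambda>i. z (fst i)"] exI[of _ "\<lambda>i. z (snd i)"]) (auto simp: I_def z_def \<zeta>)
  qed
qed

lemma kernel_rotate:
  assumes "c \<noteq> 0"
  shows "kernel c c w = kernel 1 1 (w / c)"
proof -
  have "c - w = c * (1 - w / c)" "w - qc * c = c * (w / c - qc)" using assms by (simp_all add: algebra_simps)
  then have "2 * w / (c - w) = 2 * (w / c) / (1 - w / c)" "2 * qc * c / (w - qc * c) = 2 * qc / (w / c - qc)"
    using assms by simp_all
  then show ?thesis using assms by (simp add: kernel_def kernel_reg_def)
qed

end

subsection \<open>The series in closed form\<close>

lemma has_sum_diff_complex:
  fixes f g :: "'a \<Rightarrow> complex"
  assumes "(f has_sum a) A" "(g has_sum b) A"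
  shows "((\<lambda>x. f x - g x) has_sum (a - b)) A"
  using has_sum_add[OF assms(1) has_sum_cmult_right[OF assms(2), of "-1"]] by simp

lemma has_sum_lambert:
  assumes Q: "0 < Q" "Q < 1" and x: "cmod x < 1"
  shows "((\<lambda>n. x ^ Suc n / (1 - of_real Q ^ Suc n)) has_sum lambert Q x) UNIV"
proof (rule norm_summable_imp_has_sum[OF _ lambert_sums[OF Q x]])
  show "summable (\<lambda>n. cmod (x ^ Suc n / (1 - of_real Q ^ Suc n)))"
  proof (rule summable_comparison_test'[where N = 0])
    show "summable (\<lambda>n. cmod x ^ Suc n / (1 - Q))"
      using x by (intro summable_divide) (simp add: summable_mult)
  qed (use norm_lambert_term[OF Q] in simp)
qed

text \<open>With \<open>q = (1 - \<epsilon>)\<^sup>2 r\<close> the coefficients are \<open>1 / (1 + q\<^sup>k)\<close>, and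
  \<open>1 / (1 + q\<^sup>k) = (1 - q\<^sup>k) / (1 - q\<^sup>2\<^sup>k)\<close> splits the series into Lambert series with base \<open>q\<^sup>2\<close>.\<close>

lemma Gamma_ker_eq_kernel:
  assumes r: "0 < r" "r < 1" and \<epsilon>: "0 < \<epsilon>" "\<epsilon> < 1" and z: "z \<in> Gamma_dom r \<epsilon>"
  shows "Gamma_ker r \<epsilon> z = annulus_kernel.kernel ((1 - \<epsilon>)\<^sup>2 * r) 1 1 (of_real (1 - \<epsilon>) * z)"
proof -
  define s where "s = 1 - \<epsilon>"
  define q where "q = s\<^sup>2 * r"
  define w where "w = of_real s * z"
  have s: "0 < s" "s < 1" using \<epsilon> by (auto simp: s_def)
  have "s\<^sup>2 * r < 1 * 1" using s r by (intro mult_strict_mono) (auto simp: power_less_one_iff)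
  then interpret annulus_kernel q by unfold_locales (use s r in \<open>auto simp: q_def\<close>)
  have "s * r < cmod z" "cmod z < 1 / s" using z by (auto simp: Gamma_dom_def s_def)
  then have w: "q < cmod w" "cmod w < 1"
    using s by (auto simp: w_def q_def norm_mult power2_eq_square field_simps)
  have w0: "w \<noteq> 0" using w q by auto
  have z0: "z \<noteq> 0" and s0: "complex_of_real s \<noteq> 0" using w0 s by (auto simp: w_def)
  define f where "f k = of_real (s powi k / (1 + s powi (2 * k) * r powi k)) * z powi k" for k
  have den: "1 + qc ^ Suc n \<noteq> 0" for n
  proof -
    have "0 < 1 + q ^ Suc n" using q by (simp add: add_pos_pos)
    then show ?thesis by (metis less_irrefl of_real_1 of_real_add of_real_eq_0_iff of_real_power)
  qed
  have den': "1 - complex_of_real Q ^ Suc n = (1 - qc ^ Suc n) * (1 + qc ^ Suc n)" for n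
  proof -
    have "complex_of_real Q ^ Suc n = (qc ^ Suc n)\<^sup>2" by (simp only: of_real_power power_mult[symmetric] mult.commute)
    then show ?thesis by (simp only: power2_eq_square) (simp add: algebra_simps)
  qed
  have key: "x ^ Suc n / (1 - complex_of_real Q ^ Suc n) - (qc * x) ^ Suc n / (1 - complex_of_real Q ^ Suc n) = x ^ Suc n / (1 + qc ^ Suc n)" for x n
  proof -
    have "1 - qc ^ Suc n \<noteq> 0" using lambert_denominator(2)[OF Q(1,2), of n] den'[of n] by auto
    moreover have "x ^ Suc n / (1 - complex_of_real Q ^ Suc n) - (qc * x) ^ Suc n / (1 - complex_of_real Q ^ Suc n) =
        (1 - qc ^ Suc n) * x ^ Suc n / ((1 - qc ^ Suc n) * (1 + qc ^ Suc n))"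
      unfolding den' power_mult_distrib by (simp only: diff_divide_distrib[symmetric] left_diff_distrib mult_1_left)
    ultimately show ?thesis by simp
  qed
  have fpos: "f (int (Suc n)) = w ^ Suc n / (1 + qc ^ Suc n)" for n
  proof -
    have "s powi (2 * int (Suc n)) * r powi int (Suc n) = q ^ Suc n"
      unfolding q_def power_mult_distrib power_mult[symmetric]
      by (metis of_nat_mult of_nat_numeral power_int_of_nat)
    then have "f (int (Suc n)) = of_real (s ^ Suc n / (1 + q ^ Suc n)) * z ^ Suc n"
      by (simp only: f_def power_int_of_nat)
    then show ?thesis by (simp add: w_def power_mult_distrib del: power_Suc)
  qed
  have fneg: "f (- int (Suc n)) = (qc / w) ^ Suc n / (1 + qc ^ Suc n)" for n
  proof -
    have "s powi (2 * - int (Suc n)) * r powi (- int (Suc n)) = 1 / q ^ Suc n"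
    proof -
      have "s powi (2 * - int (Suc n)) = 1 / s ^ (2 * Suc n)"
        by (metis inverse_eq_divide mult_minus_right of_nat_mult of_nat_numeral power_int_minus power_int_of_nat)
      moreover have "r powi (- int (Suc n)) = 1 / r ^ Suc n"
        by (metis inverse_eq_divide power_int_minus power_int_of_nat)
      ultimately show ?thesis by (simp add: q_def power_mult_distrib power_mult[symmetric] del: power_Suc)
    qed
    moreover have "s powi (- int (Suc n)) = 1 / s ^ Suc n" "z powi (- int (Suc n)) = 1 / z ^ Suc n"
      by (metis inverse_eq_divide power_int_minus power_int_of_nat)+
    ultimately have "f (- int (Suc n)) = of_real (1 / s ^ Suc n / (1 + 1 / q ^ Suc n)) * (1 / z ^ Suc n)"
      by (simp only: f_def)
    also have "1 / s ^ Suc n / (1 + 1 / q ^ Suc n) = q ^ Suc n / (s ^ Suc n * (1 + q ^ Suc n))"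
      using q s by (simp add: field_simps del: power_Suc)
    also have "of_real \<dots> * (1 / z ^ Suc n) = (qc / w) ^ Suc n / (1 + qc ^ Suc n)"
      by (simp add: w_def power_mult_distrib power_divide del: power_Suc)
    finally show ?thesis .
  qed
  have small: "cmod (qc * w) < 1" "cmod (qc / w) < 1" "cmod (qc\<^sup>2 / w) < 1"
  proof -
    show "cmod (qc * w) < 1" using w q mult_strict_mono[of q 1 "cmod w" 1] by (simp add: norm_mult)
    have "0 < cmod w" "Q < cmod w" using w Q q by linarith+
    then show "cmod (qc / w) < 1" "cmod (qc\<^sup>2 / w) < 1"
      using w q by (simp_all add: norm_divide norm_power divide_less_eq)
  qed
  have S1: "(f has_sum (lambert Q w - lambert Q (qc * w))) ((\<lambda>n. int (Suc n)) ` UNIV)"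
  proof (subst has_sum_reindex)
    show "inj (\<lambda>n. int (Suc n))" by (auto simp: inj_def)
    have "((\<lambda>n. w ^ Suc n / (1 - complex_of_real Q ^ Suc n) - (qc * w) ^ Suc n / (1 - complex_of_real Q ^ Suc n)) has_sum (lambert Q w - lambert Q (qc * w))) UNIV"
      using has_sum_lambert[OF Q(1,2) w(2)] has_sum_lambert[OF Q(1,2) small(1)] by (rule has_sum_diff_complex)
    then show "(f \<circ> (\<lambda>n. int (Suc n)) has_sum (lambert Q w - lambert Q (qc * w))) UNIV"
      unfolding key by (simp only: o_def fpos)
  qed
  have S2: "(f has_sum (lambert Q (qc / w) - lambert Q (qc\<^sup>2 / w))) ((\<lambda>n. - int (Suc n)) ` UNIV)"
  proof (subst has_sum_reindex)
    show "inj (\<lambda>n. - int (Suc n))" by (auto simp: inj_def)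
    have eq: "qc\<^sup>2 / w = qc * (qc / w)" by (simp add: power2_eq_square)
    have "((\<lambda>n. (qc / w) ^ Suc n / (1 - complex_of_real Q ^ Suc n) - (qc * (qc / w)) ^ Suc n / (1 - complex_of_real Q ^ Suc n)) has_sum (lambert Q (qc / w) - lambert Q (qc\<^sup>2 / w))) UNIV"
      unfolding eq by (rule has_sum_diff_complex[OF has_sum_lambert[OF Q(1,2) small(2)] has_sum_lambert[OF Q(1,2) small(3)[unfolded eq]]])
    then show "(f \<circ> (\<lambda>n. - int (Suc n)) has_sum (lambert Q (qc / w) - lambert Q (qc\<^sup>2 / w))) UNIV"
      unfolding key by (simp only: o_def fneg)
  qed
  have S0: "(f has_sum (1 / 2)) {0}"
    using has_sum_finite[of "{0}" f] by (simp add: f_def)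
  have "(f has_sum (1 / 2 + (lambert Q w - lambert Q (qc * w)) + (lambert Q (qc / w) - lambert Q (qc\<^sup>2 / w))))
      ({0} \<union> (\<lambda>n. int (Suc n)) ` UNIV \<union> (\<lambda>n. - int (Suc n)) ` UNIV)"
    by (intro has_sum_Un_disjoint S0 S1 S2) auto
  moreover have "{0} \<union> (\<lambda>n. int (Suc n)) ` UNIV \<union> (\<lambda>n. - int (Suc n)) ` UNIV = (UNIV :: int set)"
  proof -
    have "k \<in> {0} \<union> (\<lambda>n. int (Suc n)) ` UNIV \<union> (\<lambda>n. - int (Suc n)) ` UNIV" for k :: int
    proof -
      consider "k = 0" | "k = int (Suc (nat (k - 1)))" | "k = - int (Suc (nat (- k - 1)))" by linarith
      then show ?thesis by cases blast+
    qed
    then show ?thesis by blast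
  qed
  ultimately have "infsum f UNIV = 1 / 2 + (lambert Q w - lambert Q (qc * w)) + (lambert Q (qc / w) - lambert Q (qc\<^sup>2 / w))"
    by (simp add: infsumI)
  then have "Gamma_ker r \<epsilon> z = 1 + 2 * lambert Q w - 2 * lambert Q (qc\<^sup>2 / w) + 2 * lambert Q (qc / w) - 2 * lambert Q (qc * w)"
    unfolding Gamma_ker_def s_def[symmetric] f_def[symmetric] by simp
  also have "\<dots> = kernel 1 1 w" using w by (subst kernel_laurent) auto
  finally show ?thesis by (simp add: q_def s_def w_def)
qed

section \<open>Functions approximable by Laurent polynomials\<close>

text \<open>The class on which the calculus is multiplicative by continuity. By Laurent expansion every
  holomorphic function belongs to it; for the kernels membership is visible from their series.\<close>

definition approximable :: "real \<Rightarrow> real \<Rightarrow> (complex \<Rightarrow> complex) \<Rightarrow> bool" where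
  "approximable R1 R2 f \<longleftrightarrow> f holomorphic_on open_annulus R1 R2 \<and>
     (\<forall>a' b' e. R1 < a' \<longrightarrow> b' < R2 \<longrightarrow> 0 < e \<longrightarrow>
        (\<exists>g. laurent_poly g \<and> (\<forall>z\<in>closed_annulus a' b'. cmod (f z - g z) < e)))"

context annular_operator
begin

abbreviation "Phi f \<equiv> hol_calc U f T"

lemma laurent_poly_holomorphic: "laurent_poly f \<Longrightarrow> f holomorphic_on U"
proof -
  assume "laurent_poly f"
  then obtain p n where f: "\<And>z. z \<noteq> 0 \<Longrightarrow> f z = poly p z / z ^ n" by (auto simp: laurent_poly_def)
  show ?thesis
    by (rule holomorphic_transform[OF laurent_holomorphic[of p n]]) (simp add: f zero_not_in_V)
qed

lemma closed_annulus_subset_U: "R1 < a' \<Longrightarrow> b' < R2 \<Longrightarrow> closed_annulus a' b' \<subseteq> U"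
  by (auto simp: open_annulus_def closed_annulus_def)

lemma hol_calc_cong:
  assumes "f holomorphic_on U" "\<And>z. z \<in> U \<Longrightarrow> f z = g z"
  shows "Phi f = Phi g"
proof (rule blinfun_eq_of_cinner)
  fix x y
  have g: "g holomorphic_on U" using assms holomorphic_transform by blast
  have "cycle_integral cyc (\<lambda>z. f z * cinner (resolvent T z x) y) = cycle_integral cyc (\<lambda>z. g z * cinner (resolvent T z x) y)"
    by (rule cycle_integral_cong[OF loops_V]) (use assms in auto)
  then show "cinner (Phi f x) y = cinner (Phi g x) y"
    by (simp add: hol_calc_weak assms(1) g)
qed

lemma hol_calc_lincomb:
  assumes "f holomorphic_on U" "g holomorphic_on U"
  shows "Phi (\<lambda>z. c * f z + g z) = cmul_op c (Phi f) + Phi g"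
proof (rule blinfun_eq_of_cinner)
  fix x y
  have fg: "(\<lambda>z. f z * cinner (resolvent T z x) y) holomorphic_on V" "(\<lambda>z. g z * cinner (resolvent T z x) y) holomorphic_on V"
    using assms by (auto intro!: holomorphic_on_mult holomorphic_resolvent_V elim: holomorphic_on_subset)
  have "cycle_integral cyc (\<lambda>z. c * (f z * cinner (resolvent T z x) y) + g z * cinner (resolvent T z x) y) =
      c * cycle_integral cyc (\<lambda>z. f z * cinner (resolvent T z x) y) + cycle_integral cyc (\<lambda>z. g z * cinner (resolvent T z x) y)"
    using fg by (simp add: cycle_simps(1)[OF holomorphic_on_mult[OF holomorphic_on_const fg(1)] fg(2)] cycle_simps(3))
  moreover have "(\<lambda>z. c * f z + g z) holomorphic_on U" by (intro holomorphic_intros assms)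
  ultimately show "cinner (Phi (\<lambda>z. c * f z + g z) x) y = cinner ((cmul_op c (Phi f) + Phi g) x) y"
    by (simp add: hol_calc_weak assms blinfun.add_left cinner_add_left cinner_scaleC_left distrib_right mult.assoc add_divide_distrib)
qed

lemma complex_linear_hol_calc:
  assumes "f holomorphic_on U"
  shows "complex_linear (Phi f)"
  unfolding complex_linear_def
proof (intro allI)
  fix c x
  have "cinner (Phi f (c *\<^sub>C x) - c *\<^sub>C Phi f x) y = 0" for y
  proof -
    have "(\<lambda>z. f z * cinner (resolvent T z x) y) holomorphic_on V"
      using assms by (auto intro!: holomorphic_on_mult holomorphic_resolvent_V elim: holomorphic_on_subset)
    note lm = cycle_simps(3)[OF this, of c]
    have "cycle_integral cyc (\<lambda>z. f z * cinner (resolvent T z (c *\<^sub>C x)) y) = cycle_integral cyc (\<lambda>z. c * (f z * cinner (resolvent T z x) y))"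
      by (rule cycle_integral_cong[OF loops_V])
         (simp add: complex_linearD[OF complex_linear_resolvent[OF lin]] cinner_scaleC_left)
    then show ?thesis by (simp add: cinner.diff_left cinner_scaleC_left hol_calc_weak[OF assms] lm)
  qed
  from this[of "Phi f (c *\<^sub>C x) - c *\<^sub>C Phi f x"] show "Phi f (c *\<^sub>C x) = c *\<^sub>C Phi f x"
    by (simp add: cinner_self)
qed

lemma hol_calc_const [simp]: "Phi (\<lambda>_. c) = scalar_op c"
  using hol_calc_laurent[of "[:c:]" 0] by (simp add: laurent_op_def)

lemma hol_calc_sum:
  assumes "finite I" "\<And>i. i \<in> I \<Longrightarrow> f i holomorphic_on U"
  shows "Phi (\<lambda>z. \<Sum>i\<in>I. c i * f i z) = (\<Sum>i\<in>I. cmul_op (c i) (Phi (f i)))"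
  using assms
proof (induction I rule: finite_induct)
  case (insert i I)
  have "Phi (\<lambda>z. c i * f i z + (\<Sum>i\<in>I. c i * f i z)) = cmul_op (c i) (Phi (f i)) + Phi (\<lambda>z. \<Sum>i\<in>I. c i * f i z)"
    by (intro hol_calc_lincomb holomorphic_on_sum holomorphic_on_mult holomorphic_on_const) (use insert in auto)
  then show ?case using insert by simp
qed (simp add: scalar_op_simps)

lemma laurent_op_mult: "laurent_op p n o\<^sub>L laurent_op p' n' = laurent_op (p * p') (n + n')"
proof -
  have "op_power T_inv n o\<^sub>L poly_op p' T = poly_op p' T o\<^sub>L op_power T_inv n"
  proof (rule poly_op_commute[OF lin complex_linear_op_power[OF complex_linear_T_inv]])
    show "op_power T_inv n o\<^sub>L T = T o\<^sub>L op_power T_inv n"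
      using op_power_commute[of T T_inv n] by (simp add: T_inv)
  qed
  then have "(poly_op p T o\<^sub>L op_power T_inv n) o\<^sub>L (poly_op p' T o\<^sub>L op_power T_inv n') =
      (poly_op p T o\<^sub>L poly_op p' T) o\<^sub>L (op_power T_inv n o\<^sub>L op_power T_inv n')"
    by (metis compose_assoc)
  then show ?thesis by (simp add: laurent_op_def poly_op_mult[OF lin] op_power_add)
qed

lemma hol_calc_laurent_poly:
  assumes "\<And>z. z \<noteq> 0 \<Longrightarrow> f z = poly p z / z ^ n"
  shows "Phi f = laurent_op p n"
  using hol_calc_cong[OF laurent_holomorphic[of p n], of f] assms zero_not_in_V by (simp add: hol_calc_laurent)

lemma hol_calc_mult_laurent_poly:
  assumes "laurent_poly f" "laurent_poly g"
  shows "Phi (\<lambda>z. f z * g z) = Phi f o\<^sub>L Phi g"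
proof -
  obtain p n where f: "\<And>z. z \<noteq> 0 \<Longrightarrow> f z = poly p z / z ^ n" using assms(1) by (auto simp: laurent_poly_def)
  obtain p' n' where g: "\<And>z. z \<noteq> 0 \<Longrightarrow> g z = poly p' z / z ^ n'" using assms(2) by (auto simp: laurent_poly_def)
  have "Phi (\<lambda>z. f z * g z) = laurent_op (p * p') (n + n')"
    by (rule hol_calc_laurent_poly) (simp add: f g power_add)
  then show ?thesis by (simp add: hol_calc_laurent_poly[OF f] hol_calc_laurent_poly[OF g] laurent_op_mult)
qed

lemma hol_calc_power_laurent_poly: "laurent_poly f \<Longrightarrow> Phi (\<lambda>z. f z ^ n) = op_power (Phi f) n"
  by (induction n) (simp_all add: scalar_op_simps hol_calc_mult_laurent_poly laurent_poly_power)

lemma holomorphic_bounded: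
  assumes "f holomorphic_on U" "R1 < a'" "b' < R2"
  obtains M where "M > 0" "\<And>z. z \<in> closed_annulus a' b' \<Longrightarrow> cmod (f z) \<le> M"
proof -
  have "continuous_on (closed_annulus a' b') f"
    by (rule holomorphic_on_imp_continuous_on[OF holomorphic_on_subset[OF assms(1) closed_annulus_subset_U[OF assms(2,3)]]])
  then have "bounded (f ` closed_annulus a' b')" by (intro compact_imp_bounded compact_continuous_image) auto
  then show thesis using that unfolding bounded_pos by blast
qed

text \<open>Multiplicativity holds for Laurent polynomials, where the calculus is algebraic, and passes to the limit.\<close>

lemma hol_calc_mult:
  assumes f: "approximable R1 R2 f" and g: "approximable R1 R2 g"
  shows "Phi (\<lambda>z. f z * g z) = Phi f o\<^sub>L Phi g"
proof -
  obtain a' b' C where ab: "R1 < a'" "a' < a" "b < b'" "b' < R2" and C: "0 < C"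
    "\<And>f B. f holomorphic_on U \<Longrightarrow> (\<And>z. z \<in> closed_annulus a' b' \<Longrightarrow> cmod (f z) \<le> B) \<Longrightarrow> norm (Phi f) \<le> C * B"
    by (rule hol_calc_bound) blast
  have fh: "f holomorphic_on U" and gh: "g holomorphic_on U" using f g by (auto simp: approximable_def)
  obtain M1 where M1: "M1 > 0" "\<And>z. z \<in> closed_annulus a' b' \<Longrightarrow> cmod (f z) \<le> M1"
    using holomorphic_bounded[OF fh ab(1,4)] by blast
  obtain M2 where M2: "M2 > 0" "\<And>z. z \<in> closed_annulus a' b' \<Longrightarrow> cmod (g z) \<le> M2"
    using holomorphic_bounded[OF gh ab(1,4)] by blast
  define K where "K = C * (M1 + M2 + 1) + C * (M1 + 1) * C + C * (C * M2)"
  have K: "K > 0" using C M1 M2 by (simp add: K_def add_pos_pos)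
  have bound: "norm (Phi (\<lambda>z. f z * g z) - (Phi f o\<^sub>L Phi g)) \<le> K * e" if e: "0 < e" "e < 1" for e
  proof -
    obtain f' where f': "laurent_poly f'" "\<And>z. z \<in> closed_annulus a' b' \<Longrightarrow> cmod (f z - f' z) < e"
      using f ab e unfolding approximable_def by metis
    obtain g' where g': "laurent_poly g'" "\<And>z. z \<in> closed_annulus a' b' \<Longrightarrow> cmod (g z - g' z) < e"
      using g ab e unfolding approximable_def by metis
    note hol = laurent_poly_holomorphic[OF f'(1)] laurent_poly_holomorphic[OF g'(1)]
    have f'M: "cmod (f' z) \<le> M1 + 1" if "z \<in> closed_annulus a' b'" for z
      using M1(2)[OF that] f'(2)[OF that] e norm_triangle_ineq3[of "f' z" "f z"] by (simp add: norm_minus_commute)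
    have 1: "norm (Phi (\<lambda>z. f z * g z) - Phi (\<lambda>z. f' z * g' z)) \<le> C * ((M1 + M2 + 1) * e)"
    proof (subst hol_calc_diff[symmetric])
      show "norm (Phi (\<lambda>z. f z * g z - f' z * g' z)) \<le> C * ((M1 + M2 + 1) * e)"
      proof (rule C(2))
        fix z assume z: "z \<in> closed_annulus a' b'"
        have "f z * g z - f' z * g' z = (f z - f' z) * g z + f' z * (g z - g' z)" by (simp add: algebra_simps)
        then have "cmod (f z * g z - f' z * g' z) \<le> cmod (f z - f' z) * cmod (g z) + cmod (f' z) * cmod (g z - g' z)"
          by (metis norm_mult norm_triangle_ineq)
        also have "\<dots> \<le> e * M2 + (M1 + 1) * e"
          using f'(2)[OF z] g'(2)[OF z] M2(2)[OF z] f'M[OF z] M1(1) M2(1) e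
          by (intro add_mono mult_mono) auto
        finally show "cmod (f z * g z - f' z * g' z) \<le> (M1 + M2 + 1) * e" by (simp add: algebra_simps)
      qed (intro holomorphic_intros fh gh hol)
    qed (intro holomorphic_intros fh gh hol)+
    have 2: "norm (Phi f - Phi f') \<le> C * e" "norm (Phi g - Phi g') \<le> C * e"
      using C(2)[of "\<lambda>z. f z - f' z" e] C(2)[of "\<lambda>z. g z - g' z" e] f'(2) g'(2)
      by (auto simp: hol_calc_diff fh gh hol holomorphic_on_diff less_imp_le)
    have 3: "norm (Phi f') \<le> C * (M1 + 1)" "norm (Phi g) \<le> C * M2"
      using C(2)[OF hol(1) f'M] C(2)[OF gh M2(2)] by auto
    have "(Phi f' o\<^sub>L Phi g') - (Phi f o\<^sub>L Phi g) = - (Phi f' o\<^sub>L (Phi g - Phi g')) - ((Phi f - Phi f') o\<^sub>L Phi g)"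
      by (simp add: compose.diff_left compose.diff_right)
    then have "norm ((Phi f' o\<^sub>L Phi g') - (Phi f o\<^sub>L Phi g)) \<le> norm (Phi f' o\<^sub>L (Phi g - Phi g')) + norm ((Phi f - Phi f') o\<^sub>L Phi g)"
      by (metis norm_minus_cancel norm_triangle_ineq4)
    also have "\<dots> \<le> (C * (M1 + 1)) * (C * e) + (C * e) * (C * M2)"
      using 2 3 C(1) M1(1) M2(1) e
      by (intro add_mono order_trans[OF norm_blinfun_compose] mult_mono) auto
    finally have 4: "norm ((Phi f' o\<^sub>L Phi g') - (Phi f o\<^sub>L Phi g)) \<le> (C * (M1 + 1)) * (C * e) + (C * e) * (C * M2)" .
    have "Phi (\<lambda>z. f z * g z) - (Phi f o\<^sub>L Phi g) =
        (Phi (\<lambda>z. f z * g z) - Phi (\<lambda>z. f' z * g' z)) + ((Phi f' o\<^sub>L Phi g') - (Phi f o\<^sub>L Phi g))"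
      by (simp add: hol_calc_mult_laurent_poly[OF f'(1) g'(1)])
    then have "norm (Phi (\<lambda>z. f z * g z) - (Phi f o\<^sub>L Phi g)) \<le> C * ((M1 + M2 + 1) * e) + ((C * (M1 + 1)) * (C * e) + (C * e) * (C * M2))"
      by (simp only:) (rule norm_triangle_mono[OF 1 4])
    then show ?thesis by (simp add: K_def algebra_simps)
  qed
  have "norm (Phi (\<lambda>z. f z * g z) - (Phi f o\<^sub>L Phi g)) \<le> 0"
  proof (rule field_le_epsilon)
    fix e :: real assume e: "0 < e"
    define d where "d = min (1 / 2) (e / K)"
    have "0 < d" "d < 1" "K * d \<le> e" using e K by (auto simp: d_def min_def field_simps)
    then show "norm (Phi (\<lambda>z. f z * g z) - (Phi f o\<^sub>L Phi g)) \<le> 0 + e" using bound[of d] by simp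
  qed
  then show ?thesis by simp
qed

lemma approximable_diff_const:
  assumes "approximable R1 R2 f"
  shows "approximable R1 R2 (\<lambda>z. f z - c)"
  unfolding approximable_def
proof (intro conjI allI impI)
  show "(\<lambda>z. f z - c) holomorphic_on U" using assms by (auto simp: approximable_def intro!: holomorphic_intros)
  fix a' b' e :: real assume "R1 < a'" "b' < R2" "0 < e"
  then obtain g where g: "laurent_poly g" "\<forall>z\<in>closed_annulus a' b'. cmod (f z - g z) < e"
    using assms unfolding approximable_def by metis
  then show "\<exists>g. laurent_poly g \<and> (\<forall>z\<in>closed_annulus a' b'. cmod (f z - c - g z) < e)"
    by (intro exI[of _ "\<lambda>z. g z - c"]) (auto intro: laurent_poly_diff)
qed

end

section \<open>Accretive kernels force the von Neumann inequality\<close>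

definition accretive :: "('a::real_inner \<Rightarrow>\<^sub>L 'a) \<Rightarrow> bool" where
  "accretive A \<longleftrightarrow> (\<forall>x. 0 \<le> inner (A x) x)"

lemma accretiveI_approx:
  fixes A :: "'a::real_inner \<Rightarrow>\<^sub>L 'a"
  assumes "\<And>x e. 0 < e \<Longrightarrow> - (e * (norm x)\<^sup>2) \<le> inner (A x) x"
  shows "accretive A"
  unfolding accretive_def
proof
  fix x
  show "0 \<le> inner (A x) x"
  proof (rule field_le_epsilon)
    fix e :: real assume e: "0 < e"
    define d where "d = e / ((norm x)\<^sup>2 + 1)"
    have n: "(norm x)\<^sup>2 + 1 > 0" by (simp add: add_nonneg_pos)
    then have "d * ((norm x)\<^sup>2 + 1) = e" by (simp add: d_def)
    moreover have "d > 0" using e n by (simp add: d_def)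
    ultimately have "d > 0" "d * (norm x)\<^sup>2 \<le> e" by (simp_all add: distrib_left)
    then show "0 \<le> inner (A x) x + e" using assms[of d x] by linarith
  qed
qed

lemma inner_perturbation:
  fixes A B :: "'a::real_inner \<Rightarrow>\<^sub>L 'a"
  shows "\<bar>inner (A x) x - inner (B x) x\<bar> \<le> norm (A - B) * (norm x)\<^sup>2"
proof -
  have "\<bar>inner ((A - B) x) x\<bar> \<le> norm ((A - B) x) * norm x" by (rule Cauchy_Schwarz_ineq2)
  also have "\<dots> \<le> (norm (A - B) * norm x) * norm x" by (intro mult_right_mono norm_blinfun) simp
  finally show ?thesis by (simp add: blinfun.diff_left inner_diff_left power2_eq_square mult.assoc)
qed

text \<open>The spectrum lies in \<open>r \<le> |z| \<le> 1\<close>, and the dilation by \<open>s\<close> maps the larger annulus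
  \<open>s r < |z| < 1 / s\<close> onto \<open>s\<^sup>2 r < |w| < 1\<close>, where kernels with \<open>q = s\<^sup>2 r\<close> are positive. So these kernels are
  holomorphic near the spectrum.\<close>

locale kernel_operator =
  fixes T :: "'a::complex_hilbert_space \<Rightarrow>\<^sub>L 'a" and r s :: real
  assumes T: "complex_linear T" and r: "0 < r" "r < 1" and s: "0 < s" "s < 1"
    and spec: "op_spectrum T \<subseteq> closed_annulus r 1"

sublocale kernel_operator \<subseteq> annular_operator T "s * r" r 1 "1 / s"
  by unfold_locales (use T r s spec in auto)

sublocale kernel_operator \<subseteq> annulus_kernel "s\<^sup>2 * r"
proof
  show "s\<^sup>2 * r < 1"
    using mult_strict_mono[of "s\<^sup>2" 1 r 1] r s by (simp add: power_less_one_iff)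
qed (use r s in simp)

context kernel_operator
begin

definition H :: "complex \<Rightarrow> complex \<Rightarrow> complex \<Rightarrow> complex" where
  "H a b z = kernel a b (of_real s * z)"

lemma scaled_closed_annulus:
  assumes "z \<in> closed_annulus a' b'"
  shows "of_real s * z \<in> closed_annulus (s * a') (s * b')"
  using assms s by (auto simp: closed_annulus_def norm_mult)

lemma scaled_in_annulus:
  assumes "z \<in> U"
  shows "of_real s * z \<in> open_annulus (s\<^sup>2 * r) 1"
proof -
  have "s * (s * r) < s * cmod z" "s * cmod z < s * (1 / s)"
    using assms s by (auto simp: open_annulus_def intro!: mult_strict_left_mono simp del: times_divide_eq_right)
  then show ?thesis using s by (simp add: open_annulus_def norm_mult power2_eq_square mult.assoc)
qed

lemma H_holomorphic:
  assumes "cmod a = 1" "cmod b = 1"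
  shows "H a b holomorphic_on U"
proof -
  have "(kernel a b \<circ> (\<lambda>z. of_real s * z)) holomorphic_on U"
    by (rule holomorphic_on_compose_gen[OF _ kernel_holomorphic_annulus[OF assms]])
       (auto intro!: holomorphic_intros scaled_in_annulus)
  then show ?thesis by (simp add: o_def H_def[abs_def])
qed

lemma scaled_radii:
  assumes "s * r < a'" "b' < 1 / s"
  shows "s\<^sup>2 * r < s * a'" "s * b' < 1"
proof -
  show "s\<^sup>2 * r < s * a'" using mult_strict_left_mono[OF assms(1) s(1)] by (simp add: power2_eq_square mult.assoc)
  show "s * b' < 1" using mult_strict_left_mono[OF assms(2) s(1)] s by simp
qed

lemma H_approximable:
  assumes ab: "cmod a = 1" "cmod b = 1"
  shows "approximable (s * r) (1 / s) (H a b)"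
  unfolding approximable_def
proof (intro conjI allI impI H_holomorphic ab)
  fix a' b' e :: real assume ab': "s * r < a'" "b' < 1 / s" "0 < e"
  show "\<exists>g. laurent_poly g \<and> (\<forall>z\<in>closed_annulus a' b'. cmod (H a b z - g z) < e)"
  proof (cases "a' \<le> b'")
    case False
    then have "closed_annulus a' b' = {}" by (auto simp: closed_annulus_def)
    then show ?thesis by (intro exI[of _ "\<lambda>z. 0"]) simp
  next
    case True
    then have "s * a' \<le> s * b'" using s by simp
    with scaled_radii[OF ab'(1,2)] obtain L where L: "\<And>w. w \<in> closed_annulus (s * a') (s * b') \<Longrightarrow> cmod (kernel a b w - kernel_part L a b w) < e"
      using kernel_part_uniform[of "s * a'" "s * b'" e] ab ab'(3) by (metis order_refl)
    have "laurent_poly (\<lambda>z. kernel_part L a b (of_real s * z))"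
      by (rule laurent_poly_scale[OF laurent_poly_kernel_part]) (use s in simp)
    then show ?thesis using L scaled_closed_annulus unfolding H_def by blast
  qed
qed

lemma H_positive: "cmod a = 1 \<Longrightarrow> cmod b = 1 \<Longrightarrow> z \<in> U \<Longrightarrow> 0 < Re (H a b z)"
  unfolding H_def by (intro kernel_positive scaled_in_annulus)

lemma inner_imaginary_scalar: "inner (((\<i> * of_real t) *\<^sub>C x)) x = 0"
  by (subst inner_eq_Re_cinner) (simp add: cinner_scaleC_left cinner_self)

text \<open>Only symmetric kernels occur in the criterion. A general kernel \<open>N\<close> satisfies \<open>N M = k > 0\<close> for a
  symmetric kernel \<open>M\<close>, up to imaginary constants, and \<open>k N(T) = N(T)\<^sup>* M(T)\<^sup>* N(T)\<close> is accretive with \<open>M(T)\<close>.\<close>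

lemma accretive_general_kernel:
  assumes sym: "\<And>c. cmod c = 1 \<Longrightarrow> accretive (Phi (H c c))" and a: "cmod a = 1" and b: "cmod b = 1"
  shows "accretive (Phi (H a b))"
proof (cases "a = b")
  case True
  then show ?thesis using sym a by simp
next
  case False
  define c where "c = csqrt (a * b)"
  have sq: "c\<^sup>2 = a * b" by (simp add: c_def)
  have "(cmod c)\<^sup>2 = 1" using arg_cong[OF sq, of cmod] a b by (simp add: norm_power norm_mult)
  then have c: "cmod c = 1" by (intro power2_eq_imp_eq[of "cmod c" 1]) auto
  have "a \<noteq> 0" using a by auto
  then have ca: "c \<noteq> a" using sq False by (auto simp: power2_eq_square)
  obtain k t1 t2 :: real where k: "k > 0"
    "\<And>w. w \<in> open_annulus (s\<^sup>2 * r) 1 \<Longrightarrow> (kernel a b w - \<i> * t1) * (kernel c c w - \<i> * t2) = k"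
    using kernel_product_constant[OF a b c sq ca] by blast
  define N where "N z = H a b z - \<i> * t1" for z
  define M where "M z = H c c z - \<i> * t2" for z
  have app: "approximable (s * r) (1 / s) N" "approximable (s * r) (1 / s) M"
    unfolding N_def M_def by (intro approximable_diff_const H_approximable a b c)+
  have "N z * M z = of_real k" if "z \<in> U" for z
    unfolding N_def M_def H_def by (rule k(2)[OF scaled_in_annulus[OF that]])
  then have "Phi (\<lambda>z. M z * N z) = Phi (\<lambda>z. of_real k)"
    using app unfolding approximable_def
    by (intro hol_calc_cong holomorphic_on_mult) (simp_all add: mult.commute[of "M _"])
  then have MN: "Phi M o\<^sub>L Phi N = scalar_op k" by (simp only: hol_calc_mult[OF app(2,1)] hol_calc_const)
  have PhiN: "Phi N = Phi (H a b) - scalar_op (\<i> * t1)" and PhiM: "Phi M = Phi (H c c) - scalar_op (\<i> * t2)"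
    unfolding N_def M_def by (subst hol_calc_diff, auto intro!: H_holomorphic a b c holomorphic_intros)+
  show ?thesis
    unfolding accretive_def
  proof
    fix y
    define x where "x = Phi N y"
    have "Phi M x = k *\<^sub>R y"
      using arg_cong[OF MN, of "\<lambda>A. A y"] by (simp add: x_def scaleR_eq_scaleC)
    then have "k * inner (Phi N y) y = inner (Phi M x) x"
      by (simp add: x_def inner_commute)
    also have "\<dots> = inner (Phi (H c c) x) x"
      by (simp add: PhiM blinfun.diff_left inner_diff_left inner_imaginary_scalar)
    also have "\<dots> \<ge> 0" using sym[OF c] by (simp add: accretive_def)
    finally have "0 \<le> inner (Phi N y) y" using k(1) by (simp add: zero_le_mult_iff)
    then show "0 \<le> inner (Phi (H a b) y) y"
      by (simp add: PhiN blinfun.diff_left inner_diff_left inner_imaginary_scalar)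
  qed
qed

text \<open>Up to scaling and an imaginary constant, such a function is a limit of positive combinations of kernels.\<close>

lemma accretive_positive_laurent_poly:
  assumes acc: "\<And>a b. cmod a = 1 \<Longrightarrow> cmod b = 1 \<Longrightarrow> accretive (Phi (H a b))"
    and G: "laurent_poly G" and pos: "\<And>z. cmod z = 1 / s \<or> cmod z = s * r \<Longrightarrow> 0 < Re (G z)"
  shows "accretive (Phi G)"
proof -
  obtain a' b' C where ab: "s * r < a'" "a' < r" "1 < b'" "b' < 1 / s" and C: "0 < C"
    "\<And>f B. f holomorphic_on U \<Longrightarrow> (\<And>z. z \<in> closed_annulus a' b' \<Longrightarrow> cmod (f z) \<le> B) \<Longrightarrow> norm (Phi f) \<le> C * B"
    by (rule hol_calc_bound) blast
  have s0: "complex_of_real s \<noteq> 0" using s by simp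
  define G' where "G' w = G (1 / of_real s * w)" for w
  have G': "laurent_poly G'" unfolding G'_def by (rule laurent_poly_scale[OF G]) (use s in simp)
  have pos': "0 < Re (G' w)" if "cmod w = 1 \<or> cmod w = s\<^sup>2 * r" for w
    unfolding G'_def by (rule pos) (use that s in \<open>auto simp: norm_mult norm_divide power2_eq_square\<close>)
  have rad: "s\<^sup>2 * r < s * a'" "s * a' \<le> s * b'" "s * b' < 1"
    using scaled_radii[OF ab(1,4)] ab r s by auto
  obtain m t :: real where m: "m > 0" and
    avg: "\<And>e. e > 0 \<Longrightarrow> \<exists>I x a b. finite I \<and> (\<forall>i\<in>I. 0 \<le> x i \<and> cmod (a i) = 1 \<and> cmod (b i) = 1) \<and>
        (\<forall>w\<in>closed_annulus (s * a') (s * b'). cmod (of_real m * (G' w - \<i> * of_real t) - (\<Sum>i\<in>(I::(nat \<times> nat) set). of_real (x i) * kernel (a i) (b i) w)) < e)"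
    using positive_laurent_average[OF G' pos' rad] by blast
  show ?thesis
  proof (rule accretiveI_approx)
    fix x :: 'a and e :: real assume e: "0 < e"
    define d where "d = e * m / C"
    have d: "d > 0" using e m C by (simp add: d_def)
    obtain I :: "(nat \<times> nat) set" and wt a b where I: "finite I" "\<forall>i\<in>I. 0 \<le> wt i \<and> cmod (a i) = 1 \<and> cmod (b i) = 1"
      "\<forall>w\<in>closed_annulus (s * a') (s * b'). cmod (of_real m * (G' w - \<i> * of_real t) - (\<Sum>i\<in>I. of_real (wt i) * kernel (a i) (b i) w)) < d"
      using avg[OF d] by (elim exE conjE) (rule that)
    define f where "f z = of_real m * G z + (- (of_real m * (\<i> * of_real t)))" for z
    define g where "g z = (\<Sum>i\<in>I. of_real (wt i) * H (a i) (b i) z)" for z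
    have Gh: "G holomorphic_on U" by (rule laurent_poly_holomorphic[OF G])
    have fh: "f holomorphic_on U" unfolding f_def by (intro holomorphic_intros Gh)
    have gh: "g holomorphic_on U" unfolding g_def using I by (intro holomorphic_intros H_holomorphic) auto
    have "norm (Phi (\<lambda>z. f z - g z)) \<le> C * d"
    proof (rule C(2))
      fix z assume "z \<in> closed_annulus a' b'"
      from I(3)[rule_format, OF scaled_closed_annulus[OF this]] show "cmod (f z - g z) \<le> d"
        using s0 by (simp add: f_def g_def H_def G'_def right_diff_distrib)
    qed (intro holomorphic_intros fh gh)
    then have "norm (Phi f - Phi g) \<le> e * m" using C(1) by (simp add: hol_calc_diff fh gh d_def)
    then have close: "\<bar>inner (Phi f x) x - inner (Phi g x) x\<bar> \<le> e * m * (norm x)\<^sup>2"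
      using inner_perturbation[of "Phi f" x "Phi g"] mult_right_mono[of "norm (Phi f - Phi g)" "e * m" "(norm x)\<^sup>2"] by simp
    have "Phi g = (\<Sum>i\<in>I. cmul_op (of_real (wt i)) (Phi (H (a i) (b i))))"
      unfolding g_def using I by (intro hol_calc_sum H_holomorphic) auto
    then have "inner (Phi g x) x = (\<Sum>i\<in>I. wt i * inner (Phi (H (a i) (b i)) x) x)"
      by (simp add: blinfun.sum_left inner_sum_left scaleR_eq_scaleC[symmetric])
    also have "\<dots> \<ge> 0" using I acc by (intro sum_nonneg mult_nonneg_nonneg) (auto simp: accretive_def)
    finally have g0: "0 \<le> inner (Phi g x) x" .
    have "Phi f = cmul_op (of_real m) (Phi G) + scalar_op (- (of_real m * (\<i> * of_real t)))"
      unfolding f_def by (subst hol_calc_lincomb[OF Gh]) (auto intro!: holomorphic_intros)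
    moreover have "inner ((- (of_real m * (\<i> * of_real t))) *\<^sub>C x) x = 0"
      using inner_imaginary_scalar[of "- m * t" x] by (simp add: mult.commute mult.left_commute)
    ultimately have "inner (Phi f x) x = m * inner (Phi G x) x"
      by (simp add: blinfun.add_left inner_add_left scaleR_eq_scaleC[symmetric])
    then have "- (e * m * (norm x)\<^sup>2) \<le> m * inner (Phi G x) x" using close g0 by linarith
    then have "m * (- (e * (norm x)\<^sup>2)) \<le> m * inner (Phi G x) x" by (simp add: mult_ac)
    then show "- (e * (norm x)\<^sup>2) \<le> inner (Phi G x) x" using m by (simp only: mult_le_cancel_left_pos)
  qed
qed

text \<open>The Cayley transform of \<open>P\<close>, expanded as a geometric series and truncated, is a Laurent polynomial
  with positive real part; accretivity at \<open>T\<close> of these transforms is contractivity of \<open>P\<close> at \<open>T\<close>.\<close>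

lemma contractive_laurent_poly:
  assumes acc: "\<And>a b. cmod a = 1 \<Longrightarrow> cmod b = 1 \<Longrightarrow> accretive (Phi (H a b))"
    and P: "laurent_poly P" and le: "\<And>z. z \<in> closed_annulus (s * r) (1 / s) \<Longrightarrow> cmod (P z) \<le> c" and c: "0 \<le> c" "c < 1"
  shows "norm (Phi P) \<le> 1"
proof (rule norm_blinfun_bound)
  fix y
  obtain a' b' C where ab: "s * r < a'" "a' < r" "1 < b'" "b' < 1 / s" and C: "0 < C"
    "\<And>f B. f holomorphic_on U \<Longrightarrow> (\<And>z. z \<in> closed_annulus a' b' \<Longrightarrow> cmod (f z) \<le> B) \<Longrightarrow> norm (Phi f) \<le> C * B"
    by (rule hol_calc_bound) blast
  define B where "B = Phi P"
  define G where "G K z = 1 + (\<Sum>k<K. 2 * P z ^ Suc k)" for K z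
  have Pk: "laurent_poly (\<lambda>z. P z ^ k)" for k by (rule laurent_poly_power[OF P])
  have G_lp: "laurent_poly (G K)" for K
    unfolding G_def by (intro laurent_poly_add laurent_poly_const laurent_poly_sum laurent_poly_mult Pk)
  have PhiG: "Phi (G K) = id_blinfun + (\<Sum>k<K. 2 *\<^sub>R op_power B (Suc k))" for K
  proof -
    have "Phi (\<lambda>z. 1 * (\<Sum>k<K. 2 * P z ^ Suc k) + 1) = cmul_op 1 (Phi (\<lambda>z. \<Sum>k<K. 2 * P z ^ Suc k)) + Phi (\<lambda>z. 1)"
      by (intro hol_calc_lincomb laurent_poly_holomorphic laurent_poly_sum laurent_poly_mult Pk laurent_poly_const)
    also have "Phi (\<lambda>z. \<Sum>k<K. 2 * P z ^ Suc k) = (\<Sum>k<K. cmul_op 2 (Phi (\<lambda>z. P z ^ Suc k)))"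
      by (intro hol_calc_sum laurent_poly_holomorphic Pk) simp
    also have "\<dots> = (\<Sum>k<K. 2 *\<^sub>R op_power B (Suc k))"
      unfolding hol_calc_power_laurent_poly[OF P] B_def
      by (intro sum.cong refl blinfun_eqI) (simp add: blinfun.scaleR_left scaleR_eq_scaleC)
    finally have "Phi (\<lambda>z. 1 * (\<Sum>k<K. 2 * P z ^ Suc k) + 1) = (\<Sum>k<K. 2 *\<^sub>R op_power B (Suc k)) + id_blinfun"
      by (simp only: cmul_op_one hol_calc_const scalar_op_simps)
    moreover have "G K = (\<lambda>z. 1 * (\<Sum>k<K. 2 * P z ^ Suc k) + 1)"
      by (rule ext) (simp add: G_def)
    ultimately show ?thesis by (simp only: add.commute)
  qed
  have tele: "Phi (G K) o\<^sub>L (id_blinfun - B) = id_blinfun + B - 2 *\<^sub>R op_power B (Suc K)" for K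
  proof (induction K)
    case (Suc K)
    have "Phi (G (Suc K)) o\<^sub>L (id_blinfun - B) = (Phi (G K) o\<^sub>L (id_blinfun - B)) + (2 *\<^sub>R op_power B (Suc K) o\<^sub>L (id_blinfun - B))"
      by (simp only: PhiG sum.lessThan_Suc add.assoc[symmetric] compose.add_left)
    also have "(2 *\<^sub>R op_power B (Suc K)) o\<^sub>L (id_blinfun - B) = 2 *\<^sub>R op_power B (Suc K) - 2 *\<^sub>R op_power B (Suc (Suc K))"
      using op_power_commute[of B B "Suc K"] by (simp add: compose.diff_right compose.scaleR_left)
    finally show ?case unfolding Suc by simp
  qed (simp add: PhiG compose.diff_left compose.diff_right scaleR_2)
  have c_lim: "(\<lambda>K. c ^ Suc K) \<longlonglongrightarrow> 0" using c by (intro LIMSEQ_Suc LIMSEQ_power_zero) simp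
  have "\<forall>\<^sub>F K in sequentially. c ^ Suc K < (1 - c\<^sup>2) / 4"
    using c by (intro order_tendstoD[OF c_lim]) (simp add: power_less_one_iff)
  then have ev: "\<forall>\<^sub>F K in sequentially. 0 \<le> inner ((id_blinfun + B - 2 *\<^sub>R op_power B (Suc K)) y) (y - B y)"
  proof eventually_elim
    case (elim K)
    have "accretive (Phi (G K))"
    proof (rule accretive_positive_laurent_poly[OF acc G_lp])
      fix z assume z: "cmod z = 1 / s \<or> cmod z = s * r"
      have "s * r \<le> 1 / s" using ab r by linarith
      then have Pz: "cmod (P z) \<le> c" by (intro le) (use z in \<open>auto simp: closed_annulus_def\<close>)
      have sum: "G K z * (1 - P z) = 1 + P z - 2 * P z ^ Suc K"
        unfolding G_def
      proof (induction K)
        case (Suc K)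
        have "(1 + (\<Sum>k<Suc K. 2 * P z ^ Suc k)) * (1 - P z) = (1 + (\<Sum>k<K. 2 * P z ^ Suc k)) * (1 - P z) + 2 * P z ^ Suc K * (1 - P z)"
          by (simp only: sum.lessThan_Suc add.assoc[symmetric] distrib_right)
        also have "\<dots> = 1 + P z - 2 * P z ^ Suc K + 2 * P z ^ Suc K * (1 - P z)" by (simp only: Suc)
        also have "\<dots> = 1 + P z - 2 * P z ^ Suc (Suc K)" by (simp add: algebra_simps)
        finally show ?case .
      qed simp
      have "1 - P z \<noteq> 0" using Pz c by auto
      have "G K z * ((1 - P z) * cnj (1 - P z)) = (1 + P z - 2 * P z ^ Suc K) * cnj (1 - P z)"
        by (simp only: mult.assoc[symmetric] sum)
      moreover have "(1 - P z) * cnj (1 - P z) = of_real ((cmod (1 - P z))\<^sup>2)" by (simp only: complex_norm_square)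
      ultimately have eq: "G K z * of_real ((cmod (1 - P z))\<^sup>2) = (1 + P z - 2 * P z ^ Suc K) * cnj (1 - P z)"
        by (simp only:)
      have "Re (u * of_real t) = Re u * t" for u t by simp
      from arg_cong[OF eq, of Re, unfolded this]
      have "Re (G K z) * (cmod (1 - P z))\<^sup>2 = Re ((1 + P z - 2 * P z ^ Suc K) * cnj (1 - P z))" .
      also have "(1 + P z - 2 * P z ^ Suc K) * cnj (1 - P z) = (1 + P z) * cnj (1 - P z) - 2 * P z ^ Suc K * cnj (1 - P z)"
        by (simp only: left_diff_distrib)
      also have "Re \<dots> = 1 - (cmod (P z))\<^sup>2 - Re (2 * P z ^ Suc K * cnj (1 - P z))"
        by (simp add: cmod_power2) (simp add: power2_eq_square algebra_simps)
      also have "\<dots> > 0"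
      proof -
        have "Re (2 * P z ^ Suc K * cnj (1 - P z)) \<le> cmod (2 * P z ^ Suc K * cnj (1 - P z))" by (rule complex_Re_le_cmod)
        also have "\<dots> = 2 * cmod (P z) ^ Suc K * cmod (1 - P z)" by (simp only: norm_mult norm_power complex_mod_cnj norm_numeral)
        also have "\<dots> \<le> 2 * c ^ Suc K * 2"
          using Pz c norm_triangle_ineq4[of 1 "P z"] by (intro mult_mono power_mono) (auto intro!: mult_nonneg_nonneg)
        also have "\<dots> < 1 - c\<^sup>2" using elim by simp
        also have "\<dots> \<le> 1 - (cmod (P z))\<^sup>2" using Pz by (simp add: power_mono)
        finally show ?thesis by simp
      qed
      finally show "0 < Re (G K z)" by (simp add: zero_less_mult_iff)
    qed
    then have "0 \<le> inner (Phi (G K) ((id_blinfun - B) y)) ((id_blinfun - B) y)" by (simp add: accretive_def)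
    also have "Phi (G K) ((id_blinfun - B) y) = (id_blinfun + B - 2 *\<^sub>R op_power B (Suc K)) y"
      using arg_cong[OF tele[of K], of "\<lambda>A. A y"] by simp
    finally show ?case by (simp add: blinfun.diff_left)
  qed
  have "norm (op_power B (Suc K)) \<le> C * c ^ Suc K" for K
  proof -
    have "cmod (P z ^ Suc K) \<le> c ^ Suc K" if "z \<in> closed_annulus a' b'" for z
      unfolding norm_power using that ab by (intro power_mono le) (auto simp: closed_annulus_def)
    from C(2)[OF laurent_poly_holomorphic[OF Pk] this] show ?thesis
      by (simp only: hol_calc_power_laurent_poly[OF P] B_def)
  qed
  then have "(\<lambda>K. op_power B (Suc K)) \<longlonglongrightarrow> 0"
    by (intro Lim_null_comparison[OF _ tendsto_mult_right_zero[OF c_lim, of C]] always_eventually) blast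
  then have "(\<lambda>K. inner ((id_blinfun + B - 2 *\<^sub>R op_power B (Suc K)) y) (y - B y)) \<longlonglongrightarrow> inner ((id_blinfun + B - 2 *\<^sub>R 0) y) (y - B y)"
    by (intro tendsto_intros)
  then have "0 \<le> inner ((id_blinfun + B - 2 *\<^sub>R 0) y) (y - B y)"
    by (rule tendsto_lowerbound[OF _ ev]) simp
  then have "(norm (B y))\<^sup>2 \<le> (norm y)\<^sup>2"
    by (simp add: power2_norm_eq_inner blinfun.add_left inner_add inner_diff inner_commute)
  then show "norm (Phi P y) \<le> 1 * norm y" by (simp add: B_def)
qed simp

lemma norm_laurent_poly_le:
  assumes acc: "\<And>a b. cmod a = 1 \<Longrightarrow> cmod b = 1 \<Longrightarrow> accretive (Phi (H a b))"
    and P: "laurent_poly P" and le: "\<And>z. z \<in> closed_annulus (s * r) (1 / s) \<Longrightarrow> cmod (P z) \<le> M" and M: "M < M'" "0 \<le> M"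
  shows "norm (Phi P) \<le> M'"
proof -
  have "norm (Phi (\<lambda>z. of_real (1 / M') * P z + 0)) \<le> 1"
  proof (rule contractive_laurent_poly[OF acc, of _ "M / M'"])
    show "cmod (of_real (1 / M') * P z + 0) \<le> M / M'" if "z \<in> closed_annulus (s * r) (1 / s)" for z
      using le[OF that] M by (simp add: norm_divide norm_mult divide_right_mono)
    show "laurent_poly (\<lambda>z. of_real (1 / M') * P z + 0)"
      by (intro laurent_poly_add laurent_poly_mult P laurent_poly_const)
  qed (use M in auto)
  also have "Phi (\<lambda>z. of_real (1 / M') * P z + 0) = cmul_op (of_real (1 / M')) (Phi P) + Phi (\<lambda>z. 0)"
    by (intro hol_calc_lincomb laurent_poly_holomorphic P laurent_poly_const)
  finally have "cmod (of_real (1 / M')) * norm (Phi P) \<le> 1"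
    by (simp only: hol_calc_const scalar_op_simps add_0_right norm_cmul_op)
  then show ?thesis using M by (simp add: norm_divide field_simps)
qed

text \<open>The Cayley transform \<open>(H - 1) / (H + 1)\<close> is bounded by one where \<open>Re H > 0\<close>. The spectral set condition sees
  only rational functions, so \<open>H\<close> is first replaced by a nearby Laurent polynomial, lifted by \<open>d\<close> to keep
  its real part positive.\<close>

lemma accretive_of_spectral_set:
  assumes vN: "spectral_set (closed_annulus r 1) T" and a: "cmod a = 1" and b: "cmod b = 1"
  shows "accretive (Phi (H a b))"
proof (rule accretiveI_approx)
  fix x :: 'a and e :: real assume e: "0 < e"
  obtain a' b' C where ab: "s * r < a'" "a' < r" "1 < b'" "b' < 1 / s" and C: "0 < C"
    "\<And>f B. f holomorphic_on U \<Longrightarrow> (\<And>z. z \<in> closed_annulus a' b' \<Longrightarrow> cmod (f z) \<le> B) \<Longrightarrow> norm (Phi f) \<le> C * B"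
    by (rule hol_calc_bound) blast
  define d where "d = e / (C + 1)"
  have "(C + 1) * d = e" using C by (simp add: d_def)
  then have d: "d > 0" "C * d + d = e" using e C by (simp add: d_def, simp add: distrib_right)
  obtain P where P: "laurent_poly P" "\<And>z. z \<in> closed_annulus a' b' \<Longrightarrow> cmod (H a b z - P z) < d"
    using H_approximable[OF a b] ab d unfolding approximable_def by metis
  then obtain p n where p: "\<And>z. z \<noteq> 0 \<Longrightarrow> P z = poly p z / z ^ n" by (auto simp: laurent_poly_def)
  define A where "A = p + smult (of_real (d - 1)) (monom 1 n)"
  define B where "B = p + smult (of_real (d + 1)) (monom 1 n)"
  have val: "poly A z = z ^ n * (P z + of_real d - 1)" "poly B z = z ^ n * (P z + of_real d + 1)" if "z \<noteq> 0" for z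
    using that by (simp_all add: A_def B_def p poly_monom algebra_simps)
  have pos: "0 < Re (P z + of_real d)" "z \<noteq> 0" if z: "z \<in> closed_annulus r 1" for z
  proof -
    have "z \<in> U" "z \<in> closed_annulus a' b'" using z ab by (auto simp: open_annulus_def closed_annulus_def)
    then have "0 < Re (H a b z)" "cmod (H a b z - P z) < d" using H_positive[OF a b] P by auto
    then show "0 < Re (P z + of_real d)" using complex_Re_le_cmod[of "H a b z - P z"] by simp
    show "z \<noteq> 0" using z r by (auto simp: closed_annulus_def)
  qed
  have Bnz: "poly B z \<noteq> 0" if z: "z \<in> closed_annulus r 1" for z
  proof -
    have "Re (P z + of_real d + 1) > 0" using pos(1)[OF z] by simp
    then have "P z + of_real d + 1 \<noteq> 0" by (metis less_irrefl zero_complex.sel(1))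
    then show ?thesis using val(2)[OF pos(2)[OF z]] pos(2)[OF z] by simp
  qed
  have ratio: "cmod (poly A z / poly B z) \<le> 1" if z: "z \<in> closed_annulus r 1" for z
  proof -
    define w where "w = P z + of_real d"
    have w: "Re w > 0" using pos(1)[OF z] by (simp add: w_def)
    have "(cmod (w - 1))\<^sup>2 \<le> (cmod (w + 1))\<^sup>2" unfolding cmod_power2 using w by (simp add: power2_eq_square algebra_simps)
    then have "cmod (w - 1) \<le> cmod (w + 1)" by (simp add: power2_le_iff_abs_le)
    moreover have "poly A z / poly B z = (w - 1) / (w + 1)"
      using val[OF pos(2)[OF z]] pos(2)[OF z] by (simp add: w_def)
    moreover have "w + 1 \<noteq> 0" using Bnz[OF z] val(2)[OF pos(2)[OF z]] by (auto simp: w_def)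
    ultimately show ?thesis by (simp add: norm_divide)
  qed
  have "complex_of_real 1 \<in> closed_annulus r 1" using r by (simp add: closed_annulus_def)
  then have ne: "closed_annulus r 1 \<noteq> {}" by blast
  have "norm (poly_op A T o\<^sub>L inverse_op (poly_op B T)) \<le> (SUP z\<in>closed_annulus r 1. cmod (poly A z / poly B z))"
    using vN Bnz unfolding spectral_set_def by blast
  also have "\<dots> \<le> 1" using ne ratio by (intro cSUP_least) auto
  finally have nAB: "norm (poly_op A T o\<^sub>L inverse_op (poly_op B T)) \<le> 1" .
  have "B \<noteq> 0" using ne Bnz by auto
  then obtain B' where B': "is_inverse_op (poly_op B T) B'"
    using poly_op_invertible[OF T, of B] Bnz spec by blast
  have inv: "inverse_op (poly_op B T) (poly_op B T u) = u" for u
    using B' by (simp only: inverse_op_eq[OF B']) (metis is_inverse_op_def blinfun_apply_blinfun_compose blinfun_apply_id_blinfun)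
  have le: "norm (poly_op A T u) \<le> norm (poly_op B T u)" for u
  proof -
    have "norm ((poly_op A T o\<^sub>L inverse_op (poly_op B T)) (poly_op B T u)) \<le> 1 * norm (poly_op B T u)"
      by (rule order_trans[OF norm_blinfun mult_right_mono[OF nAB]]) simp
    then show ?thesis by (simp add: inv)
  qed
  define u where "u = op_power T_inv n x"
  have Tn: "op_power T n u = x"
  proof -
    have "laurent_op (monom 1 n) n = Phi (\<lambda>z. 1)"
      by (rule hol_calc_laurent_poly[symmetric]) (simp add: poly_monom)
    then have "laurent_op (monom 1 n) n x = x" by (simp add: scalar_op_simps)
    then show ?thesis by (simp add: laurent_op_def poly_op_monom u_def)
  qed
  have pu: "poly_op p T u = Phi P x" by (simp add: hol_calc_laurent_poly[OF p] laurent_op_def u_def)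
  have "poly_op A T u = Phi P x + (d - 1) *\<^sub>R x" "poly_op B T u = Phi P x + (d + 1) *\<^sub>R x"
    by (simp_all only: A_def B_def poly_op_add poly_op_smult poly_op_monom blinfun.add_left cmul_op_apply pu Tn scaleR_eq_scaleC scaleC_one)
  then have "(norm (Phi P x + (d - 1) *\<^sub>R x))\<^sup>2 \<le> (norm (Phi P x + (d + 1) *\<^sub>R x))\<^sup>2" using le[of u] by simp
  then have "0 \<le> inner (Phi P x) x + d * inner x x"
    by (simp add: power2_norm_eq_inner inner_add inner_commute algebra_simps)
  moreover have "norm (Phi (\<lambda>z. H a b z - P z)) \<le> C * d"
    using P(2) by (intro C(2) holomorphic_intros H_holomorphic a b laurent_poly_holomorphic P(1)) (auto intro: less_imp_le)
  then have "norm (Phi (H a b) - Phi P) \<le> C * d"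
    by (simp add: hol_calc_diff H_holomorphic a b laurent_poly_holomorphic P(1))
  then have "\<bar>inner (Phi (H a b) x) x - inner (Phi P x) x\<bar> \<le> C * d * (norm x)\<^sup>2"
    using inner_perturbation[of "Phi (H a b)" x "Phi P"] mult_right_mono[of "norm (Phi (H a b) - Phi P)" "C * d" "(norm x)\<^sup>2"] by simp
  ultimately have "- ((C * d + d) * (norm x)\<^sup>2) \<le> inner (Phi (H a b) x) x"
    unfolding distrib_right power2_norm_eq_inner by linarith
  then show "- (e * (norm x)\<^sup>2) \<le> inner (Phi (H a b) x) x" unfolding d(2) .
qed

end

lemma closure_annulus:
  assumes r: "0 < r" "r < 1"
  shows "closure (annulus r) = closed_annulus r 1"
proof
  have "annulus r \<subseteq> closed_annulus r 1" by (auto simp: annulus_def closed_annulus_def)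
  then show "closure (annulus r) \<subseteq> closed_annulus r 1"
    by (rule closure_minimal) (simp add: compact_imp_closed)
  show "closed_annulus r 1 \<subseteq> closure (annulus r)"
  proof
    fix z assume z: "z \<in> closed_annulus r 1"
    then have z': "r \<le> cmod z" "cmod z \<le> 1" "z \<noteq> 0" using r by (auto simp: closed_annulus_def)
    \<comment> \<open>Move radially towards the circle of radius \<open>(1 + r) / 2\<close>.\<close>
    define m where "m = (1 + r) / 2"
    have m: "r < m" "m < 1" using r by (auto simp: m_def)
    define t where "t n = cmod z + (m - cmod z) * inverse (real (Suc n))" for n
    have t: "r < t n" "t n < 1" for n
    proof -
      define i where "i = inverse (real (Suc n))"
      have i: "0 < i" "i \<le> 1" by (auto simp: i_def inverse_le_1_iff)
      have "t n = (1 - i) * cmod z + i * m" by (simp add: t_def i_def algebra_simps)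
      moreover have "(1 - i) * r \<le> (1 - i) * cmod z" by (rule mult_left_mono) (use z' i in auto)
      moreover have "(1 - i) * cmod z \<le> (1 - i) * 1" by (rule mult_left_mono) (use z' i in auto)
      moreover have "i * r < i * m" "i * m < i * 1" using m i by auto
      ultimately show "r < t n" "t n < 1" by (simp_all add: algebra_simps)
    qed
    have "(\<lambda>n. of_real (t n / cmod z) * z) \<longlonglongrightarrow> of_real ((cmod z + (m - cmod z) * 0) / cmod z) * z"
      unfolding t_def using z'(3) by (intro tendsto_intros LIMSEQ_inverse_real_of_nat) auto
    then have "(\<lambda>n. of_real (t n / cmod z) * z) \<longlonglongrightarrow> z" using z'(3) by simp
    moreover have "of_real (t n / cmod z) * z \<in> annulus r" for n
      using t[of n] r z'(3) by (simp add: annulus_def norm_mult norm_divide)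
    ultimately show "z \<in> closure (annulus r)" unfolding closure_sequential
      by (intro exI[of _ "\<lambda>n. of_real (t n / cmod z) * z"]) auto
  qed
qed

section \<open>Rational functions\<close>

text \<open>A rational function is treated as a limit of Laurent polynomials on a closed annulus free of
  its poles.\<close>

definition laurent_limit :: "complex set \<Rightarrow> (complex \<Rightarrow> complex) \<Rightarrow> bool" where
  "laurent_limit Y f \<longleftrightarrow> (\<forall>e>0. \<exists>g. laurent_poly g \<and> (\<forall>z\<in>Y. cmod (f z - g z) < e))"

lemma laurent_limit_mult:
  assumes f: "laurent_limit Y f" and g: "laurent_limit Y g"
    and M1: "\<And>z. z \<in> Y \<Longrightarrow> cmod (f z) \<le> M1" and M2: "\<And>z. z \<in> Y \<Longrightarrow> cmod (g z) \<le> M2"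
  shows "laurent_limit Y (\<lambda>z. f z * g z)"
  unfolding laurent_limit_def
proof (intro allI impI)
  fix e :: real assume e: "0 < e"
  define K where "K = \<bar>M1\<bar> + \<bar>M2\<bar> + 2"
  define d where "d = min 1 (e / K)"
  have K: "K > 0" by (simp add: K_def)
  have d: "0 < d" "d \<le> 1" "d * K \<le> e" using e K by (auto simp: d_def min_def field_simps)
  obtain f' where f': "laurent_poly f'" "\<And>z. z \<in> Y \<Longrightarrow> cmod (f z - f' z) < d" using f d unfolding laurent_limit_def by metis
  obtain g' where g': "laurent_poly g'" "\<And>z. z \<in> Y \<Longrightarrow> cmod (g z - g' z) < d" using g d unfolding laurent_limit_def by metis
  have "cmod (f z * g z - f' z * g' z) < e" if z: "z \<in> Y" for z
  proof -
    have "cmod (g' z) \<le> \<bar>M2\<bar> + 1"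
      using M2[OF z] g'(2)[OF z] d norm_triangle_ineq3[of "g' z" "g z"] by (simp add: norm_minus_commute)
    moreover have "f z * g z - f' z * g' z = f z * (g z - g' z) + (f z - f' z) * g' z" by (simp add: algebra_simps)
    then have "cmod (f z * g z - f' z * g' z) \<le> cmod (f z) * cmod (g z - g' z) + cmod (f z - f' z) * cmod (g' z)"
      by (metis norm_mult norm_triangle_ineq)
    moreover have "cmod (f z) * cmod (g z - g' z) \<le> \<bar>M1\<bar> * d"
      using M1[OF z] g'(2)[OF z] by (intro mult_mono) auto
    moreover have "cmod (f z - f' z) * cmod (g' z) \<le> d * (\<bar>M2\<bar> + 1)"
      using calculation(1) f'(2)[OF z] d by (intro mult_mono) auto
    ultimately have "cmod (f z * g z - f' z * g' z) \<le> d * (K - 1)" by (simp add: K_def algebra_simps)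
    also have "\<dots> < d * K" using d by simp
    finally show ?thesis using d by simp
  qed
  then show "\<exists>h. laurent_poly h \<and> (\<forall>z\<in>Y. cmod (f z * g z - h z) < e)"
    by (intro exI[of _ "\<lambda>z. f' z * g' z"]) (auto intro: laurent_poly_mult f' g')
qed

lemma laurent_limit_laurent_poly: "laurent_poly f \<Longrightarrow> laurent_limit Y f"
  unfolding laurent_limit_def by (metis cancel_comm_monoid_add_class.diff_cancel norm_zero)

lemma geometric_tail:
  fixes x :: complex
  assumes "cmod x \<le> \<rho>" "\<rho> < 1"
  shows "cmod (1 / (1 - x) - (\<Sum>n<N. x ^ n)) \<le> \<rho> ^ N / (1 - \<rho>)"
proof -
  have x: "x \<noteq> 1" using assms by auto
  have "1 / (1 - x) - (\<Sum>n<N. x ^ n) = x ^ N / (1 - x)"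
  proof -
    have "(\<Sum>n<N. x ^ n) = (1 - x ^ N) / (1 - x)"
      using x by (simp add: sum_gp_strict)
    then show ?thesis by (simp add: diff_divide_distrib)
  qed
  moreover have "1 - \<rho> \<le> cmod (1 - x)" using assms norm_triangle_ineq2[of 1 x] by simp
  moreover have "cmod x ^ N \<le> \<rho> ^ N" using assms by (intro power_mono) auto
  moreover have "0 \<le> \<rho> ^ N" using assms norm_ge_zero[of x] by (intro zero_le_power) linarith
  ultimately have "cmod x ^ N / cmod (1 - x) \<le> \<rho> ^ N / (1 - \<rho>)" using assms by (intro frac_le) auto
  then show ?thesis
    using \<open>1 / (1 - x) - (\<Sum>n<N. x ^ n) = x ^ N / (1 - x)\<close> by (simp add: norm_divide norm_power)
qed

lemma laurent_limit_geometric: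
  assumes x: "laurent_poly x" "\<And>z. z \<in> Y \<Longrightarrow> cmod (x z) \<le> \<rho>" and \<rho>: "0 \<le> \<rho>" "\<rho> < 1"
  shows "laurent_limit Y (\<lambda>z. 1 / (1 - x z))"
  unfolding laurent_limit_def
proof (intro allI impI)
  fix e :: real assume e: "0 < e"
  have "(\<lambda>N. \<rho> ^ N / (1 - \<rho>)) \<longlonglongrightarrow> 0 / (1 - \<rho>)" using \<rho> by (intro tendsto_intros LIMSEQ_power_zero) auto
  then have "\<forall>\<^sub>F N in sequentially. \<rho> ^ N / (1 - \<rho>) < e" using e by (intro order_tendstoD(2)) auto
  then obtain N where "\<rho> ^ N / (1 - \<rho>) < e" by (auto simp: eventually_sequentially)
  then have "\<forall>z\<in>Y. cmod (1 / (1 - x z) - (\<Sum>n<N. x z ^ n)) < e"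
    using geometric_tail[OF x(2) \<rho>(2)] by (meson le_less_trans)
  then show "\<exists>g. laurent_poly g \<and> (\<forall>z\<in>Y. cmod (1 / (1 - x z) - g z) < e)"
    by (intro exI[of _ "\<lambda>z. \<Sum>n<N. x z ^ n"]) (auto intro!: laurent_poly_sum laurent_poly_power x)
qed

lemma bounded_inverse_poly:
  assumes "\<And>z. z \<in> closed_annulus \<alpha> \<beta> \<Longrightarrow> poly p z \<noteq> 0"
  obtains M where "\<And>z. z \<in> closed_annulus \<alpha> \<beta> \<Longrightarrow> cmod (1 / poly p z) \<le> M"
proof -
  have "continuous_on (closed_annulus \<alpha> \<beta>) (\<lambda>z. 1 / poly p z)"
    using assms by (intro continuous_intros) auto
  then have "bounded ((\<lambda>z. 1 / poly p z) ` closed_annulus \<alpha> \<beta>)"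
    by (intro compact_imp_bounded compact_continuous_image) auto
  then show thesis using that unfolding bounded_iff by blast
qed

text \<open>Geometric series, in \<open>w / z\<close> or in \<open>z / w\<close> according to the side of the annulus on which \<open>w\<close> lies.\<close>

lemma laurent_limit_inverse_linear:
  assumes \<alpha>: "0 < \<alpha>" and w: "w \<notin> closed_annulus \<alpha> \<beta>"
  shows "laurent_limit (closed_annulus \<alpha> \<beta>) (\<lambda>z. 1 / (z - w))"
proof -
  let ?Y = "closed_annulus \<alpha> \<beta>"
  obtain M where M: "\<And>z. z \<in> ?Y \<Longrightarrow> cmod (1 / poly [:- w, 1:] z) \<le> M"
    using bounded_inverse_poly[of \<alpha> \<beta> "[:- w, 1:]"] w by (metis add.right_inverse add_uminus_conv_diff eq_iff_diff_eq_0 mult.right_neutral poly_pCons poly_0 add.commute mult_zero_right add_0_right)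
  show ?thesis
  proof (cases "cmod w < \<alpha>")
    case True
    have x: "cmod (w / z) \<le> cmod w / \<alpha>" if "z \<in> ?Y" for z
      using that \<alpha> by (auto simp: norm_divide closed_annulus_def intro!: divide_left_mono mult_pos_pos)
    have g: "laurent_limit ?Y (\<lambda>z. 1 / (1 - w / z))"
      by (rule laurent_limit_geometric[OF laurent_poly_inverse x]) (use True \<alpha> in auto)
    have b: "cmod (1 / (1 - w / z)) \<le> 1 / (1 - cmod w / \<alpha>)" if "z \<in> ?Y" for z
      using geometric_tail[of "w / z" "cmod w / \<alpha>" 0] x[OF that] True \<alpha> by simp
    have "laurent_limit ?Y (\<lambda>z. 1 / z * (1 / (1 - w / z)))"
    proof (rule laurent_limit_mult[OF laurent_limit_laurent_poly[OF laurent_poly_inverse] g _ b])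
      show "cmod (1 / z) \<le> 1 / \<alpha>" if "z \<in> ?Y" for z
        using that \<alpha> by (auto simp: norm_divide closed_annulus_def intro!: divide_left_mono mult_pos_pos)
    qed
    moreover have "1 / z * (1 / (1 - w / z)) = 1 / (z - w)" if "z \<in> ?Y" for z
      using that \<alpha> by (cases "z = 0") (auto simp: closed_annulus_def right_diff_distrib)
    ultimately show ?thesis unfolding laurent_limit_def by (metis (no_types, lifting))
  next
    case False
    then have w': "\<beta> < cmod w" using w by (auto simp: closed_annulus_def)
    show ?thesis
    proof (cases "?Y = {}")
      case True
      then show ?thesis unfolding laurent_limit_def by (auto intro!: exI[of _ "\<lambda>z. 0"])
    next
      case False
      then have \<beta>: "0 < \<beta>" using \<alpha> by (auto simp: closed_annulus_def)
      then have w0: "w \<noteq> 0" "cmod w > 0" using w' by auto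
      have x: "cmod (1 / w * z) \<le> \<beta> / cmod w" if "z \<in> ?Y" for z
        using that by (auto simp: norm_divide norm_mult closed_annulus_def intro!: divide_right_mono)
      have g: "laurent_limit ?Y (\<lambda>z. 1 / (1 - 1 / w * z))"
        by (rule laurent_limit_geometric[OF laurent_poly_linear x]) (use w' w0 \<beta> in auto)
      have b: "cmod (1 / (1 - 1 / w * z)) \<le> 1 / (1 - \<beta> / cmod w)" if "z \<in> ?Y" for z
        using geometric_tail[of "1 / w * z" "\<beta> / cmod w" 0] x[OF that] w' w0 by simp
      have "laurent_limit ?Y (\<lambda>z. - (1 / w) * (1 / (1 - 1 / w * z)))"
        by (rule laurent_limit_mult[OF laurent_limit_laurent_poly[OF laurent_poly_const] g order_refl b])
      moreover have "- (1 / w) * (1 / (1 - 1 / w * z)) = 1 / (z - w)" if "z \<in> ?Y" for z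
      proof -
        have "z \<noteq> w" using that w by auto
        then have "1 - 1 / w * z \<noteq> 0" "z - w \<noteq> 0" using w0 by (auto simp: field_simps)
        moreover have "- w * (1 - 1 / w * z) = z - w" using w0 by (simp add: right_diff_distrib)
        ultimately show ?thesis using w0 by (simp add: field_simps)
      qed
      ultimately show ?thesis unfolding laurent_limit_def by (metis (no_types, lifting))
    qed
  qed
qed

lemma laurent_limit_inverse_poly:
  assumes \<alpha>: "0 < \<alpha>" and "\<And>z. z \<in> closed_annulus \<alpha> \<beta> \<Longrightarrow> poly p z \<noteq> 0" and "p \<noteq> 0"
  shows "laurent_limit (closed_annulus \<alpha> \<beta>) (\<lambda>z. 1 / poly p z)"
  using assms(2,3)
proof (induction "degree p" arbitrary: p)
  case 0
  then obtain c where "p = [:c:]" by (metis degree_eq_zeroE)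
  then show ?case by (simp add: laurent_limit_laurent_poly)
next
  case (Suc n)
  then have "\<not> constant (poly p)" by (simp add: constant_degree)
  then obtain w where w: "poly p w = 0" using fundamental_theorem_of_algebra by blast
  then obtain q where q: "p = [:- w, 1:] * q" by (metis dvdE poly_eq_0_iff_dvd)
  have q0: "q \<noteq> 0" using q Suc.prems(2) by auto
  have "degree p = degree [:- w, 1:] + degree q"
    unfolding q by (rule degree_mult_eq) (use q0 in auto)
  then have "degree q = n" using Suc(2) by simp
  have val: "poly p z = (z - w) * poly q z" for z by (simp add: q algebra_simps)
  have qnz: "poly q z \<noteq> 0" if "z \<in> closed_annulus \<alpha> \<beta>" for z using Suc.prems(1)[OF that] val[of z] by auto
  have wn: "w \<notin> closed_annulus \<alpha> \<beta>" using w Suc.prems(1) by blast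
  have lnz: "poly [:- w, 1:] z \<noteq> 0" if "z \<in> closed_annulus \<alpha> \<beta>" for z using that wn by auto
  obtain M1 where M1: "\<And>z. z \<in> closed_annulus \<alpha> \<beta> \<Longrightarrow> cmod (1 / poly [:- w, 1:] z) \<le> M1"
    using bounded_inverse_poly[OF lnz] by blast
  obtain M2 where M2: "\<And>z. z \<in> closed_annulus \<alpha> \<beta> \<Longrightarrow> cmod (1 / poly q z) \<le> M2"
    using bounded_inverse_poly[OF qnz] by blast
  have "laurent_limit (closed_annulus \<alpha> \<beta>) (\<lambda>z. 1 / (z - w) * (1 / poly q z))"
    by (rule laurent_limit_mult[OF laurent_limit_inverse_linear[OF \<alpha> wn] Suc(1)[OF \<open>degree q = n\<close>[symmetric] qnz q0] _ M2])
       (use M1 in auto)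
  then show ?case unfolding val by simp
qed

text \<open>The von Neumann inequality for Laurent polynomials holds with the supremum over the slightly larger
  annulus \<open>s r \<le> |z| \<le> 1 / s\<close>. For \<open>s\<close> near one the quotient \<open>p / q\<close> has no poles there and is nearly
  bounded by its supremum over the original annulus.\<close>

lemma spectral_set_of_accretive_kernels:
  fixes T :: "'a::complex_hilbert_space \<Rightarrow>\<^sub>L 'a"
  assumes T: "complex_linear T" and r: "0 < r" "r < 1" and spec: "op_spectrum T \<subseteq> closed_annulus r 1"
    and acc: "\<And>s c. 0 < s \<Longrightarrow> s < 1 \<Longrightarrow> cmod c = 1 \<Longrightarrow>
      accretive (hol_calc (open_annulus (s * r) (1 / s)) (kernel_operator.H r s c c) T)"
  shows "spectral_set (closed_annulus r 1) T"
  unfolding spectral_set_def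
proof (intro conjI allI impI spec)
  let ?K = "closed_annulus r 1"
  fix p q assume q: "\<forall>z\<in>?K. poly q z \<noteq> 0"
  define M where "M = (SUP z\<in>?K. cmod (poly p z / poly q z))"
  have one: "1 \<in> ?K" using r by (simp add: closed_annulus_def)
  have q0: "q \<noteq> 0" using q one by auto
  have "continuous_on ?K (\<lambda>z. cmod (poly p z / poly q z))" using q by (intro continuous_intros) auto
  then have bdd: "bdd_above ((\<lambda>z. cmod (poly p z / poly q z)) ` ?K)"
    by (intro bounded_imp_bdd_above compact_imp_bounded compact_continuous_image) auto
  have M: "cmod (poly p z / poly q z) \<le> M" if "z \<in> ?K" for z
    unfolding M_def by (rule cSUP_upper[OF that bdd])
  have M0: "0 \<le> M" using M[OF one] norm_ge_zero order_trans by blast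
  obtain B' where B': "is_inverse_op (poly_op q T) B'"
    using poly_op_invertible[OF T, of q] q spec q0 by blast
  have "norm (poly_op p T o\<^sub>L B') \<le> M"
  proof (rule field_le_epsilon)
    fix e0 :: real assume "0 < e0"
    define e where "e = e0 / 4"
    have e: "0 < e" using \<open>0 < e0\<close> by (simp add: e_def)
    define W where "W = {z. cmod (poly p z) < (M + e) * cmod (poly q z)}"
    have "open W" unfolding W_def by (intro open_Collect_less continuous_intros)
    moreover have "?K \<subseteq> W"
    proof
      fix z assume z: "z \<in> ?K"
      have qz: "cmod (poly q z) > 0" using q z by simp
      then have "cmod (poly p z) \<le> M * cmod (poly q z)" using M[OF z] by (simp add: norm_divide field_simps)
      also have "\<dots> < (M + e) * cmod (poly q z)" using e qz by (simp add: distrib_right)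
      finally show "z \<in> W" by (simp add: W_def)
    qed
    ultimately obtain \<delta> where \<delta>: "\<delta> > 0" "(\<Union>x\<in>?K. ball x \<delta>) \<subseteq> W"
      using compact_subset_open_imp_ball_epsilon_subset[of ?K W] by auto
    define s where "s = 1 / (1 + \<delta> / 2)"
    have s: "0 < s" "s < 1" "1 / s - 1 < \<delta>" using \<delta> by (auto simp: s_def field_simps)
    have s_close: "1 / s - 1 < \<delta>" by (rule s(3))
    have sr: "r - s * r < \<delta>"
    proof -
      have "r * (1 - s) \<le> 1 * (1 - s)" using r s by (intro mult_right_mono) auto
      also have "1 * (1 - s) = (1 - s) / 1" by simp
      also have "(1 - s) / 1 \<le> (1 - s) / s" using s by (intro divide_left_mono) auto
      also have "(1 - s) / s = 1 / s - 1" using s by (simp add: field_simps)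
      finally show ?thesis using s by (simp add: algebra_simps)
    qed
    interpret kernel_operator T r s by unfold_locales (use T r s spec in auto)
    let ?Y = "closed_annulus (s * r) (1 / s)"
    have sr0: "0 < s * r" using s r by simp
    have YW: "?Y \<subseteq> W"
    proof
      fix z assume z: "z \<in> ?Y"
      then have z': "s * r \<le> cmod z" "cmod z \<le> 1 / s" by (auto simp: closed_annulus_def)
      then have z0: "0 < cmod z" using sr0 by linarith
      define t where "t = max r (min 1 (cmod z))"
      define x where "x = of_real (t / cmod z) * z"
      have "0 < t" using r by (simp add: t_def)
      then have "cmod x = t" using z0 by (simp add: x_def norm_mult norm_divide)
      then have "x \<in> ?K" using r by (auto simp: closed_annulus_def t_def)
      moreover have "x - z = of_real ((t - cmod z) / cmod z) * z" using z0 by (simp add: x_def diff_divide_distrib left_diff_distrib)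
      then have "dist x z = \<bar>t - cmod z\<bar>" using z0 by (simp add: dist_norm norm_mult norm_divide del: of_real_divide of_real_diff)
      then have "dist x z < \<delta>" using z' s_close sr \<delta>(1) r by (auto simp: t_def)
      ultimately show "z \<in> W" using \<delta>(2) by (meson UN_I mem_ball subsetD)
    qed
    have pq: "cmod (poly p z) < (M + e) * cmod (poly q z)" "poly q z \<noteq> 0" if "z \<in> ?Y" for z
    proof -
      show 1: "cmod (poly p z) < (M + e) * cmod (poly q z)" using YW that by (auto simp: W_def)
      show "poly q z \<noteq> 0" using 1 norm_ge_zero[of "poly p z"] by (metis mult_zero_right norm_zero not_less)
    qed
    obtain a' b' C where ab: "s * r < a'" "a' < r" "1 < b'" "b' < 1 / s" and C: "0 < C"
      "\<And>f B. f holomorphic_on U \<Longrightarrow> (\<And>z. z \<in> closed_annulus a' b' \<Longrightarrow> cmod (f z) \<le> B) \<Longrightarrow> norm (Phi f) \<le> C * B"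
      by (rule hol_calc_bound) blast
    have bnd: "\<exists>M>0. \<forall>z\<in>?Y. cmod (poly p z) \<le> M" for p
    proof -
      have "bounded (poly p ` ?Y)" by (intro compact_imp_bounded compact_continuous_image continuous_intros) auto
      then show ?thesis unfolding bounded_pos by blast
    qed
    obtain Mp Mq where Mp: "Mp > 0" "\<And>z. z \<in> ?Y \<Longrightarrow> cmod (poly p z) \<le> Mp"
      and Mq: "Mq > 0" "\<And>z. z \<in> ?Y \<Longrightarrow> cmod (poly q z) \<le> Mq"
      using bnd[of p] bnd[of q] by blast
    define K where "K = Mp + norm B' * C * (Mp * Mq)"
    have K: "K > 0" "Mp \<le> K" "norm B' * C * (Mp * Mq) \<le> K" using Mp Mq C by (auto simp: K_def add_pos_nonneg)
    define d where "d = e / K"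
    have d: "d > 0" "K * d = e" using e K by (auto simp: d_def)
    have "laurent_limit ?Y (\<lambda>z. 1 / poly q z)"
      by (rule laurent_limit_inverse_poly[OF sr0 pq(2) q0])
    then obtain R where R: "laurent_poly R" "\<And>z. z \<in> ?Y \<Longrightarrow> cmod (1 / poly q z - R z) < d"
      using d(1) unfolding laurent_limit_def by metis
    define P where "P z = poly p z * R z" for z
    have P: "laurent_poly P" unfolding P_def by (intro laurent_poly_mult R) simp
    have P_le: "cmod (P z) \<le> M + 2 * e" if z: "z \<in> ?Y" for z
    proof -
      have "P z = poly p z / poly q z - poly p z * (1 / poly q z - R z)" by (simp add: P_def algebra_simps)
      then have "cmod (P z) \<le> cmod (poly p z / poly q z) + cmod (poly p z) * cmod (1 / poly q z - R z)"
        by (metis norm_mult norm_triangle_ineq4)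
      also have "cmod (poly p z / poly q z) \<le> M + e" using pq[OF z] by (simp add: norm_divide field_simps)
      also have "cmod (poly p z) * cmod (1 / poly q z - R z) \<le> Mp * d"
        using Mp(2)[OF z] R(2)[OF z] Mp(1) by (intro mult_mono) auto
      also have "Mp * d \<le> K * d" using K d by (intro mult_right_mono) auto
      finally show ?thesis using d by simp
    qed
    have accH: "accretive (Phi (H a b))" if "cmod a = 1" "cmod b = 1" for a b
      by (rule accretive_general_kernel[OF acc[OF s(1,2)] that])
    have "norm (Phi P) \<le> M + 3 * e"
      by (rule norm_laurent_poly_le[OF accH P P_le]) (use e M0 in auto)
    have Phi_poly: "Phi (poly f) = poly_op f T" for f
      using hol_calc_laurent_poly[of "poly f" f 0] by (simp add: laurent_op_def)
    have "Phi (\<lambda>z. poly q z * P z - poly p z) = (poly_op q T o\<^sub>L Phi P) - poly_op p T"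
      by (subst hol_calc_diff) (auto intro!: laurent_poly_holomorphic laurent_poly_mult P simp: Phi_poly hol_calc_mult_laurent_poly[OF _ P])
    moreover have "norm (Phi (\<lambda>z. poly q z * P z - poly p z)) \<le> C * (Mp * Mq * d)"
    proof (rule C(2))
      show "(\<lambda>z. poly q z * P z - poly p z) holomorphic_on U"
        by (intro laurent_poly_holomorphic laurent_poly_diff laurent_poly_mult P) auto
      fix z assume "z \<in> closed_annulus a' b'"
      then have z: "z \<in> ?Y" using ab by (auto simp: closed_annulus_def)
      have "poly q z * P z - poly p z = - (poly p z * poly q z * (1 / poly q z - R z))"
        using pq(2)[OF z] by (simp add: P_def field_simps)
      then have "cmod (poly q z * P z - poly p z) = cmod (poly p z) * cmod (poly q z) * cmod (1 / poly q z - R z)"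
        by (metis norm_minus_cancel norm_mult)
      also have "\<dots> \<le> Mp * Mq * d"
        using Mp(2)[OF z] Mq(2)[OF z] R(2)[OF z] Mp(1) Mq(1) by (intro mult_mono) auto
      finally show "cmod (poly q z * P z - poly p z) \<le> Mp * Mq * d" .
    qed
    ultimately have near: "norm ((poly_op q T o\<^sub>L Phi P) - poly_op p T) \<le> C * (Mp * Mq * d)" by simp
    have B'q: "B' o\<^sub>L (poly_op q T o\<^sub>L A) = A" for A
      using B' by (simp add: is_inverse_op_def compose_assoc[symmetric])
    have com: "poly_op p T o\<^sub>L B' = B' o\<^sub>L poly_op p T"
      by (rule is_inverse_op_commute[OF B']) (metis mult.commute poly_op_mult[OF T])
    have "Phi P - (poly_op p T o\<^sub>L B') = B' o\<^sub>L ((poly_op q T o\<^sub>L Phi P) - poly_op p T)"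
      by (simp add: compose.diff_right B'q com)
    then have "norm (Phi P - (poly_op p T o\<^sub>L B')) \<le> norm B' * (C * (Mp * Mq * d))"
      using norm_blinfun_compose[of B' "(poly_op q T o\<^sub>L Phi P) - poly_op p T"] mult_left_mono[OF near, of "norm B'"] by simp
    also have "\<dots> = norm B' * C * (Mp * Mq) * d" by (simp add: mult_ac)
    also have "\<dots> \<le> K * d" using K d by (intro mult_right_mono) auto
    finally have "norm (Phi P - (poly_op p T o\<^sub>L B')) \<le> e" using d by simp
    moreover have "norm (poly_op p T o\<^sub>L B') \<le> norm (Phi P) + norm (Phi P - (poly_op p T o\<^sub>L B'))"
      by (metis norm_triangle_sub norm_minus_commute)
    ultimately show "norm (poly_op p T o\<^sub>L B') \<le> M + e0"
      using \<open>norm (Phi P) \<le> M + 3 * e\<close> by (simp add: e_def)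
  qed
  then show "norm (poly_op p T o\<^sub>L inverse_op (poly_op q T)) \<le> (SUP z\<in>?K. cmod (poly p z / poly q z))"
    by (simp add: inverse_op_eq[OF B'] M_def)
qed simp

section \<open>The calculus at a triangular block operator\<close>

context
  fixes T X :: "'a::complex_hilbert_space \<Rightarrow>\<^sub>L 'a"
  assumes T: "complex_linear T" and X: "complex_linear X" and TX: "T o\<^sub>L X = X o\<^sub>L T"
begin

lemma scalar_minus_block:
  "scalar_op z - block_op T X 0 T = block_op (scalar_op z - T) (- X) 0 (scalar_op z - T)"
  by (rule blinfun_eqI) (auto simp: blinfun.diff_left blinfun.minus_left)

lemma resolvent_X_commute: "z \<notin> op_spectrum T \<Longrightarrow> resolvent T z (X x) = X (resolvent T z x)"
  using resolvent_commute[OF T _ X TX[symmetric]] by (metis blinfun_apply_blinfun_compose)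

lemma is_inverse_block:
  assumes z: "z \<notin> op_spectrum T"
  shows "is_inverse_op (scalar_op z - block_op T X 0 T)
    (block_op (resolvent T z) (resolvent T z o\<^sub>L X o\<^sub>L resolvent T z) 0 (resolvent T z))"
proof -
  have *: "(scalar_op z - T) o\<^sub>L resolvent T z = id_blinfun" "resolvent T z o\<^sub>L (scalar_op z - T) = id_blinfun"
    using resolvent_inverse[OF z] by (auto simp: is_inverse_op_def)
  have 1: "(scalar_op z - T) o\<^sub>L (resolvent T z o\<^sub>L X o\<^sub>L resolvent T z) = X o\<^sub>L resolvent T z"
    using *(1) by (metis compose_assoc compose_id(2))
  have 2: "(resolvent T z o\<^sub>L X o\<^sub>L resolvent T z) o\<^sub>L (scalar_op z - T) = resolvent T z o\<^sub>L X"
    by (simp only: compose_assoc *(2) compose_id)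
  show ?thesis
    unfolding is_inverse_op_def scalar_minus_block block_op_compose block_op_id[symmetric] block_op_eq_iff
    by (simp add: * 1 2 compose.minus_left compose.minus_right)
qed

lemma resolvent_block:
  "z \<notin> op_spectrum T \<Longrightarrow> resolvent (block_op T X 0 T) z =
    block_op (resolvent T z) (resolvent T z o\<^sub>L X o\<^sub>L resolvent T z) 0 (resolvent T z)"
  unfolding resolvent_def[of "block_op T X 0 T"] by (rule inverse_op_eq[OF is_inverse_block])

lemma op_spectrum_block: "op_spectrum (block_op T X 0 T) = op_spectrum T"
proof
  show "op_spectrum (block_op T X 0 T) \<subseteq> op_spectrum T"
    using is_inverse_block not_in_op_spectrum by blast
  show "op_spectrum T \<subseteq> op_spectrum (block_op T X 0 T)"
  proof (rule ccontr)
    assume "\<not> op_spectrum T \<subseteq> op_spectrum (block_op T X 0 T)"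
    then obtain z M where z: "z \<in> op_spectrum T" and M: "is_inverse_op (scalar_op z - block_op T X 0 T) M"
      using not_in_op_spectrum by blast
    \<comment> \<open>The lower right corner of the inverse is a right inverse of \<open>z - T\<close>, the upper left one a left inverse.\<close>
    define A where "A = scalar_op z - T"
    define d where "d = row_op 0 id_blinfun o\<^sub>L M o\<^sub>L column_op 0 id_blinfun"
    define a where "a = row_op id_blinfun 0 o\<^sub>L M o\<^sub>L column_op id_blinfun 0"
    have 1: "block_op A (- X) 0 A (M p) = p" and 2: "M (block_op A (- X) 0 A p) = p" for p
      using M unfolding is_inverse_op_def scalar_minus_block A_def[symmetric]
      by (metis blinfun_apply_blinfun_compose blinfun_apply_id_blinfun)+
    have Ad: "A o\<^sub>L d = id_blinfun"
    proof (rule blinfun_eqI)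
      fix v
      have "snd (block_op A (- X) 0 A (M (0, v))) = v" using 1[of "(0, v)"] by simp
      then show "(A o\<^sub>L d) v = id_blinfun v" by (simp add: d_def block_op_def)
    qed
    have aA: "a o\<^sub>L A = id_blinfun"
    proof (rule blinfun_eqI)
      fix x
      have "M (A x, 0) = (x, 0)" using 2[of "(x, 0)"] by simp
      then show "(a o\<^sub>L A) x = id_blinfun x" by (simp add: a_def)
    qed
    have "a = a o\<^sub>L (A o\<^sub>L d)" by (simp add: Ad)
    also have "\<dots> = d" by (simp add: compose_assoc[symmetric] aA)
    finally have "is_inverse_op A d" using Ad aA by (simp add: is_inverse_op_def)
    then show False using z not_in_op_spectrum unfolding A_def by blast
  qed
qed

text \<open>Integration by parts: the off-diagonal entry of the resolvent is \<open>X R\<^sup>2\<close>, and \<open>- R\<^sup>2\<close> is the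
  derivative of the resolvent \<open>R\<close>.\<close>

lemma hol_calc_block:
  assumes radii: "0 < R1" "R1 < a" "a \<le> b" "b < R2" and spec: "op_spectrum T \<subseteq> closed_annulus a b"
    and f: "f holomorphic_on open_annulus R1 R2"
  shows "hol_calc (open_annulus R1 R2) f (block_op T X 0 T) =
    block_op (hol_calc (open_annulus R1 R2) f T) (X o\<^sub>L hol_calc (open_annulus R1 R2) (deriv f) T) 0
      (hol_calc (open_annulus R1 R2) f T)"
proof -
  interpret k1: annular_operator T R1 a b R2 by unfold_locales (use T radii spec in auto)
  interpret k2: annular_operator "block_op T X 0 T" R1 a b R2
    by unfold_locales (use T X radii spec in \<open>auto simp: op_spectrum_block complex_linear_block\<close>)
  have cyc: "k2.cyc = k1.cyc" unfolding k2.cyc_def k1.cyc_def op_spectrum_block ..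
  let ?R = "resolvent T"
  have f': "deriv f holomorphic_on k1.U" by (rule holomorphic_deriv[OF f]) simp
  have fV: "f holomorphic_on k1.V" "deriv f holomorphic_on k1.V"
    using f f' by (auto elim: holomorphic_on_subset)
  have "cinner (hol_calc k1.U f (block_op T X 0 T) (x1, x2)) (u, v) =
      cinner (block_op (hol_calc k1.U f T) (X o\<^sub>L hol_calc k1.U (deriv f) T) 0 (hol_calc k1.U f T) (x1, x2)) (u, v)" for x1 x2 u v
  proof -
    define w where "w = adjoint_op X u"
    define g where "g z = cinner (?R z x2) w" for z
    define h where "h z = cinner (?R z (?R z x2)) w" for z
    have g_deriv: "(g has_field_derivative - h z) (at z)" if "z \<in> k1.V" for z
      unfolding g_def h_def by (rule resolvent_weak_derivative[OF T]) (use that in auto)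
    have g_hol: "g holomorphic_on k1.V" unfolding g_def by (rule k1.holomorphic_resolvent_V)
    have "deriv g holomorphic_on k1.V" by (rule holomorphic_deriv[OF g_hol k1.open_V])
    then have h_hol: "h holomorphic_on k1.V"
      by (rule holomorphic_transform[OF holomorphic_on_minus]) (use DERIV_imp_deriv[OF g_deriv] in auto)
    have parts: "cycle_integral k1.cyc (\<lambda>z. f z * h z) = cycle_integral k1.cyc (\<lambda>z. deriv f z * g z)"
    proof -
      have "cycle_integral k1.cyc (\<lambda>z. deriv f z * g z - f z * h z) = 0"
      proof (rule cycle_integral_primitive[OF k1.open_V k1.loops_V])
        fix z assume z: "z \<in> k1.V"
        have "(f has_field_derivative deriv f z) (at z)"
          using z by (intro holomorphic_derivI[OF f]) auto
        from DERIV_mult[OF this g_deriv[OF z]]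
        show "((\<lambda>z. f z * g z) has_field_derivative deriv f z * g z - f z * h z) (at z)"
          by (rule DERIV_cong) (simp add: algebra_simps)
      qed
      then show ?thesis
        using k1.cycle_simps(2)[OF holomorphic_on_mult[OF fV(2) g_hol] holomorphic_on_mult[OF fV(1) h_hol]] by simp
    qed
    have "cycle_integral k1.cyc (\<lambda>z. f z * cinner (resolvent (block_op T X 0 T) z (x1, x2)) (u, v)) =
        cycle_integral k1.cyc (\<lambda>z. (f z * cinner (?R z x1) u + f z * h z) + f z * cinner (?R z x2) v)"
    proof (rule cycle_integral_cong[OF k1.loops_V])
      fix z assume z: "z \<in> k1.V"
      then have zs: "z \<notin> op_spectrum T" by auto
      have "cinner (?R z (X (?R z x2))) u = h z"
        by (simp add: resolvent_X_commute[OF zs] h_def w_def cinner_adjoint(1)[OF X])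
      then show "f z * cinner (resolvent (block_op T X 0 T) z (x1, x2)) (u, v) =
          (f z * cinner (?R z x1) u + f z * h z) + f z * cinner (?R z x2) v"
        by (simp add: resolvent_block[OF zs] cinner_add_left distrib_left)
    qed
    also have "\<dots> = cycle_integral k1.cyc (\<lambda>z. f z * cinner (?R z x1) u) + cycle_integral k1.cyc (\<lambda>z. deriv f z * g z)
        + cycle_integral k1.cyc (\<lambda>z. f z * cinner (?R z x2) v)"
    proof -
      have hol: "(\<lambda>z. f z * cinner (?R z y) y') holomorphic_on k1.V" for y y'
        by (rule holomorphic_on_mult[OF fV(1) k1.holomorphic_resolvent_V])
      have fh: "(\<lambda>z. f z * h z) holomorphic_on k1.V" by (rule holomorphic_on_mult[OF fV(1) h_hol])
      show ?thesis
        unfolding k1.cycle_simps(1)[OF holomorphic_on_add[OF hol fh] hol] k1.cycle_simps(1)[OF hol fh] parts ..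
    qed
    finally have "cinner (hol_calc k1.U f (block_op T X 0 T) (x1, x2)) (u, v) =
        cinner (hol_calc k1.U f T x1) u + cinner (hol_calc k1.U (deriv f) T x2) w + cinner (hol_calc k1.U f T x2) v"
      unfolding k2.hol_calc_weak[OF f] k1.hol_calc_weak[OF f] k1.hol_calc_weak[OF f'] cyc g_def
      by (simp only: add_divide_distrib)
    then show ?thesis
      by (simp add: w_def cinner_adjoint(1)[OF X] cinner_add_left)
  qed
  then show ?thesis by (intro blinfun_eq_of_cinner) (metis surj_pair)
qed

end

section \<open>Rotations\<close>

lemma op_spectrum_cmul:
  assumes T: "complex_linear T" and \<alpha>: "cmod \<alpha> = 1" and spec: "op_spectrum T \<subseteq> closed_annulus a b"
  shows "op_spectrum (cmul_op \<alpha> T) \<subseteq> closed_annulus a b"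
proof
  fix z assume z: "z \<in> op_spectrum (cmul_op \<alpha> T)"
  have a0: "\<alpha> \<noteq> 0" using \<alpha> by auto
  have "z / \<alpha> \<in> op_spectrum T"
  proof (rule ccontr)
    assume "z / \<alpha> \<notin> op_spectrum T"
    then obtain B where B: "is_inverse_op (scalar_op (z / \<alpha>) - T) B" using not_in_op_spectrum by blast
    have B_lin: "complex_linear B" by (rule complex_linear_inverse[OF _ B]) (simp add: complex_linear_diff T)
    have eq: "scalar_op z - cmul_op \<alpha> T = cmul_op \<alpha> (scalar_op (z / \<alpha>) - T)"
      by (rule blinfun_eqI) (simp add: blinfun.diff_left scaleC_diff_right scaleC_scaleC a0)
    have "is_inverse_op (scalar_op z - cmul_op \<alpha> T) (cmul_op (1 / \<alpha>) B)"
      using B a0 unfolding is_inverse_op_def eq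
      by (simp add: cmul_op_compose compose_cmul_op B_lin compose_cmul_op[OF complex_linear_diff[OF complex_linear_simps(3) T]] cmul_op_cmul_op)
    then show False using z not_in_op_spectrum by blast
  qed
  then show "z \<in> closed_annulus a b" using spec \<alpha> by (auto simp: closed_annulus_def norm_divide)
qed

lemma op_power_cmul:
  assumes "complex_linear A"
  shows "op_power (cmul_op c A) n = cmul_op (c ^ n) (op_power A n)"
  by (induction n) (simp_all add: cmul_op_compose compose_cmul_op[OF assms] cmul_op_cmul_op)

text \<open>For Laurent polynomials this is algebra, and both sides are continuous in \<open>f\<close>.\<close>

lemma hol_calc_rotate:
  fixes T :: "'a::complex_hilbert_space \<Rightarrow>\<^sub>L 'a"
  assumes T: "complex_linear T" and radii: "0 < R1" "R1 < a" "a \<le> b" "b < R2"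
    and spec: "op_spectrum T \<subseteq> closed_annulus a b" and \<alpha>: "cmod \<alpha> = 1" and f: "approximable R1 R2 f"
  shows "hol_calc (open_annulus R1 R2) f (cmul_op \<alpha> T) = hol_calc (open_annulus R1 R2) (\<lambda>z. f (\<alpha> * z)) T"
proof -
  interpret k1: annular_operator T R1 a b R2 by unfold_locales (use T radii spec in auto)
  interpret k2: annular_operator "cmul_op \<alpha> T" R1 a b R2
    by unfold_locales (use T radii op_spectrum_cmul[OF T \<alpha> spec] in \<open>auto simp: complex_linear_cmul\<close>)
  have a0: "\<alpha> \<noteq> 0" using \<alpha> by auto
  have inv: "k2.T_inv = cmul_op (1 / \<alpha>) k1.T_inv"
  proof (rule is_inverse_op_unique)
    show "is_inverse_op (cmul_op \<alpha> T) k2.T_inv" using k2.T_inv by (simp add: is_inverse_op_def)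
    show "is_inverse_op (cmul_op \<alpha> T) (cmul_op (1 / \<alpha>) k1.T_inv)"
      using a0 by (simp add: is_inverse_op_def cmul_op_compose compose_cmul_op[OF T]
          compose_cmul_op[OF k1.complex_linear_T_inv] cmul_op_cmul_op k1.T_inv)
  qed
  have lp: "k2.Phi g = k1.Phi (\<lambda>z. g (\<alpha> * z))" if g: "laurent_poly g" for g
  proof -
    obtain p n where p: "\<And>z. z \<noteq> 0 \<Longrightarrow> g z = poly p z / z ^ n" using g by (auto simp: laurent_poly_def)
    have "k2.Phi g = poly_op p (cmul_op \<alpha> T) o\<^sub>L cmul_op ((1 / \<alpha>) ^ n) (op_power k1.T_inv n)"
      by (simp add: k2.hol_calc_laurent_poly[OF p] k2.laurent_op_def inv op_power_cmul[OF k1.complex_linear_T_inv])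
    also have "\<dots> = k1.laurent_op (smult ((1 / \<alpha>) ^ n) (pcompose p [:0, \<alpha>:])) n"
      by (simp add: k1.laurent_op_def poly_op_smult poly_op_cmul[OF T] cmul_op_compose
          compose_cmul_op[OF complex_linear_poly_op[OF complex_linear_cmul[OF T]]])
    also have "\<dots> = k1.Phi (\<lambda>z. g (\<alpha> * z))"
      by (rule k1.hol_calc_laurent_poly[symmetric])
         (use a0 in \<open>simp add: p poly_pcompose power_mult_distrib power_divide mult.commute\<close>)
    finally show ?thesis .
  qed
  have f_hol: "f holomorphic_on k1.U" using f by (simp add: approximable_def)
  have rot_U: "\<alpha> * z \<in> k1.U" if "z \<in> k1.U" for z using that \<alpha> by (simp add: open_annulus_def norm_mult)
  have fr_hol: "(\<lambda>z. f (\<alpha> * z)) holomorphic_on k1.U"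
    using holomorphic_on_compose_gen[of "\<lambda>z. \<alpha> * z" k1.U f k1.U] f_hol rot_U
    by (auto simp: o_def intro!: holomorphic_intros)
  obtain a1 b1 C1 where 1: "R1 < a1" "a1 < a" "b < b1" "b1 < R2" "0 < C1"
    "\<And>f B. f holomorphic_on k1.U \<Longrightarrow> (\<And>z. z \<in> closed_annulus a1 b1 \<Longrightarrow> cmod (f z) \<le> B) \<Longrightarrow> norm (k1.Phi f) \<le> C1 * B"
    by (rule k1.hol_calc_bound) blast
  obtain a2 b2 C2 where 2: "R1 < a2" "a2 < a" "b < b2" "b2 < R2" "0 < C2"
    "\<And>f B. f holomorphic_on k1.U \<Longrightarrow> (\<And>z. z \<in> closed_annulus a2 b2 \<Longrightarrow> cmod (f z) \<le> B) \<Longrightarrow> norm (k2.Phi f) \<le> C2 * B"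
    by (rule k2.hol_calc_bound) blast
  have "norm (k2.Phi f - k1.Phi (\<lambda>z. f (\<alpha> * z))) \<le> 0"
  proof (rule field_le_epsilon)
    fix e :: real assume e: "0 < e"
    define d where "d = e / (C1 + C2)"
    have C: "0 < C1 + C2" using 1(5) 2(5) by simp
    have d: "0 < d" "(C1 + C2) * d = e" using e C by (auto simp: d_def)
    have "R1 < min a1 a2" "max b1 b2 < R2" using 1 2 by auto
    then obtain g where g: "laurent_poly g" "\<And>z. z \<in> closed_annulus (min a1 a2) (max b1 b2) \<Longrightarrow> cmod (f z - g z) < d"
      using f d(1) unfolding approximable_def by metis
    have gr: "laurent_poly (\<lambda>z. g (\<alpha> * z))" by (rule laurent_poly_scale[OF g(1) a0])
    have "norm (k2.Phi (\<lambda>z. f z - g z)) \<le> C2 * d"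
      by (intro 2(6) holomorphic_intros f_hol k1.laurent_poly_holomorphic g(1) less_imp_le[OF g(2)])
         (auto simp: closed_annulus_def)
    then have n2: "norm (k2.Phi f - k2.Phi g) \<le> C2 * d"
      by (simp add: k2.hol_calc_diff f_hol k1.laurent_poly_holomorphic g(1))
    have "norm (k1.Phi (\<lambda>z. f (\<alpha> * z) - g (\<alpha> * z))) \<le> C1 * d"
      by (intro 1(6) holomorphic_on_diff fr_hol k1.laurent_poly_holomorphic[OF gr] less_imp_le[OF g(2)])
         (use \<alpha> in \<open>auto simp: closed_annulus_def norm_mult\<close>)
    then have n1: "norm (k1.Phi (\<lambda>z. f (\<alpha> * z)) - k1.Phi (\<lambda>z. g (\<alpha> * z))) \<le> C1 * d"
      by (simp add: k1.hol_calc_diff fr_hol k1.laurent_poly_holomorphic[OF gr])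
    have split: "k2.Phi f - k1.Phi (\<lambda>z. f (\<alpha> * z)) = (k2.Phi f - k2.Phi g) - (k1.Phi (\<lambda>z. f (\<alpha> * z)) - k1.Phi (\<lambda>z. g (\<alpha> * z)))"
      by (simp add: lp[OF g(1)])
    have "norm (k2.Phi f - k1.Phi (\<lambda>z. f (\<alpha> * z))) \<le> C2 * d + C1 * d"
      unfolding split by (rule order_trans[OF norm_triangle_ineq4 add_mono[OF n2 n1]])
    then show "norm (k2.Phi f - k1.Phi (\<lambda>z. f (\<alpha> * z))) \<le> 0 + e" using d(2) by (simp add: distrib_right)
  qed
  then show ?thesis by simp
qed

section \<open>Agler's criterion and the theorem\<close>

lemma (in kernel_operator) Gamma_eq_H:
  assumes "z \<in> U"
  shows "Gamma_ker r (1 - s) z = H 1 1 z"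
  using Gamma_ker_eq_kernel[of r "1 - s" z] r s assms
  by (simp add: H_def Gamma_dom_def open_annulus_def)

lemma (in kernel_operator) Gamma_op_eq:
  shows "Gamma_op r (1 - s) T = Phi (H 1 1)" and "Gamma_deriv_op r (1 - s) T = Phi (deriv (H 1 1))"
proof -
  have U: "Gamma_dom r (1 - s) = U" by (simp add: Gamma_dom_def open_annulus_def)
  have H: "H 1 1 holomorphic_on U" by (rule H_holomorphic) auto
  show "Gamma_op r (1 - s) T = Phi (H 1 1)"
    unfolding Gamma_op_def U by (rule hol_calc_cong[OF H, symmetric]) (simp add: Gamma_eq_H)
  have "deriv (H 1 1) z = deriv (Gamma_ker r (1 - s)) z" if z: "z \<in> U" for z
  proof (rule deriv_cong_ev[OF _ refl])
    have "\<forall>\<^sub>F w in nhds z. w \<in> U" using z by (intro eventually_nhds_in_open) auto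
    then show "\<forall>\<^sub>F w in nhds z. H 1 1 w = Gamma_ker r (1 - s) w"
      by eventually_elim (simp add: Gamma_eq_H)
  qed
  then show "Gamma_deriv_op r (1 - s) T = Phi (deriv (H 1 1))"
    unfolding Gamma_deriv_op_def U
    by (intro hol_calc_cong[symmetric] holomorphic_deriv[OF H]) auto
qed

lemma kernel_operator_cmul:
  assumes "complex_linear S" "0 < r" "r < 1" "0 < s" "s < 1" "op_spectrum S \<subseteq> closed_annulus r 1" "cmod \<alpha> = 1"
  shows "kernel_operator (cmul_op \<alpha> S) r s"
  by unfold_locales (use assms op_spectrum_cmul[OF assms(1,7,6)] in \<open>auto simp: complex_linear_cmul\<close>)

text \<open>The parameter \<open>\<alpha>\<close> moves the poles of the symmetric kernel around the circles, so that all
  symmetric kernels occur.\<close>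

lemma (in kernel_operator) Gamma_op_rotate:
  assumes \<alpha>: "cmod \<alpha> = 1"
  shows "Gamma_op r (1 - s) (cmul_op \<alpha> T) = Phi (H (1 / \<alpha>) (1 / \<alpha>))"
proof -
  interpret k: kernel_operator "cmul_op \<alpha> T" r s by (rule kernel_operator_cmul[OF T r s spec \<alpha>])
  have "Gamma_op r (1 - s) (cmul_op \<alpha> T) = k.Phi (H 1 1)" by (rule k.Gamma_op_eq(1))
  also have "\<dots> = Phi (\<lambda>z. H 1 1 (\<alpha> * z))"
    by (rule hol_calc_rotate[OF T radii spec \<alpha> H_approximable]) auto
  also have "(\<lambda>z. H 1 1 (\<alpha> * z)) = H (1 / \<alpha>) (1 / \<alpha>)"
  proof
    fix z
    have "1 / \<alpha> \<noteq> 0" using \<alpha> by auto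
    then have rot: "H (1 / \<alpha>) (1 / \<alpha>) z = kernel 1 1 (of_real s * z / (1 / \<alpha>))"
      unfolding H_def by (rule kernel_rotate)
    have arg: "of_real s * z / (1 / \<alpha>) = of_real s * (\<alpha> * z)" by (simp add: mult_ac)
    show "H 1 1 (\<alpha> * z) = H (1 / \<alpha>) (1 / \<alpha>) z" unfolding rot arg by (simp only: H_def)
  qed
  finally show ?thesis .
qed

text \<open>Agler's criterion. One direction applies the spectral set condition to Cayley transforms of the kernel.
  For the other, the rotated symmetric kernels generate all functions of positive real part.\<close>

lemma annulus_contraction_iff_accretive:
  fixes S :: "'a::complex_hilbert_space \<Rightarrow>\<^sub>L 'a"
  assumes r: "0 < r" "r < 1" and S: "complex_linear S" and spec: "op_spectrum S \<subseteq> closed_annulus r 1"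
  shows "annulus_contraction r S \<longleftrightarrow>
    (\<forall>\<epsilon> \<alpha>. 0 < \<epsilon> \<and> \<epsilon> < 1 \<and> cmod \<alpha> = 1 \<longrightarrow> accretive (Gamma_op r \<epsilon> (cmul_op \<alpha> S)))"
proof
  assume "annulus_contraction r S"
  then have vN: "spectral_set (closed_annulus r 1) S" by (simp add: annulus_contraction_def closure_annulus[OF r])
  show "\<forall>\<epsilon> \<alpha>. 0 < \<epsilon> \<and> \<epsilon> < 1 \<and> cmod \<alpha> = 1 \<longrightarrow> accretive (Gamma_op r \<epsilon> (cmul_op \<alpha> S))"
  proof (intro allI impI)
    fix \<epsilon> :: real and \<alpha> :: complex assume *: "0 < \<epsilon> \<and> \<epsilon> < 1 \<and> cmod \<alpha> = 1"
    interpret kernel_operator S r "1 - \<epsilon>" by unfold_locales (use S r spec * in auto)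
    have "accretive (Phi (H (1 / \<alpha>) (1 / \<alpha>)))"
      by (rule accretive_of_spectral_set[OF vN]) (use * in \<open>auto simp: norm_divide\<close>)
    then show "accretive (Gamma_op r \<epsilon> (cmul_op \<alpha> S))"
      using Gamma_op_rotate[of \<alpha>] * by simp
  qed
next
  assume acc: "\<forall>\<epsilon> \<alpha>. 0 < \<epsilon> \<and> \<epsilon> < 1 \<and> cmod \<alpha> = 1 \<longrightarrow> accretive (Gamma_op r \<epsilon> (cmul_op \<alpha> S))"
  have "spectral_set (closed_annulus r 1) S"
  proof (rule spectral_set_of_accretive_kernels[OF S r spec])
    fix s :: real and c :: complex assume s: "0 < s" "s < 1" and c: "cmod c = 1"
    interpret kernel_operator S r s by unfold_locales (use S r spec s in auto)
    have "cmod (1 / c) = 1" using c by (simp add: norm_divide)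
    then show "accretive (Phi (H c c))"
      using Gamma_op_rotate[of "1 / c"] acc[rule_format, of "1 - s" "1 / c"] s by simp
  qed
  then show "annulus_contraction r S" using S by (simp add: annulus_contraction_def closure_annulus[OF r])
qed

theorem theorem2p4:
  fixes r :: real and T X :: "'a::complex_hilbert_space \<Rightarrow>\<^sub>L 'a"
  assumes "0 < r" and "r < 1"
    and "annulus_contraction r T"
    and "complex_linear X"
    and "T o\<^sub>L X = X o\<^sub>L T"
  shows "(annulus_contraction r (block_op T X 0 T) \<longleftrightarrow>
          (\<forall>\<epsilon> \<alpha>. 0 < \<epsilon> \<and> \<epsilon> < 1 \<and> cmod \<alpha> = 1 \<longrightarrow>
             (\<exists>K :: 'a \<Rightarrow>\<^sub>L 'a. contraction_op K \<and>
                (1/2) *\<^sub>R (X o\<^sub>L Gamma_deriv_op r \<epsilon> (cmul_op \<alpha> T)) =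
                  sqrt_op (Re_op (Gamma_op r \<epsilon> (cmul_op \<alpha> T))) o\<^sub>L K o\<^sub>L
                  sqrt_op (Re_op (Gamma_op r \<epsilon> (cmul_op \<alpha> T)))))) \<and>
         (annulus_contraction r (block_op T X 0 T) \<longleftrightarrow>
          (\<forall>\<epsilon> \<alpha>. 0 < \<epsilon> \<and> \<epsilon> < 1 \<and> cmod \<alpha> = 1 \<longrightarrow>
             (\<exists>U :: ('a \<times> 'a) \<Rightarrow>\<^sub>L ('a \<times> 'a). unitary_op U \<and>
                (1/2) *\<^sub>R (X o\<^sub>L Gamma_deriv_op r \<epsilon> (cmul_op \<alpha> T)) =
                  row_op (sqrt_op (Re_op (Gamma_op r \<epsilon> (cmul_op \<alpha> T)))) 0 o\<^sub>L U o\<^sub>L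
                  column_op (sqrt_op (Re_op (Gamma_op r \<epsilon> (cmul_op \<alpha> T)))) 0)))"
proof -
  note r = assms(1,2) and X = assms(4) and TX = assms(5)
  let ?B = "block_op T X 0 T"
  have T: "complex_linear T" and vN: "spectral_set (closed_annulus r 1) T"
    using assms(3) by (auto simp: annulus_contraction_def closure_annulus[OF r])
  have spec: "op_spectrum T \<subseteq> closed_annulus r 1" using vN by (simp add: spectral_set_def)
  have B: "complex_linear ?B" "op_spectrum ?B \<subseteq> closed_annulus r 1"
    using T X spec by (auto simp: complex_linear_block op_spectrum_block[OF T X TX])
  have main: "accretive (Gamma_op r \<epsilon> (cmul_op \<alpha> ?B)) \<longleftrightarrow>
      (\<exists>K :: 'a \<Rightarrow>\<^sub>L 'a. contraction_op K \<and>
        (1/2) *\<^sub>R (X o\<^sub>L Gamma_deriv_op r \<epsilon> (cmul_op \<alpha> T)) =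
          sqrt_op (Re_op (Gamma_op r \<epsilon> (cmul_op \<alpha> T))) o\<^sub>L K o\<^sub>L sqrt_op (Re_op (Gamma_op r \<epsilon> (cmul_op \<alpha> T))))"
    if \<epsilon>: "0 < \<epsilon>" "\<epsilon> < 1" and \<alpha>: "cmod \<alpha> = 1" for \<epsilon> \<alpha>
  proof -
    have a0: "\<alpha> \<noteq> 0" using \<alpha> by auto
    have s: "0 < 1 - \<epsilon>" "1 - \<epsilon> < 1" using \<epsilon> by auto
    interpret k: kernel_operator "cmul_op \<alpha> T" r "1 - \<epsilon>" by (rule kernel_operator_cmul[OF T r s spec \<alpha>])
    interpret kB: kernel_operator "cmul_op \<alpha> ?B" r "1 - \<epsilon>" by (rule kernel_operator_cmul[OF B(1) r s B(2) \<alpha>])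
    define G where "G = Gamma_op r \<epsilon> (cmul_op \<alpha> T)"
    define G' where "G' = Gamma_deriv_op r \<epsilon> (cmul_op \<alpha> T)"
    have G: "G = k.Phi (k.H 1 1)" and G': "G' = k.Phi (deriv (k.H 1 1))"
      using k.Gamma_op_eq by (auto simp: G_def G'_def)
    have H: "k.H 1 1 holomorphic_on k.U" by (rule k.H_holomorphic) auto
    have G_lin: "complex_linear G" unfolding G by (rule k.complex_linear_hol_calc[OF H])
    have "complex_linear G'"
      unfolding G' by (rule k.complex_linear_hol_calc[OF holomorphic_deriv[OF H]]) simp
    define P where "P = Re_op G"
    define Y where "Y = (1/2) *\<^sub>R (X o\<^sub>L G')"
    have Y: "complex_linear Y" unfolding Y_def by (intro complex_linear_scaleR complex_linear_compose X) fact
    have "accretive G"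
      using annulus_contraction_iff_accretive[OF r T spec] assms(3) \<epsilon> \<alpha> by (simp add: G_def)
    then have P: "positive_op P"
      using Re_op_simps[OF G_lin] by (auto simp: positive_op_iff P_def accretive_def)
    have "cmul_op \<alpha> ?B = block_op (cmul_op \<alpha> T) (cmul_op \<alpha> X) 0 (cmul_op \<alpha> T)"
      by (rule blinfun_eqI) (auto simp: scaleC_add_right)
    moreover have "cmul_op \<alpha> T o\<^sub>L cmul_op \<alpha> X = cmul_op \<alpha> X o\<^sub>L cmul_op \<alpha> T"
      by (simp add: cmul_op_compose compose_cmul_op T X TX)
    ultimately have block: "Gamma_op r \<epsilon> (cmul_op \<alpha> ?B) = block_op G (cmul_op \<alpha> X o\<^sub>L G') 0 G"
      using kB.Gamma_op_eq(1) hol_calc_block[OF complex_linear_cmul[OF T] complex_linear_cmul[OF X] _ k.radii k.spectrum H]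
      by (simp add: G G')
    have PG: "inner (G x) x = inner (P x) x" for x using Re_op_simps(1)[OF G_lin] by (simp add: P_def)
    have form: "inner (Gamma_op r \<epsilon> (cmul_op \<alpha> ?B) (x, y)) (x, y) = inner (P x) x + inner (P y) y + 2 * inner (Y (\<alpha> *\<^sub>C y)) x" for x y
      using complex_linearD[OF X] complex_linearD[OF \<open>complex_linear G'\<close>]
      by (simp add: block Y_def inner_add_left PG blinfun.scaleR_left)
    have P_rot: "inner (P (c *\<^sub>C y)) (c *\<^sub>C y) = inner (P y) y" if "cmod c = 1" for c y
      using P that by (simp add: positive_op_iff complex_linearD inner_scaleC_scaleC)
    have "accretive (Gamma_op r \<epsilon> (cmul_op \<alpha> ?B)) \<longleftrightarrow> (\<forall>x y. 0 \<le> inner (P x) x + inner (P y) y + 2 * inner (Y y) x)"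
    proof
      assume acc: "accretive (Gamma_op r \<epsilon> (cmul_op \<alpha> ?B))"
      show "\<forall>x y. 0 \<le> inner (P x) x + inner (P y) y + 2 * inner (Y y) x"
      proof (intro allI)
        fix x y
        have "0 \<le> inner (P x) x + inner (P ((1 / \<alpha>) *\<^sub>C y)) ((1 / \<alpha>) *\<^sub>C y) + 2 * inner (Y (\<alpha> *\<^sub>C ((1 / \<alpha>) *\<^sub>C y))) x"
          using acc form[of x "(1 / \<alpha>) *\<^sub>C y"] unfolding accretive_def by metis
        then show "0 \<le> inner (P x) x + inner (P y) y + 2 * inner (Y y) x"
          using P_rot[of "1 / \<alpha>" y] \<alpha> a0 by (simp add: scaleC_scaleC norm_divide)
      qed
    next
      assume pos: "\<forall>x y. 0 \<le> inner (P x) x + inner (P y) y + 2 * inner (Y y) x"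
      have "0 \<le> inner (Gamma_op r \<epsilon> (cmul_op \<alpha> ?B) (x, y)) (x, y)" for x y
        using pos[rule_format, of x "\<alpha> *\<^sub>C y"] P_rot[OF \<alpha>, of y] by (simp add: form)
      then show "accretive (Gamma_op r \<epsilon> (cmul_op \<alpha> ?B))" by (auto simp: accretive_def)
    qed
    also have "\<dots> \<longleftrightarrow> (\<exists>K. contraction_op K \<and> Y = sqrt_op P o\<^sub>L K o\<^sub>L sqrt_op P)"
      by (rule positive_block_iff_contraction[OF P Y])
    finally show ?thesis unfolding Y_def P_def G_def G'_def .
  qed
  have 1: "annulus_contraction r ?B \<longleftrightarrow>
      (\<forall>\<epsilon> \<alpha>. 0 < \<epsilon> \<and> \<epsilon> < 1 \<and> cmod \<alpha> = 1 \<longrightarrow> accretive (Gamma_op r \<epsilon> (cmul_op \<alpha> ?B)))"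
    by (rule annulus_contraction_iff_accretive[OF r B])
  show ?thesis
    unfolding contraction_iff_compressed_unitary[symmetric] 1 using main by blast
qed

end
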